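(* Let $q,p\ge1$, $d_h,\rho_h>0$ ($1\le h\le q$), and $\xi_1,\dots,\xi_p\in\mathbb R$ with $\xi_i+\rho_h>0$ for all $i,h$. Put $D=\sum_hd_h$. Let $\boldsymbol n\in\mathbb N_0^p$ and $\boldsymbol m\in\mathbb N_0^q$, and put $C=D+|\boldsymbol m|$. Assume that $\boldsymbol m$ is near the diagonal, i.e. $|m_h-m_j|\le1$ for all $h,j$; that $\xi_1,\dots,\xi_p$ are pairwise distinct; and that the rates $\rho_j$ with $m_j>0$ are pairwise distinct. (A) If $|\boldsymbol n|=|\boldsymbol m|+1$, define $$\mathcal A^{\mathrm{LII}}_{\boldsymbol n,\boldsymbol m}(y)=\frac{(-1)^{|\boldsymbol n|}}{2\pi\mathrm i}\int_\Sigma\frac{\prod_{h=1}^q(z+\rho_h)^{d_h+m_h}}{\prod_{i=1}^p(z-\xi_i)^{n_i}}\mathrm e^{-zy}\,\mathrm dz,$$ where $\Sigma$ is a positively oriented finite union of simple closed contours enclosing the $\xi_i$ and lying to the right of the cuts $(-\infty,-\rho_h]$. Then $$\int_0^\infty y^kF_j(y)\mathcal A^{\mathrm{LII}}_{\boldsymbol n,\boldsymbol m}(y)\,\mathrm dy=0,\qquad 1\le j\le q,\ 0\le k<m_j,$$ and $\mathcal A^{\mathrm{LII}}_{\boldsymbol n,\boldsymbol m}(y)=\sum_{i=1}^pA^{(i),\mathrm{LII}}_{\boldsymbol n,\boldsymbol m}(y)\mathrm e^{-\xi_iy}$ with polynomials $A^{(i),\mathrm{LII}}_{\boldsymbol n,\boldsymbol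 m}\in\mathbb P_{n_i-1}$ (zero if $n_i=0$) given for $n_i\ge1$ by $$A^{(i),\mathrm{LII}}_{\boldsymbol n,\boldsymbol m}(y)=\frac{(-1)^{|\boldsymbol n|}}{(n_i-1)!}\left.\frac{\mathrm d^{n_i-1}}{\mathrm dz^{n_i-1}}\left[\frac{\prod_h(z+\rho_h)^{d_h+m_h}}{\prod_{k\ne i}(z-\xi_k)^{n_k}}\mathrm e^{-(z-\xi_i)y}\right]\right|_{z=\xi_i}.$$ (B) If $|\boldsymbol m|=|\boldsymbol n|+1$, let $\mathcal B^{\mathrm{LII}}_{\boldsymbol n,\boldsymbol m}$ be the function on $(0,\infty)$ characterized by its Laplace transform $$\int_0^\infty\mathrm e^{-zy}\mathcal B^{\mathrm{LII}}_{\boldsymbol n,\boldsymbol m}(y)\,\mathrm dy=-\frac{\prod_{i=1}^p(\xi_i-z)^{n_i}}{\prod_{h=1}^q(z+\rho_h)^{d_h+m_h}}.$$ Then $\int_0^\infty y^k\mathrm e^{-\xi_iy}\mathcal B^{\mathrm{LII}}_{\boldsymbol n,\boldsymbol m}(y)\,\mathrm dy=0$ for $1\le i\le p$, $0\le k<n_i$; $$\mathcal B^{\mathrm{LII}}_{\boldsymbol n,\boldsymbol m}(y)=-\prod_{i=1}^p\Bigl(\xi_i-\frac{\mathrm d}{\mathrm dy}\Bigr)^{n_i}S_{\boldsymbol m}(y),\qquad S_{\boldsymbol m}=g_{\rho_1,d_1+m_1}*_+\cdots*_+g_{\rho_q,d_q+m_q};$$ and $$\mathcal B^{\mathrm{LII}}_{\boldsymbol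 n,\boldsymbol m}(y)=-\sum_{\substack{0\le\ell_i\le n_i\\1\le i\le p}}(-1)^{|\boldsymbol\ell|}\Bigl[\prod_{i=1}^p\binom{n_i}{\ell_i}\xi_i^{n_i-\ell_i}\Bigr]\frac{y^{C-|\boldsymbol\ell|-1}}{\Gamma(C-|\boldsymbol\ell|)}\,\Phi_2^{(q)}\bigl(\boldsymbol d+\boldsymbol m;C-|\boldsymbol\ell|;-\rho_1y,\dots,-\rho_qy\bigr).$$ (Confluence) Let $a_h(\tau)=\tau\rho_h-1$, $b_h(\tau)=\tau\rho_h+d_h-1$, $\alpha_i(\tau)=\tau\xi_i$, and let $\mathcal A^{\mathrm J}_{\boldsymbol n,\boldsymbol m}$, $\mathcal B^{\mathrm J}_{\boldsymbol n,\boldsymbol m}$ be the Jacobi representatives (see context) with these parameters, in the respective balances $|\boldsymbol n|=|\boldsymbol m|+1$ and $|\boldsymbol m|=|\boldsymbol n|+1$. Then, as $\tau\to+\infty$, $$\tau^{-D}\mathcal A^{\mathrm J}_{\boldsymbol n,\boldsymbol m}(1-y/\tau)\to\mathcal A^{\mathrm{LII}}_{\boldsymbol n,\boldsymbol m}(y),\qquad \tau^{D}\mathcal B^{\mathrm J}_{\boldsymbol n,\boldsymbol m}(1-y/\tau)\to\mathcal B^{\mathrm{LII}}_{\boldsymbol n,\boldsymbol m}(y).$$ The first convergence is locally uniform on $(0,\infty)$, and the individual polynomial components satisfy, coefficientwise, $\tau^{-D}A^{(i),\mathrm J}_{\boldsymbol n,\boldsymbol m}(1-y/\tau)\to A^{(i),\mathrm{LII}}_{\boldsymbol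 n,\boldsymbol m}(y)$ in $\mathbb P_{n_i-1}$ for $n_i>0$. After extension by zero, the second convergence holds in $\mathcal D'(\mathbb R)$ and in the moments against $y^k\mathrm e^{-\zeta y}$, for every $k\in\mathbb N_0$ and every real $\zeta$ such that $\zeta+\rho_h>0$ for all $h$.
   Context: Notation: $\mathbb P_N$ is the space of polynomials of degree $\le N$, $\mathbb P_{-1}=\{0\}$; $|\boldsymbol\nu|=\sum\nu_j$; $(a)_k=a(a+1)\cdots(a+k-1)$ is the Pochhammer symbol. Gamma kernels $g_{\rho,d}(y)=\frac{y^{d-1}\mathrm e^{-\rho y}}{\Gamma(d)}\mathbf 1_{(0,\infty)}(y)$; additive convolution $(f*_+g)(y)=\int_0^yf(u)g(y-u)\,\mathrm du$. Rows: for $1\le j\le q$, $F_j=g_{\rho_1,d_1+\delta_{1,j}}*_+\cdots*_+g_{\rho_q,d_q+\delta_{q,j}}$. Powers $(z+\rho)^a$ use the principal logarithm with cut $(-\infty,-\rho]$. Confluent Lauricella function: $\Phi_2^{(R)}(a_1,\dots,a_R;c;x_1,\dots,x_R)=\sum_{k_1,\dots,k_R\ge0}\frac{\prod_h(a_h)_{k_h}}{(c)_{|\boldsymbol k|}}\prod_h\frac{x_h^{k_h}}{k_h!}$. Jacobi representatives. For parameters $-1<a_h<b_h$ and $\alpha_i$ with $\alpha_i+a_h>-1$, put $D_{\boldsymbol\alpha,\boldsymbol n}(t)=\prod_{i=1}^p(t+1-\alpha_i-n_i)_{n_i}$ (whose zeros are the nodes $\alpha_i+k$, $0\le k<n_i$)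 and $P_{\boldsymbol b,\boldsymbol m}(t)=\prod_{h=1}^q(t+1+b_h)_{m_h}$. If $|\boldsymbol n|=|\boldsymbol m|+1$ and the nodes are pairwise distinct (which holds here for all large $\tau$), $$\mathcal A^{\mathrm J}_{\boldsymbol n,\boldsymbol m}(x)=\frac{(-1)^{|\boldsymbol n|}}{2\pi\mathrm i}\int_{\Sigma'}\frac{P_{\boldsymbol b,\boldsymbol m}(t)}{D_{\boldsymbol\alpha,\boldsymbol n}(t)}\prod_{h=1}^q\frac{\Gamma(t+b_h+1)}{\Gamma(t+a_h+1)}\,x^t\,\mathrm dt,\qquad 0<x<1,$$ with $\Sigma'$ a positively oriented finite union of simple closed contours enclosing precisely those nodes and no other pole of the integrand; summing residues gives $\mathcal A^{\mathrm J}_{\boldsymbol n,\boldsymbol m}(x)=\sum_iA^{(i),\mathrm J}_{\boldsymbol n,\boldsymbol m}(x)x^{\alpha_i}$, where $A^{(i),\mathrm J}_{\boldsymbol n,\boldsymbol m}\in\mathbb P_{n_i-1}$ collects the residues at $\alpha_i+k$, $0\le k<n_i$. If $|\boldsymbol m|=|\boldsymbol n|+1$, $\mathcal B^{\mathrm J}_{\boldsymbol n,\boldsymbol m}$ is the function on $(0,1)$ with Mellin transform $$\int_0^1x^{z-1}\mathcal B^{\mathrm J}_{\boldsymbol n,\boldsymbol m}(x)\,\mathrm dx=-\prod_{h=1}^q\frac{\Gamma(z+a_h)}{\Gamma(z+b_h+m_h)}\prod_{i=1}^p(\alpha_i+1-z)_{n_i}.$$ *)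

theory Defs
  imports "HOL-Complex_Analysis.Complex_Analysis"
begin

text \<open>Tuples $(v_1,\dots,v_r)$ are functions on \<^typ>\<open>nat\<close> of which only the values on
  \<open>{1..r}\<close> are used.\<close>

definition msize :: "nat \<Rightarrow> (nat \<Rightarrow> nat) \<Rightarrow> nat" where
  "msize r k = (\<Sum>i=1..r. k i)"

text \<open>\<open>polys_below N\<close> is the space $\mathbb P_{N-1}$, with $\mathbb P_{-1} = \{0\}$.\<close>

definition polys_below :: "nat \<Rightarrow> complex poly set" where
  "polys_below N = {P. P = 0 \<or> degree P < N}"

text \<open>The Bochner integral of a non-integrable function is 0, so integrability is always
  asserted together with the value.\<close>

definition has_lebesgue_integral_on ::
    "(real \<Rightarrow> 'a::{banach, second_countable_topology}) \<Rightarrow> 'a \<Rightarrow> real set \<Rightarrow> bool" where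
  "has_lebesgue_integral_on f v S \<longleftrightarrow>
     set_integrable lborel S f \<and> set_lebesgue_integral lborel S f = v"


subsection \<open>Gamma kernels, convolution, confluent Lauricella function\<close>

definition gamma_kernel :: "real \<Rightarrow> real \<Rightarrow> real \<Rightarrow> real" where
  "gamma_kernel r c y = (if 0 < y then y powr (c - 1) * exp (- r * y) / Gamma c else 0)"

definition add_conv :: "(real \<Rightarrow> real) \<Rightarrow> (real \<Rightarrow> real) \<Rightarrow> real \<Rightarrow> real" where
  "add_conv f g y = (LINT u:{0..y}|lborel. f u * g (y - u))"

definition iter_conv :: "nat \<Rightarrow> (nat \<Rightarrow> real \<Rightarrow> real) \<Rightarrow> real \<Rightarrow> real" where
  "iter_conv r g = foldl add_conv (g 1) (map g [2..<Suc r])"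

definition row_F :: "nat \<Rightarrow> (nat \<Rightarrow> real) \<Rightarrow> (nat \<Rightarrow> real) \<Rightarrow> nat \<Rightarrow> real \<Rightarrow> real" where
  "row_F q d \<rho> j = iter_conv q (\<lambda>h. gamma_kernel (\<rho> h) (d h + (if h = j then 1 else 0)))"

definition conv_S ::
    "nat \<Rightarrow> (nat \<Rightarrow> real) \<Rightarrow> (nat \<Rightarrow> real) \<Rightarrow> (nat \<Rightarrow> nat) \<Rightarrow> real \<Rightarrow> real" where
  "conv_S q d \<rho> m = iter_conv q (\<lambda>h. gamma_kernel (\<rho> h) (d h + real (m h)))"

definition Phi2 :: "nat \<Rightarrow> (nat \<Rightarrow> real) \<Rightarrow> real \<Rightarrow> (nat \<Rightarrow> real) \<Rightarrow> real" where
  "Phi2 r a c x = (\<Sum>\<^sub>\<infinity>k\<in>PiE {1..r} (\<lambda>_. UNIV).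
     (\<Prod>h=1..r. pochhammer (a h) (k h)) / pochhammer c (msize r k)
       * (\<Prod>h=1..r. x h ^ k h / fact (k h)))"

text \<open>\<open>diff_ops p \<xi> n\<close> is the differential operator
  $\prod_{i=1}^p (\xi_i - \mathrm d/\mathrm dy)^{n_i}$; the factors commute on smooth functions.\<close>

definition diff_op :: "real \<Rightarrow> (real \<Rightarrow> real) \<Rightarrow> real \<Rightarrow> real" where
  "diff_op c f y = c * f y - deriv f y"

definition diff_ops :: "nat \<Rightarrow> (nat \<Rightarrow> real) \<Rightarrow> (nat \<Rightarrow> nat) \<Rightarrow> (real \<Rightarrow> real) \<Rightarrow> real \<Rightarrow> real" where
  "diff_ops p \<xi> n f = fold (\<lambda>i. diff_op (\<xi> i) ^^ n i) [1..<Suc p] f"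


subsection \<open>Finite unions of simple closed contours\<close>

text \<open>The components are mutually exterior, so that the winding number of the whole system is
  1 about every enclosed point.\<close>

definition contour_system :: "(real \<Rightarrow> complex) set \<Rightarrow> bool" where
  "contour_system G \<longleftrightarrow>
     finite G \<and>
     (\<forall>\<gamma>\<in>G. valid_path \<gamma> \<and> simple_path \<gamma> \<and> pathfinish \<gamma> = pathstart \<gamma> \<and>
            (\<forall>w\<in>inside (path_image \<gamma>). winding_number \<gamma> w = 1)) \<and>
     pairwise (\<lambda>\<gamma> \<gamma>'. disjnt (path_image \<gamma> \<union> inside (path_image \<gamma>))
                            (path_image \<gamma>' \<union> inside (path_image \<gamma>'))) G"

definition trace_of :: "(real \<Rightarrow> complex) set \<Rightarrow> complex set" where
  "trace_of G = (\<Union>\<gamma>\<in>G. path_image \<gamma>)"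

definition enclosed_by :: "(real \<Rightarrow> complex) set \<Rightarrow> complex set" where
  "enclosed_by G = (\<Union>\<gamma>\<in>G. inside (path_image \<gamma>))"

definition system_integral :: "(real \<Rightarrow> complex) set \<Rightarrow> (complex \<Rightarrow> complex) \<Rightarrow> complex" where
  "system_integral G f = (\<Sum>\<gamma>\<in>G. contour_integral \<gamma> f)"


subsection \<open>The limit functions\<close>

definition LII_contours ::
    "nat \<Rightarrow> nat \<Rightarrow> (nat \<Rightarrow> real) \<Rightarrow> (nat \<Rightarrow> real) \<Rightarrow> (real \<Rightarrow> complex) set \<Rightarrow> bool" where
  "LII_contours p q \<rho> \<xi> G \<longleftrightarrow>
     contour_system G \<and>
     (\<forall>i\<in>{1..p}. complex_of_real (\<xi> i) \<in> enclosed_by G) \<and>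
     (\<forall>z\<in>trace_of G. \<forall>h\<in>{1..q}. - \<rho> h < Re z)"

definition LII_A ::
    "nat \<Rightarrow> nat \<Rightarrow> (nat \<Rightarrow> real) \<Rightarrow> (nat \<Rightarrow> real) \<Rightarrow> (nat \<Rightarrow> real) \<Rightarrow> (nat \<Rightarrow> nat) \<Rightarrow> (nat \<Rightarrow> nat) \<Rightarrow>
     (real \<Rightarrow> complex) set \<Rightarrow> real \<Rightarrow> complex" where
  "LII_A p q d \<rho> \<xi> n m G y =
     (-1) ^ msize p n / (2 * of_real pi * \<i>) *
     system_integral G (\<lambda>z.
       (\<Prod>h=1..q. (z + of_real (\<rho> h)) powr of_real (d h + real (m h)))
       / (\<Prod>i=1..p. (z - of_real (\<xi> i)) ^ n i) * exp (- z * of_real y))"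

definition LII_A_comp ::
    "nat \<Rightarrow> nat \<Rightarrow> (nat \<Rightarrow> real) \<Rightarrow> (nat \<Rightarrow> real) \<Rightarrow> (nat \<Rightarrow> real) \<Rightarrow> (nat \<Rightarrow> nat) \<Rightarrow> (nat \<Rightarrow> nat) \<Rightarrow>
     nat \<Rightarrow> real \<Rightarrow> complex" where
  "LII_A_comp p q d \<rho> \<xi> n m i y =
     (if n i = 0 then 0 else
       (-1) ^ msize p n / fact (n i - 1) *
       (deriv ^^ (n i - 1)) (\<lambda>z.
         (\<Prod>h=1..q. (z + of_real (\<rho> h)) powr of_real (d h + real (m h)))
         / (\<Prod>k\<in>{1..p} - {i}. (z - of_real (\<xi> k)) ^ n k)
         * exp (- (z - of_real (\<xi> i)) * of_real y)) (of_real (\<xi> i)))"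

text \<open>A Laplace transform determines a function only almost everywhere; the representative meant
  is the continuous one.\<close>

definition is_LII_B ::
    "nat \<Rightarrow> nat \<Rightarrow> (nat \<Rightarrow> real) \<Rightarrow> (nat \<Rightarrow> real) \<Rightarrow> (nat \<Rightarrow> real) \<Rightarrow> (nat \<Rightarrow> nat) \<Rightarrow> (nat \<Rightarrow> nat) \<Rightarrow>
     (real \<Rightarrow> real) \<Rightarrow> bool" where
  "is_LII_B p q d \<rho> \<xi> n m B \<longleftrightarrow>
     continuous_on {0<..} B \<and>
     (\<forall>z::complex. (\<forall>h\<in>{1..q}. - \<rho> h < Re z) \<longrightarrow>
        has_lebesgue_integral_on (\<lambda>y. exp (- z * of_real y) * of_real (B y))
          (- ((\<Prod>i=1..p. (of_real (\<xi> i) - z) ^ n i)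
              / (\<Prod>h=1..q. (z + of_real (\<rho> h)) powr of_real (d h + real (m h))))) {0<..})"


subsection \<open>Jacobi representatives\<close>

definition jacobi_kernel ::
    "nat \<Rightarrow> nat \<Rightarrow> (nat \<Rightarrow> real) \<Rightarrow> (nat \<Rightarrow> real) \<Rightarrow> (nat \<Rightarrow> real) \<Rightarrow> (nat \<Rightarrow> nat) \<Rightarrow> (nat \<Rightarrow> nat) \<Rightarrow>
     complex \<Rightarrow> complex" where
  "jacobi_kernel p q a b \<alpha> n m t =
     (\<Prod>h=1..q. pochhammer (t + 1 + of_real (b h)) (m h))
     / (\<Prod>i=1..p. pochhammer (t + 1 - of_real (\<alpha> i) - of_nat (n i)) (n i))
     * (\<Prod>h=1..q. Gamma (t + of_real (b h) + 1) / Gamma (t + of_real (a h) + 1))"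

definition jacobi_nodes :: "nat \<Rightarrow> (nat \<Rightarrow> real) \<Rightarrow> (nat \<Rightarrow> nat) \<Rightarrow> complex set" where
  "jacobi_nodes p \<alpha> n = {of_real (\<alpha> i + real k) |i k. i \<in> {1..p} \<and> k < n i}"

text \<open>For $0 < x < 1$ the factor $x^t$ of the integrand is entire and has no zeros in $t$, so the
  poles of the integrand are those of the kernel. The predicate \<^const>\<open>is_pole\<close> ignores the
  value of the function at the point itself (the library puts $\Gamma = 0$ at the poles).\<close>

definition jacobi_contours ::
    "nat \<Rightarrow> nat \<Rightarrow> (nat \<Rightarrow> real) \<Rightarrow> (nat \<Rightarrow> real) \<Rightarrow> (nat \<Rightarrow> real) \<Rightarrow> (nat \<Rightarrow> nat) \<Rightarrow> (nat \<Rightarrow> nat) \<Rightarrow>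
     (real \<Rightarrow> complex) set \<Rightarrow> bool" where
  "jacobi_contours p q a b \<alpha> n m G \<longleftrightarrow>
     contour_system G \<and>
     jacobi_nodes p \<alpha> n \<subseteq> enclosed_by G \<and>
     (\<forall>t\<in>enclosed_by G \<union> trace_of G.
        is_pole (jacobi_kernel p q a b \<alpha> n m) t \<longrightarrow> t \<in> jacobi_nodes p \<alpha> n)"

definition jacobi_A ::
    "nat \<Rightarrow> nat \<Rightarrow> (nat \<Rightarrow> real) \<Rightarrow> (nat \<Rightarrow> real) \<Rightarrow> (nat \<Rightarrow> real) \<Rightarrow> (nat \<Rightarrow> nat) \<Rightarrow> (nat \<Rightarrow> nat) \<Rightarrow>
     (real \<Rightarrow> complex) set \<Rightarrow> real \<Rightarrow> complex" where
  "jacobi_A p q a b \<alpha> n m G x =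
     (-1) ^ msize p n / (2 * of_real pi * \<i>) *
     system_integral G (\<lambda>t. jacobi_kernel p q a b \<alpha> n m t * of_real x powr t)"

text \<open>If the nodes are pairwise distinct, they are simple poles, and the residue of the integrand
  at $\alpha_i + k$ is the residue of the kernel times $x^{\alpha_i} x^k$.\<close>

definition jacobi_A_poly ::
    "nat \<Rightarrow> nat \<Rightarrow> (nat \<Rightarrow> real) \<Rightarrow> (nat \<Rightarrow> real) \<Rightarrow> (nat \<Rightarrow> real) \<Rightarrow> (nat \<Rightarrow> nat) \<Rightarrow> (nat \<Rightarrow> nat) \<Rightarrow>
     nat \<Rightarrow> complex poly" where
  "jacobi_A_poly p q a b \<alpha> n m i =
     (\<Sum>k<n i. monom ((-1) ^ msize p n *
        residue (jacobi_kernel p q a b \<alpha> n m) (of_real (\<alpha> i + real k))) k)"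

text \<open>The Mellin transform is prescribed on its natural half-plane $\Re z > -\min_h a_h$. It
  determines the function almost everywhere, which is all that is used.\<close>

definition is_jacobi_B ::
    "nat \<Rightarrow> nat \<Rightarrow> (nat \<Rightarrow> real) \<Rightarrow> (nat \<Rightarrow> real) \<Rightarrow> (nat \<Rightarrow> real) \<Rightarrow> (nat \<Rightarrow> nat) \<Rightarrow> (nat \<Rightarrow> nat) \<Rightarrow>
     (real \<Rightarrow> real) \<Rightarrow> bool" where
  "is_jacobi_B p q a b \<alpha> n m B \<longleftrightarrow>
     (\<forall>z::complex. (\<forall>h\<in>{1..q}. - a h < Re z) \<longrightarrow>
        has_lebesgue_integral_on (\<lambda>x. of_real x powr (z - 1) * of_real (B x))
          (- ((\<Prod>h=1..q. Gamma (z + of_real (a h)) / Gamma (z + of_real (b h) + of_nat (m h)))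
              * (\<Prod>i=1..p. pochhammer (of_real (\<alpha> i) + 1 - z) (n i)))) {0<..<1})"


subsection \<open>Convergence in $\mathcal D'(\mathbb R)$\<close>

definition test_function :: "(real \<Rightarrow> complex) \<Rightarrow> bool" where
  "test_function \<phi> \<longleftrightarrow>
     (\<forall>k. ((\<lambda>f x. vector_derivative f (at x)) ^^ k) \<phi> differentiable_on UNIV) \<and>
     compact (closure {x. \<phi> x \<noteq> 0})"

definition locally_integrable :: "(real \<Rightarrow> real) \<Rightarrow> bool" where
  "locally_integrable f \<longleftrightarrow> (\<forall>u v. set_integrable lborel {u..v} f)"

definition tendsto_distr :: "(real \<Rightarrow> real \<Rightarrow> real) \<Rightarrow> (real \<Rightarrow> real) \<Rightarrow> real filter \<Rightarrow> bool" where
  "tendsto_distr f g F \<longleftrightarrow>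
     (\<forall>\<^sub>F \<tau> in F. locally_integrable (f \<tau>)) \<and> locally_integrable g \<and>
     (\<forall>\<phi>. test_function \<phi> \<longrightarrow>
        ((\<lambda>\<tau>. LINT y|lborel. of_real (f \<tau> y) * \<phi> y) \<longlongrightarrow>
          (LINT y|lborel. of_real (g y) * \<phi> y)) F)"

end

theory Submission
  imports Defs "HOL-Probability.Probability" "HOL-Real_Asymp.Real_Asymp"
begin

text \<open>Everything is read off from Laplace transforms. The convolution of gamma kernels with exponents
  $A_h$ has the transform $\prod_h (z + \rho_h)^{-A_h}$.

  For (A), $\mathcal A^{\mathrm{LII}}$ is a sum of residues at the $\xi_i$, and integrating it against
  $y^k F_j$ replaces $\mathrm e^{-zy}$ by the $k$-th derivative of the transform of $F_j$. Near the
  diagonal this derivative times $\prod_h (z + \rho_h)^{d_h + m_h}$ is a polynomial of degree at most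
  $|\mathbf n| - 2$, so the residues of a rational function of order $O(z^{-2})$ are summed, which
  gives 0. For (B), multiplication by $\xi_i - z$ is the operator $\xi_i - \mathrm d/\mathrm dy$, and
  $S_{\mathbf m}$ is $y^{C-1}$ times a series in $y$ that is differentiated termwise.

  For the confluence, $x = \mathrm e^{-v/\tau}$ turns a quotient of gamma functions into the Laplace
  transform of a rescaled beta kernel, which converges to the gamma kernel in every weighted $L^1$
  space to the right of the abscissas. Convolution and the first-order factors preserve this
  convergence, which yields the limit of $\mathcal B^{\mathrm J}$. It also makes the rescaled Jacobi
  integrand converge uniformly on small circles about the $\xi_i$; each circle encloses precisely the
  nodes of one component, so the components converge pointwise, hence coefficientwise.\<close>

section \<open>Laplace transforms on half-planes\<close>

text \<open>The functions in (B) and their Jacobi counterparts are known through transforms only,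
  hence almost everywhere only. Limits are therefore taken in weighted L^1 norms: explicit families
  with the right transforms are built, and uniqueness of the transform identifies them with the
  given functions. The polynomial factors of the transforms would call for derivatives of functions
  that are only integrable; instead z is written as (z + \<rho>_h) minus a constant, so that each
  factor lowers one \<open>m h\<close> by 1. The balance |m| = |n| + 1 makes the supply suffice, and
  the total exponent stays above D > 0. On the Jacobi side the same step is the recurrence of the
  gamma function, with coefficients that differ from the limit by O(1/\<tau>). The contours in (A)
  are arbitrary and may change with \<tau>, so integrals over them are never estimated but reduced
  to residues at once. Convergence of the sum alone would not determine its components; each
  component is isolated by a fixed small circle, and the sum is reassembled from them.\<close>

definition laplace_on :: "real \<Rightarrow> (real \<Rightarrow> real) \<Rightarrow> bool" where
  "laplace_on r f \<longleftrightarrow> (\<forall>y\<le>0. f y = 0) \<and> (\<forall>w>r. integrable lborel (\<lambda>y. exp (- w * y) * f y))"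

text \<open>The integral runs over the whole line; it is the Laplace transform because
  \<open>laplace_on\<close> makes the functions vanish on y <= 0. That convention also makes
  convolution over the whole line agree with \<open>add_conv\<close>. Real exponents are enough in
  \<open>laplace_on\<close>, since |exp(-zy)| depends only on Re z.\<close>

definition lap :: "(real \<Rightarrow> real) \<Rightarrow> complex \<Rightarrow> complex" where
  "lap f z = (LINT y|lborel. exp (- z * of_real y) * of_real (f y))"

lemma laplace_on_nonpos: "laplace_on r f \<Longrightarrow> y \<le> 0 \<Longrightarrow> f y = 0"
  by (simp add: laplace_on_def)

lemma laplace_on_integrable: "laplace_on r f \<Longrightarrow> r < w \<Longrightarrow> integrable lborel (\<lambda>y. exp (- w * y) * f y)"
  by (simp add: laplace_on_def)

lemma laplace_on_mono: "laplace_on r f \<Longrightarrow> r \<le> s \<Longrightarrow> laplace_on s f"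
  by (auto simp: laplace_on_def)

lemma laplace_on_measurable:
  assumes "laplace_on r f" shows "f \<in> borel_measurable borel"
proof -
  have "integrable lborel (\<lambda>y. exp (- (r + 1) * y) * f y)"
    by (rule laplace_on_integrable[OF assms]) simp
  from borel_measurable_integrable[OF this]
  have [measurable]: "(\<lambda>y. exp (- (r + 1) * y) * f y) \<in> borel_measurable borel" by simp
  have "(\<lambda>y. exp ((r + 1) * y) * (exp (- (r + 1) * y) * f y)) \<in> borel_measurable borel"
    by measurable
  also have "(\<lambda>y. exp ((r + 1) * y) * (exp (- (r + 1) * y) * f y)) = f"
  proof
    fix y
    have "exp ((r + 1) * y) * exp (- (r + 1) * y) = 1"
      by (subst mult_exp_exp) (simp add: algebra_simps)
    thus "exp ((r + 1) * y) * (exp (- (r + 1) * y) * f y) = f y"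
      by (simp only: mult.assoc[symmetric] mult_1)
  qed
  finally show ?thesis .
qed

lemma laplace_on_integrable_abs:
  assumes "laplace_on r f" "r < w" shows "integrable lborel (\<lambda>y. exp (- w * y) * \<bar>f y\<bar>)"
  using integrable_norm[OF laplace_on_integrable[OF assms]] by (simp add: abs_mult)

lemma lap_integrable:
  assumes "laplace_on r f" "r < Re z"
  shows "integrable lborel (\<lambda>y. exp (- z * of_real y) * of_real (f y))"
proof (rule Bochner_Integration.integrable_bound[OF laplace_on_integrable[OF assms]])
  note [measurable] = laplace_on_measurable[OF assms(1)]
  show "(\<lambda>y. exp (- z * of_real y) * of_real (f y)) \<in> borel_measurable lborel" by measurable
qed (auto simp: norm_mult)

lemma laplace_on_add:
  "laplace_on r f \<Longrightarrow> laplace_on r g \<Longrightarrow> laplace_on r (\<lambda>y. f y + g y)"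
  by (auto simp: laplace_on_def ring_distribs)

lemma laplace_on_cmult: "laplace_on r f \<Longrightarrow> laplace_on r (\<lambda>y. c * f y)"
  by (auto simp: laplace_on_def mult.left_commute[of _ c])

lemma laplace_on_zero: "laplace_on r (\<lambda>y. 0)"
  by (auto simp: laplace_on_def)

lemma laplace_on_diff:
  "laplace_on r f \<Longrightarrow> laplace_on r g \<Longrightarrow> laplace_on r (\<lambda>y. f y - g y)"
  by (auto simp: laplace_on_def right_diff_distrib)

lemma laplace_on_sum:
  "(\<And>i. i \<in> I \<Longrightarrow> laplace_on r (f i)) \<Longrightarrow> laplace_on r (\<lambda>y. \<Sum>i\<in>I. f i y)"
  by (induction I rule: infinite_finite_induct) (auto intro!: laplace_on_add laplace_on_zero)

lemma lap_add:
  assumes "laplace_on r f" "laplace_on r g" "r < Re z"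
  shows "lap (\<lambda>y. f y + g y) z = lap f z + lap g z"
  using lap_integrable[OF assms(1,3)] lap_integrable[OF assms(2,3)]
  by (simp add: lap_def ring_distribs)

lemma lap_cmult: "lap (\<lambda>y. c * f y) z = of_real c * lap f z"
  by (simp add: lap_def mult.left_commute[of _ "of_real c"])

lemma lap_zero: "lap (\<lambda>y. 0) z = 0"
  by (simp add: lap_def)

lemma lap_sum:
  assumes "\<And>i. i \<in> I \<Longrightarrow> laplace_on r (f i)" "r < Re z"
  shows "lap (\<lambda>y. \<Sum>i\<in>I. f i y) z = (\<Sum>i\<in>I. lap (f i) z)"
  using assms(1)
proof (induction I rule: infinite_finite_induct)
  case (insert x F)
  thus ?case using assms(2) by (simp add: lap_add[of r] laplace_on_sum)
qed (auto simp: lap_zero)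

section \<open>Moments and complex derivatives of the transform\<close>

lemma laplace_on_times_id:
  assumes f: "laplace_on r f" shows "laplace_on r (\<lambda>y. y * f y)"
  unfolding laplace_on_def
proof (intro conjI allI impI)
  note [measurable] = laplace_on_measurable[OF f]
  fix w assume w: "r < w"
  \<comment> \<open>Half of the distance to the abscissa is spent on the growth of y: y <=
    exp(\<delta> y) / \<delta>.\<close>
  define \<delta> where "\<delta> = (w - r) / 2"
  have \<delta>: "\<delta> > 0" "w - \<delta> > r" using w by (auto simp: \<delta>_def field_simps)
  show "integrable lborel (\<lambda>y. exp (- w * y) * (y * f y))"
  proof (rule Bochner_Integration.integrable_bound)
    show "integrable lborel (\<lambda>y. (1/\<delta>) * (exp (- (w - \<delta>) * y) * f y))"
      using laplace_on_integrable[OF f \<delta>(2)] by (intro integrable_mult_right)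
    show "AE y in lborel. norm (exp (- w * y) * (y * f y)) \<le> norm ((1/\<delta>) * (exp (- (w - \<delta>) * y) * f y))"
    proof (rule AE_I2)
      fix y :: real
      show "norm (exp (- w * y) * (y * f y)) \<le> norm ((1/\<delta>) * (exp (- (w - \<delta>) * y) * f y))"
      proof (cases "y \<le> 0")
        case True thus ?thesis using laplace_on_nonpos[OF f] by simp
      next
        case False
        have "\<delta> * y \<le> exp (\<delta> * y)" using exp_ge_add_one_self[of "\<delta> * y"] by linarith
        hence "y \<le> (1/\<delta>) * exp (\<delta> * y)" using \<delta> by (simp add: field_simps)
        hence "exp (- w * y) * \<bar>f y\<bar> * y \<le> exp (- w * y) * \<bar>f y\<bar> * ((1/\<delta>) * exp (\<delta> * y))"
          by (intro mult_left_mono) auto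
        also have "\<dots> = (1/\<delta>) * (exp (- (w - \<delta>) * y) * \<bar>f y\<bar>)"
          by (simp add: mult_exp_exp algebra_simps)
        finally show ?thesis using False \<delta> by (simp add: abs_mult mult_ac)
      qed
    qed
  qed measurable
qed (use f in \<open>simp add: laplace_on_def\<close>)

lemma laplace_on_times_power: "laplace_on r f \<Longrightarrow> laplace_on r (\<lambda>y. y ^ k * f y)"
  by (induction k) (auto dest: laplace_on_times_id simp: mult.assoc)

text \<open>The first-order Taylor remainder of exp(-hy) is at most |hy|^2 exp(\<delta> y) for |h| <
  \<delta>, and y^2 f is still integrable against exp(-(Re z - \<delta>) y). The difference quotient
  therefore misses its limit by at most K |h|, and no limit has to be interchanged with an
  integral.\<close>

lemma lap_has_field_derivative:
  assumes f: "laplace_on r f" and z: "r < Re z"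
  shows "(lap f has_field_derivative - lap (\<lambda>y. y * f y) z) (at z)"
proof -
  define \<delta> where "\<delta> = (Re z - r) / 2"
  have \<delta>: "\<delta> > 0" "Re z - \<delta> > r" using z by (auto simp: \<delta>_def field_simps)
  note [measurable] = laplace_on_measurable[OF f]
  have f1: "laplace_on r (\<lambda>y. y * f y)" by (rule laplace_on_times_id[OF f])
  have f2: "laplace_on r (\<lambda>y. y ^ 2 * f y)" by (rule laplace_on_times_power[OF f])
  define K where "K = (LINT y|lborel. exp (- (Re z - \<delta>) * y) * \<bar>y ^ 2 * f y\<bar>)"
  note iK = laplace_on_integrable_abs[OF f2 \<delta>(2)]
  have K: "K \<ge> 0" unfolding K_def by (intro integral_nonneg_AE) auto
  have bound: "norm ((lap f w - lap f z) / (w - z) - (- lap (\<lambda>y. y * f y) z)) \<le> K * norm (w - z)"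
    if w: "norm (w - z) < \<delta>" "w \<noteq> z" for w
  proof -
    have "\<bar>Re w - Re z\<bar> \<le> norm (w - z)" using abs_Re_le_cmod[of "w - z"] by simp
    hence rw: "r < Re w" using w \<delta> by linarith
    define h where "h = w - z"
    have hb: "norm h < \<delta>" "h \<noteq> 0" using w by (auto simp: h_def)
    have iw: "integrable lborel (\<lambda>y. exp (- w * of_real y) * of_real (f y) :: complex)"
      by (rule lap_integrable[OF f rw])
    have iz: "integrable lborel (\<lambda>y. exp (- z * of_real y) * of_real (f y) :: complex)"
      by (rule lap_integrable[OF f z])
    have iz1: "integrable lborel (\<lambda>y. exp (- z * of_real y) * of_real (y * f y) :: complex)"
      by (rule lap_integrable[OF f1 z])
    have eq: "lap f w - lap f z + h * lap (\<lambda>y. y * f y) z =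
      (LINT y|lborel. exp (- w * of_real y) * of_real (f y) - exp (- z * of_real y) * of_real (f y)
         + h * (exp (- z * of_real y) * of_real (y * f y)))"
      unfolding lap_def using iw iz iz1 by simp
    have "norm (lap f w - lap f z + h * lap (\<lambda>y. y * f y) z)
      \<le> (LINT y|lborel. norm h ^ 2 * (exp (- (Re z - \<delta>) * y) * \<bar>y ^ 2 * f y\<bar>))"
      unfolding eq
    proof (rule order.trans[OF integral_norm_bound], rule integral_mono)
      show "integrable lborel (\<lambda>y. norm (exp (- w * of_real y) * of_real (f y) - exp (- z * of_real y) * of_real (f y)
         + h * (exp (- z * of_real y) * of_real (y * f y))))"
        using iw iz iz1 by (intro integrable_norm Bochner_Integration.integrable_add Bochner_Integration.integrable_diff integrable_mult_right)
      show "integrable lborel (\<lambda>y. norm h ^ 2 * (exp (- (Re z - \<delta>) * y) * \<bar>y ^ 2 * f y\<bar>))"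
        by (intro integrable_mult_right iK)
      fix y :: real
      show "norm (exp (- w * of_real y) * of_real (f y) - exp (- z * of_real y) * of_real (f y)
         + h * (exp (- z * of_real y) * of_real (y * f y))) \<le> norm h ^ 2 * (exp (- (Re z - \<delta>) * y) * \<bar>y ^ 2 * f y\<bar>)"
      proof (cases "y \<le> 0")
        case True thus ?thesis using laplace_on_nonpos[OF f] by simp
      next
        case False
        have "exp (- w * of_real y) = exp (- z * of_real y) * exp (- h * of_real y)"
          by (simp add: mult_exp_exp h_def algebra_simps)
        hence "exp (- w * of_real y) * of_real (f y) - exp (- z * of_real y) * of_real (f y)
         + h * (exp (- z * of_real y) * of_real (y * f y))
          = exp (- z * of_real y) * of_real (f y) * (exp (- h * of_real y) - (\<Sum>k\<le>1. (- h * of_real y) ^ k / fact k))"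
          by (simp add: algebra_simps)
        also have "norm \<dots> \<le> exp (- Re z * y) * \<bar>f y\<bar> * (exp \<bar>Re (- h * of_real y)\<bar> * norm (- h * of_real y) ^ Suc 1 / fact 1)"
        proof -
          have "norm (exp (- z * of_real y) * of_real (f y)) = exp (- Re z * y) * \<bar>f y\<bar>"
            by (simp add: norm_mult)
          thus ?thesis
            unfolding norm_mult[of "exp (- z * of_real y) * of_real (f y)"]
            using mult_left_mono[OF Taylor_exp[of "- h * of_real y" 1], of "exp (- Re z * y) * \<bar>f y\<bar>"] by simp
        qed
        also have "\<dots> \<le> exp (- Re z * y) * \<bar>f y\<bar> * (exp (\<delta> * y) * norm (- h * of_real y) ^ Suc 1 / fact 1)"
        proof -
          have "\<bar>Re (- h * of_real y)\<bar> \<le> norm (- h * of_real y)" by (rule abs_Re_le_cmod)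
          also have "\<dots> = norm h * y" using False by (simp add: norm_mult)
          also have "\<dots> \<le> \<delta> * y" using hb False by (intro mult_right_mono) auto
          finally show ?thesis by (intro mult_left_mono divide_right_mono mult_right_mono) auto
        qed
        also have "\<dots> = norm h ^ 2 * (exp (- (Re z - \<delta>) * y) * \<bar>y ^ 2 * f y\<bar>)"
        proof -
          have "exp (- (Re z - \<delta>) * y) = exp (- Re z * y) * exp (\<delta> * y)"
            by (simp add: mult_exp_exp algebra_simps)
          thus ?thesis by (simp add: norm_mult abs_mult power2_eq_square)
        qed
        finally show ?thesis .
      qed
    qed
    also have "\<dots> = norm h ^ 2 * K" by (simp add: K_def)
    finally have *: "norm (lap f w - lap f z + h * lap (\<lambda>y. y * f y) z) \<le> norm h ^ 2 * K" .
    have "(lap f w - lap f z) / (w - z) - (- lap (\<lambda>y. y * f y) z) = (lap f w - lap f z + h * lap (\<lambda>y. y * f y) z) / h"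
      using hb by (simp add: h_def field_simps)
    hence "norm ((lap f w - lap f z) / (w - z) - (- lap (\<lambda>y. y * f y) z)) = norm (lap f w - lap f z + h * lap (\<lambda>y. y * f y) z) / norm h"
      by (simp add: norm_divide)
    also have "\<dots> \<le> norm h ^ 2 * K / norm h" by (intro divide_right_mono *) auto
    finally show ?thesis using hb by (simp add: h_def power2_eq_square mult_ac)
  qed
  have "((\<lambda>w. (lap f w - lap f z) / (w - z) - (- lap (\<lambda>y. y * f y) z)) \<longlongrightarrow> 0) (at z)"
  proof (rule Lim_null_comparison)
    show "\<forall>\<^sub>F w in at z. norm ((lap f w - lap f z) / (w - z) - (- lap (\<lambda>y. y * f y) z)) \<le> K * norm (w - z)"
      unfolding eventually_at by (intro exI[of _ \<delta>]) (use \<delta> bound in \<open>auto simp: dist_norm\<close>)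
    show "((\<lambda>w. K * norm (w - z)) \<longlongrightarrow> 0) (at z)" by (auto intro!: tendsto_eq_intros)
  qed
  thus ?thesis unfolding has_field_derivative_iff by (rule LIM_zero_cancel)
qed

lemma lap_holomorphic: "laplace_on r f \<Longrightarrow> lap f holomorphic_on {z. r < Re z}"
  unfolding holomorphic_on_def field_differentiable_def mem_Collect_eq
  by (intro ballI exI, rule has_field_derivative_at_within, rule lap_has_field_derivative) simp_all

lemma lap_higher_deriv:
  assumes "laplace_on r f" "r < Re z"
  shows "(deriv ^^ k) (lap f) z = (-1) ^ k * lap (\<lambda>y. y ^ k * f y) z"
  using assms(2)
proof (induction k arbitrary: z)
  case (Suc k)
  have op: "open {z. r < Re z}" by (simp add: open_halfspace_Re_gt)
  have "(deriv ^^ Suc k) (lap f) z = deriv (\<lambda>z. (-1) ^ k * lap (\<lambda>y. y ^ k * f y) z) z"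
    unfolding funpow.simps o_apply
    by (rule deriv_cong_ev[OF _ refl])
       (use Suc eventually_nhds_in_open[OF op, of z] in \<open>auto elim!: eventually_mono\<close>)
  also have "\<dots> = (-1) ^ k * (- lap (\<lambda>y. y * (y ^ k * f y)) z)"
    by (intro DERIV_imp_deriv DERIV_cmult lap_has_field_derivative[of r] laplace_on_times_power assms Suc)
  finally show ?case by (simp add: mult.assoc)
qed simp

section \<open>Analytic continuation and uniqueness\<close>

text \<open>Identity theorem along the ray of real arguments beyond r. It allows transforms to be
  computed at real arguments only, where Euler's gamma and beta integrals apply.\<close>

lemma half_plane_identity:
  assumes F: "F holomorphic_on {z. r < Re z}" and G: "G holomorphic_on {z. r < Re z}"
    and eq: "\<And>s::real. r < s \<Longrightarrow> F (of_real s) = G (of_real s)" and z: "r < Re z"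
  shows "F z = (G z :: complex)"
proof -
  have "F z - G z = 0"
  proof (rule analytic_continuation[where f = "\<lambda>z. F z - G z" and w = z and S = "{z. r < Re z}" and U = "of_real ` {r<..}" and \<xi> = "of_real (r + 1)"])
    show "(\<lambda>z. F z - G z) holomorphic_on {z. r < Re z}" by (intro holomorphic_intros F G)
    show "connected {z. r < Re z}" by (intro convex_connected convex_halfspace_Re_gt)
    show "complex_of_real (r + 1) islimpt of_real ` {r<..}"
      unfolding islimpt_sequential
    proof (intro exI[of _ "\<lambda>n. complex_of_real (r + 1 + 1 / Suc n)"] conjI allI)
      show "(\<lambda>n. complex_of_real (r + 1 + 1 / Suc n)) \<longlonglongrightarrow> of_real (r + 1)"
        by (intro tendsto_of_real) (use tendsto_add[OF tendsto_const[of "r + 1"] LIMSEQ_inverse_real_of_nat] in \<open>simp add: field_simps\<close>)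
      fix n have "1 / real (Suc n) > 0" by simp
      hence "r + 1 + 1 / Suc n \<in> {r<..}" "r + 1 + 1 / Suc n \<noteq> r + 1" unfolding greaterThan_iff by linarith+
      thus "complex_of_real (r + 1 + 1 / Suc n) \<in> of_real ` {r<..} - {of_real (r + 1)}"
        using of_real_eq_iff[where 'a = complex] by blast
    qed
  qed (use eq z in \<open>auto simp: open_halfspace_Re_gt\<close>)
  thus ?thesis by simp
qed

text \<open>On the vertical line Re z = r + 1 the transforms are Fourier transforms of functions
  weighted by exp(-(r + 1) y), so the weighted difference \<open>k\<close> has vanishing Fourier
  transform. Levy's uniqueness theorem speaks of probability measures, hence the split of
  \<open>k\<close> into positive and negative part, normalised by their common mass.\<close>

lemma laplace_unique:
  assumes f: "laplace_on r f" and g: "laplace_on r g"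
    and eq: "\<And>z. r < Re z \<Longrightarrow> lap f z = lap g z"
  shows "AE y in lborel. f y = g y"
proof -
  note [measurable] = laplace_on_measurable[OF f] laplace_on_measurable[OF g]
  define k where "k = (\<lambda>y. exp (- (r + 1) * y) * (f y - g y))"
  have [measurable]: "k \<in> borel_measurable borel" unfolding k_def by measurable
  have ik: "integrable lborel k"
    unfolding k_def by (rule laplace_on_integrable[OF laplace_on_diff[OF f g]]) simp
  have k0: "(LINT y|lborel. iexp (t * y) * of_real (k y)) = 0" for t
  proof -
    have "(LINT y|lborel. iexp (t * y) * of_real (k y)) =
       (LINT y|lborel. exp (- Complex (r + 1) (- t) * of_real y) * of_real (f y) - exp (- Complex (r + 1) (- t) * of_real y) * of_real (g y))"
    proof (intro Bochner_Integration.integral_cong refl)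
      fix y :: real
      have "exp (- Complex (r + 1) (- t) * of_real y) = iexp (t * y) * exp (of_real (- (r + 1) * y))"
        unfolding mult_exp_exp by (rule arg_cong[where f = exp]) (simp add: complex_eq_iff algebra_simps)
      thus "iexp (t * y) * of_real (k y) = exp (- Complex (r + 1) (- t) * of_real y) * of_real (f y)
         - exp (- Complex (r + 1) (- t) * of_real y) * of_real (g y)"
        unfolding k_def exp_of_real by (simp add: right_diff_distrib)
    qed
    also have "\<dots> = lap f (Complex (r + 1) (- t)) - lap g (Complex (r + 1) (- t))"
      unfolding lap_def by (intro Bochner_Integration.integral_diff lap_integrable[OF f] lap_integrable[OF g]) auto
    also have "\<dots> = 0" using eq by simp
    finally show ?thesis .
  qed
  define P where "P = (\<lambda>y. max 0 (k y))"
  define N where "N = (\<lambda>y. max 0 (- k y))"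
  have [measurable]: "P \<in> borel_measurable borel" "N \<in> borel_measurable borel"
    unfolding P_def N_def by measurable
  have iP: "integrable lborel P" and iN: "integrable lborel N"
    unfolding P_def N_def using ik by (auto intro!: integrable_max)
  have PN: "k y = P y - N y" for y by (auto simp: P_def N_def)
  have P0: "P y \<ge> 0" and N0: "N y \<ge> 0" for y by (auto simp: P_def N_def)
  have ich: "integrable lborel (\<lambda>y. iexp (t * y) * of_real (h y))" if "integrable lborel h" for t and h :: "real \<Rightarrow> real"
    by (rule Bochner_Integration.integrable_bound[OF that]) (use that borel_measurable_integrable[OF that] in \<open>auto simp: norm_mult\<close>)
  have ch: "(LINT y|lborel. iexp (t * y) * of_real (P y)) = (LINT y|lborel. iexp (t * y) * of_real (N y))" for t
    using k0[of t] ich[OF iP, of t] ich[OF iN, of t] by (simp add: PN ring_distribs)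
  define c where "c = (LINT y|lborel. P y)"
  \<comment> \<open>At frequency 0 the equality of the Fourier transforms says that both parts have
    the same mass \<open>c\<close>; for c = 0 no normalisation is possible, but then both vanish
    almost everywhere.\<close>
  have "complex_of_real c = of_real (LINT y|lborel. N y)"
    using ch[of 0] by (simp add: c_def)
  hence cN: "c = (LINT y|lborel. N y)" by simp
  have c0: "c \<ge> 0" unfolding c_def by (intro integral_nonneg_AE) (auto simp: P0)
  have "AE y in lborel. P y = N y"
  proof (cases "c = 0")
    case True
    have "AE y in lborel. P y = 0" using True iP P0 integral_nonneg_eq_0_iff_AE[of lborel P] by (simp add: c_def)
    moreover have "AE y in lborel. N y = 0" using True iN N0 integral_nonneg_eq_0_iff_AE[of lborel N] by (simp add: cN)
    ultimately show ?thesis by eventually_elim simp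
  next
    case False
    hence c: "c > 0" using c0 by simp
    have rd: "real_distribution (density lborel (\<lambda>y. ennreal (h y / c)))" 
      and chr: "char (density lborel (\<lambda>y. ennreal (h y / c))) t = (LINT y|lborel. iexp (t * y) * of_real (h y)) / c"
      if h: "integrable lborel h" "\<And>y. h y \<ge> 0" "(LINT y|lborel. h y) = c" for h t
    proof -
      have [measurable]: "h \<in> borel_measurable borel" using borel_measurable_integrable[OF h(1)] by simp
      have "(\<integral>\<^sup>+ y. ennreal (h y / c) \<partial>lborel) = ennreal (LINT y|lborel. h y / c)"
        using h c by (intro nn_integral_eq_integral) auto
      hence "emeasure (density lborel (\<lambda>y. ennreal (h y / c))) UNIV = 1"
        using h c by (simp add: emeasure_density)
      thus "real_distribution (density lborel (\<lambda>y. ennreal (h y / c)))"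
        by (auto simp: real_distribution_def real_distribution_axioms_def intro!: prob_spaceI)
      have "char (density lborel (\<lambda>y. ennreal (h y / c))) t = (LINT y|lborel. (h y / c) *\<^sub>R iexp (t * y))"
        unfolding char_def using h c by (subst integral_density) auto
      also have "\<dots> = (LINT y|lborel. iexp (t * y) * of_real (h y) / c)"
        by (simp add: scaleR_conv_of_real mult_ac)
      finally show "char (density lborel (\<lambda>y. ennreal (h y / c))) t = (LINT y|lborel. iexp (t * y) * of_real (h y)) / c"
        by simp
    qed
    have "density lborel (\<lambda>y. ennreal (P y / c)) = density lborel (\<lambda>y. ennreal (N y / c))"
      by (intro Levy_uniqueness rd iP iN P0 N0 c_def[symmetric] cN[symmetric] ext)
         (simp only: chr[OF iP P0 c_def[symmetric]] chr[OF iN N0 cN[symmetric]] ch)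
    hence "AE y in lborel. ennreal (P y / c) = ennreal (N y / c)"
      by (intro sigma_finite_measure.density_unique[OF sigma_finite_lborel]) auto
    thus ?thesis by eventually_elim (use c P0 N0 in \<open>auto simp: ennreal_inj\<close>)
  qed
  thus ?thesis
  proof eventually_elim
    case (elim y)
    hence "k y = 0" using PN by simp
    thus "f y = g y" unfolding k_def by simp
  qed
qed

section \<open>Additive convolution\<close>

lemma integrable_shear:
  fixes F G :: "real \<Rightarrow> 'a::{real_normed_field, banach, second_countable_topology}"
  assumes F: "integrable lborel F" and G: "integrable lborel G"
  shows "integrable (lborel \<Otimes>\<^sub>M lborel) (\<lambda>(u, y). F u * G (y - u))"
proof -
  from borel_measurable_integrable[OF F] borel_measurable_integrable[OF G]
  have [measurable]: "F \<in> borel_measurable borel" "G \<in> borel_measurable borel" by simp_all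
  have tr: "(LINT y|lborel. norm (F x * G (y - x))) = norm (F x) * (LINT y|lborel. norm (G y))" for x
    using lborel_integral_real_affine[of 1 "\<lambda>y. norm (G y)" "- x"] by (simp add: norm_mult)
  show ?thesis
  proof (rule lborel_pair.Fubini_integrable)
    show "(\<lambda>(u, y). F u * G (y - u)) \<in> borel_measurable (lborel \<Otimes>\<^sub>M lborel)" by measurable
    show "integrable lborel (\<lambda>x. \<integral>y. norm (case (x, y) of (u, y) \<Rightarrow> F u * G (y - u)) \<partial>lborel)"
      unfolding prod.case tr by (intro integrable_mult_left integrable_norm F)
    show "AE x in lborel. integrable lborel (\<lambda>y. case (x, y) of (u, y) \<Rightarrow> F u * G (y - u))"
    proof (rule AE_I2)
      fix x show "integrable lborel (\<lambda>y. case (x, y) of (u, y) \<Rightarrow> F u * G (y - u))"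
        using lborel_integrable_real_affine[OF G, of 1 "- x"] by (simp add: integrable_mult_right)
    qed
  qed
qed

text \<open>The field is kept general because the real instance yields weighted norms and the
  complex one the product rule for transforms.\<close>

lemma
  fixes F G :: "real \<Rightarrow> 'a::{real_normed_field, banach, second_countable_topology}"
  assumes F: "integrable lborel F" and G: "integrable lborel G"
  shows AE_integrable_convolution: "AE y in lborel. integrable lborel (\<lambda>u. F u * G (y - u))"
    and integrable_convolution: "integrable lborel (\<lambda>y. LINT u|lborel. F u * G (y - u))"
    and integral_convolution: "(LINT y|lborel. LINT u|lborel. F u * G (y - u)) = (LINT u|lborel. F u) * (LINT u|lborel. G u)"
proof -
  note sh = integrable_shear[OF F G]
  show "AE y in lborel. integrable lborel (\<lambda>u. F u * G (y - u))"
    by (rule lborel_pair.AE_integrable_snd[OF sh])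
  show "integrable lborel (\<lambda>y. LINT u|lborel. F u * G (y - u))"
    by (rule lborel_pair.integrable_snd[OF sh])
  have tr: "(LINT y|lborel. G (y - x)) = (LINT y|lborel. G y)" for x
    using lborel_integral_real_affine[of 1 G "- x"] by simp
  have "(LINT y|lborel. LINT u|lborel. F u * G (y - u)) = (LINT u|lborel. LINT y|lborel. F u * G (y - u))"
    using lborel_pair.integral_snd[OF sh] lborel_pair.integral_fst[OF sh] by simp
  thus "(LINT y|lborel. LINT u|lborel. F u * G (y - u)) = (LINT u|lborel. F u) * (LINT u|lborel. G u)"
    by (simp add: tr)
qed

lemma convolution_norm_le:
  fixes F G :: "real \<Rightarrow> real"
  assumes F: "integrable lborel F" and G: "integrable lborel G"
  shows "(LINT y|lborel. \<bar>LINT u|lborel. F u * G (y - u)\<bar>) \<le> (LINT u|lborel. \<bar>F u\<bar>) * (LINT u|lborel. \<bar>G u\<bar>)"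
proof -
  have "(LINT y|lborel. \<bar>LINT u|lborel. F u * G (y - u)\<bar>) \<le> (LINT y|lborel. LINT u|lborel. \<bar>F u\<bar> * \<bar>G (y - u)\<bar>)"
  proof (rule integral_mono)
    show "integrable lborel (\<lambda>y. \<bar>LINT u|lborel. F u * G (y - u)\<bar>)"
      by (intro integrable_abs integrable_convolution F G)
    show "integrable lborel (\<lambda>y. LINT u|lborel. \<bar>F u\<bar> * \<bar>G (y - u)\<bar>)"
      by (intro integrable_convolution integrable_abs F G)
    fix y
    have "\<bar>LINT u|lborel. F u * G (y - u)\<bar> \<le> (LINT u|lborel. norm (F u * G (y - u)))"
      using integral_norm_bound[of lborel "\<lambda>u. F u * G (y - u)"] by simp
    thus "\<bar>LINT u|lborel. F u * G (y - u)\<bar> \<le> (LINT u|lborel. \<bar>F u\<bar> * \<bar>G (y - u)\<bar>)"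
      by (simp add: abs_mult)
  qed
  also have "\<dots> = (LINT u|lborel. \<bar>F u\<bar>) * (LINT u|lborel. \<bar>G u\<bar>)"
    by (intro integral_convolution integrable_abs F G)
  finally show ?thesis .
qed

text \<open>Both supports lie in the open positive axis, so the restriction to [0, y] is
  automatic.\<close>

lemma add_conv_eq:
  assumes f: "\<And>y. y \<le> 0 \<Longrightarrow> f y = 0" and g: "\<And>y. y \<le> 0 \<Longrightarrow> g y = 0"
  shows "add_conv f g y = (LINT u|lborel. f u * g (y - u))"
  unfolding add_conv_def set_lebesgue_integral_def
proof (intro Bochner_Integration.integral_cong refl)
  fix u show "indicator {0..y} u *\<^sub>R (f u * g (y - u)) = f u * g (y - u)"
    using f[of u] g[of "y - u"] by (cases "0 \<le> u"; cases "u \<le> y") auto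
qed

lemma add_conv_nonpos:
  assumes f: "\<And>y. y \<le> 0 \<Longrightarrow> f y = 0" and g: "\<And>y. y \<le> 0 \<Longrightarrow> g y = 0" and y: "y \<le> 0"
  shows "add_conv f g y = 0"
proof -
  have "f u * g (y - u) = 0" for u using f[of u] g[of "y - u"] y by (cases "u \<le> 0") auto
  thus ?thesis by (simp only: add_conv_eq[OF f g]) simp
qed

text \<open>exp(-zy) = exp(-zu) exp(-z(y - u)): weighting by an exponential commutes with
  convolution, so unweighted L^1 theory applies to the weighted functions.\<close>

lemma exp_convolution_integrand:
  fixes z :: "'a::{real_normed_field, banach}"
  shows "exp (- z * of_real y) * (of_real (f u) * of_real (g (y - u))) =
    (exp (- z * of_real u) * of_real (f u)) * (exp (- z * of_real (y - u)) * of_real (g (y - u)))"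
proof -
  have "exp (- z * of_real y) = exp (- z * of_real u) * exp (- z * of_real (y - u))"
    by (subst mult_exp_exp) (simp add: algebra_simps)
  thus ?thesis by simp
qed

lemma exp_add_conv_real:
  assumes f: "laplace_on r f" and g: "laplace_on r g"
  shows "exp (- w * y) * add_conv f g y = (LINT u|lborel. (exp (- w * u) * f u) * (exp (- w * (y - u)) * g (y - u)))"
proof -
  have "exp (- w * y) * add_conv f g y = (LINT u|lborel. exp (- w * y) * (f u * g (y - u)))"
    using laplace_on_nonpos[OF f] laplace_on_nonpos[OF g] by (simp add: add_conv_eq)
  thus ?thesis
    by (simp only: exp_convolution_integrand[where 'a = real, unfolded of_real_eq_id id_apply])
qed

lemma exp_add_conv_complex:
  assumes f: "laplace_on r f" and g: "laplace_on r g"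
  shows "exp (- z * of_real y) * complex_of_real (add_conv f g y) =
    (LINT u|lborel. (exp (- z * of_real u) * of_real (f u)) * (exp (- z * of_real (y - u)) * of_real (g (y - u))))"
proof -
  have "complex_of_real (add_conv f g y) = (LINT u|lborel. complex_of_real (f u * g (y - u)))"
    using laplace_on_nonpos[OF f] laplace_on_nonpos[OF g]
    by (simp only: add_conv_eq integral_complex_of_real)
  hence "exp (- z * of_real y) * complex_of_real (add_conv f g y)
     = (LINT u|lborel. exp (- z * of_real y) * complex_of_real (f u * g (y - u)))"
    by (simp only: integral_mult_right_zero)
  thus ?thesis by (simp only: of_real_mult exp_convolution_integrand)
qed

lemma laplace_on_add_conv:
  assumes f: "laplace_on r f" and g: "laplace_on r g"
  shows "laplace_on r (add_conv f g)"
  unfolding laplace_on_def exp_add_conv_real[OF f g]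
  using integrable_convolution[OF laplace_on_integrable[OF f] laplace_on_integrable[OF g]]
  by (auto intro!: add_conv_nonpos laplace_on_nonpos[OF f] laplace_on_nonpos[OF g])

lemma lap_add_conv:
  assumes f: "laplace_on r f" and g: "laplace_on r g" and z: "r < Re z"
  shows "lap (add_conv f g) z = lap f z * lap g z"
  unfolding lap_def exp_add_conv_complex[OF f g]
  by (rule integral_convolution[OF lap_integrable[OF f z] lap_integrable[OF g z]])

section \<open>Weighted $L^1$ convergence\<close>

text \<open>The members of the family may live on a half-plane that is smaller by \<open>1 / \<tau>\<close>: the
  Mellin transforms of the Jacobi functions are prescribed for $\Re z > -a_h$, that is, for
  $\Re (z / \tau) > - \rho_h + 1 / \tau$.\<close>

definition laplace_tendsto :: "real \<Rightarrow> (real \<Rightarrow> real \<Rightarrow> real) \<Rightarrow> (real \<Rightarrow> real) \<Rightarrow> bool" where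
  "laplace_tendsto r F f \<longleftrightarrow> laplace_on r f \<and> (\<forall>\<tau>>0. laplace_on (r + 1 / \<tau>) (F \<tau>)) \<and>
     (\<forall>w>r. ((\<lambda>\<tau>. LINT y|lborel. exp (- w * y) * \<bar>F \<tau> y - f y\<bar>) \<longlongrightarrow> 0) at_top)"

lemma laplace_tendsto_on: "laplace_tendsto r F f \<Longrightarrow> laplace_on r f"
  and laplace_tendsto_family: "laplace_tendsto r F f \<Longrightarrow> 0 < \<tau> \<Longrightarrow> laplace_on (r + 1 / \<tau>) (F \<tau>)"
  and laplace_tendsto_norm: "laplace_tendsto r F f \<Longrightarrow> r < w \<Longrightarrow>
    ((\<lambda>\<tau>. LINT y|lborel. exp (- w * y) * \<bar>F \<tau> y - f y\<bar>) \<longlongrightarrow> 0) at_top"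
  by (simp_all add: laplace_tendsto_def)

text \<open>The defect 1/\<tau> of the half-planes is eventually below the margin w - r; every
  convergence proof at a fixed weight starts from here.\<close>

lemma eventually_half_plane:
  fixes r w :: real assumes "r < w" shows "\<forall>\<^sub>F \<tau> in at_top. 0 < \<tau> \<and> r + 1 / \<tau> < w"
proof -
  have "\<forall>\<^sub>F \<tau>::real in at_top. r + 1 / \<tau> < w"
    using assms by (intro order_tendstoD(2)[of "\<lambda>\<tau>. r + 1 / \<tau>" r]) real_asymp
  with eventually_gt_at_top[of 0] show ?thesis by eventually_elim simp
qed

lemma laplace_tendsto_diff_integrable:
  assumes F: "laplace_tendsto r F f" and w: "0 < \<tau>" "r + 1 / \<tau> < w"
  shows "integrable lborel (\<lambda>y. exp (- w * y) * \<bar>F \<tau> y - f y\<bar>)"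
proof (rule laplace_on_integrable_abs[OF laplace_on_diff w(2)])
  show "laplace_on (r + 1 / \<tau>) (F \<tau>)" by (rule laplace_tendsto_family[OF F w(1)])
  show "laplace_on (r + 1 / \<tau>) f" using laplace_tendsto_on[OF F] w by (auto intro: laplace_on_mono)
qed

lemma laplace_tendsto_add:
  assumes F: "laplace_tendsto r F f" and G: "laplace_tendsto r G g"
  shows "laplace_tendsto r (\<lambda>\<tau> y. F \<tau> y + G \<tau> y) (\<lambda>y. f y + g y)"
  unfolding laplace_tendsto_def
proof (intro conjI allI impI)
  fix w assume w: "r < w"
  show "((\<lambda>\<tau>. LINT y|lborel. exp (- w * y) * \<bar>F \<tau> y + G \<tau> y - (f y + g y)\<bar>) \<longlongrightarrow> 0) at_top"
  proof (rule Lim_null_comparison)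
    show "((\<lambda>\<tau>. (LINT y|lborel. exp (- w * y) * \<bar>F \<tau> y - f y\<bar>) + (LINT y|lborel. exp (- w * y) * \<bar>G \<tau> y - g y\<bar>)) \<longlongrightarrow> 0) at_top"
      using tendsto_add[OF laplace_tendsto_norm[OF F w] laplace_tendsto_norm[OF G w]] by simp
    show "\<forall>\<^sub>F \<tau> in at_top. norm (LINT y|lborel. exp (- w * y) * \<bar>F \<tau> y + G \<tau> y - (f y + g y)\<bar>) \<le>
       (LINT y|lborel. exp (- w * y) * \<bar>F \<tau> y - f y\<bar>) + (LINT y|lborel. exp (- w * y) * \<bar>G \<tau> y - g y\<bar>)"
      using eventually_half_plane[OF w]
    proof eventually_elim
      case (elim \<tau>)
      note iF = laplace_tendsto_diff_integrable[OF F, of \<tau> w] and iG = laplace_tendsto_diff_integrable[OF G, of \<tau> w]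
      have "norm (LINT y|lborel. exp (- w * y) * \<bar>F \<tau> y + G \<tau> y - (f y + g y)\<bar>) =
        (LINT y|lborel. exp (- w * y) * \<bar>F \<tau> y + G \<tau> y - (f y + g y)\<bar>)"
        by (simp add: integral_nonneg_AE)
      also have "\<dots> \<le> (LINT y|lborel. exp (- w * y) * \<bar>F \<tau> y - f y\<bar> + exp (- w * y) * \<bar>G \<tau> y - g y\<bar>)"
      proof (rule integral_mono')
        show "exp (- w * y) * \<bar>F \<tau> y + G \<tau> y - (f y + g y)\<bar> \<le> exp (- w * y) * \<bar>F \<tau> y - f y\<bar> + exp (- w * y) * \<bar>G \<tau> y - g y\<bar>" for y
          unfolding distrib_left[symmetric] by (intro mult_left_mono) auto
      qed (use elim iF iG in auto)
      finally show ?case using elim iF iG by simp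
    qed
  qed
qed (use F G in \<open>auto simp: laplace_tendsto_def intro!: laplace_on_add\<close>)

lemma laplace_tendsto_cmult:
  assumes F: "laplace_tendsto r F f" and c: "(c \<longlongrightarrow> c0) at_top"
  shows "laplace_tendsto r (\<lambda>\<tau> y. c \<tau> * F \<tau> y) (\<lambda>y. c0 * f y)"
  unfolding laplace_tendsto_def
proof (intro conjI allI impI)
  fix w assume w: "r < w"
  define K where "K = (LINT y|lborel. exp (- w * y) * \<bar>f y\<bar>)"
  show "((\<lambda>\<tau>. LINT y|lborel. exp (- w * y) * \<bar>c \<tau> * F \<tau> y - c0 * f y\<bar>) \<longlongrightarrow> 0) at_top"
  proof (rule Lim_null_comparison)
    show "((\<lambda>\<tau>. \<bar>c \<tau>\<bar> * (LINT y|lborel. exp (- w * y) * \<bar>F \<tau> y - f y\<bar>) + \<bar>c \<tau> - c0\<bar> * K) \<longlongrightarrow> 0) at_top"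
      by (rule tendsto_eq_intros c laplace_tendsto_norm[OF F w] refl | simp)+
    show "\<forall>\<^sub>F \<tau> in at_top. norm (LINT y|lborel. exp (- w * y) * \<bar>c \<tau> * F \<tau> y - c0 * f y\<bar>) \<le>
       \<bar>c \<tau>\<bar> * (LINT y|lborel. exp (- w * y) * \<bar>F \<tau> y - f y\<bar>) + \<bar>c \<tau> - c0\<bar> * K"
      using eventually_half_plane[OF w]
    proof eventually_elim
      case (elim \<tau>)
      note iF = laplace_tendsto_diff_integrable[OF F, of \<tau> w]
      note i_f = laplace_on_integrable_abs[OF laplace_tendsto_on[OF F] w]
      have "norm (LINT y|lborel. exp (- w * y) * \<bar>c \<tau> * F \<tau> y - c0 * f y\<bar>) =
        (LINT y|lborel. exp (- w * y) * \<bar>c \<tau> * F \<tau> y - c0 * f y\<bar>)"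
        by (simp add: integral_nonneg_AE)
      also have "\<dots> \<le> (LINT y|lborel. \<bar>c \<tau>\<bar> * (exp (- w * y) * \<bar>F \<tau> y - f y\<bar>) + \<bar>c \<tau> - c0\<bar> * (exp (- w * y) * \<bar>f y\<bar>))"
      proof (rule integral_mono')
        fix y
        have "\<bar>c \<tau> * F \<tau> y - c0 * f y\<bar> = \<bar>c \<tau> * (F \<tau> y - f y) + (c \<tau> - c0) * f y\<bar>" by (simp add: algebra_simps)
        also have "\<dots> \<le> \<bar>c \<tau>\<bar> * \<bar>F \<tau> y - f y\<bar> + \<bar>c \<tau> - c0\<bar> * \<bar>f y\<bar>"
          unfolding abs_mult[symmetric] by (rule abs_triangle_ineq)
        finally have "exp (- w * y) * \<bar>c \<tau> * F \<tau> y - c0 * f y\<bar> \<le> exp (- w * y) * (\<bar>c \<tau>\<bar> * \<bar>F \<tau> y - f y\<bar> + \<bar>c \<tau> - c0\<bar> * \<bar>f y\<bar>)"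
          by (intro mult_left_mono) auto
        thus "exp (- w * y) * \<bar>c \<tau> * F \<tau> y - c0 * f y\<bar> \<le> \<bar>c \<tau>\<bar> * (exp (- w * y) * \<bar>F \<tau> y - f y\<bar>) + \<bar>c \<tau> - c0\<bar> * (exp (- w * y) * \<bar>f y\<bar>)"
          by (simp add: algebra_simps)
      qed (use elim iF i_f in auto)
      finally show ?case using elim iF i_f by (simp add: K_def)
    qed
  qed
qed (use F in \<open>auto simp: laplace_tendsto_def intro!: laplace_on_cmult\<close>)

text \<open>With A = F - f and B = G - g the difference of the convolutions is A*B + f*B + A*g.
  Young's inequality holds for the weighted norm because the weight is multiplicative.\<close>

lemma laplace_tendsto_add_conv:
  assumes F: "laplace_tendsto r F f" and G: "laplace_tendsto r G g"
  shows "laplace_tendsto r (\<lambda>\<tau>. add_conv (F \<tau>) (G \<tau>)) (add_conv f g)"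
  unfolding laplace_tendsto_def
proof (intro conjI allI impI)
  fix w assume w: "r < w"
  note f = laplace_tendsto_on[OF F] and g = laplace_tendsto_on[OF G]
  define nrm where "nrm = (\<lambda>h::real \<Rightarrow> real. LINT y|lborel. exp (- w * y) * \<bar>h y\<bar>)"
  have nn: "nrm h \<ge> 0" for h unfolding nrm_def by (intro integral_nonneg_AE) auto
  have conv_le: "nrm (add_conv h k) \<le> nrm h * nrm k" if "laplace_on s h" "laplace_on s k" "s < w" for h k s
  proof -
    have "nrm (add_conv h k) = (LINT y|lborel. \<bar>LINT u|lborel. (exp (- w * u) * h u) * (exp (- w * (y - u)) * k (y - u))\<bar>)"
      unfolding nrm_def exp_add_conv_real[OF that(1,2), symmetric] by (simp add: abs_mult)
    also have "\<dots> \<le> nrm h * nrm k"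
      using convolution_norm_le[OF laplace_on_integrable[OF that(1,3)] laplace_on_integrable[OF that(2,3)]]
      by (simp add: nrm_def abs_mult)
    finally show ?thesis .
  qed
  have lim: "((\<lambda>\<tau>. nrm (\<lambda>y. F \<tau> y - f y)) \<longlongrightarrow> 0) at_top" "((\<lambda>\<tau>. nrm (\<lambda>y. G \<tau> y - g y)) \<longlongrightarrow> 0) at_top"
    using laplace_tendsto_norm[OF F w] laplace_tendsto_norm[OF G w] by (simp_all add: nrm_def)
  have "((\<lambda>\<tau>. nrm (\<lambda>y. add_conv (F \<tau>) (G \<tau>) y - add_conv f g y)) \<longlongrightarrow> 0) at_top"
  proof (rule Lim_null_comparison)
    show "((\<lambda>\<tau>. nrm (\<lambda>y. F \<tau> y - f y) * nrm (\<lambda>y. G \<tau> y - g y) + nrm f * nrm (\<lambda>y. G \<tau> y - g y)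
      + nrm (\<lambda>y. F \<tau> y - f y) * nrm g) \<longlongrightarrow> 0) at_top"
      by (rule tendsto_eq_intros lim refl | simp)+
    show "\<forall>\<^sub>F \<tau> in at_top. norm (nrm (\<lambda>y. add_conv (F \<tau>) (G \<tau>) y - add_conv f g y)) \<le>
      nrm (\<lambda>y. F \<tau> y - f y) * nrm (\<lambda>y. G \<tau> y - g y) + nrm f * nrm (\<lambda>y. G \<tau> y - g y)
      + nrm (\<lambda>y. F \<tau> y - f y) * nrm g"
      using eventually_half_plane[OF w]
    proof eventually_elim
      case (elim \<tau>)
      define s where "s = r + 1 / \<tau>"
      have s: "s < w" using elim by (simp add: s_def)
      have f': "laplace_on s f" and g': "laplace_on s g" using f g elim by (auto simp: s_def intro: laplace_on_mono)
      have F': "laplace_on s (F \<tau>)" and G': "laplace_on s (G \<tau>)"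
        unfolding s_def by (rule laplace_tendsto_family F G elim[THEN conjunct1])+
      define A where "A = (\<lambda>y. F \<tau> y - f y)"
      define B where "B = (\<lambda>y. G \<tau> y - g y)"
      have A: "laplace_on s A" and B: "laplace_on s B" unfolding A_def B_def by (intro laplace_on_diff F' G' f' g')+
      \<comment> \<open>The expansion holds where the four convolution integrals converge, which is
        almost everywhere only.\<close>
      have ae: "AE y in lborel. exp (- w * y) * \<bar>add_conv (F \<tau>) (G \<tau>) y - add_conv f g y\<bar> =
         exp (- w * y) * \<bar>add_conv A B y + add_conv f B y + add_conv A g y\<bar>"
        using AE_integrable_convolution[OF laplace_on_integrable[OF A s] laplace_on_integrable[OF B s]]
          AE_integrable_convolution[OF laplace_on_integrable[OF f' s] laplace_on_integrable[OF B s]]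
          AE_integrable_convolution[OF laplace_on_integrable[OF A s] laplace_on_integrable[OF g' s]]
          AE_integrable_convolution[OF laplace_on_integrable[OF f' s] laplace_on_integrable[OF g' s]]
      proof eventually_elim
        case (elim y)
        have "exp (- w * y) * (add_conv A B y + add_conv f B y + add_conv A g y + add_conv f g y) =
           exp (- w * y) * add_conv A B y + exp (- w * y) * add_conv f B y + exp (- w * y) * add_conv A g y + exp (- w * y) * add_conv f g y"
          by (simp add: distrib_left)
        also have "\<dots> = exp (- w * y) * add_conv (F \<tau>) (G \<tau>) y"
          unfolding exp_add_conv_real[OF A B] exp_add_conv_real[OF f' B] exp_add_conv_real[OF A g']
            exp_add_conv_real[OF f' g'] exp_add_conv_real[OF F' G']
          using elim
          by (simp add: Bochner_Integration.integral_add[symmetric] del: Bochner_Integration.integral_add)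
             (simp add: A_def B_def algebra_simps)
        finally have "add_conv A B y + add_conv f B y + add_conv A g y + add_conv f g y = add_conv (F \<tau>) (G \<tau>) y"
          by simp
        thus ?case by (simp add: algebra_simps)
      qed
      have i1: "integrable lborel (\<lambda>y. exp (- w * y) * \<bar>add_conv A B y\<bar>)"
           "integrable lborel (\<lambda>y. exp (- w * y) * \<bar>add_conv f B y\<bar>)"
           "integrable lborel (\<lambda>y. exp (- w * y) * \<bar>add_conv A g y\<bar>)"
        by (intro laplace_on_integrable_abs[OF _ s] laplace_on_add_conv A B f' g')+
      have m: "h \<in> borel_measurable lborel" if "laplace_on s h" for h using laplace_on_measurable[OF that] by simp
      have [measurable]: "add_conv (F \<tau>) (G \<tau>) \<in> borel_measurable borel" "add_conv f g \<in> borel_measurable borel"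
         "add_conv A B \<in> borel_measurable borel" "add_conv f B \<in> borel_measurable borel" "add_conv A g \<in> borel_measurable borel"
        by (rule laplace_on_measurable laplace_on_add_conv F' G' f' g' A B)+
      have "norm (nrm (\<lambda>y. add_conv (F \<tau>) (G \<tau>) y - add_conv f g y)) =
         (LINT y|lborel. exp (- w * y) * \<bar>add_conv (F \<tau>) (G \<tau>) y - add_conv f g y\<bar>)"
        using nn by (simp add: nrm_def)
      also have "\<dots> = (LINT y|lborel. exp (- w * y) * \<bar>add_conv A B y + add_conv f B y + add_conv A g y\<bar>)"
        by (rule integral_cong_AE[OF _ _ ae]) measurable
      also have "\<dots> \<le> (LINT y|lborel. exp (- w * y) * \<bar>add_conv A B y\<bar> + exp (- w * y) * \<bar>add_conv f B y\<bar> + exp (- w * y) * \<bar>add_conv A g y\<bar>)"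
      proof (rule integral_mono')
        show "exp (- w * y) * \<bar>add_conv A B y + add_conv f B y + add_conv A g y\<bar> \<le>
          exp (- w * y) * \<bar>add_conv A B y\<bar> + exp (- w * y) * \<bar>add_conv f B y\<bar> + exp (- w * y) * \<bar>add_conv A g y\<bar>" for y
          unfolding distrib_left[symmetric] by (intro mult_left_mono) auto
      qed (use i1 in auto)
      also have "\<dots> = nrm (add_conv A B) + nrm (add_conv f B) + nrm (add_conv A g)"
        using i1 by (simp add: nrm_def)
      also have "\<dots> \<le> nrm A * nrm B + nrm f * nrm B + nrm A * nrm g"
        by (intro add_mono conv_le[OF _ _ s] A B f' g')
      finally show ?case by (simp add: A_def B_def)
    qed
  qed
  thus "((\<lambda>\<tau>. LINT y|lborel. exp (- w * y) * \<bar>add_conv (F \<tau>) (G \<tau>) y - add_conv f g y\<bar>) \<longlongrightarrow> 0) at_top"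
    by (simp add: nrm_def)
qed (use F G in \<open>auto simp: laplace_tendsto_def intro!: laplace_on_add_conv\<close>)

section \<open>Gamma and beta kernels\<close>

lemma lap_of_real: "lap f (of_real s) = of_real (LINT y|lborel. exp (- s * y) * f y)"
proof -
  have "complex_of_real (LINT y|lborel. exp (- s * y) * f y) = (LINT y|lborel. complex_of_real (exp (- s * y) * f y))"
    by (rule integral_complex_of_real[symmetric])
  thus ?thesis by (simp add: lap_def exp_of_real[symmetric])
qed

section \<open>Gamma kernels\<close>

lemma has_bochner_integral_Gamma:
  fixes c s :: real assumes c: "0 < c" and s: "0 < s"
  shows "has_bochner_integral lborel (\<lambda>y. indicator {0<..} y * (y powr (c - 1) * exp (- s * y))) (Gamma c / s powr c)"
proof (rule has_bochner_integral_nn_integral)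
  define f where "f = (\<lambda>t::real. ennreal (indicator {0..} t * t powr (c - 1) / exp t))"
  define I where "I = (\<integral>\<^sup>+y. ennreal (indicator {0<..} y * (y powr (c - 1) * exp (- s * y))) \<partial>lborel)"
  have [measurable]: "f \<in> borel_measurable borel" unfolding f_def by measurable
  have "ennreal (Gamma c) = (\<integral>\<^sup>+t. f t \<partial>lborel)"
    unfolding f_def by (rule Gamma_conv_nn_integral_real[OF c])
  also have "\<dots> = ennreal \<bar>s\<bar> * (\<integral>\<^sup>+x. f (0 + s * x) \<partial>lborel)"
    by (rule nn_integral_real_affine) (use s in auto)
  also have "(\<lambda>x. f (0 + s * x)) = (\<lambda>x. ennreal (s powr (c - 1)) * ennreal (indicator {0<..} x * (x powr (c - 1) * exp (- s * x))))"
  proof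
    fix x
    show "f (0 + s * x) = ennreal (s powr (c - 1)) * ennreal (indicator {0<..} x * (x powr (c - 1) * exp (- s * x)))"
    proof (cases "0 < x")
      case True thus ?thesis using s
        by (simp add: f_def ennreal_mult'[symmetric] powr_mult exp_minus field_simps)
    next
      case False thus ?thesis using s by (cases "x = 0") (auto simp: f_def zero_le_mult_iff indicator_def)
    qed
  qed
  also have "ennreal \<bar>s\<bar> * (\<integral>\<^sup>+x. ennreal (s powr (c - 1)) * ennreal (indicator {0<..} x * (x powr (c - 1) * exp (- s * x))) \<partial>lborel)
     = ennreal \<bar>s\<bar> * (ennreal (s powr (c - 1)) * I)"
    unfolding I_def by (subst nn_integral_cmult) auto
  also have "\<dots> = ennreal (s powr c) * I"
    using s by (simp add: mult.assoc[symmetric] ennreal_mult'[symmetric] powr_mult_base)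
  finally have eq: "ennreal (Gamma c) = ennreal (s powr c) * I" .
  have "ennreal (Gamma c / s powr c) = ennreal (1 / s powr c) * ennreal (Gamma c)"
    by (subst ennreal_mult'[symmetric]) auto
  also have "\<dots> = I" unfolding eq using s by (simp add: mult.assoc[symmetric] ennreal_mult'[symmetric])
  finally show "(\<integral>\<^sup>+y. ennreal (indicator {0<..} y * (y powr (c - 1) * exp (- s * y))) \<partial>lborel) = ennreal (Gamma c / s powr c)"
    unfolding I_def ..
qed (use c in \<open>auto intro!: AE_I2 divide_nonneg_nonneg simp: less_imp_le Gamma_real_pos\<close>)

lemma exp_gamma_kernel:
  "exp (- w * y) * gamma_kernel r c y = (1 / Gamma c) * (indicator {0<..} y * (y powr (c - 1) * exp (- (w + r) * y)))"
proof (cases "0 < y")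
  case True
  have "exp (- (w + r) * y) = exp (- w * y) * exp (- r * y)" by (subst mult_exp_exp) (simp add: algebra_simps)
  thus ?thesis using True by (simp add: gamma_kernel_def)
qed (simp add: gamma_kernel_def)

lemma laplace_on_gamma_kernel:
  assumes c: "0 < c" shows "laplace_on (- r) (gamma_kernel r c)"
  unfolding laplace_on_def exp_gamma_kernel
proof (intro conjI allI impI)
  fix w assume "- r < w"
  thus "integrable lborel (\<lambda>y. (1 / Gamma c) * (indicator {0<..} y * (y powr (c - 1) * exp (- (w + r) * y))))"
    using has_bochner_integral_Gamma[OF c, of "w + r"] by (intro integrable_mult_right) (auto simp: has_bochner_integral_iff)
qed (simp add: gamma_kernel_def)

text \<open>At real arguments this is the gamma integral, and both sides are holomorphic on the
  half-plane.\<close>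

lemma lap_gamma_kernel:
  assumes c: "0 < c" and z: "- r < Re z"
  shows "lap (gamma_kernel r c) z = (z + of_real r) powr (- of_real c)"
proof (rule half_plane_identity[OF _ _ _ z])
  show "lap (gamma_kernel r c) holomorphic_on {z. - r < Re z}"
    by (rule lap_holomorphic[OF laplace_on_gamma_kernel[OF c]])
  show "(\<lambda>z. (z + of_real r) powr (- of_real c)) holomorphic_on {z. - r < Re z}"
    by (intro holomorphic_intros) (auto simp: complex_nonpos_Reals_iff)
  fix s :: real assume s: "- r < s"
  have "(LINT y|lborel. exp (- s * y) * gamma_kernel r c y) = (1 / Gamma c) * (Gamma c / (s + r) powr c)"
    unfolding exp_gamma_kernel using has_bochner_integral_Gamma[OF c, of "s + r"] s
    by (simp add: has_bochner_integral_iff)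
  also have "\<dots> = (s + r) powr (- c)" using s Gamma_real_pos[OF c] by (simp add: powr_minus divide_simps)
  finally have "lap (gamma_kernel r c) (of_real s) = of_real ((s + r) powr (- c))" by (simp add: lap_of_real)
  thus "lap (gamma_kernel r c) (of_real s) = (of_real s + of_real r) powr (- of_real c)"
    using s by (simp add: powr_of_real[symmetric])
qed

section \<open>The substitution x = exp(-v/\<tau>)\<close>

text \<open>If v is exponentially distributed with rate 1/\<tau>, then exp(-v/\<tau>) is uniform on
  (0, 1). As a statement on measures this is the change of variables for every measurable
  integrand.\<close>

lemma distr_exponential_density:
  assumes \<tau>: "0 < \<tau>"
  shows "distr (density lborel (\<lambda>v. ennreal (exponential_density (1 / \<tau>) v))) borel (\<lambda>v. exp (- v / \<tau>)) =
    density lborel (\<lambda>x. ennreal (indicator {0<..<1} x))"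
proof (rule measure_eqI_lessThan)
  let ?E = "density lborel (\<lambda>v. ennreal (exponential_density (1 / \<tau>) v))"
  let ?N = "density lborel (\<lambda>x. ennreal (indicator {0<..<1} x :: real))"
  interpret E: prob_space ?E by (rule prob_space_exponential_density) (use \<tau> in auto)
  have em: "emeasure (distr ?E borel (\<lambda>v. exp (- v / \<tau>))) {x<..} = emeasure ?E {v. x < exp (- v / \<tau>)}" for x
    by (subst emeasure_distr) (auto intro!: arg_cong2[where f = emeasure])
  have N: "emeasure ?N {x<..} = emeasure lborel ({0<..<1} \<inter> {x<..})" for x :: real
  proof -
    have "emeasure ?N {x<..} = (\<integral>\<^sup>+y. indicator ({0<..<1} \<inter> {x<..}) y \<partial>lborel)"
      by (subst emeasure_density) (auto intro!: nn_integral_cong split: split_indicator simp del: nn_integral_indicator)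
    thus ?thesis by (subst (asm) nn_integral_indicator) auto
  qed
  show "emeasure (distr ?E borel (\<lambda>v. exp (- v / \<tau>))) {x<..} < \<infinity>" for x
    unfolding em by (rule le_less_trans[OF E.emeasure_le_1]) simp
  show "emeasure (distr ?E borel (\<lambda>v. exp (- v / \<tau>))) {x<..} = emeasure ?N {x<..}" for x
  proof -
    consider "x \<le> 0" | "x \<ge> 1" | "0 < x" "x < 1" by linarith
    thus ?thesis
    proof cases
      case 1
      hence "{v. x < exp (- v / \<tau>)} = space ?E" "{0<..<1} \<inter> {x<..} = {0<..<1::real}"
        using less_le_trans[OF exp_gt_zero] by (auto intro: le_less_trans)
      thus ?thesis unfolding em N using E.emeasure_space_1 by simp
    next
      case 2
      have "{v. x < exp (- v / \<tau>)} \<subseteq> {..0}"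
      proof safe
        fix v assume "x < exp (- v / \<tau>)"
        hence "exp 0 < exp (- v / \<tau>)" using 2 unfolding exp_zero by linarith
        hence "0 < - v / \<tau>" by (simp only: exp_less_cancel_iff)
        thus "v \<le> 0" using \<tau> by (simp add: field_simps)
      qed
      hence "emeasure ?E {v. x < exp (- v / \<tau>)} \<le> emeasure ?E {..0}" by (intro emeasure_mono) auto
      also have "\<dots> = 0" using \<tau> by (subst emeasure_erlang_density) (auto simp: erlang_CDF_0)
      finally have "emeasure ?E {v. x < exp (- v / \<tau>)} = 0" by simp
      moreover have "{0<..<1} \<inter> {x<..} = {}" using 2 by auto
      ultimately show ?thesis unfolding em N by simp
    next
      case 3
      define a where "a = - \<tau> * ln x"
      have a: "a > 0" using 3 \<tau> by (simp add: a_def mult_pos_neg)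
      have ex: "exp (- a / \<tau>) = x" using 3 \<tau> by (simp add: a_def)
      have "x < exp (- v / \<tau>) \<longleftrightarrow> v < a" for v
      proof -
        have "x < exp (- v / \<tau>) \<longleftrightarrow> exp (- a / \<tau>) < exp (- v / \<tau>)" by (simp only: ex)
        also have "\<dots> \<longleftrightarrow> - a / \<tau> < - v / \<tau>" by (simp only: exp_less_cancel_iff)
        also have "\<dots> \<longleftrightarrow> - a < - v" unfolding divide_less_cancel using \<tau> by simp
        also have "\<dots> \<longleftrightarrow> v < a" by simp
        finally show ?thesis .
      qed
      hence "{v. x < exp (- v / \<tau>)} = {..<a}" by auto
      moreover have "emeasure ?E {..<a} = emeasure ?E {..a}"
      proof (rule emeasure_eq_AE)
        have "AE v in lborel. v \<noteq> a" by (rule AE_lborel_singleton)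
        hence "AE v in lborel. 0 < ennreal (exponential_density (1 / \<tau>) v) \<longrightarrow> (v \<in> {..<a}) = (v \<in> {..a})"
          by eventually_elim auto
        thus "AE v in ?E. (v \<in> {..<a}) = (v \<in> {..a})" by (subst AE_density) auto
      qed simp_all
      moreover have "emeasure ?E {..a} = ennreal (1 - x)"
        using \<tau> a ex by (subst emeasure_erlang_density) (auto simp: erlang_CDF_0)
      moreover have "{0<..<1} \<inter> {x<..} = {x<..<1}" using 3 by auto
      ultimately show ?thesis unfolding em N using 3 by simp
    qed
  qed
qed simp_all

text \<open>The density exp(-v/\<tau>)/\<tau> of the exponential law is the Jacobian of the
  substitution.\<close>

lemma
  fixes f :: "real \<Rightarrow> 'a::{banach, second_countable_topology}"
  assumes \<tau>: "0 < \<tau>" and m: "(\<lambda>x. indicator {0<..<1} x *\<^sub>R f x) \<in> borel_measurable borel"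
  shows integrable_exp_substitution: "integrable lborel (\<lambda>x. indicator {0<..<1} x *\<^sub>R f x) \<longleftrightarrow>
      integrable lborel (\<lambda>v. indicator {0<..} v *\<^sub>R ((exp (- v / \<tau>) / \<tau>) *\<^sub>R f (exp (- v / \<tau>))))" (is ?A)
    and integral_exp_substitution: "(LINT x|lborel. indicator {0<..<1} x *\<^sub>R f x) =
      (LINT v|lborel. indicator {0<..} v *\<^sub>R ((exp (- v / \<tau>) / \<tau>) *\<^sub>R f (exp (- v / \<tau>))))" (is ?B)
proof -
  let ?E = "density lborel (\<lambda>v. ennreal (exponential_density (1 / \<tau>) v))"
  let ?N = "density lborel (\<lambda>x. ennreal (indicator {0<..<1} x :: real))"
  define g where "g = (\<lambda>x. indicator {0<..<1} x *\<^sub>R f x)"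
  have [measurable]: "g \<in> borel_measurable borel" using m by (simp add: g_def)
  have g: "indicator {0<..<1} x *\<^sub>R g x = g x" for x by (simp add: g_def indicator_def)
  have e: "exponential_density (1 / \<tau>) v *\<^sub>R g (exp (- v / \<tau>)) =
     indicator {0<..} v *\<^sub>R ((exp (- v / \<tau>) / \<tau>) *\<^sub>R f (exp (- v / \<tau>)))" for v
    using \<tau> by (cases "v = 0") (auto simp: erlang_density_def g_def indicator_def field_simps)
  have nn: "AE v in lborel. 0 \<le> exponential_density (1 / \<tau>) v" using \<tau> by (auto intro!: AE_I2 erlang_density_nonneg)
  have "integrable lborel g \<longleftrightarrow> integrable ?N g"
    by (subst integrable_density) (auto simp: g)
  also have "\<dots> \<longleftrightarrow> integrable ?E (\<lambda>v. g (exp (- v / \<tau>)))"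
    unfolding distr_exponential_density[OF \<tau>, symmetric] by (rule integrable_distr_eq) auto
  also have "\<dots> \<longleftrightarrow> integrable lborel (\<lambda>v. exponential_density (1 / \<tau>) v *\<^sub>R g (exp (- v / \<tau>)))"
    by (rule integrable_density) (auto simp: nn)
  finally show ?A unfolding e unfolding g_def .
  have "integral\<^sup>L lborel g = integral\<^sup>L ?N g"
    by (subst integral_density) (auto simp: g)
  also have "\<dots> = (LINT v|?E. g (exp (- v / \<tau>)))"
    unfolding distr_exponential_density[OF \<tau>, symmetric] by (rule integral_distr) auto
  also have "\<dots> = (LINT v|lborel. exponential_density (1 / \<tau>) v *\<^sub>R g (exp (- v / \<tau>)))"
    by (rule integral_density) (auto simp: nn)
  finally show ?B unfolding e unfolding g_def .
qed

section \<open>Beta kernels and their limit\<close>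

text \<open>With x = exp(-v/\<tau>) this is, up to a constant, x^(\<tau> s) (1 - x)^(c - 1), the
  beta density with respect to dx/x. Since \<tau>(1 - exp(-v/\<tau>)) tends to v, the kernel tends
  to \<open>gamma_kernel s c\<close>.\<close>

definition beta_kernel :: "real \<Rightarrow> real \<Rightarrow> real \<Rightarrow> real \<Rightarrow> real" where
  "beta_kernel \<tau> s c v = (if 0 < v then exp (- s * v) * (\<tau> * (1 - exp (- v / \<tau>))) powr (c - 1) / Gamma c else 0)"

text \<open>One bound serves both signs of c - 1. For c >= 1 the base is at most v. For c < 1 it is
  at least v / (1 + v/\<tau>), by exp(v/\<tau>) >= 1 + v/\<tau>, and 0 < c makes the exponent 1 - c
  smaller than 1, so that the first power of 1 + v/\<tau> suffices.\<close>

lemma beta_kernel_base_bound: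
  fixes v \<tau> c :: real
  assumes v: "0 < v" and \<tau>: "0 < \<tau>" and "0 < c"
  shows "0 < \<tau> * (1 - exp (- v / \<tau>))" "(\<tau> * (1 - exp (- v / \<tau>))) powr (c - 1) \<le> v powr (c - 1) * (1 + v / \<tau>)"
proof -
  have "exp (- v / \<tau>) < exp 0" unfolding exp_less_cancel_iff using v \<tau> by simp
  thus pos: "0 < \<tau> * (1 - exp (- v / \<tau>))" using \<tau> by simp
  have up: "\<tau> * (1 - exp (- v / \<tau>)) \<le> v"
    using exp_ge_add_one_self[of "- v / \<tau>"] \<tau> by (simp add: field_simps)
  show "(\<tau> * (1 - exp (- v / \<tau>))) powr (c - 1) \<le> v powr (c - 1) * (1 + v / \<tau>)"
  proof (cases "1 \<le> c")
    case True
    have "(\<tau> * (1 - exp (- v / \<tau>))) powr (c - 1) \<le> v powr (c - 1) * 1"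
      using True pos up by (simp add: powr_mono2)
    also have "\<dots> \<le> v powr (c - 1) * (1 + v / \<tau>)" using v \<tau> by (intro mult_left_mono) auto
    finally show ?thesis .
  next
    case False
    have u: "1 + v / \<tau> > 1" using v \<tau> by simp
    have "1 + v / \<tau> \<le> exp (v / \<tau>)" by (rule exp_ge_add_one_self)
    hence "exp (- v / \<tau>) \<le> 1 / (1 + v / \<tau>)" using u by (simp add: exp_minus field_simps)
    hence "1 - 1 / (1 + v / \<tau>) \<le> 1 - exp (- v / \<tau>)" by simp
    hence "\<tau> * (1 - 1 / (1 + v / \<tau>)) \<le> \<tau> * (1 - exp (- v / \<tau>))" using \<tau> by (intro mult_left_mono) auto
    moreover have "\<tau> * (1 - 1 / (1 + v / \<tau>)) = v / (1 + v / \<tau>)" using v \<tau> by (simp add: field_simps)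
    ultimately have "(\<tau> * (1 - exp (- v / \<tau>))) powr (c - 1) \<le> (v / (1 + v / \<tau>)) powr (c - 1)"
      using False v u by (intro powr_mono2') auto
    also have "\<dots> = v powr (c - 1) * (1 + v / \<tau>) powr (1 - c)"
      using v u by (simp add: powr_divide powr_diff powr_minus field_simps)
    also have "\<dots> \<le> v powr (c - 1) * (1 + v / \<tau>) powr 1"
      using u \<open>0 < c\<close> by (intro mult_left_mono powr_mono) auto
    finally show ?thesis using u by simp
  qed
qed

lemma beta_kernel_nonneg: "0 < c \<Longrightarrow> 0 \<le> beta_kernel \<tau> s c v"
  by (auto simp: beta_kernel_def Gamma_real_pos less_imp_le)

lemma beta_kernel_measurable [measurable]: "beta_kernel \<tau> s c \<in> borel_measurable borel"
  unfolding beta_kernel_def by measurable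

text \<open>The factor 1 + v/\<tau> splits the majorant into gamma integrands with parameters c and
  c + 1; the form \<open>c + 1 - 1\<close> matches \<open>has_bochner_integral_Gamma\<close> at c +
  1.\<close>

lemma exp_beta_kernel_le:
  assumes \<tau>: "0 < \<tau>" and c: "0 < c"
  shows "exp (- w * v) * beta_kernel \<tau> s c v \<le>
    (1 / Gamma c) * (indicator {0<..} v * (v powr (c - 1) * exp (- (w + s) * v))
       + 1 / \<tau> * (indicator {0<..} v * (v powr (c + 1 - 1) * exp (- (w + s) * v))))"
proof (cases "0 < v")
  case True
  have e: "exp (- (w + s) * v) = exp (- w * v) * exp (- s * v)" by (subst mult_exp_exp) (simp add: algebra_simps)
  have "exp (- w * v) * beta_kernel \<tau> s c v = exp (- (w + s) * v) / Gamma c * (\<tau> * (1 - exp (- v / \<tau>))) powr (c - 1)"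
    unfolding e beta_kernel_def using True by simp
  also have "\<dots> \<le> exp (- (w + s) * v) / Gamma c * (v powr (c - 1) * (1 + v / \<tau>))"
    using c by (intro mult_left_mono beta_kernel_base_bound True \<tau>) (auto simp: Gamma_real_pos less_imp_le)
  also have "v powr (c - 1) * (1 + v / \<tau>) = v powr (c - 1) + 1 / \<tau> * v powr c"
    using True by (simp add: distrib_left powr_diff)
  finally have "exp (- w * v) * beta_kernel \<tau> s c v \<le> exp (- (w + s) * v) / Gamma c * (v powr (c - 1) + 1 / \<tau> * v powr c)" .
  also have "\<dots> = (1 / Gamma c) * (v powr (c - 1) * exp (- (w + s) * v) + 1 / \<tau> * (v powr c * exp (- (w + s) * v)))"
  proof -
    have "E / G * (a + 1 / \<tau> * b) = (1 / G) * (a * E + 1 / \<tau> * (b * E))" for E G a b :: real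
      by (simp add: field_simps)
    thus ?thesis .
  qed
  finally show ?thesis using True by simp
qed (simp add: beta_kernel_def)

lemma laplace_on_beta_kernel:
  assumes \<tau>: "0 < \<tau>" and c: "0 < c" shows "laplace_on (- s) (beta_kernel \<tau> s c)"
  unfolding laplace_on_def
proof (intro conjI allI impI)
  fix w assume w: "- s < w"
  show "integrable lborel (\<lambda>y. exp (- w * y) * beta_kernel \<tau> s c y)"
  proof (rule Bochner_Integration.integrable_bound)
    show "integrable lborel (\<lambda>v. (1 / Gamma c) * (indicator {0<..} v * (v powr (c - 1) * exp (- (w + s) * v))
       + 1 / \<tau> * (indicator {0<..} v * (v powr (c + 1 - 1) * exp (- (w + s) * v)))))"
      using has_bochner_integral_Gamma[of c "w + s"] has_bochner_integral_Gamma[of "c + 1" "w + s"] c w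
      by (intro integrable_mult_right Bochner_Integration.integrable_add) (auto simp: has_bochner_integral_iff)
    show "AE v in lborel. norm (exp (- w * v) * beta_kernel \<tau> s c v) \<le> norm ((1 / Gamma c) * (indicator {0<..} v * (v powr (c - 1) * exp (- (w + s) * v))
       + 1 / \<tau> * (indicator {0<..} v * (v powr (c + 1 - 1) * exp (- (w + s) * v)))))"
    proof (rule AE_I2)
      fix v
      have "norm (exp (- w * v) * beta_kernel \<tau> s c v) = exp (- w * v) * beta_kernel \<tau> s c v"
        using beta_kernel_nonneg[OF c, of \<tau> s v] by simp
      also note exp_beta_kernel_le[OF \<tau> c]
      finally show "norm (exp (- w * v) * beta_kernel \<tau> s c v) \<le> norm ((1 / Gamma c) * (indicator {0<..} v * (v powr (c - 1) * exp (- (w + s) * v))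
       + 1 / \<tau> * (indicator {0<..} v * (v powr (c + 1 - 1) * exp (- (w + s) * v)))))"
        unfolding real_norm_def by (rule order.trans[OF _ abs_ge_self])
    qed
  qed measurable
qed (simp add: beta_kernel_def)

text \<open>At a real argument x the substitution leads to Euler's beta integral with parameters
  \<tau>(x + s) and c. The denominator is written with \<open>rGamma\<close>, which is entire, so
  only the numerator has to be kept off its poles in the continuation.\<close>

lemma lap_beta_kernel:
  assumes \<tau>: "0 < \<tau>" and c: "0 < c" and z: "- s < Re z"
  shows "lap (beta_kernel \<tau> s c) z = of_real (\<tau> powr c) * Gamma (of_real \<tau> * (z + of_real s)) * rGamma (of_real \<tau> * (z + of_real s) + of_real c)"
proof (rule half_plane_identity[OF _ _ _ z])
  show "lap (beta_kernel \<tau> s c) holomorphic_on {z. - s < Re z}"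
    by (rule lap_holomorphic[OF laplace_on_beta_kernel[OF \<tau> c]])
  have "of_real \<tau> * (z + of_real s) \<notin> \<int>\<^sub>\<le>\<^sub>0" if "- s < Re z" for z :: complex
  proof
    assume "of_real \<tau> * (z + of_real s) \<in> \<int>\<^sub>\<le>\<^sub>0"
    then obtain n where "of_real \<tau> * (z + of_real s) = of_int n" "n \<le> 0" by (elim nonpos_Ints_cases)
    hence "Re (of_real \<tau> * (z + of_real s)) \<le> 0" by (simp only: complex_Re_of_int of_int_le_0_iff)
    moreover have "Re (of_real \<tau> * (z + of_real s)) > 0" using that \<tau> by simp
    ultimately show False by simp
  qed
  thus "(\<lambda>z. of_real (\<tau> powr c) * Gamma (of_real \<tau> * (z + of_real s)) * rGamma (of_real \<tau> * (z + of_real s) + of_real c))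
     holomorphic_on {z. - s < Re z}" by (intro holomorphic_intros) auto
  fix x :: real assume x: "- s < x"
  define A where "A = \<tau> * (x + s)"
  have A: "A > 0" using x \<tau> by (simp add: A_def)
  define f where "f = (\<lambda>t::real. t powr (A - 1) * (1 - t) powr (c - 1))"
  have [measurable]: "f \<in> borel_measurable borel" unfolding f_def by measurable
  have "(LINT t|lborel. indicator {0..1} t *\<^sub>R f t) = Beta A c"
    using set_borel_integral_eq_integral(2)[OF integrable_Beta[OF A c]] integral_unique[OF has_integral_Beta_real[OF A c]]
    by (simp add: f_def set_lebesgue_integral_def)
  also have "(\<lambda>t. indicator {0..1} t *\<^sub>R f t) = (\<lambda>t. indicator {0<..<1} t *\<^sub>R f t)"
    by (auto simp: fun_eq_iff f_def indicator_def)
  also have "(LINT t|lborel. indicator {0<..<1} t *\<^sub>R f t) =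
    (LINT v|lborel. indicator {0<..} v *\<^sub>R ((exp (- v / \<tau>) / \<tau>) *\<^sub>R f (exp (- v / \<tau>))))"
    by (rule integral_exp_substitution[OF \<tau>]) measurable
  also have "(\<lambda>v. indicator {0<..} v *\<^sub>R ((exp (- v / \<tau>) / \<tau>) *\<^sub>R f (exp (- v / \<tau>)))) =
    (\<lambda>v. (Gamma c / \<tau> powr c) * (exp (- x * v) * beta_kernel \<tau> s c v))"
  proof
    fix v
    show "indicator {0<..} v *\<^sub>R ((exp (- v / \<tau>) / \<tau>) *\<^sub>R f (exp (- v / \<tau>))) =
       (Gamma c / \<tau> powr c) * (exp (- x * v) * beta_kernel \<tau> s c v)"
    proof (cases "0 < v")
      case True
      have "exp (- v / \<tau>) * exp (- v / \<tau>) powr (A - 1) = exp (- v / \<tau>) powr A"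
        by (simp add: powr_diff)
      also have "\<dots> = exp (- v * (x + s))" using \<tau> by (simp add: powr_def A_def)
      also have "\<dots> = exp (- x * v) * exp (- s * v)" by (subst mult_exp_exp) (simp add: algebra_simps)
      finally have e: "exp (- v / \<tau>) * exp (- v / \<tau>) powr (A - 1) = exp (- x * v) * exp (- s * v)" .
      have t: "(\<tau> * (1 - exp (- v / \<tau>))) powr (c - 1) = \<tau> powr c / \<tau> * (1 - exp (- v / \<tau>)) powr (c - 1)"
        using beta_kernel_base_bound(1)[OF True \<tau> c] \<tau> by (simp add: powr_mult powr_diff zero_less_mult_iff)
      have "indicator {0<..} v *\<^sub>R ((exp (- v / \<tau>) / \<tau>) *\<^sub>R f (exp (- v / \<tau>))) =
         exp (- v / \<tau>) * exp (- v / \<tau>) powr (A - 1) / \<tau> * (1 - exp (- v / \<tau>)) powr (c - 1)"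
        using True by (simp add: f_def)
      also have "\<dots> = (Gamma c / \<tau> powr c) * (exp (- x * v) * beta_kernel \<tau> s c v)"
        unfolding e beta_kernel_def t using True \<tau> Gamma_real_pos[OF c] by (simp add: field_simps)
      finally show ?thesis .
    qed (simp add: beta_kernel_def)
  qed
  finally have "(LINT v|lborel. exp (- x * v) * beta_kernel \<tau> s c v) = \<tau> powr c / Gamma c * Beta A c"
    using \<tau> Gamma_real_pos[OF c] by (simp add: field_simps)
  also have "\<dots> = \<tau> powr c * Gamma A * rGamma (A + c)"
    using Gamma_real_pos[OF c] by (simp add: Beta_altdef field_simps)
  finally have "lap (beta_kernel \<tau> s c) (of_real x) = of_real (\<tau> powr c * Gamma A * rGamma (A + c))"
    by (simp only: lap_of_real)
  thus "lap (beta_kernel \<tau> s c) (of_real x) = of_real (\<tau> powr c) * Gamma (of_real \<tau> * (of_real x + of_real s)) *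
     rGamma (of_real \<tau> * (of_real x + of_real s) + of_real c)"
    by (simp add: A_def Gamma_complex_of_real[symmetric] rGamma_complex_of_real[symmetric])
qed

text \<open>Dominated convergence. The shift \<open>s\<close> may move with \<tau> because the
  Mellin side uses \<rho>_h - 1/\<tau> and the contour side \<rho>_h itself; \<open>sb\<close> keeps
  every member on the half-plane shrunk by 1/\<tau>.\<close>

lemma laplace_tendsto_beta_kernel:
  assumes c: "0 < c" and s: "(s \<longlongrightarrow> \<rho>) at_top" and sb: "\<And>\<tau>. 0 < \<tau> \<Longrightarrow> \<rho> - 1 / \<tau> \<le> s \<tau>"
  shows "laplace_tendsto (- \<rho>) (\<lambda>\<tau>. beta_kernel \<tau> (s \<tau>) c) (gamma_kernel \<rho> c)"
  unfolding laplace_tendsto_def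
proof (intro conjI allI impI)
  show "laplace_on (- \<rho>) (gamma_kernel \<rho> c)" by (rule laplace_on_gamma_kernel[OF c])
  show "laplace_on (- \<rho> + 1 / \<tau>) (beta_kernel \<tau> (s \<tau>) c)" if "0 < \<tau>" for \<tau>
    using sb[OF that] by (intro laplace_on_mono[OF laplace_on_beta_kernel[OF that c]]) auto
  fix w assume w: "- \<rho> < w"
  \<comment> \<open>Eventually s \<tau> > \<rho> - \<delta>. With this margin, half of w + \<rho>,
    and with 1/\<tau> <= 1, the majorant \<open>bnd\<close> does not depend on \<tau>.\<close>
  define \<delta> where "\<delta> = (w + \<rho>) / 2"
  have \<delta>: "\<delta> > 0" "w + \<rho> - \<delta> > 0" using w by (simp_all add: \<delta>_def field_simps)
  define bnd where "bnd = (\<lambda>v. (1 / Gamma c) * (indicator {0<..} v * (v powr (c - 1) * exp (- (w + (\<rho> - \<delta>)) * v))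
       + (indicator {0<..} v * (v powr (c + 1 - 1) * exp (- (w + (\<rho> - \<delta>)) * v)))))"
  have [measurable]: "gamma_kernel \<rho> c \<in> borel_measurable borel"
    by (rule laplace_on_measurable[OF laplace_on_gamma_kernel[OF c]])
  have gp: "Gamma c > 0" using c by (rule Gamma_real_pos)
  have "((\<lambda>\<tau>. LINT v|lborel. exp (- w * v) * \<bar>beta_kernel \<tau> (s \<tau>) c v - gamma_kernel \<rho> c v\<bar>) \<longlongrightarrow> (LINT v::real|lborel. (0::real))) at_top"
  proof (rule integral_dominated_convergence_at_top[where M = lborel and f = "\<lambda>v. 0 :: real" and w = "\<lambda>v. 2 * bnd v"
      and s = "\<lambda>\<tau> v. exp (- w * v) * \<bar>beta_kernel \<tau> (s \<tau>) c v - gamma_kernel \<rho> c v\<bar>"])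
    show "integrable lborel (\<lambda>v. 2 * bnd v)" unfolding bnd_def
      using has_bochner_integral_Gamma[of c "w + (\<rho> - \<delta>)"] has_bochner_integral_Gamma[of "c + 1" "w + (\<rho> - \<delta>)"] c \<delta>
      by (intro integrable_mult_right Bochner_Integration.integrable_add) (auto simp: has_bochner_integral_iff)
    show "AE v in lborel. ((\<lambda>\<tau>. exp (- w * v) * \<bar>beta_kernel \<tau> (s \<tau>) c v - gamma_kernel \<rho> c v\<bar>) \<longlongrightarrow> 0) at_top"
    proof (rule AE_I2)
      fix v :: real
      show "((\<lambda>\<tau>. exp (- w * v) * \<bar>beta_kernel \<tau> (s \<tau>) c v - gamma_kernel \<rho> c v\<bar>) \<longlongrightarrow> 0) at_top"
      proof (cases "0 < v")
        case True
        have b: "((\<lambda>\<tau>. \<tau> * (1 - exp (- v / \<tau>))) \<longlongrightarrow> v) at_top" using True by real_asymp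
        have "((\<lambda>\<tau>. exp (- s \<tau> * v) * (\<tau> * (1 - exp (- v / \<tau>))) powr (c - 1) / Gamma c)
           \<longlongrightarrow> exp (- \<rho> * v) * v powr (c - 1) / Gamma c) at_top"
          by (intro tendsto_intros b s) (use True gp in auto)
        hence "((\<lambda>\<tau>. beta_kernel \<tau> (s \<tau>) c v) \<longlongrightarrow> gamma_kernel \<rho> c v) at_top"
          unfolding beta_kernel_def gamma_kernel_def using True by (simp add: mult_ac)
        thus ?thesis by (auto intro!: tendsto_eq_intros)
      qed (simp add: beta_kernel_def gamma_kernel_def)
    qed
    have "\<forall>\<^sub>F \<tau> in at_top. \<rho> - \<delta> < s \<tau>" using \<delta> by (intro order_tendstoD(1)[OF s]) auto
    with eventually_ge_at_top[of 1]
    show "\<forall>\<^sub>F \<tau> in at_top. AE v in lborel. norm (exp (- w * v) * \<bar>beta_kernel \<tau> (s \<tau>) c v - gamma_kernel \<rho> c v\<bar>) \<le> 2 * bnd v"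
    proof eventually_elim
      case (elim \<tau>)
      show ?case
      proof (rule AE_I2)
        fix v :: real
        show "norm (exp (- w * v) * \<bar>beta_kernel \<tau> (s \<tau>) c v - gamma_kernel \<rho> c v\<bar>) \<le> 2 * bnd v"
        proof (cases "0 < v")
          case True
          have mono: "exp (- (w + t) * v) \<le> exp (- (w + (\<rho> - \<delta>)) * v)" if "\<rho> - \<delta> \<le> t" for t
            using that True by (simp add: mult_right_mono)
          have "exp (- w * v) * beta_kernel \<tau> (s \<tau>) c v \<le> (1 / Gamma c) * (indicator {0<..} v * (v powr (c - 1) * exp (- (w + s \<tau>) * v))
             + 1 / \<tau> * (indicator {0<..} v * (v powr (c + 1 - 1) * exp (- (w + s \<tau>) * v))))"
            by (rule exp_beta_kernel_le) (use elim c in auto)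
          also have "\<dots> \<le> (1 / Gamma c) * (indicator {0<..} v * (v powr (c - 1) * exp (- (w + (\<rho> - \<delta>)) * v))
             + 1 * (indicator {0<..} v * (v powr (c + 1 - 1) * exp (- (w + (\<rho> - \<delta>)) * v))))"
            by (intro mult_left_mono add_mono mult_mono mono) (use elim gp in auto)
          also have "\<dots> = bnd v" by (simp add: bnd_def)
          finally have 1: "exp (- w * v) * beta_kernel \<tau> (s \<tau>) c v \<le> bnd v" .
          have "exp (- w * v) * gamma_kernel \<rho> c v \<le> (1 / Gamma c) * (indicator {0<..} v * (v powr (c - 1) * exp (- (w + (\<rho> - \<delta>)) * v)))"
            unfolding exp_gamma_kernel by (intro mult_left_mono mono) (use \<delta> gp in auto)
          also have "\<dots> \<le> bnd v" unfolding bnd_def using gp by (intro mult_left_mono) auto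
          finally have 2: "exp (- w * v) * gamma_kernel \<rho> c v \<le> bnd v" .
          have n: "beta_kernel \<tau> (s \<tau>) c v \<ge> 0" "gamma_kernel \<rho> c v \<ge> 0"
            using beta_kernel_nonneg[OF c] gp by (auto simp: gamma_kernel_def)
          have "norm (exp (- w * v) * \<bar>beta_kernel \<tau> (s \<tau>) c v - gamma_kernel \<rho> c v\<bar>) =
             exp (- w * v) * \<bar>beta_kernel \<tau> (s \<tau>) c v - gamma_kernel \<rho> c v\<bar>" by simp
          also have "\<dots> \<le> exp (- w * v) * (beta_kernel \<tau> (s \<tau>) c v + gamma_kernel \<rho> c v)"
            using n by (intro mult_left_mono) auto
          finally show ?thesis using 1 2 by (simp add: distrib_left)
        qed (simp add: beta_kernel_def gamma_kernel_def bnd_def)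
      qed
    qed
  qed measurable
  thus "((\<lambda>\<tau>. LINT v|lborel. exp (- w * v) * \<bar>beta_kernel \<tau> (s \<tau>) c v - gamma_kernel \<rho> c v\<bar>) \<longlongrightarrow> 0) at_top"
    by simp
qed

lemma laplace_tendsto_mono:
  assumes F: "laplace_tendsto r F f" and rs: "r \<le> s" shows "laplace_tendsto s F f"
  using F rs unfolding laplace_tendsto_def by (auto intro: laplace_on_mono)

section \<open>Iterated convolutions\<close>

lemma iter_conv_1: "iter_conv (Suc 0) g = g 1"
  by (simp add: iter_conv_def)

lemma iter_conv_Suc: "1 \<le> r \<Longrightarrow> iter_conv (Suc r) g = add_conv (iter_conv r g) (g (Suc r))"
  by (simp add: iter_conv_def)

lemma laplace_on_iter_conv:
  assumes "1 \<le> q" "\<And>h. h \<in> {1..q} \<Longrightarrow> laplace_on r (g h)"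
  shows "laplace_on r (iter_conv q g)"
  using assms by (induction q rule: nat_induct_at_least) (auto simp: iter_conv_1 iter_conv_Suc intro!: laplace_on_add_conv)

lemma lap_iter_conv:
  assumes "1 \<le> q" "\<And>h. h \<in> {1..q} \<Longrightarrow> laplace_on r (g h)" and z: "r < Re z"
  shows "lap (iter_conv q g) z = (\<Prod>h=1..q. lap (g h) z)"
  using assms(1,2)
proof (induction q rule: nat_induct_at_least)
  case (Suc q)
  have "laplace_on r (iter_conv q g)" "laplace_on r (g (Suc q))" using Suc by (auto intro!: laplace_on_iter_conv)
  from lap_add_conv[OF this z] show ?case using Suc by (simp add: iter_conv_Suc)
qed (simp add: iter_conv_1)

lemma laplace_tendsto_iter_conv:
  assumes "1 \<le> q" "\<And>h. h \<in> {1..q} \<Longrightarrow> laplace_tendsto r (\<lambda>\<tau>. F \<tau> h) (f h)"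
  shows "laplace_tendsto r (\<lambda>\<tau>. iter_conv q (F \<tau>)) (iter_conv q f)"
  using assms by (induction q rule: nat_induct_at_least) (auto simp: iter_conv_1 iter_conv_Suc intro!: laplace_tendsto_add_conv)

section \<open>Generalised exponential series\<close>

text \<open>The growth conditions for two kinds of factors: coefficients of a power series with
  positive radius of convergence, and sequences that beat every geometric one, such as 1/Gamma(c +
  N). The product of the two kinds is absolutely summable.\<close>

definition geom_bounded :: "(nat \<Rightarrow> real) \<Rightarrow> bool" where
  "geom_bounded u \<longleftrightarrow> (\<exists>M R. 0 < R \<and> (\<forall>N. \<bar>u N\<bar> \<le> M * R ^ N))"

definition superexp_small :: "(nat \<Rightarrow> real) \<Rightarrow> bool" where
  "superexp_small \<phi> \<longleftrightarrow> (\<forall>R>0. \<exists>K. \<forall>N. \<bar>\<phi> N\<bar> * R ^ N \<le> K)"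

lemma geom_boundedE:
  assumes "geom_bounded u" obtains M R where "0 < M" "0 < R" "\<And>N. \<bar>u N\<bar> \<le> M * R ^ N"
proof -
  from assms obtain M R where R: "0 < R" "\<And>N. \<bar>u N\<bar> \<le> M * R ^ N" by (auto simp: geom_bounded_def)
  have "\<bar>u N\<bar> \<le> (\<bar>M\<bar> + 1) * R ^ N" for N
    by (rule order.trans[OF R(2)]) (use R(1) in \<open>intro mult_right_mono, auto\<close>)
  with R(1) show thesis by (intro that[of "\<bar>M\<bar> + 1" R]) auto
qed

text \<open>The N + 1 terms of the Cauchy product are absorbed by N + 1 <= 2^N, hence the rate
  2Q.\<close>

lemma geom_bounded_conv:
  fixes u v :: "real fps"
  assumes "geom_bounded (fps_nth u)" "geom_bounded (fps_nth v)"
  shows "geom_bounded (fps_nth (u * v))"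
proof -
  from assms(1) obtain M R where u: "0 < M" "0 < R" "\<And>N. \<bar>u $ N\<bar> \<le> M * R ^ N" by (rule geom_boundedE) blast
  from assms(2) obtain M' R' where v: "0 < M'" "0 < R'" "\<And>N. \<bar>v $ N\<bar> \<le> M' * R' ^ N" by (rule geom_boundedE) blast
  define Q where "Q = max R R'"
  have Q: "0 < Q" "R \<le> Q" "R' \<le> Q" using u v by (auto simp: Q_def)
  have "\<bar>(u * v) $ N\<bar> \<le> (M * M') * (2 * Q) ^ N" for N
  proof -
    have "\<bar>(u * v) $ N\<bar> \<le> (\<Sum>i=0..N. \<bar>u $ i * v $ (N - i)\<bar>)" unfolding fps_mult_nth by (rule sum_abs)
    also have "\<dots> \<le> (\<Sum>i=0..N. M * M' * Q ^ N)"
    proof (rule sum_mono)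
      fix i assume i: "i \<in> {0..N}"
      have "\<bar>u $ i * v $ (N - i)\<bar> \<le> (M * Q ^ i) * (M' * Q ^ (N - i))"
        unfolding abs_mult
      proof (rule mult_mono)
        show "\<bar>u $ i\<bar> \<le> M * Q ^ i" by (rule order.trans[OF u(3)]) (use u v Q in \<open>intro mult_left_mono power_mono, auto\<close>)
        show "\<bar>v $ (N - i)\<bar> \<le> M' * Q ^ (N - i)" by (rule order.trans[OF v(3)]) (use u v Q in \<open>intro mult_left_mono power_mono, auto\<close>)
      qed (use u v Q in auto)
      also have "\<dots> = M * M' * Q ^ N" using i by (simp add: power_add[symmetric] mult_ac)
      finally show "\<bar>u $ i * v $ (N - i)\<bar> \<le> M * M' * Q ^ N" .
    qed
    also have "\<dots> = (M * M' * Q ^ N) * real (Suc N)" by simp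
    also have "\<dots> \<le> (M * M' * Q ^ N) * 2 ^ N"
    proof (rule mult_left_mono)
      have "Suc N \<le> 2 ^ N" by (rule Suc_leI) (rule less_exp)
      thus "real (Suc N) \<le> 2 ^ N" by (metis of_nat_le_iff of_nat_numeral of_nat_power)
    qed (use u v Q in auto)
    finally show ?thesis by (simp add: power_mult_distrib mult_ac)
  qed
  thus ?thesis using Q unfolding geom_bounded_def by (intro exI[of _ "M * M'"] exI[of _ "2 * Q"]) auto
qed

lemma geom_bounded_prod:
  fixes V :: "'a \<Rightarrow> real fps"
  assumes "\<And>h. h \<in> H \<Longrightarrow> geom_bounded (fps_nth (V h))"
  shows "geom_bounded (fps_nth (\<Prod>h\<in>H. V h))"
  using assms
proof (induction H rule: infinite_finite_induct)
  case (insert x F) thus ?case by (simp add: geom_bounded_conv)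
qed (auto simp: geom_bounded_def intro!: exI[of _ 1])

text \<open>The summability proofs pass twice the geometric rate of the other factor, which leaves a
  geometric series of ratio 1/2.\<close>

lemma superexp_small_half:
  assumes \<phi>: "superexp_small \<phi>" and R: "0 < R"
  obtains K where "0 < K" "\<And>N. \<bar>\<phi> N\<bar> \<le> K * (1 / R) ^ N"
proof -
  from \<phi> R obtain K where K: "\<And>N. \<bar>\<phi> N\<bar> * R ^ N \<le> K" unfolding superexp_small_def by blast
  have "\<bar>\<phi> N\<bar> \<le> (\<bar>K\<bar> + 1) * (1 / R) ^ N" for N
  proof -
    have "\<bar>\<phi> N\<bar> = \<bar>\<phi> N\<bar> * R ^ N * (1 / R) ^ N" using R by (simp add: power_one_over)
    also have "\<dots> \<le> (\<bar>K\<bar> + 1) * (1 / R) ^ N" by (intro mult_right_mono order.trans[OF K]) (use R in auto)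
    finally show ?thesis .
  qed
  thus thesis by (intro that[of "\<bar>K\<bar> + 1"]) auto
qed

lemma superexp_small_shift:
  assumes \<phi>: "superexp_small \<phi>" shows "superexp_small (\<lambda>N. \<phi> (y + N))"
  unfolding superexp_small_def
proof (intro allI impI)
  fix R :: real assume R: "0 < R"
  then obtain K where K: "0 < K" "\<And>N. \<bar>\<phi> N\<bar> \<le> K * (1 / R) ^ N" using superexp_small_half[OF \<phi>] by blast
  have "\<bar>\<phi> (y + N)\<bar> * R ^ N \<le> K * (1 / R) ^ y" for N
  proof -
    have "\<bar>\<phi> (y + N)\<bar> * R ^ N \<le> K * (1 / R) ^ (y + N) * R ^ N" by (intro mult_right_mono K) (use R in auto)
    thus ?thesis using R by (simp add: power_add power_one_over)
  qed
  thus "\<exists>K. \<forall>N. \<bar>\<phi> (y + N)\<bar> * R ^ N \<le> K" by blast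
qed

lemma superexp_small_power:
  assumes \<phi>: "superexp_small \<phi>" shows "superexp_small (\<lambda>N. \<phi> N * y ^ N)"
  unfolding superexp_small_def
proof (intro allI impI)
  fix R :: real assume R: "0 < R"
  then obtain K where K: "\<And>N. \<bar>\<phi> N\<bar> * (R * (\<bar>y\<bar> + 1)) ^ N \<le> K"
    using \<phi> unfolding superexp_small_def by (metis add_nonneg_pos abs_ge_zero less_numeral_extra(1) mult_pos_pos)
  have "\<bar>\<phi> N * y ^ N\<bar> * R ^ N \<le> K" for N
  proof -
    have "\<bar>\<phi> N * y ^ N\<bar> * R ^ N = \<bar>\<phi> N\<bar> * (R * \<bar>y\<bar>) ^ N" by (simp add: abs_mult power_mult_distrib power_abs)
    also have "\<dots> \<le> \<bar>\<phi> N\<bar> * (R * (\<bar>y\<bar> + 1)) ^ N" using R by (intro mult_left_mono power_mono) auto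
    finally show ?thesis using K[of N] by linarith
  qed
  thus "\<exists>K. \<forall>N. \<bar>\<phi> N * y ^ N\<bar> * R ^ N \<le> K" by blast
qed

lemma Gamma_real_plus1: "0 < x \<Longrightarrow> Gamma (x + 1) = x * Gamma (x :: real)"
  by (rule Gamma_plus1) (auto elim!: nonpos_Ints_cases)

text \<open>Consecutive terms of R^N / Gamma(c + N) have ratio R/(c + N), at most 1/2 once N >= 2R;
  a summable sequence is bounded.\<close>

lemma superexp_small_inverse_Gamma:
  assumes c: "0 < c" shows "superexp_small (\<lambda>N. 1 / Gamma (c + real N))"
  unfolding superexp_small_def
proof (intro allI impI)
  fix R :: real assume R: "0 < R"
  define f where "f = (\<lambda>N. R ^ N / Gamma (c + real N))"
  have gp: "Gamma (c + real N) > 0" for N using c by (intro Gamma_real_pos) auto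
  obtain N0 :: nat where N0: "real N0 \<ge> 2 * R" using real_arch_simple by blast
  have "summable f"
  proof (rule summable_ratio_test[of "1/2" N0])
    fix N assume N: "N \<ge> N0"
    have G: "Gamma (c + real (Suc N)) = (c + real N) * Gamma (c + real N)"
      using c Gamma_real_plus1[of "c + real N"] by (simp add: add_ac)
    have "norm (f (Suc N)) = norm (f N) * (R / (c + real N))"
      unfolding f_def G using gp[of N] R c by (simp add: field_simps)
    also have "\<dots> \<le> norm (f N) * (1/2)"
    proof (rule mult_left_mono)
      have "2 * R \<le> real N" using N N0 by linarith
      thus "R / (c + real N) \<le> 1/2" using c by (simp add: field_simps)
    qed simp
    finally show "norm (f (Suc N)) \<le> 1/2 * norm (f N)" by simp
  qed simp
  hence "Bseq f" using summable_imp_Bseq by blast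
  then obtain K where K: "\<And>N. norm (f N) \<le> K" by (auto simp: Bseq_def)
  have "\<bar>1 / Gamma (c + real N)\<bar> * R ^ N \<le> K" for N
    using K[of N] gp[of N] R by (simp add: f_def)
  thus "\<exists>K. \<forall>N. \<bar>1 / Gamma (c + real N)\<bar> * R ^ N \<le> K" by blast
qed

lemma summable_geom_superexp:
  assumes u: "geom_bounded u" and \<phi>: "superexp_small \<phi>"
  shows "summable (\<lambda>N. \<bar>u N * \<phi> N\<bar>)"
proof -
  from u obtain M R where u: "0 < M" "0 < R" "\<And>N. \<bar>u N\<bar> \<le> M * R ^ N" by (rule geom_boundedE) blast
  obtain K where K: "0 < K" "\<And>N. \<bar>\<phi> N\<bar> \<le> K * (1 / (2 * R)) ^ N"
    using superexp_small_half[OF \<phi>, of "2 * R"] u by auto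
  show ?thesis
  proof (rule summable_comparison_test')
    show "summable (\<lambda>N. M * K * (1/2::real) ^ N)" by (intro summable_mult summable_geometric) simp
    fix N
    have "\<bar>u N * \<phi> N\<bar> \<le> (M * R ^ N) * (K * (1 / (2 * R)) ^ N)"
      unfolding abs_mult by (intro mult_mono u K) (use u in auto)
    also have "\<dots> = M * K * (1/2) ^ N" using u by (simp add: power_mult_distrib power_divide)
    finally show "norm \<bar>u N * \<phi> N\<bar> \<le> M * K * (1/2) ^ N" by simp
  qed
qed

text \<open>Each y^(c + N - 1) / Gamma(c + N) has the Laplace transform z^(-c - N), so the series is
  the formal inverse transform of z^(-c) u(1/z). Products of \<open>u\<close> thus correspond to
  convolutions, and lowering c by 1 corresponds to d/dy.\<close>

definition gseries :: "real fps \<Rightarrow> real \<Rightarrow> real \<Rightarrow> real" where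
  "gseries u c y = (if 0 < y then y powr (c - 1) * (\<Sum>N. u $ N * (1 / Gamma (c + real N) * y ^ N)) else 0)"

lemma summable_gseries:
  assumes u: "geom_bounded (fps_nth u)" and c: "0 < c"
  shows "summable (\<lambda>N. \<bar>u $ N * (1 / Gamma (c + real N) * y ^ N)\<bar>)"
  by (intro summable_geom_superexp u superexp_small_power superexp_small_inverse_Gamma c)

lemma summable_gseries':
  assumes u: "geom_bounded (fps_nth u)" and c: "0 < c"
  shows "summable (\<lambda>N. u $ N * (1 / Gamma (c + real N) * y ^ N))"
  by (rule summable_rabs_cancel[OF summable_gseries[OF assms]])

text \<open>The recurrence of the gamma function gives (c - 1 + N) / Gamma(c + N) = 1 / Gamma(c - 1
  + N); for c > 1 the argument is positive even at N = 0.\<close>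

lemma gseries_has_field_derivative:
  assumes u: "geom_bounded (fps_nth u)" and c: "1 < c" and y: "0 < y"
  shows "(gseries u c has_field_derivative gseries u (c - 1) y) (at y)"
proof -
  define e where "e = (\<lambda>N. u $ N / Gamma (c + real N))"
  have se: "summable (\<lambda>N. e N * x ^ N)" for x
    using summable_gseries'[OF u, of c x] c by (simp add: e_def)
  define E where "E = (\<lambda>x. \<Sum>N. e N * x ^ N)"
  define E' where "E' = (\<Sum>N. diffs e N * y ^ N)"
  have DE: "(E has_field_derivative E') (at y)"
    unfolding E_def E'_def by (rule termdiffs_strong_converges_everywhere) (rule se)
  have sd: "summable (\<lambda>N. diffs e N * y ^ N)" by (rule termdiff_converges_all) (rule se)
  \<comment> \<open>Multiplication by y undoes the index shift of the derived series, so that both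
    sums can be combined termwise.\<close>
  have yE': "(\<lambda>N. real N * e N * y ^ N) sums (y * E')"
  proof (rule sums_Suc_imp)
    have "(\<lambda>N. y * (diffs e N * y ^ N)) sums (y * E')"
      unfolding E'_def by (intro sums_mult summable_sums sd)
    thus "(\<lambda>N. real (Suc N) * e (Suc N) * y ^ Suc N) sums (y * E')"
      by (simp add: diffs_def mult_ac)
  qed simp
  have "((\<lambda>x. x powr (c - 1) * E x) has_field_derivative (y powr (c - 1) * E' + (c - 1) * y powr (c - 1 - 1) * E y)) (at y)"
    using y by (auto intro!: derivative_eq_intros DE)
  also have "y powr (c - 1) * E' + (c - 1) * y powr (c - 1 - 1) * E y = y powr (c - 1 - 1) * ((c - 1) * E y + y * E')"
  proof -
    have "y powr (c - 1) = y powr (c - 1 - 1) * y powr 1" by (subst powr_add[symmetric]) simp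
    thus ?thesis using y by (simp add: algebra_simps)
  qed
  also have "(c - 1) * E y + y * E' = (\<Sum>N. u $ N * (1 / Gamma (c - 1 + real N) * y ^ N))"
  proof (rule sums_unique)
    have "(\<lambda>N. (c - 1) * (e N * y ^ N) + real N * e N * y ^ N) sums ((c - 1) * E y + y * E')"
      unfolding E_def by (intro sums_add sums_mult summable_sums se yE')
    also have "(\<lambda>N. (c - 1) * (e N * y ^ N) + real N * e N * y ^ N) = (\<lambda>N. u $ N * (1 / Gamma (c - 1 + real N) * y ^ N))"
    proof
      fix N
      have p: "c - 1 + real N > 0" using c by simp
      have eq: "Gamma (c + real N) = (c - 1 + real N) * Gamma (c - 1 + real N)"
        using Gamma_real_plus1[OF p] by (simp add: add_ac)
      show "(c - 1) * (e N * y ^ N) + real N * e N * y ^ N = u $ N * (1 / Gamma (c - 1 + real N) * y ^ N)"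
      proof -
        have "k * (s / ((k + n) * G) * Y) + n * (s / ((k + n) * G)) * Y = s * (1 / G * Y)"
          if "k + n > 0" "G > 0" for k n s G Y :: real
          using that by (simp add: divide_simps) (simp add: algebra_simps)
        from this[OF p Gamma_real_pos[OF p]] show ?thesis unfolding e_def eq .
      qed
    qed
    finally show "(\<lambda>N. u $ N * (1 / Gamma (c - 1 + real N) * y ^ N)) sums ((c - 1) * E y + y * E')" .
  qed
  also have "y powr (c - 1 - 1) * (\<Sum>N. u $ N * (1 / Gamma (c - 1 + real N) * y ^ N)) = gseries u (c - 1) y"
    using y by (simp add: gseries_def)
  finally have "((\<lambda>x. x powr (c - 1) * E x) has_field_derivative gseries u (c - 1) y) (at y)" .
  moreover have "\<forall>\<^sub>F x in nhds y. gseries u c x = x powr (c - 1) * E x"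
    using eventually_nhds_in_open[of "{0<..}" y] y
    by (auto elim!: eventually_mono simp: gseries_def E_def e_def)
  ultimately show ?thesis by (subst DERIV_cong_ev[OF refl _ refl])
qed

lemma beta_scaled:
  fixes \<alpha> \<beta> y :: real assumes a: "0 < \<alpha>" and b: "0 < \<beta>" and y: "0 < y"
  shows "has_bochner_integral lborel (\<lambda>x. indicator {0..y} x * (x powr (\<alpha> - 1) * (y - x) powr (\<beta> - 1))) (y powr (\<alpha> + \<beta> - 1) * Beta \<alpha> \<beta>)"
proof -
  have 1: "has_bochner_integral lborel (\<lambda>t. indicator {0..1} t * (t powr (\<alpha> - 1) * (1 - t) powr (\<beta> - 1))) (Beta \<alpha> \<beta>)"
    using integrable_Beta[OF a b] set_borel_integral_eq_integral(2)[OF integrable_Beta[OF a b]]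
      integral_unique[OF has_integral_Beta_real[OF a b]]
    by (simp add: has_bochner_integral_iff set_integrable_def set_lebesgue_integral_def)
  have "has_bochner_integral lborel (\<lambda>x. y powr (\<alpha> + \<beta> - 2) * (indicator {0..1} (0 + (1/y) * x) * ((0 + (1/y) * x) powr (\<alpha> - 1) * (1 - (0 + (1/y) * x)) powr (\<beta> - 1))))
     (y powr (\<alpha> + \<beta> - 2) * (Beta \<alpha> \<beta> /\<^sub>R \<bar>1/y\<bar>))"
    by (intro has_bochner_integral_mult_right) (rule lborel_has_bochner_integral_real_affine_iff[THEN iffD1, OF _ 1], use y in auto)
  also have "(\<lambda>x. y powr (\<alpha> + \<beta> - 2) * (indicator {0..1} (0 + (1/y) * x) * ((0 + (1/y) * x) powr (\<alpha> - 1) * (1 - (0 + (1/y) * x)) powr (\<beta> - 1)))) =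
     (\<lambda>x. indicator {0..y} x * (x powr (\<alpha> - 1) * (y - x) powr (\<beta> - 1)))"
  proof
    fix x
    show "y powr (\<alpha> + \<beta> - 2) * (indicator {0..1} (0 + (1/y) * x) * ((0 + (1/y) * x) powr (\<alpha> - 1) * (1 - (0 + (1/y) * x)) powr (\<beta> - 1))) =
       indicator {0..y} x * (x powr (\<alpha> - 1) * (y - x) powr (\<beta> - 1))"
    proof (cases "0 \<le> x \<and> x \<le> y")
      case True
      have "1 - x / y = (y - x) / y" using y by (simp add: field_simps)
      moreover have "y powr (\<alpha> + \<beta> - 2) = y powr (\<alpha> - 1) * y powr (\<beta> - 1)" by (simp add: powr_add[symmetric])
      ultimately show ?thesis using True y by (simp add: powr_divide)
    next
      case False
      thus ?thesis using y by (auto simp: indicator_def field_simps)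
    qed
  qed
  also have "y powr (\<alpha> + \<beta> - 2) * (Beta \<alpha> \<beta> /\<^sub>R \<bar>1/y\<bar>) = y powr (\<alpha> + \<beta> - 1) * Beta \<alpha> \<beta>"
  proof -
    have "y powr (\<alpha> + \<beta> - 1) = y powr (\<alpha> + \<beta> - 2) * y powr 1" by (subst powr_add[symmetric]) simp
    thus ?thesis using y by simp
  qed
  finally show ?thesis .
qed

text \<open>Pointwise the product of the two series is a Cauchy product, and each of its terms
  integrates to a beta integral whose gamma factors cancel those of the series. The remaining work
  is the interchange of sum and integral.\<close>

lemma add_conv_gseries:
  assumes u: "geom_bounded (fps_nth u)" and v: "geom_bounded (fps_nth v)" and a: "0 < a" and b: "0 < b"
  shows "add_conv (gseries u a) (gseries v b) = gseries (u * v) (a + b)"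
proof
  fix y
  show "add_conv (gseries u a) (gseries v b) y = gseries (u * v) (a + b) y"
  proof (cases "0 < y")
    case False
    thus ?thesis by (subst add_conv_nonpos) (auto simp: gseries_def)
  next
    case y: True
    define t where "t = (\<lambda>K i x. indicator {0..y} x * (x powr (a + real i - 1) * (y - x) powr (b + real (K - i) - 1)))"
    define w where "w = (\<lambda>K i. u $ i * v $ (K - i) / (Gamma (a + real i) * Gamma (b + real (K - i))))"
    define F where "F = (\<lambda>K x. \<Sum>i\<le>K. w K i * t K i x)"
    have gp: "Gamma (a + real i) > 0" "Gamma (b + real i) > 0" for i using a b by (auto intro!: Gamma_real_pos)
    have gp2: "Gamma (a + b + real K) > 0" for K using a b by (auto intro!: Gamma_real_pos)
    have t: "has_bochner_integral lborel (t K i) (y powr (a + b + real K - 1) * (Gamma (a + real i) * Gamma (b + real (K - i)) / Gamma (a + b + real K)))"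
      if "i \<le> K" for K i
      using beta_scaled[of "a + real i" "b + real (K - i)" y] that a b y
      by (simp add: t_def Beta_def of_nat_diff algebra_simps)
    have t0: "t K i x \<ge> 0" for K i x by (simp add: t_def)
    have canc: "s / (g1 * g2) * (Y * (g1 * g2 / G)) = s * (Y / G)" if "0 < g1" "0 < g2" for s g1 g2 Y G :: real
      using that by simp
    have it: "integrable lborel (t K i)" if "i \<le> K" for K i using t[OF that] by (simp add: has_bochner_integral_iff)
    have iF: "integrable lborel (F K)" for K
      unfolding F_def by (intro Bochner_Integration.integrable_sum integrable_mult_right it) auto
    have IF: "(LINT x|lborel. F K x) = y powr (a + b - 1) * ((u * v) $ K * (1 / Gamma (a + b + real K) * y ^ K))" for K
    proof -
      have "(LINT x|lborel. F K x) = (\<Sum>i\<le>K. w K i * (LINT x|lborel. t K i x))"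
        unfolding F_def by (subst Bochner_Integration.integral_sum) (auto intro!: integrable_mult_right it)
      also have "\<dots> = (\<Sum>i\<le>K. u $ i * v $ (K - i) * (y powr (a + b + real K - 1) / Gamma (a + b + real K)))"
      proof (intro sum.cong refl)
        fix i assume "i \<in> {..K}"
        hence "(LINT x|lborel. t K i x) = y powr (a + b + real K - 1) * (Gamma (a + real i) * Gamma (b + real (K - i)) / Gamma (a + b + real K))"
          using t[of i K] by (simp add: has_bochner_integral_iff del: of_nat_diff)
        thus "w K i * (LINT x|lborel. t K i x) = u $ i * v $ (K - i) * (y powr (a + b + real K - 1) / Gamma (a + b + real K))"
          using canc[OF gp(1)[of i] gp(2)[of "K - i"]] by (simp only: w_def)
      qed
      also have "\<dots> = (u * v) $ K * (y powr (a + b + real K - 1) / Gamma (a + b + real K))"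
        by (simp only: fps_mult_nth sum_distrib_right[symmetric] atLeast0AtMost)
      also have "y powr (a + b + real K - 1) = y powr (a + b - 1) * y ^ K"
        using y by (simp add: powr_realpow[symmetric] powr_add[symmetric] algebra_simps)
      finally show ?thesis by simp
    qed
    \<comment> \<open>The absolute values of the coefficients satisfy the same growth bounds, and
      the integrals of the norms are bounded by the same expression in \<open>u'\<close> and
      \<open>v'\<close>. This is the summable majorant for the interchange.\<close>
    define u' where "u' = Abs_fps (\<lambda>N. \<bar>u $ N\<bar>)"
    define v' where "v' = Abs_fps (\<lambda>N. \<bar>v $ N\<bar>)"
    have u': "geom_bounded (fps_nth u')" and v': "geom_bounded (fps_nth v')"
      using u v by (simp_all add: geom_bounded_def u'_def v'_def)
    have nF: "(LINT x|lborel. norm (F K x)) \<le> y powr (a + b - 1) * ((u' * v') $ K * (1 / Gamma (a + b + real K) * y ^ K))" for K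
    proof -
      have "(LINT x|lborel. norm (F K x)) \<le> (LINT x|lborel. (\<Sum>i\<le>K. \<bar>w K i\<bar> * t K i x))"
      proof (rule integral_mono)
        show "norm (F K x) \<le> (\<Sum>i\<le>K. \<bar>w K i\<bar> * t K i x)" for x
          unfolding F_def real_norm_def by (rule order.trans[OF sum_abs]) (simp add: abs_mult t0)
      qed (use iF in \<open>auto intro!: Bochner_Integration.integrable_sum integrable_mult_right it\<close>)
      also have "\<dots> = (\<Sum>i\<le>K. \<bar>w K i\<bar> * (LINT x|lborel. t K i x))"
        by (subst Bochner_Integration.integral_sum) (auto intro!: integrable_mult_right it)
      also have "\<dots> = (\<Sum>i\<le>K. u' $ i * v' $ (K - i) * (y powr (a + b + real K - 1) / Gamma (a + b + real K)))"
      proof (intro sum.cong refl)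
        fix i assume "i \<in> {..K}"
        hence "(LINT x|lborel. t K i x) = y powr (a + b + real K - 1) * (Gamma (a + real i) * Gamma (b + real (K - i)) / Gamma (a + b + real K))"
          using t[of i K] by (simp add: has_bochner_integral_iff del: of_nat_diff)
        moreover have "\<bar>w K i\<bar> = u' $ i * v' $ (K - i) / (Gamma (a + real i) * Gamma (b + real (K - i)))"
          using gp(1)[of i] gp(2)[of "K - i"] by (simp add: w_def u'_def v'_def abs_mult del: of_nat_diff)
        ultimately show "\<bar>w K i\<bar> * (LINT x|lborel. t K i x) = u' $ i * v' $ (K - i) * (y powr (a + b + real K - 1) / Gamma (a + b + real K))"
          using canc[OF gp(1)[of i] gp(2)[of "K - i"]] by (simp only:)
      qed
      also have "\<dots> = (u' * v') $ K * (y powr (a + b + real K - 1) / Gamma (a + b + real K))"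
        by (simp only: fps_mult_nth sum_distrib_right[symmetric] atLeast0AtMost)
      also have "y powr (a + b + real K - 1) = y powr (a + b - 1) * y ^ K"
        using y by (simp add: powr_realpow[symmetric] powr_add[symmetric] algebra_simps)
      finally show ?thesis by (simp add: mult_ac)
    qed
    have sumF: "(\<lambda>K. F K x) sums (indicator {0..y} x * (gseries u a x * gseries v b (y - x))) \<and> summable (\<lambda>K. norm (F K x))" for x
    proof (cases "0 < x \<and> x < y")
      case False
      \<comment> \<open>At the end points \<open>0 powr _ = 0\<close>, whatever the exponent, which
        matches the value 0 of \<open>gseries\<close> at 0.\<close>
      have "F K x = 0" for K
        using False unfolding F_def t_def by (intro sum.neutral) (auto simp: indicator_def)
      moreover have "indicator {0..y} x * (gseries u a x * gseries v b (y - x)) = 0"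
        using False by (auto simp: indicator_def gseries_def)
      ultimately show ?thesis by (simp only: sums_zero summable_zero norm_zero simp_thms)
    next
      case True
      define f where "f = (\<lambda>i. x powr (a - 1) * (u $ i * (1 / Gamma (a + real i) * x ^ i)))"
      define g where "g = (\<lambda>i. (y - x) powr (b - 1) * (v $ i * (1 / Gamma (b + real i) * (y - x) ^ i)))"
      have sf: "summable (\<lambda>i. norm (f i))" unfolding f_def norm_mult
        using summable_mult[OF summable_gseries[OF u a, of x], of "norm (x powr (a - 1))"] by (simp add: abs_mult)
      have sg: "summable (\<lambda>i. norm (g i))" unfolding g_def norm_mult
        using summable_mult[OF summable_gseries[OF v b, of "y - x"], of "norm ((y - x) powr (b - 1))"] by (simp add: abs_mult)
      have FK: "F K x = (\<Sum>i\<le>K. f i * g (K - i))" for K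
        unfolding F_def
      proof (intro sum.cong refl)
        fix i
        have "x powr (a + real i - 1) = x powr (a - 1) * x ^ i"
          using True by (simp add: powr_realpow[symmetric] powr_add[symmetric] algebra_simps)
        moreover have "(y - x) powr (b + real (K - i) - 1) = (y - x) powr (b - 1) * (y - x) ^ (K - i)"
          using True by (simp add: powr_realpow[symmetric] powr_add[symmetric] algebra_simps)
        ultimately show "w K i * t K i x = f i * g (K - i)"
          using True by (simp add: w_def t_def f_def g_def)
      qed
      have "(\<Sum>i. f i) = gseries u a x" "(\<Sum>i. g i) = gseries v b (y - x)"
        unfolding f_def g_def suminf_mult[OF summable_gseries'[OF u a]] suminf_mult[OF summable_gseries'[OF v b]]
        using True by (simp_all only: gseries_def if_True diff_gt_0_iff_gt)
      hence "(\<lambda>K. F K x) sums (gseries u a x * gseries v b (y - x))"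
        using Cauchy_product_sums[OF sf sg] by (simp add: FK)
      moreover have "summable (\<lambda>K. norm (F K x))"
      proof (rule summable_comparison_test')
        show "summable (\<lambda>K. \<Sum>i\<le>K. norm (f i) * norm (g (K - i)))"
          using summable_Cauchy_product[of "\<lambda>i. norm (f i)" "\<lambda>i. norm (g i)"] sf sg by simp
        show "norm (norm (F K x)) \<le> (\<Sum>i\<le>K. norm (f i) * norm (g (K - i)))" for K
          using norm_sum[of "\<lambda>i. f i * g (K - i)" "{..K}"] by (simp add: FK abs_mult)
      qed
      ultimately show ?thesis using True by simp
    qed
    have "(\<lambda>K. LINT x|lborel. F K x) sums (LINT x|lborel. (\<Sum>K. F K x))"
    proof (rule sums_integral)
      show "AE x in lborel. summable (\<lambda>K. norm (F K x))" using sumF by auto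
      show "summable (\<lambda>K. LINT x|lborel. norm (F K x))"
      proof (rule summable_comparison_test')
        show "summable (\<lambda>K. y powr (a + b - 1) * ((u' * v') $ K * (1 / Gamma (a + b + real K) * y ^ K)))"
          using a b by (intro summable_mult summable_gseries' geom_bounded_conv u' v') auto
        show "norm (LINT x|lborel. norm (F K x)) \<le> y powr (a + b - 1) * ((u' * v') $ K * (1 / Gamma (a + b + real K) * y ^ K))" for K
          using nF[of K] by (simp add: integral_nonneg_AE)
      qed
    qed (rule iF)
    also have "(\<lambda>x. \<Sum>K. F K x) = (\<lambda>x. indicator {0..y} x * (gseries u a x * gseries v b (y - x)))"
      using sumF by (auto simp: sums_iff)
    finally have "(LINT x|lborel. indicator {0..y} x * (gseries u a x * gseries v b (y - x))) =
       (\<Sum>K. y powr (a + b - 1) * ((u * v) $ K * (1 / Gamma (a + b + real K) * y ^ K)))"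
      by (simp only: IF sums_iff)
    also have "\<dots> = gseries (u * v) (a + b) y"
      using y a b by (subst suminf_mult[OF summable_gseries'[OF geom_bounded_conv[OF u v]]]) (auto simp: gseries_def)
    finally show ?thesis by (simp add: add_conv_def set_lebesgue_integral_def)
  qed
qed

section \<open>Gamma kernels and their convolutions as series\<close>

text \<open>The power series of (1 + \<rho> X)^(-a). With X = 1/z, its product with z^(-a) is (z +
  \<rho>)^(-a), the transform of \<open>gamma_kernel \<rho> a\<close>.\<close>

definition binom_fps :: "real \<Rightarrow> real \<Rightarrow> real fps" where
  "binom_fps \<rho> a = Abs_fps (\<lambda>N. pochhammer a N * (- \<rho>) ^ N / fact N)"

lemma geom_bounded_binom_fps:
  assumes a: "0 < a" shows "geom_bounded (fps_nth (binom_fps \<rho> a))"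
proof -
  define R where "R = max 1 a * (\<bar>\<rho>\<bar> + 1)"
  have p: "pochhammer a N / fact N \<le> max 1 a ^ N" for N
  proof (induction N)
    case (Suc N)
    have "pochhammer a (Suc N) / fact (Suc N) = pochhammer a N / fact N * ((a + real N) / (1 + real N))"
      by (simp add: pochhammer_Suc)
    also have "\<dots> \<le> max 1 a ^ N * max 1 a"
    proof (intro mult_mono Suc)
      have "a + real N \<le> max 1 a * (1 + real N)"
        using mult_right_mono[of 1 "max 1 a" "real N"] by (simp add: distrib_left)
      thus "(a + real N) / (1 + real N) \<le> max 1 a" by (simp add: divide_le_eq)
    qed (use a in auto)
    finally show ?case by (simp add: mult.commute)
  qed simp
  have "\<bar>binom_fps \<rho> a $ N\<bar> \<le> 1 * R ^ N" for N
  proof -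
    have "\<bar>binom_fps \<rho> a $ N\<bar> = pochhammer a N / fact N * \<bar>\<rho>\<bar> ^ N"
      using a by (simp add: binom_fps_def abs_mult power_abs pochhammer_nonneg)
    also have "\<dots> \<le> max 1 a ^ N * (\<bar>\<rho>\<bar> + 1) ^ N" by (intro mult_mono p power_mono) auto
    finally show ?thesis by (simp add: R_def power_mult_distrib)
  qed
  moreover have "R > 0" unfolding R_def by (intro mult_pos_pos) auto
  ultimately show ?thesis unfolding geom_bounded_def by blast
qed

text \<open>On coefficients this is \<open>pochhammer a (Suc k) - real (Suc k) * pochhammer a k =
  pochhammer (a - 1) (Suc k)\<close>. It is the formal version of multiplying a transform by z +
  \<rho>.\<close>

lemma binom_fps_shift:
  "(1 + fps_const \<rho> * fps_X) * binom_fps \<rho> a = binom_fps \<rho> (a - 1)"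
proof (rule fps_ext)
  fix N
  show "((1 + fps_const \<rho> * fps_X) * binom_fps \<rho> a) $ N = binom_fps \<rho> (a - 1) $ N"
  proof (cases N)
    case (Suc k)
    have "((1 + fps_const \<rho> * fps_X) * binom_fps \<rho> a) $ N = binom_fps \<rho> a $ Suc k + \<rho> * binom_fps \<rho> a $ k"
      by (simp add: Suc distrib_right mult.assoc)
    also have "\<dots> = (- \<rho>) ^ Suc k / fact (Suc k) * (pochhammer a (Suc k) - real (Suc k) * pochhammer a k)"
    proof -
      have "(- \<rho>) ^ Suc k / fact (Suc k) * (real (Suc k) * pochhammer a k) = (- \<rho>) ^ Suc k / fact k * pochhammer a k"
        by (simp add: fact_Suc del: of_nat_Suc power_Suc)
      moreover have "binom_fps \<rho> a $ Suc k = (- \<rho>) ^ Suc k / fact (Suc k) * pochhammer a (Suc k)"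
        by (simp add: binom_fps_def mult_ac)
      moreover have "\<rho> * binom_fps \<rho> a $ k = - ((- \<rho>) ^ Suc k / fact k * pochhammer a k)"
        by (simp add: binom_fps_def mult_ac)
      ultimately show ?thesis by (simp only: right_diff_distrib)
    qed
    also have "pochhammer a (Suc k) - real (Suc k) * pochhammer a k = pochhammer (a - 1) (Suc k)"
      unfolding pochhammer_rec[of "a - 1"] by (simp add: pochhammer_Suc algebra_simps)
    finally show ?thesis by (simp add: binom_fps_def Suc mult_ac)
  qed (simp add: binom_fps_def)
qed

text \<open>Gamma(a + N) is Gamma(a) times the Pochhammer symbol, which cancels that of
  \<open>binom_fps\<close> and leaves the exponential series.\<close>

lemma gamma_kernel_gseries:
  assumes a: "0 < a" shows "gamma_kernel \<rho> a = gseries (binom_fps \<rho> a) a"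
proof
  fix y
  show "gamma_kernel \<rho> a y = gseries (binom_fps \<rho> a) a y"
  proof (cases "0 < y")
    case True
    have g: "Gamma (a + real N) = Gamma a * pochhammer a N" for N
    proof (induction N)
      case (Suc N)
      have "Gamma (a + real N + 1) = (a + real N) * Gamma (a + real N)" using a by (intro Gamma_real_plus1) auto
      thus ?case using Suc by (simp add: pochhammer_Suc add_ac mult_ac)
    qed simp
    have pz: "pochhammer a N > 0" for N using a by (rule pochhammer_pos)
    have "binom_fps \<rho> a $ N * (1 / Gamma (a + real N) * y ^ N) = (1 / Gamma a) * ((- \<rho> * y) ^ N /\<^sub>R fact N)" for N
      using pz[of N] Gamma_real_pos[OF a] unfolding g power_mult_distrib by (simp add: binom_fps_def field_simps)
    hence "(\<Sum>N. binom_fps \<rho> a $ N * (1 / Gamma (a + real N) * y ^ N)) = (1 / Gamma a) * exp (- \<rho> * y)"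
      by (simp only: suminf_mult[OF summable_exp_generic] exp_def)
    thus ?thesis using True by (simp add: gamma_kernel_def gseries_def)
  qed (simp add: gamma_kernel_def gseries_def)
qed

lemma iter_conv_gamma_gseries:
  assumes "1 \<le> q" "\<And>h. h \<in> {1..q} \<Longrightarrow> 0 < A h"
  shows "iter_conv q (\<lambda>h. gamma_kernel (\<rho> h) (A h)) = gseries (\<Prod>h=1..q. binom_fps (\<rho> h) (A h)) (\<Sum>h=1..q. A h)"
  using assms
proof (induction q rule: nat_induct_at_least)
  case base
  thus ?case by (simp add: iter_conv_1 gamma_kernel_gseries)
next
  case (Suc q)
  have "(\<Sum>h=1..q. A h) > 0" using Suc by (intro sum_pos) auto
  hence "add_conv (gseries (\<Prod>h=1..q. binom_fps (\<rho> h) (A h)) (\<Sum>h=1..q. A h)) (gseries (binom_fps (\<rho> (Suc q)) (A (Suc q))) (A (Suc q)))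
     = gseries ((\<Prod>h=1..q. binom_fps (\<rho> h) (A h)) * binom_fps (\<rho> (Suc q)) (A (Suc q))) ((\<Sum>h=1..q. A h) + A (Suc q))"
    using Suc by (intro add_conv_gseries geom_bounded_prod geom_bounded_binom_fps) auto
  thus ?case using Suc by (simp add: iter_conv_Suc gamma_kernel_gseries)
qed

section \<open>The confluent Lauricella series\<close>

lemma summable_on_PiE_halves:
  assumes "finite H" shows "(\<lambda>k. \<Prod>h\<in>H. (1 / 2 :: real) ^ k h) summable_on (PiE H (\<lambda>_. UNIV))"
proof -
  have "Infinite_Set_Sum.abs_summable_on (\<lambda>k. \<Prod>h\<in>H. (1 / 2 :: real) ^ k h) (PiE H (\<lambda>_. UNIV))"
    by (rule abs_summable_on_prod_PiE) (use assms in \<open>auto simp: abs_summable_on_nat_iff'\<close>)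
  hence "(\<lambda>k. norm (\<Prod>h\<in>H. (1 / 2 :: real) ^ k h)) summable_on (PiE H (\<lambda>_. UNIV))"
    by (simp only: abs_summable_equivalent)
  thus ?thesis by (simp add: prod_nonneg)
qed

lemma prod_geom_bound:
  fixes V :: "'a \<Rightarrow> real fps"
  assumes "finite H" "\<And>h. h \<in> H \<Longrightarrow> geom_bounded (fps_nth (V h))"
  shows "\<exists>M R. 0 < M \<and> 0 < R \<and> (\<forall>k. \<bar>\<Prod>h\<in>H. V h $ k h\<bar> \<le> M * R ^ (\<Sum>h\<in>H. k h))"
  using assms
proof (induction H rule: finite_induct)
  case empty
  show ?case by (intro exI[of _ 1]) auto
next
  case (insert x F)
  then obtain M R where MR: "0 < M" "0 < R" "\<And>k. \<bar>\<Prod>h\<in>F. V h $ k h\<bar> \<le> M * R ^ (\<Sum>h\<in>F. k h)" by auto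
  have "geom_bounded (fps_nth (V x))" using insert by auto
  then obtain M' R' where MR': "0 < M'" "0 < R'" "\<And>N. \<bar>V x $ N\<bar> \<le> M' * R' ^ N" by (rule geom_boundedE) blast
  define Q where "Q = max R R'"
  have Q: "0 < Q" "R \<le> Q" "R' \<le> Q" using MR MR' by (auto simp: Q_def)
  have "\<bar>\<Prod>h\<in>insert x F. V h $ k h\<bar> \<le> (M' * M) * Q ^ (\<Sum>h\<in>insert x F. k h)" for k
  proof -
    have "\<bar>\<Prod>h\<in>insert x F. V h $ k h\<bar> = \<bar>V x $ k x\<bar> * \<bar>\<Prod>h\<in>F. V h $ k h\<bar>"
      using insert by (simp add: abs_mult)
    also have "\<dots> \<le> (M' * Q ^ k x) * (M * Q ^ (\<Sum>h\<in>F. k h))"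
    proof (rule mult_mono)
      show "\<bar>V x $ k x\<bar> \<le> M' * Q ^ k x" by (rule order.trans[OF MR'(3)]) (use MR' Q in \<open>intro mult_left_mono power_mono, auto\<close>)
      show "\<bar>\<Prod>h\<in>F. V h $ k h\<bar> \<le> M * Q ^ (\<Sum>h\<in>F. k h)"
        by (rule order.trans[OF MR(3)]) (use MR Q in \<open>intro mult_left_mono power_mono, auto\<close>)
    qed (use MR' Q in auto)
    also have "\<dots> = (M' * M) * Q ^ (\<Sum>h\<in>insert x F. k h)" using insert by (simp add: power_add mult_ac)
    finally show ?thesis .
  qed
  thus ?case using Q MR MR' by (intro exI[of _ "M' * M"] exI[of _ Q]) auto
qed

text \<open>The coefficients grow at most like R^|k| while \<phi> decays at least like (2R)^(-|k|),
  so a product of geometric series of ratio 1/2 is a majorant.\<close>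

lemma summable_on_PiE_series:
  fixes V :: "'a \<Rightarrow> real fps"
  assumes H: "finite H" and V: "\<And>h. h \<in> H \<Longrightarrow> geom_bounded (fps_nth (V h))" and \<phi>: "superexp_small \<phi>"
  shows "(\<lambda>k. (\<Prod>h\<in>H. V h $ k h) * \<phi> (\<Sum>h\<in>H. k h)) summable_on (PiE H (\<lambda>_. UNIV))"
proof (rule abs_summable_summable)
  obtain M R where MR: "0 < M" "0 < R" "\<And>k. \<bar>\<Prod>h\<in>H. V h $ k h\<bar> \<le> M * R ^ (\<Sum>h\<in>H. k h)"
    using prod_geom_bound[of H V] H V by blast
  obtain K where K: "0 < K" "\<And>N. \<bar>\<phi> N\<bar> \<le> K * (1 / (2 * R)) ^ N"
    using superexp_small_half[OF \<phi>, of "2 * R"] MR by auto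
  show "(\<lambda>k. norm ((\<Prod>h\<in>H. V h $ k h) * \<phi> (\<Sum>h\<in>H. k h))) summable_on (PiE H (\<lambda>_. UNIV))"
  proof (rule summable_on_comparison_test)
    show "(\<lambda>k. M * K * (\<Prod>h\<in>H. (1 / 2 :: real) ^ k h)) summable_on (PiE H (\<lambda>_. UNIV))"
      by (intro summable_on_cmult_right summable_on_PiE_halves H)
    fix k
    have "norm ((\<Prod>h\<in>H. V h $ k h) * \<phi> (\<Sum>h\<in>H. k h)) \<le> (M * R ^ (\<Sum>h\<in>H. k h)) * (K * (1 / (2 * R)) ^ (\<Sum>h\<in>H. k h))"
      unfolding real_norm_def abs_mult
      by (rule mult_mono[OF MR(3)[of k] K(2)]) (use MR in auto)
    also have "\<dots> = M * K * (1 / 2) ^ (\<Sum>h\<in>H. k h)" using MR by (simp add: power_mult_distrib power_divide)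
    also have "\<dots> = M * K * (\<Prod>h\<in>H. (1 / 2 :: real) ^ k h)" by (simp only: power_sum)
    finally show "norm ((\<Prod>h\<in>H. V h $ k h) * \<phi> (\<Sum>h\<in>H. k h)) \<le> M * K * (\<Prod>h\<in>H. (1 / 2 :: real) ^ k h)" .
  qed auto
qed

text \<open>Absolute summability over pairs justifies the regrouping by the total degree y + N
  below.\<close>

lemma summable_on_pair_series:
  assumes u: "geom_bounded u" and v: "geom_bounded v" and \<phi>: "superexp_small \<phi>"
  shows "(\<lambda>(y, N). u y * (v N * \<phi> (y + N))) summable_on (UNIV \<times> UNIV)"
proof -
  from u obtain M R where u: "0 < M" "0 < R" "\<And>N. \<bar>u N\<bar> \<le> M * R ^ N" by (rule geom_boundedE) blast
  from v obtain M' R' where v: "0 < M'" "0 < R'" "\<And>N. \<bar>v N\<bar> \<le> M' * R' ^ N" by (rule geom_boundedE) blast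
  define Q where "Q = max R R'"
  have Q: "0 < Q" "R \<le> Q" "R' \<le> Q" using u v by (auto simp: Q_def)
  obtain K where K: "0 < K" "\<And>N. \<bar>\<phi> N\<bar> \<le> K * (1 / (2 * Q)) ^ N"
    using superexp_small_half[OF \<phi>, of "2 * Q"] Q by auto
  have hs: "((\<lambda>N. c * (1/2) ^ N) has_sum (2 * c)) (UNIV :: nat set)" for c :: real
  proof (rule norm_summable_imp_has_sum)
    show "summable (\<lambda>n. norm (c * (1/2) ^ n))" by (simp add: abs_mult power_abs summable_mult)
    show "(\<lambda>N. c * (1/2) ^ N) sums (2 * c)"
      using sums_mult[OF geometric_sums[of "1/2 :: real"], of c] by (simp add: mult.commute)
  qed
  have G: "(\<lambda>(y, N). (M * (M' * K)) * (1/2::real) ^ y * (1/2) ^ N) summable_on (UNIV \<times> (UNIV :: nat set))"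
  proof (rule summable_on_SigmaI)
    fix y :: nat
    show "((\<lambda>N. case (y, N) of (y, N) \<Rightarrow> (M * (M' * K)) * (1/2::real) ^ y * (1/2) ^ N) has_sum (2 * ((M * (M' * K)) * (1/2) ^ y))) UNIV"
      unfolding prod.case by (rule hs)
  next
    show "(\<lambda>y. 2 * ((M * (M' * K)) * (1/2::real) ^ y)) summable_on (UNIV :: nat set)"
      by (intro summable_on_cmult_right has_sum_imp_summable[OF hs])
  qed (use u v K in auto)
  show ?thesis
  proof (rule abs_summable_summable, rule summable_on_comparison_test[OF G])
    fix p :: "nat \<times> nat"
    obtain y N where p: "p = (y, N)" by (cases p)
    have "\<bar>u y * (v N * \<phi> (y + N))\<bar> \<le> (M * Q ^ y) * ((M' * Q ^ N) * (K * (1 / (2 * Q)) ^ (y + N)))"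
      unfolding abs_mult
    proof (intro mult_mono K)
      show "\<bar>u y\<bar> \<le> M * Q ^ y" by (rule order.trans[OF u(3)]) (use u Q in \<open>intro mult_left_mono power_mono, auto\<close>)
      show "\<bar>v N\<bar> \<le> M' * Q ^ N" by (rule order.trans[OF v(3)]) (use v Q in \<open>intro mult_left_mono power_mono, auto\<close>)
    qed (use u v Q in auto)
    also have "\<dots> = (M * (M' * K)) * (1/2) ^ y * (1/2) ^ N"
      using Q by (simp add: power_add power_divide power_mult_distrib)
    finally show "norm (case p of (y, N) \<Rightarrow> u y * (v N * \<phi> (y + N))) \<le> (case p of (y, N) \<Rightarrow> M * (M' * K) * (1/2) ^ y * (1/2) ^ N)"
      by (simp add: p)
  qed auto
qed

text \<open>A multiple sum whose terms depend on k through coefficients and through |k| collapses to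
  a sum over the total degree, with the coefficients of the product series. In the induction one
  index y is split off and regrouped with the degree N of the others as K = y + N. The inner sum
  sees \<phi> shifted by y, so \<phi> has to be general.\<close>

lemma infsum_PiE_series:
  fixes V :: "'a \<Rightarrow> real fps"
  assumes "finite H" "\<And>h. h \<in> H \<Longrightarrow> geom_bounded (fps_nth (V h))" "superexp_small \<phi>"
  shows "infsum (\<lambda>k. (\<Prod>h\<in>H. V h $ k h) * \<phi> (\<Sum>h\<in>H. k h)) (PiE H (\<lambda>_. UNIV)) =
         infsum (\<lambda>N. (\<Prod>h\<in>H. V h) $ N * \<phi> N) UNIV"
  using assms
proof (induction H arbitrary: \<phi> rule: finite_induct)
  case empty
  have "infsum (\<lambda>N. (1 :: real fps) $ N * \<phi> N) UNIV = infsum (\<lambda>N. (1 :: real fps) $ N * \<phi> N) {0}"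
    by (rule infsum_cong_neutral) (auto split: if_splits)
  thus ?case by simp
next
  case (insert x F)
  let ?U = "\<Prod>h\<in>F. V h"
  have gV: "geom_bounded (fps_nth (V x))" using insert by auto
  have gU: "geom_bounded (fps_nth ?U)" using insert by (intro geom_bounded_prod) auto
  let ?t = "\<lambda>k. (\<Prod>h\<in>insert x F. V h $ k h) * \<phi> (\<Sum>h\<in>insert x F. k h)"
  let ?s = "\<lambda>y g. V x $ y * ((\<Prod>h\<in>F. V h $ g h) * \<phi> (y + (\<Sum>h\<in>F. g h)))"
  have inj: "inj_on (\<lambda>(y, g). g(x := y)) ((UNIV :: nat set) \<times> PiE F (\<lambda>_. UNIV))"
    using inj_combinator[of x F "\<lambda>_. UNIV :: nat set"] insert by simp
  have PiE: "PiE (insert x F) (\<lambda>_. UNIV :: nat set) = (\<lambda>(y, g). g(x := y)) ` (UNIV \<times> PiE F (\<lambda>_. UNIV))"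
    by (simp add: PiE_insert_eq)
  have ts: "?t \<circ> (\<lambda>(y, g). g(x := y)) = (\<lambda>(y, g). ?s y g)"
  proof
    fix p :: "nat \<times> ('a \<Rightarrow> nat)"
    obtain y g where p: "p = (y, g)" by (cases p)
    have "(\<Prod>h\<in>F. V h $ (g(x := y)) h) = (\<Prod>h\<in>F. V h $ g h)" "(\<Sum>h\<in>F. (g(x := y)) h) = (\<Sum>h\<in>F. g h)"
      using insert by (auto intro!: prod.cong sum.cong)
    thus "(?t \<circ> (\<lambda>(y, g). g(x := y))) p = (case p of (y, g) \<Rightarrow> ?s y g)" using insert by (simp add: p mult.assoc)
  qed
  have sum1: "(\<lambda>(y, g). ?s y g) summable_on (UNIV \<times> PiE F (\<lambda>_. UNIV))"
    using summable_on_PiE_series[of "insert x F" V \<phi>] insert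
    unfolding PiE summable_on_reindex[OF inj] ts by auto
  have sum2: "(\<lambda>(y, N). V x $ y * (?U $ N * \<phi> (y + N))) summable_on (UNIV \<times> UNIV)"
    by (rule summable_on_pair_series[OF gV gU insert.prems(2)])
  have w: "(\<lambda>(y, N). V x $ y * (?U $ N * \<phi> (y + N))) summable_on (UNIV \<times> UNIV) \<longleftrightarrow>
      (\<lambda>(K, i). V x $ i * (?U $ (K - i) * \<phi> K)) summable_on (SIGMA K:UNIV. {..K})"
    by (rule summable_on_reindex_bij_witness[where i = "\<lambda>(K, i). (i, K - i)" and j = "\<lambda>(y, N). (y + N, y)"]) auto
  have "infsum ?t (PiE (insert x F) (\<lambda>_. UNIV)) = infsum (\<lambda>(y, g). ?s y g) (UNIV \<times> PiE F (\<lambda>_. UNIV))"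
    unfolding PiE infsum_reindex[OF inj] ts ..
  also have "\<dots> = infsum (\<lambda>y. infsum (?s y) (PiE F (\<lambda>_. UNIV))) UNIV"
    by (rule infsum_Sigma'_banach[symmetric]) (rule sum1)
  also have "\<dots> = infsum (\<lambda>y. infsum (\<lambda>N. V x $ y * (?U $ N * \<phi> (y + N))) UNIV) UNIV"
  proof (rule infsum_cong)
    fix y
    have "infsum (\<lambda>g. (\<Prod>h\<in>F. V h $ g h) * \<phi> (y + (\<Sum>h\<in>F. g h))) (PiE F (\<lambda>_. UNIV)) = infsum (\<lambda>N. ?U $ N * \<phi> (y + N)) UNIV"
      using insert by (intro insert.IH superexp_small_shift) auto
    thus "infsum (?s y) (PiE F (\<lambda>_. UNIV)) = infsum (\<lambda>N. V x $ y * (?U $ N * \<phi> (y + N))) UNIV"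
      by (simp only: infsum_cmult_right')
  qed
  also have "\<dots> = infsum (\<lambda>(y, N). V x $ y * (?U $ N * \<phi> (y + N))) (UNIV \<times> UNIV)"
    by (rule infsum_Sigma'_banach) (rule sum2)
  also have "\<dots> = infsum (\<lambda>(K, i). V x $ i * (?U $ (K - i) * \<phi> K)) (SIGMA K:UNIV. {..K})"
    by (rule infsum_reindex_bij_witness[where i = "\<lambda>(K, i). (i, K - i)" and j = "\<lambda>(y, N). (y + N, y)"]) auto
  also have "\<dots> = infsum (\<lambda>K. infsum (\<lambda>i. V x $ i * (?U $ (K - i) * \<phi> K)) {..K}) UNIV"
    by (rule infsum_Sigma'_banach[symmetric]) (use w sum2 in blast)
  also have "\<dots> = infsum (\<lambda>K. (V x * ?U) $ K * \<phi> K) UNIV"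
    by (rule infsum_cong) (simp add: fps_mult_nth sum_distrib_right atLeast0AtMost mult.assoc)
  finally show ?case using insert by simp
qed

text \<open>The arguments -\<rho>_h y contribute powers of -\<rho>_h to the coefficients of
  \<open>binom_fps\<close> and the power y^|k| to \<phi>, while the reciprocal of the Pochhammer
  symbol of c is Gamma(c) / Gamma(c + |k|).\<close>

lemma gseries_Phi2:
  assumes A: "\<And>h. h \<in> {1..q} \<Longrightarrow> 0 < A h" and c: "0 < c" and y: "0 < y"
  shows "gseries (\<Prod>h=1..q. binom_fps (\<rho> h) (A h)) c y = y powr (c - 1) / Gamma c * Phi2 q A c (\<lambda>h. - \<rho> h * y)"
proof -
  let ?U = "\<Prod>h=1..q. binom_fps (\<rho> h) (A h)"
  have gp: "Gamma c > 0" using c by (rule Gamma_real_pos)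
  have pg: "1 / pochhammer c N = Gamma c * (1 / Gamma (c + real N))" for N
  proof -
    have "c \<notin> \<int>\<^sub>\<le>\<^sub>0" using c by (auto elim!: nonpos_Ints_cases)
    thus ?thesis using pochhammer_Gamma[of c N] by simp
  qed
  define \<phi> where "\<phi> = (\<lambda>N. 1 / Gamma (c + real N) * y ^ N)"
  have \<phi>: "superexp_small \<phi>" unfolding \<phi>_def by (intro superexp_small_power superexp_small_inverse_Gamma c)
  have "Phi2 q A c (\<lambda>h. - \<rho> h * y) = (\<Sum>\<^sub>\<infinity>k\<in>PiE {1..q} (\<lambda>_. UNIV). Gamma c * ((\<Prod>h=1..q. binom_fps (\<rho> h) (A h) $ k h) * \<phi> (\<Sum>h=1..q. k h)))"
    unfolding Phi2_def
  proof (rule infsum_cong)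
    fix k :: "nat \<Rightarrow> nat"
    have "(\<Prod>h=1..q. pochhammer (A h) (k h)) * (\<Prod>h=1..q. (- \<rho> h * y) ^ k h / fact (k h)) =
       (\<Prod>h=1..q. binom_fps (\<rho> h) (A h) $ k h * y ^ k h)"
      unfolding prod.distrib[symmetric] power_mult_distrib by (intro prod.cong refl) (simp add: binom_fps_def)
    also have "\<dots> = (\<Prod>h=1..q. binom_fps (\<rho> h) (A h) $ k h) * y ^ (\<Sum>h=1..q. k h)"
      by (simp add: prod.distrib power_sum)
    finally have e: "(\<Prod>h=1..q. pochhammer (A h) (k h)) * (\<Prod>h=1..q. (- \<rho> h * y) ^ k h / fact (k h)) = \<dots>" .
    have "(\<Prod>h=1..q. pochhammer (A h) (k h)) / pochhammer c (msize q k) * (\<Prod>h=1..q. (- \<rho> h * y) ^ k h / fact (k h)) =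
      1 / pochhammer c (msize q k) * ((\<Prod>h=1..q. pochhammer (A h) (k h)) * (\<Prod>h=1..q. (- \<rho> h * y) ^ k h / fact (k h)))"
      by (simp add: mult_ac)
    also have "\<dots> = Gamma c * ((\<Prod>h=1..q. binom_fps (\<rho> h) (A h) $ k h) * \<phi> (\<Sum>h=1..q. k h))"
      unfolding e pg by (simp add: \<phi>_def msize_def mult_ac)
    finally show "(\<Prod>h=1..q. pochhammer (A h) (k h)) / pochhammer c (msize q k) * (\<Prod>h=1..q. (- \<rho> h * y) ^ k h / fact (k h)) = \<dots>" .
  qed
  also have "\<dots> = Gamma c * infsum (\<lambda>N. ?U $ N * \<phi> N) UNIV"
    by (subst infsum_cmult_right', subst infsum_PiE_series) (auto intro!: geom_bounded_binom_fps A \<phi>)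
  also have "infsum (\<lambda>N. ?U $ N * \<phi> N) UNIV = (\<Sum>N. ?U $ N * \<phi> N)"
  proof (rule infsumI, rule norm_summable_imp_has_sum)
    have gU: "geom_bounded (fps_nth ?U)" by (intro geom_bounded_prod geom_bounded_binom_fps A)
    show "summable (\<lambda>N. norm (?U $ N * \<phi> N))" using summable_geom_superexp[OF gU \<phi>] by simp
    hence "summable (\<lambda>N. ?U $ N * \<phi> N)" by (rule summable_norm_cancel)
    thus "(\<lambda>N. ?U $ N * \<phi> N) sums (\<Sum>N. ?U $ N * \<phi> N)" by (rule summable_sums)
  qed
  finally show ?thesis using y gp by (simp add: gseries_def \<phi>_def)
qed

text \<open>The factor X shifts the index by one, and Gamma(e + (N + 1)) is read as Gamma((e + 1) +
  N). On transforms this is multiplication by 1 + r/z.\<close>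

lemma gseries_shift:
  assumes u: "geom_bounded (fps_nth u)" and e: "0 < e"
  shows "gseries ((1 + fps_const r * fps_X) * u) e y = gseries u e y + r * gseries u (e + 1) y"
proof (cases "0 < y")
  case True
  have s1: "(\<lambda>N. u $ N * (1 / Gamma (e + real N) * y ^ N)) sums (\<Sum>N. u $ N * (1 / Gamma (e + real N) * y ^ N))"
    by (intro summable_sums summable_gseries' u e)
  have "(\<lambda>N. r * y * (u $ N * (1 / Gamma (e + 1 + real N) * y ^ N))) sums (r * y * (\<Sum>N. u $ N * (1 / Gamma (e + 1 + real N) * y ^ N)))"
    using e by (intro sums_mult summable_sums summable_gseries' u) auto
  moreover have "(fps_const r * (fps_X * u)) $ Suc N * (1 / Gamma (e + real (Suc N)) * y ^ Suc N) =
     r * y * (u $ N * (1 / Gamma (e + 1 + real N) * y ^ N))" for N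
  proof -
    have "e + real (Suc N) = e + 1 + real N" by simp
    moreover have "(fps_const r * (fps_X * u)) $ Suc N = r * u $ N" by simp
    ultimately show ?thesis by (simp only: power_Suc mult_ac)
  qed
  ultimately have "(\<lambda>N. (fps_const r * (fps_X * u)) $ Suc N * (1 / Gamma (e + real (Suc N)) * y ^ Suc N)) sums (r * y * (\<Sum>N. u $ N * (1 / Gamma (e + 1 + real N) * y ^ N)))"
    by (simp only:)
  hence s2: "(\<lambda>N. (fps_const r * (fps_X * u)) $ N * (1 / Gamma (e + real N) * y ^ N)) sums (r * y * (\<Sum>N. u $ N * (1 / Gamma (e + 1 + real N) * y ^ N)))"
    by (rule sums_Suc_imp[rotated]) simp
  have "(\<Sum>N. ((1 + fps_const r * fps_X) * u) $ N * (1 / Gamma (e + real N) * y ^ N)) =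
    (\<Sum>N. u $ N * (1 / Gamma (e + real N) * y ^ N)) + r * y * (\<Sum>N. u $ N * (1 / Gamma (e + 1 + real N) * y ^ N))"
  proof -
    have "(1 + fps_const r * fps_X) * u = u + fps_const r * (fps_X * u)"
      by (simp only: distrib_right mult_1_left mult.assoc)
    thus ?thesis using sums_unique[OF sums_add[OF s1 s2], symmetric] by (simp only: fps_add_nth distrib_right)
  qed
  moreover have "y powr (e + 1 - 1) = y powr (e - 1) * y"
    using True by (simp add: powr_diff)
  ultimately show ?thesis using True by (simp add: gseries_def distrib_left mult_ac)
qed (simp add: gseries_def)

section \<open>The limit function of part (B)\<close>

locale gamma_system =
  fixes q :: nat and d \<rho> :: "nat \<Rightarrow> real"
  assumes q: "1 \<le> q" and d: "\<And>h. h \<in> {1..q} \<Longrightarrow> 0 < d h"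
begin

text \<open>The largest of the abscissas -\<rho>_h: Re z > \<open>edge\<close> says that z lies
  strictly to the right of all branch points.\<close>

definition edge :: real where "edge = Max ((\<lambda>h. - \<rho> h) ` {1..q})"

lemma edge_ge: "h \<in> {1..q} \<Longrightarrow> - \<rho> h \<le> edge"
  unfolding edge_def by (intro Max_ge) auto

lemma edge_less_iff: "edge < x \<longleftrightarrow> (\<forall>h\<in>{1..q}. - \<rho> h < x)"
  using q by (auto simp: edge_def)

lemma edge_Re_pos: "edge < Re z \<Longrightarrow> h \<in> {1..q} \<Longrightarrow> 0 < Re (z + of_real (\<rho> h))"
  using edge_ge[of h] by simp

lemma edge_not_nonpos: "edge < Re z \<Longrightarrow> h \<in> {1..q} \<Longrightarrow> z + of_real (\<rho> h) \<notin> \<real>\<^sub>\<le>\<^sub>0"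
  using edge_Re_pos[of z h] by (auto simp: complex_nonpos_Reals_iff)

text \<open>Formally \<open>P m z\<close> is z^(-cc m) times the series \<open>U m\<close> in 1/z.
  Here \<open>cc m\<close> is the constant C of the theorem, and \<open>P m\<close> will be the
  transform of \<open>conv_S q d \<rho> m\<close>.\<close>

definition U :: "(nat \<Rightarrow> nat) \<Rightarrow> real fps" where
  "U m = (\<Prod>h=1..q. binom_fps (\<rho> h) (d h + real (m h)))"

definition cc :: "(nat \<Rightarrow> nat) \<Rightarrow> real" where
  "cc m = (\<Sum>h=1..q. d h) + real (msize q m)"

definition P :: "(nat \<Rightarrow> nat) \<Rightarrow> complex \<Rightarrow> complex" where
  "P m z = (\<Prod>h=1..q. (z + of_real (\<rho> h)) powr (- of_real (d h + real (m h))))"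

lemma sum_d_pos: "0 < (\<Sum>h=1..q. d h)"
  using q d by (intro sum_pos) auto

lemma geom_bounded_U: "geom_bounded (fps_nth (U m))"
  unfolding U_def using d by (intro geom_bounded_prod geom_bounded_binom_fps) (auto intro: add_pos_nonneg)

lemma conv_S_eq: "conv_S q d \<rho> m = gseries (U m) (cc m)"
proof -
  have "0 < d h + real (m h)" if "h \<in> {1..q}" for h using d[OF that] by simp
  from iter_conv_gamma_gseries[OF q this] show ?thesis
    by (simp add: conv_S_def U_def cc_def msize_def sum.distrib)
qed

lemma laplace_on_gamma: "h \<in> {1..q} \<Longrightarrow> 0 < a \<Longrightarrow> laplace_on edge (gamma_kernel (\<rho> h) a)"
  by (rule laplace_on_mono[OF laplace_on_gamma_kernel edge_ge])

lemma lap_conv_gamma: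
  assumes A: "\<And>h. h \<in> {1..q} \<Longrightarrow> 0 < A h"
  shows "laplace_on edge (iter_conv q (\<lambda>h. gamma_kernel (\<rho> h) (A h)))"
    and "edge < Re z \<Longrightarrow> lap (iter_conv q (\<lambda>h. gamma_kernel (\<rho> h) (A h))) z = (\<Prod>h=1..q. (z + of_real (\<rho> h)) powr (- of_real (A h)))"
proof -
  show "laplace_on edge (iter_conv q (\<lambda>h. gamma_kernel (\<rho> h) (A h)))"
    by (intro laplace_on_iter_conv q laplace_on_gamma A)
  assume z: "edge < Re z"
  have "lap (iter_conv q (\<lambda>h. gamma_kernel (\<rho> h) (A h))) z = (\<Prod>h=1..q. lap (gamma_kernel (\<rho> h) (A h)) z)"
    by (intro lap_iter_conv[OF q _ z] laplace_on_gamma A)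
  also have "\<dots> = (\<Prod>h=1..q. (z + of_real (\<rho> h)) powr (- of_real (A h)))"
    using z by (intro prod.cong refl lap_gamma_kernel A) (auto simp: edge_less_iff)
  finally show "lap (iter_conv q (\<lambda>h. gamma_kernel (\<rho> h) (A h))) z = \<dots>" .
qed

section \<open>Lowering one exponent\<close>

text \<open>Raising the power -(d_h + m_h) by 1 is multiplication by z + \<rho>_h.
  \<open>U_lower\<close> and \<open>T_lower\<close> are the counterparts for the series and for the
  Jacobi quotients.\<close>

lemma P_lower:
  assumes h: "h \<in> {1..q}" "0 < m h" and z: "edge < Re z"
  shows "P (m(h := m h - 1)) z = (z + of_real (\<rho> h)) * P m z"
proof -
  have nz: "z + of_real (\<rho> h) \<noteq> 0"
    using edge_Re_pos[OF z h(1)] by (metis less_irrefl zero_complex.simps(1))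
  have e: "(z + of_real (\<rho> h)) powr (- of_real (d h + real (m h - 1))) = (z + of_real (\<rho> h)) * (z + of_real (\<rho> h)) powr (- of_real (d h + real (m h)))"
  proof -
    have "(- of_real (d h + real (m h - 1)) :: complex) = 1 + (- of_real (d h + real (m h)))"
      using h by (simp add: of_nat_diff)
    hence "(z + of_real (\<rho> h)) powr (- of_real (d h + real (m h - 1))) =
      (z + of_real (\<rho> h)) powr 1 * (z + of_real (\<rho> h)) powr (- of_real (d h + real (m h)))"
      by (simp only: powr_add)
    thus ?thesis using nz by (simp only: powr_to_1)
  qed
  have "P (m(h := m h - 1)) z = (z + of_real (\<rho> h)) powr (- of_real (d h + real (m h - 1))) * (\<Prod>k\<in>{1..q} - {h}. (z + of_real (\<rho> k)) powr (- of_real (d k + real (m k))))"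
    unfolding P_def using h by (subst prod.remove[of _ h]) (auto intro!: arg_cong2[where f = "(*)"] prod.cong)
  also have "\<dots> = (z + of_real (\<rho> h)) * P m z"
    unfolding P_def e using h by (subst (2) prod.remove[of _ h]) (auto simp: mult.assoc)
  finally show ?thesis .
qed

lemma msize_lower:
  assumes h: "h \<in> {1..q}" "0 < m h" shows "msize q m = Suc (msize q (m(h := m h - 1)))"
proof -
  have "msize q (m(h := m h - 1)) = (m h - 1) + (\<Sum>k\<in>{1..q} - {h}. m k)"
    unfolding msize_def using h by (subst sum.remove[of _ h]) (auto intro!: sum.cong)
  moreover have "msize q m = m h + (\<Sum>k\<in>{1..q} - {h}. m k)"
    unfolding msize_def using h by (subst sum.remove[of _ h]) auto
  ultimately show ?thesis using h by simp
qed

lemma U_lower: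
  assumes h: "h \<in> {1..q}" "0 < m h"
  shows "U (m(h := m h - 1)) = (1 + fps_const (\<rho> h) * fps_X) * U m"
proof -
  have e: "d h + real (m h - 1) = d h + real (m h) - 1" using h by (simp add: of_nat_diff)
  have "U (m(h := m h - 1)) = binom_fps (\<rho> h) (d h + real (m h - 1)) * (\<Prod>k\<in>{1..q} - {h}. binom_fps (\<rho> k) (d k + real (m k)))"
    unfolding U_def using h by (subst prod.remove[of _ h]) (auto intro!: arg_cong2[where f = "(*)"] prod.cong)
  also have "\<dots> = (1 + fps_const (\<rho> h) * fps_X) * (binom_fps (\<rho> h) (d h + real (m h)) * (\<Prod>k\<in>{1..q} - {h}. binom_fps (\<rho> k) (d k + real (m k))))"
    unfolding e binom_fps_shift[symmetric] by (simp only: mult.assoc)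
  also have "binom_fps (\<rho> h) (d h + real (m h)) * (\<Prod>k\<in>{1..q} - {h}. binom_fps (\<rho> k) (d k + real (m k))) = U m"
    unfolding U_def using h by (subst (2) prod.remove[of _ h]) auto
  finally show ?thesis .
qed

text \<open>Lowering one exponent \<open>m h\<close> turns the derivative of a series into a series of the same kind,
  so that the transform of a derivative needs no boundary terms.\<close>

lemma lap_gseries_U:
  assumes "j < msize q m"
  shows "laplace_on edge (gseries (U m) (cc m - real j)) \<and>
     (\<forall>z. edge < Re z \<longrightarrow> lap (gseries (U m) (cc m - real j)) z = z ^ j * P m z)"
  using assms
proof (induction j arbitrary: m)
  case 0
  have A: "0 < d h + real (m h)" if "h \<in> {1..q}" for h using d[OF that] by simp
  have S: "gseries (U m) (cc m - real 0) = iter_conv q (\<lambda>h. gamma_kernel (\<rho> h) (d h + real (m h)))"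
    using conv_S_eq[of m] by (simp add: conv_S_def)
  show ?case unfolding S P_def using lap_conv_gamma[OF A] by simp
next
  case (Suc j)
  have "\<exists>h\<in>{1..q}. 0 < m h"
  proof (rule ccontr)
    assume "\<not> ?thesis" hence "msize q m = 0" by (auto simp: msize_def)
    thus False using Suc by simp
  qed
  then obtain h where h: "h \<in> {1..q}" "0 < m h" by blast
  define m' where "m' = m(h := m h - 1)"
  have ms: "msize q m = Suc (msize q m')" unfolding m'_def by (rule msize_lower[of h m, OF h])
  have c': "cc m' = cc m - 1" by (simp add: cc_def ms)
  define e where "e = cc m - real (Suc j)"
  have e: "0 < e" using sum_d_pos Suc.prems by (simp add: e_def cc_def)
  \<comment> \<open>On transforms this reads z = (z + \<rho>_h) - \<rho>_h, where the first summand
    passes to \<open>m'\<close>.\<close>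
  have eq: "gseries (U m) e = (\<lambda>y. gseries (U m') (cc m' - real j) y - \<rho> h * gseries (U m) (cc m - real j) y)"
  proof
    fix y
    have "gseries (U m') e y = gseries (U m) e y + \<rho> h * gseries (U m) (e + 1) y"
      unfolding m'_def U_lower[of h m, OF h] by (rule gseries_shift[OF geom_bounded_U e])
    moreover have "cc m' - real j = e" "e + 1 = cc m - real j" by (simp_all add: e_def c')
    ultimately show "gseries (U m) e y = gseries (U m') (cc m' - real j) y - \<rho> h * gseries (U m) (cc m - real j) y" by simp
  qed
  have 1: "laplace_on edge (gseries (U m') (cc m' - real j))" "edge < Re z \<Longrightarrow> lap (gseries (U m') (cc m' - real j)) z = z ^ j * P m' z" for z
    using Suc.IH[of m'] Suc.prems ms by auto
  have 2: "laplace_on edge (gseries (U m) (cc m - real j))" "edge < Re z \<Longrightarrow> lap (gseries (U m) (cc m - real j)) z = z ^ j * P m z" for z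
    using Suc.IH[of m] Suc.prems by auto
  have 3: "laplace_on edge (\<lambda>y. (- \<rho> h) * gseries (U m) (cc m - real j) y)" by (rule laplace_on_cmult[OF 2(1)])
  have eq': "gseries (U m) e = (\<lambda>y. gseries (U m') (cc m' - real j) y + (- \<rho> h) * gseries (U m) (cc m - real j) y)"
    unfolding eq by simp
  have "laplace_on edge (gseries (U m) e)" unfolding eq' by (rule laplace_on_add[OF 1(1) 3])
  moreover have "lap (gseries (U m) e) z = z ^ Suc j * P m z" if z: "edge < Re z" for z
  proof -
    have "lap (gseries (U m) e) z = z ^ j * P m' z + of_real (- \<rho> h) * (z ^ j * P m z)"
      unfolding eq' lap_add[OF 1(1) 3 z] lap_cmult 1(2)[OF z] 2(2)[OF z] ..
    also have "P m' z = (z + of_real (\<rho> h)) * P m z" unfolding m'_def by (rule P_lower[of h m z, OF h z])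
    finally show ?thesis by (simp add: algebra_simps)
  qed
  ultimately show ?case by (simp add: e_def)
qed

text \<open>An order j < |m| leaves an exponent of at least D + 1, and D > 0; this is what termwise
  differentiation asks for.\<close>

lemma cc_gt_1: "j < msize q m \<Longrightarrow> 1 < cc m - real j"
  using sum_d_pos by (simp add: cc_def)

lemma gseries_U_deriv:
  assumes "j < msize q m" "0 < y"
  shows "(gseries (U m) (cc m - real j) has_field_derivative gseries (U m) (cc m - real (Suc j)) y) (at y)"
  using gseries_has_field_derivative[OF geom_bounded_U cc_gt_1[OF assms(1)] assms(2)] by (simp add: algebra_simps)

lemma funpow_deriv_conv_S:
  assumes "k < msize q m" "0 < y"
  shows "(deriv ^^ k) (conv_S q d \<rho> m) y = gseries (U m) (cc m - real k) y"
  using assms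
proof (induction k arbitrary: y)
  case (Suc k)
  have "\<forall>\<^sub>F x in nhds y. (deriv ^^ k) (conv_S q d \<rho> m) x = gseries (U m) (cc m - real k) x"
    using eventually_nhds_in_open[of "{0<..}" y] Suc by (auto elim!: eventually_mono)
  hence "(deriv ^^ Suc k) (conv_S q d \<rho> m) y = deriv (gseries (U m) (cc m - real k)) y"
    unfolding funpow.simps o_apply by (intro deriv_cong_ev refl)
  also have "\<dots> = gseries (U m) (cc m - real (Suc k)) y"
    using Suc by (intro DERIV_imp_deriv gseries_U_deriv) auto
  finally show ?case .
qed (simp add: conv_S_eq)

lemma funpow_deriv_conv_S_differentiable:
  assumes "k < msize q m" "0 < y"
  shows "(deriv ^^ k) (conv_S q d \<rho> m) field_differentiable at y"
proof -
  have "\<forall>\<^sub>F x in nhds y. (deriv ^^ k) (conv_S q d \<rho> m) x = gseries (U m) (cc m - real k) x"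
    using eventually_nhds_in_open[of "{0<..}" y] assms by (auto elim!: eventually_mono simp: funpow_deriv_conv_S)
  hence "((deriv ^^ k) (conv_S q d \<rho> m) has_field_derivative gseries (U m) (cc m - real (Suc k)) y) (at y)"
    using gseries_U_deriv[OF assms] by (subst DERIV_cong_ev[OF refl _ refl]) auto
  thus ?thesis by (auto simp: field_differentiable_def)
qed

section \<open>Operators with constant coefficients acting on S_m\<close>

text \<open>This is \<Psi>(d/dy) applied to S_m, because the j-th derivative of S_m is the series
  with exponent \<open>cc m - real j\<close>. Only the orders below |m| are kept, where this
  description of the derivative is available.\<close>

definition series_poly :: "(nat \<Rightarrow> nat) \<Rightarrow> real poly \<Rightarrow> real \<Rightarrow> real" where
  "series_poly m \<Psi> y = (\<Sum>j<msize q m. coeff \<Psi> j * gseries (U m) (cc m - real j) y)"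

lemma series_poly_sum: "series_poly m (\<Sum>i\<in>I. f i) y = (\<Sum>i\<in>I. series_poly m (f i) y)"
  unfolding series_poly_def coeff_sum sum_distrib_right by (rule sum.swap)

lemma series_poly_monom: "j < msize q m \<Longrightarrow> series_poly m (monom c j) y = c * gseries (U m) (cc m - real j) y"
  unfolding series_poly_def
  by (subst sum.mono_neutral_right[of _ "{j}"]) auto

text \<open>The factor c - d/dy is multiplication of \<Psi> by c - X. Agreement of f with the series
  is required on the open set y > 0 only, which already determines the derivative there.\<close>

lemma diff_op_series_poly:
  assumes f: "\<And>y. 0 < y \<Longrightarrow> f y = series_poly m \<Psi> y" and deg: "degree \<Psi> + 1 < msize q m" and y: "0 < y"
  shows "diff_op c f y = series_poly m ([:c, -1:] * \<Psi>) y"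
proof -
  let ?G = "\<lambda>j. gseries (U m) (cc m - real j)"
  obtain K where K: "msize q m = Suc K" using deg by (cases "msize q m") auto
  have ev: "\<forall>\<^sub>F x in nhds y. f x = (\<Sum>j<msize q m. coeff \<Psi> j * ?G j x)"
    using eventually_nhds_in_open[of "{0<..}" y] y f by (auto elim!: eventually_mono simp: series_poly_def)
  have "((\<lambda>x. \<Sum>j<msize q m. coeff \<Psi> j * ?G j x) has_field_derivative (\<Sum>j<msize q m. coeff \<Psi> j * ?G (Suc j) y)) (at y)"
    by (intro DERIV_sum DERIV_cmult gseries_U_deriv y) auto
  hence "deriv f y = (\<Sum>j<msize q m. coeff \<Psi> j * ?G (Suc j) y)"
    using deriv_cong_ev[OF ev refl] by (simp only: DERIV_imp_deriv)
  \<comment> \<open>The degree bound makes the top coefficient vanish, so no derivative of order |m|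
    appears.\<close>
  also have "\<dots> = (\<Sum>j<K. coeff \<Psi> j * ?G (Suc j) y)"
    using deg K by (simp add: coeff_eq_0)
  also have "\<dots> = (\<Sum>j<msize q m. (case j of 0 \<Rightarrow> 0 | Suc i \<Rightarrow> coeff \<Psi> i) * ?G j y)"
    unfolding K sum.lessThan_Suc_shift by simp
  finally have D: "deriv f y = (\<Sum>j<msize q m. (case j of 0 \<Rightarrow> 0 | Suc i \<Rightarrow> coeff \<Psi> i) * ?G j y)" .
  have ce: "coeff ([:c, -1:] * \<Psi>) j = c * coeff \<Psi> j - (case j of 0 \<Rightarrow> 0 | Suc i \<Rightarrow> coeff \<Psi> i)" for j
    by (simp add: mult_pCons_left coeff_pCons split: nat.split)
  show ?thesis unfolding diff_op_def D f[OF y] series_poly_def ce left_diff_distrib sum_subtractf sum_distrib_left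
    by (simp only: mult.assoc)
qed

lemma degree_linear_times: "degree ([:c, -1:] * \<Psi> :: real poly) \<le> degree \<Psi> + 1"
  using degree_mult_le[of "[:c, -1:]" \<Psi>] by simp

lemma diff_op_power_series_poly:
  assumes "\<And>y. 0 < y \<Longrightarrow> f y = series_poly m \<Psi> y" and "degree \<Psi> + k < msize q m" and "0 < y"
  shows "(diff_op c ^^ k) f y = series_poly m ([:c, -1:] ^ k * \<Psi>) y \<and> degree ([:c, -1:] ^ k * \<Psi>) \<le> degree \<Psi> + k"
  using assms(2,3)
proof (induction k arbitrary: y)
  case (Suc k)
  have dg: "degree ([:c, -1:] ^ k * \<Psi>) \<le> degree \<Psi> + k" using Suc.IH[of 1] Suc.prems by simp
  have "diff_op c ((diff_op c ^^ k) f) y = series_poly m ([:c, -1:] * ([:c, -1:] ^ k * \<Psi>)) y"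
    by (rule diff_op_series_poly) (use Suc dg in auto)
  moreover have "degree ([:c, -1:] * ([:c, -1:] ^ k * \<Psi>)) \<le> degree \<Psi> + Suc k"
    using degree_linear_times[of c "[:c, -1:] ^ k * \<Psi>"] dg by linarith
  ultimately show ?case by (simp only: funpow.simps o_apply power_Suc mult.assoc simp_thms)
qed (use assms(1) in simp)

lemma fold_diff_op_series_poly:
  assumes "\<And>y. 0 < y \<Longrightarrow> f y = series_poly m \<Psi> y" and "degree \<Psi> + sum_list (map n xs) < msize q m" and "0 < y"
  shows "fold (\<lambda>i. diff_op (\<xi> i) ^^ n i) xs f y = series_poly m ((\<Prod>i\<leftarrow>xs. [:\<xi> i, -1:] ^ n i) * \<Psi>) y"
  using assms
proof (induction xs arbitrary: f \<Psi>)
  case (Cons x xs)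
  have 1: "(diff_op (\<xi> x) ^^ n x) f y = series_poly m ([:\<xi> x, -1:] ^ n x * \<Psi>) y \<and> degree ([:\<xi> x, -1:] ^ n x * \<Psi>) \<le> degree \<Psi> + n x"
    if "0 < y" for y
    by (rule diff_op_power_series_poly) (use Cons that in auto)
  have "fold (\<lambda>i. diff_op (\<xi> i) ^^ n i) xs ((diff_op (\<xi> x) ^^ n x) f) y = series_poly m ((\<Prod>i\<leftarrow>xs. [:\<xi> i, -1:] ^ n i) * ([:\<xi> x, -1:] ^ n x * \<Psi>)) y"
  proof (rule Cons.IH)
    show "degree ([:\<xi> x, -1:] ^ n x * \<Psi>) + sum_list (map n xs) < msize q m"
      using 1[OF zero_less_one] Cons.prems(2) by simp
  qed (use 1 Cons.prems in blast)+
  thus ?case by (simp only: fold_simps list.map prod_list.Cons mult_ac)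
qed simp

lemma prod_const_poly: "(\<Prod>i\<in>A. [:f i:]) = [:\<Prod>i\<in>A. f i :: real:]"
  by (induction A rule: infinite_finite_induct) (auto simp: one_pCons)

lemma msize_PiE_le: "l \<in> PiE {1..p} (\<lambda>i. {0..n i}) \<Longrightarrow> msize p l \<le> msize p n"
  unfolding msize_def by (intro sum_mono) (auto dest: PiE_mem)

text \<open>Stated over a commutative ring because it is used for the operator, where z is the
  indeterminate of real polynomials, and for the transform, where z is complex.\<close>

lemma prod_linear_expansion:
  fixes \<xi> :: "nat \<Rightarrow> 'a::comm_ring_1"
  shows "(\<Prod>i=1..p. (\<xi> i - z) ^ n i) =
    (\<Sum>l\<in>PiE {1..p} (\<lambda>i. {0..n i}). (-1) ^ msize p l * (\<Prod>i=1..p. of_nat (n i choose l i) * \<xi> i ^ (n i - l i)) * z ^ msize p l)"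
proof -
  have "(\<Prod>i=1..p. (\<xi> i - z) ^ n i) = (\<Prod>i=1..p. \<Sum>k\<in>{0..n i}. of_nat (n i choose k) * (- z) ^ k * \<xi> i ^ (n i - k))"
    using binomial_ring[of "- z" "\<xi> i" "n i" for i] by (simp add: atLeast0AtMost)
  also have "\<dots> = (\<Sum>l\<in>PiE {1..p} (\<lambda>i. {0..n i}). \<Prod>i=1..p. of_nat (n i choose l i) * (- z) ^ l i * \<xi> i ^ (n i - l i))"
    by (rule prod_sum_PiE) auto
  also have "\<dots> = (\<Sum>l\<in>PiE {1..p} (\<lambda>i. {0..n i}). (-1) ^ msize p l * (\<Prod>i=1..p. of_nat (n i choose l i) * \<xi> i ^ (n i - l i)) * z ^ msize p l)"
  proof (rule sum.cong[OF refl])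
    fix l :: "nat \<Rightarrow> nat"
    have "(\<Prod>i=1..p. of_nat (n i choose l i) * (- z) ^ l i * \<xi> i ^ (n i - l i)) = (\<Prod>i=1..p. (of_nat (n i choose l i) * \<xi> i ^ (n i - l i)) * (- z) ^ l i)"
      by (intro prod.cong refl) (simp only: mult_ac)
    also have "\<dots> = (\<Prod>i=1..p. of_nat (n i choose l i) * \<xi> i ^ (n i - l i)) * (- z) ^ msize p l"
      unfolding prod.distrib msize_def power_sum ..
    also have "(- z) ^ msize p l = (-1) ^ msize p l * z ^ msize p l" by (rule power_minus)
    finally show "(\<Prod>i=1..p. of_nat (n i choose l i) * (- z) ^ l i * \<xi> i ^ (n i - l i)) =
        (-1) ^ msize p l * (\<Prod>i=1..p. of_nat (n i choose l i) * \<xi> i ^ (n i - l i)) * z ^ msize p l"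
      by (simp only: mult_ac)
  qed
  finally show ?thesis .
qed

section \<open>The explicit limit function and its transform\<close>

text \<open>The expanded operator with the derivatives of S_m written as series. The operator
  formula, the Lauricella formula and the transform are all compared with this form.\<close>

definition Bfun :: "nat \<Rightarrow> (nat \<Rightarrow> real) \<Rightarrow> (nat \<Rightarrow> nat) \<Rightarrow> (nat \<Rightarrow> nat) \<Rightarrow> real \<Rightarrow> real" where
  "Bfun p \<xi> n m y = - (\<Sum>l\<in>PiE {1..p} (\<lambda>i. {0..n i}).
     (-1) ^ msize p l * (\<Prod>i=1..p. real (n i choose l i) * \<xi> i ^ (n i - l i)) * gseries (U m) (cc m - real (msize p l)) y)"

lemma Bfun_Phi2:
  assumes bal: "msize q m = msize p n + 1" and y: "0 < y"
  shows "Bfun p \<xi> n m y = - (\<Sum>l\<in>PiE {1..p} (\<lambda>i. {0..n i}).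
     (-1) ^ msize p l * (\<Prod>i=1..p. real (n i choose l i) * \<xi> i ^ (n i - l i))
     * (y powr (cc m - real (msize p l) - 1) / Gamma (cc m - real (msize p l)))
     * Phi2 q (\<lambda>h. d h + real (m h)) (cc m - real (msize p l)) (\<lambda>h. - \<rho> h * y))"
proof -
  have "gseries (U m) (cc m - real (msize p l)) y = y powr (cc m - real (msize p l) - 1) / Gamma (cc m - real (msize p l)) *
      Phi2 q (\<lambda>h. d h + real (m h)) (cc m - real (msize p l)) (\<lambda>h. - \<rho> h * y)"
    if "l \<in> PiE {1..p} (\<lambda>i. {0..n i})" for l
    unfolding U_def using msize_PiE_le[OF that] cc_gt_1[of "msize p l" m] bal y d
    by (intro gseries_Phi2) (auto intro: add_pos_nonneg)
  thus ?thesis unfolding Bfun_def by (simp add: mult.assoc)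
qed

text \<open>The composed operators form one polynomial in d/dy, which is expanded in the polynomial
  ring; its degree |n| is below |m|.\<close>

lemma Bfun_diff_ops:
  assumes bal: "msize q m = msize p n + 1" and y: "0 < y"
  shows "Bfun p \<xi> n m y = - diff_ops p \<xi> n (conv_S q d \<rho> m) y"
proof -
  have "conv_S q d \<rho> m y = series_poly m 1 y" for y
    using series_poly_monom[of 0 m 1 y] bal by (simp add: conv_S_eq monom_0 one_pCons)
  hence "diff_ops p \<xi> n (conv_S q d \<rho> m) y = series_poly m ((\<Prod>i\<leftarrow>[1..<Suc p]. [:\<xi> i, -1:] ^ n i) * 1) y"
    unfolding diff_ops_def
    by (rule fold_diff_op_series_poly)
       (use bal y in \<open>auto simp: msize_def interv_sum_list_conv_sum_set_nat atLeastLessThanSuc_atLeastAtMost simp del: upt_Suc\<close>)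
  also have "(\<Prod>i\<leftarrow>[1..<Suc p]. [:\<xi> i, -1:] ^ n i) * 1 = (\<Prod>i=1..p. ([:\<xi> i:] - monom 1 1) ^ n i)"
  proof -
    have "[:\<xi> i, -1:] = [:\<xi> i:] - monom 1 1" for i by (simp add: monom_altdef)
    thus ?thesis by (simp add: prod.distinct_set_conv_list[symmetric] atLeastLessThanSuc_atLeastAtMost del: upt_Suc)
  qed
  also have "\<dots> = (\<Sum>l\<in>PiE {1..p} (\<lambda>i. {0..n i}). monom ((-1) ^ msize p l * (\<Prod>i=1..p. real (n i choose l i) * \<xi> i ^ (n i - l i))) (msize p l))"
    unfolding prod_linear_expansion
  proof (rule sum.cong[OF refl])
    fix l :: "nat \<Rightarrow> nat"
    have c: "(\<Prod>i=1..p. of_nat (n i choose l i) * [:\<xi> i:] ^ (n i - l i)) = [:\<Prod>i=1..p. real (n i choose l i) * \<xi> i ^ (n i - l i):]"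
      unfolding prod_const_poly[symmetric] by (intro prod.cong refl) (simp add: of_nat_poly poly_const_pow)
    have m1: "((-1) ^ msize p l :: real poly) = [:(-1) ^ msize p l:]"
    proof -
      have "(-1 :: real poly) = [:-1:]" by (simp add: one_pCons)
      thus ?thesis by (simp only: poly_const_pow)
    qed
    show "(-1) ^ msize p l * (\<Prod>i=1..p. of_nat (n i choose l i) * [:\<xi> i:] ^ (n i - l i)) * monom 1 1 ^ msize p l =
       monom ((-1) ^ msize p l * (\<Prod>i=1..p. real (n i choose l i) * \<xi> i ^ (n i - l i))) (msize p l)"
      unfolding c m1 by (simp add: monom_power smult_monom)
  qed
  also have "series_poly m \<dots> y = - Bfun p \<xi> n m y"
    unfolding series_poly_sum Bfun_def minus_minus
  proof (rule sum.cong[OF refl], rule series_poly_monom)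
    fix l assume "l \<in> PiE {1..p} (\<lambda>i. {0..n i})"
    from msize_PiE_le[OF this] show "msize p l < msize q m" using bal by simp
  qed
  finally show ?thesis by simp
qed

text \<open>The summand of index l is transformed to a multiple of z^|l| P m z, and the expansion of
  the product is then read backwards.\<close>

lemma laplace_on_Bfun:
  assumes bal: "msize q m = msize p n + 1"
  shows "laplace_on edge (Bfun p \<xi> n m)"
    and "edge < Re z \<Longrightarrow> lap (Bfun p \<xi> n m) z = - ((\<Prod>i=1..p. (of_real (\<xi> i) - z) ^ n i) * P m z)"
proof -
  let ?c = "\<lambda>l. (-1) ^ msize p l * (\<Prod>i=1..p. real (n i choose l i) * \<xi> i ^ (n i - l i))"
  have lt: "msize p l < msize q m" if "l \<in> PiE {1..p} (\<lambda>i. {0..n i})" for l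
    using msize_PiE_le[OF that] bal by simp
  have B: "Bfun p \<xi> n m = (\<lambda>y. (-1) * (\<Sum>l\<in>PiE {1..p} (\<lambda>i. {0..n i}). ?c l * gseries (U m) (cc m - real (msize p l)) y))"
    by (simp add: Bfun_def fun_eq_iff)
  have on: "laplace_on edge (\<lambda>y. ?c l * gseries (U m) (cc m - real (msize p l)) y)" if "l \<in> PiE {1..p} (\<lambda>i. {0..n i})" for l
    using lap_gseries_U[OF lt[OF that]] by (intro laplace_on_cmult) auto
  show "laplace_on edge (Bfun p \<xi> n m)" unfolding B by (intro laplace_on_cmult laplace_on_sum on)
  assume z: "edge < Re z"
  have "lap (Bfun p \<xi> n m) z = - (\<Sum>l\<in>PiE {1..p} (\<lambda>i. {0..n i}). lap (\<lambda>y. ?c l * gseries (U m) (cc m - real (msize p l)) y) z)"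
  proof -
    have s: "lap (\<lambda>y. \<Sum>l\<in>PiE {1..p} (\<lambda>i. {0..n i}). ?c l * gseries (U m) (cc m - real (msize p l)) y) z =
      (\<Sum>l\<in>PiE {1..p} (\<lambda>i. {0..n i}). lap (\<lambda>y. ?c l * gseries (U m) (cc m - real (msize p l)) y) z)"
      by (rule lap_sum[OF on z])
    show ?thesis unfolding B lap_cmult[of "-1"] s by simp
  qed
  also have "(\<Sum>l\<in>PiE {1..p} (\<lambda>i. {0..n i}). lap (\<lambda>y. ?c l * gseries (U m) (cc m - real (msize p l)) y) z) =
     (\<Sum>l\<in>PiE {1..p} (\<lambda>i. {0..n i}). ((-1) ^ msize p l * (\<Prod>i=1..p. of_nat (n i choose l i) * of_real (\<xi> i) ^ (n i - l i)) * z ^ msize p l) * P m z)"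
  proof (rule sum.cong[OF refl])
    fix l assume l: "l \<in> PiE {1..p} (\<lambda>i. {0..n i})"
    have "lap (gseries (U m) (cc m - real (msize p l))) z = z ^ msize p l * P m z"
      using lap_gseries_U[OF lt[OF l]] z by auto
    thus "lap (\<lambda>y. ?c l * gseries (U m) (cc m - real (msize p l)) y) z =
       ((-1) ^ msize p l * (\<Prod>i=1..p. of_nat (n i choose l i) * of_real (\<xi> i) ^ (n i - l i)) * z ^ msize p l) * P m z"
      unfolding lap_cmult by simp
  qed
  also have "\<dots> = (\<Prod>i=1..p. (of_real (\<xi> i) - z) ^ n i) * P m z"
    unfolding prod_linear_expansion sum_distrib_right ..
  finally show "lap (Bfun p \<xi> n m) z = - ((\<Prod>i=1..p. (of_real (\<xi> i) - z) ^ n i) * P m z)" .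
qed

lemma continuous_on_Bfun:
  assumes bal: "msize q m = msize p n + 1" shows "continuous_on {0<..} (Bfun p \<xi> n m)"
  unfolding Bfun_def
proof (intro continuous_on_minus continuous_on_sum continuous_on_mult_left)
  fix l assume "l \<in> PiE {1..p} (\<lambda>i. {0..n i})"
  from msize_PiE_le[OF this] have lt: "msize p l < msize q m" using bal by simp
  show "continuous_on {0<..} (gseries (U m) (cc m - real (msize p l)))"
    using gseries_U_deriv[OF lt]
    by (intro continuous_at_imp_continuous_on ballI) (auto intro: DERIV_isCont)
qed

lemma P_eq: "(\<Prod>i=1..p. (of_real (\<xi> i) - z) ^ n i) * P m z = (\<Prod>i=1..p. (of_real (\<xi> i) - z) ^ n i) / (\<Prod>h=1..q. (z + of_real (\<rho> h)) powr of_real (d h + real (m h)))"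
  unfolding P_def powr_minus by (simp only: prod_inversef[unfolded o_def] divide_inverse)

text \<open>Extension by zero brings the definition into the form in which the results on
  \<open>laplace_on\<close> and \<open>lap\<close> apply.\<close>

lemma is_LII_B_iff:
  "is_LII_B p q d \<rho> \<xi> n m B \<longleftrightarrow> continuous_on {0<..} B \<and> laplace_on edge (\<lambda>y. indicator {0<..} y * B y) \<and>
    (\<forall>z. edge < Re z \<longrightarrow> lap (\<lambda>y. indicator {0<..} y * B y) z = - ((\<Prod>i=1..p. (of_real (\<xi> i) - z) ^ n i) * P m z))"
proof -
  let ?B = "\<lambda>y. indicator {0<..} y * B y"
  have int: "indicator {0<..} y *\<^sub>R (exp (- z * of_real y) * of_real (B y)) = exp (- z * of_real y) * complex_of_real (?B y)" for z y
    by (simp add: indicator_def)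
  have hl: "has_lebesgue_integral_on (\<lambda>y. exp (- z * of_real y) * of_real (B y)) v {0<..} \<longleftrightarrow>
     complex_integrable lborel (\<lambda>y. exp (- z * of_real y) * of_real (?B y)) \<and> lap ?B z = v" for z v
    unfolding has_lebesgue_integral_on_def set_integrable_def set_lebesgue_integral_def int lap_def ..
  have "laplace_on edge ?B \<longleftrightarrow> (\<forall>z. edge < Re z \<longrightarrow> complex_integrable lborel (\<lambda>y. exp (- z * of_real y) * of_real (?B y)))"
  proof safe
    fix z assume "laplace_on edge ?B" "edge < Re z"
    thus "complex_integrable lborel (\<lambda>y. exp (- z * of_real y) * of_real (?B y))" by (rule lap_integrable)
  next
    assume *: "\<forall>z. edge < Re z \<longrightarrow> complex_integrable lborel (\<lambda>y. exp (- z * of_real y) * of_real (?B y))"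
    show "laplace_on edge ?B" unfolding laplace_on_def
    proof (intro conjI allI impI)
      fix w assume "edge < w"
      hence "complex_integrable lborel (\<lambda>y. exp (- of_real w * of_real y) * of_real (?B y))"
        using *[rule_format, of "of_real w"] by simp
      also have "(\<lambda>y. exp (- of_real w * of_real y) * complex_of_real (?B y)) = (\<lambda>y. complex_of_real (exp (- w * y) * ?B y))"
        by (simp add: exp_of_real[symmetric])
      finally show "integrable lborel (\<lambda>y. exp (- w * y) * ?B y)" by (simp only: complex_of_real_integrable_eq)
    qed simp
  qed
  thus ?thesis unfolding is_LII_B_def hl P_eq edge_less_iff by blast
qed

lemma is_LII_B_Bfun:
  assumes bal: "msize q m = msize p n + 1" shows "is_LII_B p q d \<rho> \<xi> n m (Bfun p \<xi> n m)"
proof -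
  have "(\<lambda>y. indicator {0<..} y * Bfun p \<xi> n m y) = Bfun p \<xi> n m"
  proof
    fix y show "indicator {0<..} y * Bfun p \<xi> n m y = Bfun p \<xi> n m y"
      using laplace_on_nonpos[OF laplace_on_Bfun(1)[OF bal]] by (cases "0 < y") auto
  qed
  thus ?thesis unfolding is_LII_B_iff using laplace_on_Bfun[OF bal] continuous_on_Bfun[OF bal] by simp
qed

section \<open>Uniqueness and vanishing moments\<close>

text \<open>The set of positive y at which the functions differ is open and a null set, hence
  empty.\<close>

lemma continuous_on_AE_eq:
  fixes f g :: "real \<Rightarrow> real"
  assumes f: "continuous_on {0<..} f" and g: "continuous_on {0<..} g"
    and ae: "AE y in lborel. 0 < y \<longrightarrow> f y = g y" and y: "0 < y"
  shows "f y = g y"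
proof (rule ccontr)
  assume ne: "f y \<noteq> g y"
  define S where "S = {x\<in>{0<..}. f x - g x \<noteq> 0}"
  have "S = {0<..} \<inter> (\<lambda>x. f x - g x) -` (- {0})" by (auto simp: S_def)
  moreover have "open ({0<..} \<inter> (\<lambda>x. f x - g x) -` (- {0}))"
    by (intro continuous_open_preimage continuous_intros f g)
  ultimately have S: "open S" by simp
  have "AE x in lborel. x \<notin> S" using ae by eventually_elim (auto simp: S_def)
  hence "S \<in> null_sets lborel" using borel_open[OF S] by (subst AE_iff_null_sets) simp_all
  hence "negligible S" by (simp add: negligible_iff_null_sets null_sets_completionI)
  moreover have "y \<in> S" using ne y by (simp add: S_def)
  ultimately show False using open_not_negligible[OF S] by auto
qed

lemma is_LII_B_unique:
  assumes bal: "msize q m = msize p n + 1" and B: "is_LII_B p q d \<rho> \<xi> n m B" and y: "0 < y"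
  shows "B y = Bfun p \<xi> n m y"
proof (rule continuous_on_AE_eq[OF _ _ _ y])
  show "continuous_on {0<..} B" using B by (simp add: is_LII_B_iff)
  show "continuous_on {0<..} (Bfun p \<xi> n m)" by (rule continuous_on_Bfun[OF bal])
  have "AE y in lborel. indicator {0<..} y * B y = Bfun p \<xi> n m y"
    by (rule laplace_unique[of edge]) (use B laplace_on_Bfun[OF bal] in \<open>auto simp: is_LII_B_iff\<close>)
  thus "AE y in lborel. 0 < y \<longrightarrow> B y = Bfun p \<xi> n m y" by eventually_elim auto
qed

lemma P_holomorphic: "P m holomorphic_on {z. edge < Re z}"
  unfolding P_def
  by (intro holomorphic_intros edge_not_nonpos) auto

text \<open>Every term of the Leibniz sum contains a derivative of (w - z)^N of order at most k < N,
  taken at the zero.\<close>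

lemma higher_deriv_zero_order:
  assumes g: "g holomorphic_on S" and S: "open S" "z \<in> S" and k: "k < N"
  shows "(deriv ^^ k) (\<lambda>w. (w - z) ^ N * g w) z = 0"
proof -
  have "(deriv ^^ k) (\<lambda>w. (w - z) ^ N * g w) z =
     (\<Sum>i = 0..k. of_nat (k choose i) * (deriv ^^ i) (\<lambda>w. (w - z) ^ N) z * (deriv ^^ (k - i)) g z)"
    by (rule higher_deriv_mult[OF _ g S]) (auto intro!: holomorphic_intros)
  also have "\<dots> = 0"
    using k by (intro sum.neutral ballI) (simp add: higher_deriv_power)
  finally show ?thesis .
qed

text \<open>Up to sign the moment is the k-th derivative of the transform at \<xi>_i, where the
  transform has a zero of order at least n_i > k.\<close>

lemma LII_B_moments:
  assumes bal: "msize q m = msize p n + 1" and B: "is_LII_B p q d \<rho> \<xi> n m B"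
    and i: "i \<in> {1..p}" "k < n i" and \<xi>: "\<And>h. h \<in> {1..q} \<Longrightarrow> 0 < \<xi> i + \<rho> h"
  shows "has_lebesgue_integral_on (\<lambda>y. y ^ k * exp (- \<xi> i * y) * B y) 0 {0<..}"
proof -
  let ?B = "\<lambda>y. indicator {0<..} y * B y"
  have B': "laplace_on edge ?B" "\<And>z. edge < Re z \<Longrightarrow> lap ?B z = - ((\<Prod>i=1..p. (of_real (\<xi> i) - z) ^ n i) * P m z)"
    using B by (simp_all add: is_LII_B_iff)
  have e: "edge < \<xi> i" using \<xi> by (force simp: edge_less_iff)
  have on: "laplace_on edge (\<lambda>y. y ^ k * ?B y)" by (rule laplace_on_times_power[OF B'(1)])
  have int: "indicator {0<..} y *\<^sub>R (y ^ k * exp (- \<xi> i * y) * B y) = exp (- \<xi> i * y) * (y ^ k * ?B y)" for y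
    by (simp add: indicator_def)
  define g where "g = (\<lambda>z. (-1) ^ Suc (n i) * ((\<Prod>j\<in>{1..p} - {i}. (of_real (\<xi> j) - z) ^ n j) * P m z))"
  have g: "g holomorphic_on {z. edge < Re z}" unfolding g_def by (intro holomorphic_intros P_holomorphic)
  have op: "open {z. edge < Re z}" by (simp add: open_halfspace_Re_gt)
  have fac: "lap ?B z = (z - of_real (\<xi> i)) ^ n i * g z" if "edge < Re z" for z
  proof -
    have "(of_real (\<xi> i) - z) ^ n i = (-1) ^ n i * (z - of_real (\<xi> i)) ^ n i"
      using power_minus[of "z - of_real (\<xi> i)" "n i"] by simp
    thus ?thesis unfolding B'(2)[OF that] g_def using i
      by (subst prod.remove[of _ i]) (auto simp: mult_ac)
  qed
  have "(deriv ^^ k) (lap ?B) (of_real (\<xi> i)) = (deriv ^^ k) (\<lambda>z. (z - of_real (\<xi> i)) ^ n i * g z) (of_real (\<xi> i))"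
    by (rule higher_deriv_transform_within_open[OF lap_holomorphic[OF B'(1)] _ op])
       (use e in \<open>auto intro!: holomorphic_intros g fac\<close>)
  also have "\<dots> = 0" by (rule higher_deriv_zero_order[OF g op]) (use e i in auto)
  finally have "(-1) ^ k * lap (\<lambda>y. y ^ k * ?B y) (of_real (\<xi> i)) = 0"
    using lap_higher_deriv[OF B'(1), of "of_real (\<xi> i)" k] e by simp
  hence "(LINT y|lborel. exp (- \<xi> i * y) * (y ^ k * ?B y)) = 0"
    unfolding lap_of_real by simp
  thus ?thesis
    unfolding has_lebesgue_integral_on_def set_integrable_def set_lebesgue_integral_def int
    using laplace_on_integrable[OF on e] by simp
qed

end

section \<open>Contour systems and residues\<close>

text \<open>Different components are disjoint together with their interiors, so a point inside one
  of them lies on none.\<close>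

lemma contour_system_trace_disjoint:
  assumes G: "contour_system G" and z: "z \<in> enclosed_by G" shows "z \<notin> trace_of G"
proof
  assume "z \<in> trace_of G"
  then obtain \<gamma>' where g': "\<gamma>' \<in> G" "z \<in> path_image \<gamma>'" by (auto simp: trace_of_def)
  obtain \<gamma> where g: "\<gamma> \<in> G" "z \<in> inside (path_image \<gamma>)" using z by (auto simp: enclosed_by_def)
  show False
  proof (cases "\<gamma> = \<gamma>'")
    case True thus False using g g' inside_no_overlap by blast
  next
    case False
    hence "disjnt (path_image \<gamma> \<union> inside (path_image \<gamma>)) (path_image \<gamma>' \<union> inside (path_image \<gamma>'))"
      using G g g' by (auto simp: contour_system_def pairwise_def)
    thus False using g g' by (auto simp: disjnt_def)
  qed
qed

text \<open>Convexity of S makes the winding numbers about points outside S vanish. The components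
  are mutually exterior, so a point of \<open>pts\<close> is inside at most one of them and every
  enclosed point is counted exactly once.\<close>

lemma system_integral_residues:
  assumes G: "contour_system G" and S: "open S" "convex S" and pts: "finite pts"
    and f: "f holomorphic_on S - pts" and tr: "trace_of G \<subseteq> S - pts"
  shows "system_integral G f = 2 * of_real pi * \<i> * (\<Sum>x\<in>pts \<inter> enclosed_by G. residue f x)"
proof -
  have fin: "finite G" using G by (simp add: contour_system_def)
  have one: "contour_integral \<gamma> f = 2 * of_real pi * \<i> * (\<Sum>x\<in>pts. if x \<in> inside (path_image \<gamma>) then residue f x else 0)"
    if g: "\<gamma> \<in> G" for \<gamma>
  proof -
    have vp: "valid_path \<gamma>" "pathfinish \<gamma> = pathstart \<gamma>" and w1: "\<And>w. w \<in> inside (path_image \<gamma>) \<Longrightarrow> winding_number \<gamma> w = 1"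
      using G g by (auto simp: contour_system_def)
    have im: "path_image \<gamma> \<subseteq> S - pts" using tr g by (auto simp: trace_of_def)
    have pa: "path \<gamma>" using vp by (simp add: valid_path_imp_path)
    have "contour_integral \<gamma> f = 2 * of_real pi * \<i> * (\<Sum>x\<in>pts. winding_number \<gamma> x * residue f x)"
    proof -
      have "\<forall>z. z \<notin> S \<longrightarrow> winding_number \<gamma> z = 0"
        using winding_number_zero_outside[OF pa S(2) vp(2)] im by blast
      from Residue_theorem[OF S(1) convex_connected[OF S(2)] pts f vp im this] show ?thesis by simp
    qed
    also have "(\<Sum>x\<in>pts. winding_number \<gamma> x * residue f x) = (\<Sum>x\<in>pts. if x \<in> inside (path_image \<gamma>) then residue f x else 0)"
    proof (rule sum.cong[OF refl])
      fix x assume x: "x \<in> pts"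
      show "winding_number \<gamma> x * residue f x = (if x \<in> inside (path_image \<gamma>) then residue f x else 0)"
      proof (cases "x \<in> inside (path_image \<gamma>)")
        case False
        have "x \<notin> path_image \<gamma>" using im x by auto
        hence "x \<in> outside (path_image \<gamma>)" using False inside_Un_outside[of "path_image \<gamma>"] by blast
        thus ?thesis using False winding_number_zero_in_outside[OF pa vp(2)] by simp
      qed (simp add: w1)
    qed
    finally show ?thesis .
  qed
  have count: "(\<Sum>\<gamma>\<in>G. if x \<in> inside (path_image \<gamma>) then c else 0) = (if x \<in> enclosed_by G then c else 0)" for x and c :: complex
  proof (cases "x \<in> enclosed_by G")
    case True
    then obtain \<gamma>0 where g0: "\<gamma>0 \<in> G" "x \<in> inside (path_image \<gamma>0)" by (auto simp: enclosed_by_def)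
    have "x \<in> inside (path_image \<gamma>) \<longleftrightarrow> \<gamma> = \<gamma>0" if "\<gamma> \<in> G" for \<gamma>
    proof
      assume x: "x \<in> inside (path_image \<gamma>)"
      show "\<gamma> = \<gamma>0"
      proof (rule ccontr)
        assume "\<gamma> \<noteq> \<gamma>0"
        hence "disjnt (path_image \<gamma> \<union> inside (path_image \<gamma>)) (path_image \<gamma>0 \<union> inside (path_image \<gamma>0))"
          using G g0 that by (auto simp: contour_system_def pairwise_def)
        thus False using x g0 by (auto simp: disjnt_def)
      qed
    qed (use g0 in simp)
    hence "(\<Sum>\<gamma>\<in>G. if x \<in> inside (path_image \<gamma>) then c else 0) = (\<Sum>\<gamma>\<in>G. if \<gamma> = \<gamma>0 then c else 0)"
      by (intro sum.cong) auto
    thus ?thesis using True g0 fin by simp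
  next
    case False
    thus ?thesis by (auto simp: enclosed_by_def intro!: sum.neutral)
  qed
  have "system_integral G f = 2 * of_real pi * \<i> * (\<Sum>\<gamma>\<in>G. \<Sum>x\<in>pts. if x \<in> inside (path_image \<gamma>) then residue f x else 0)"
    unfolding system_integral_def sum_distrib_left[of _ _ G] by (intro sum.cong refl one)
  also have "(\<Sum>\<gamma>\<in>G. \<Sum>x\<in>pts. if x \<in> inside (path_image \<gamma>) then residue f x else 0) = (\<Sum>x\<in>pts. if x \<in> enclosed_by G then residue f x else 0)"
    by (subst sum.swap) (simp only: count)
  also have "\<dots> = (\<Sum>x\<in>pts \<inter> enclosed_by G. residue f x)"
    using pts by (simp add: sum.inter_restrict)
  finally show ?thesis .
qed

lemma inside_sphere_complex: "0 < R \<Longrightarrow> inside (sphere c R) = ball (c :: complex) R"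
  using inside_frontier_eq_interior[of "cball c R"] by simp

lemma
  assumes R: "0 < R"
  shows contour_system_circlepath: "contour_system {circlepath c R}"
    and enclosed_by_circlepath: "enclosed_by {circlepath c R} = ball c R"
    and trace_of_circlepath: "trace_of {circlepath c R} = sphere c R"
proof -
  show "enclosed_by {circlepath c R} = ball c R" "trace_of {circlepath c R} = sphere c R"
    using R by (simp_all add: enclosed_by_def trace_of_def inside_sphere_complex)
  show "contour_system {circlepath c R}"
    using R by (auto simp: contour_system_def simple_path_circlepath inside_sphere_complex winding_number_circlepath dist_norm norm_minus_commute)
qed

text \<open>The contour is pushed to infinity, where the integrand is $o(1/|z|)$.\<close>

lemma rational_residue_sum_eq_0:
  fixes N Q :: "complex poly"
  assumes pts: "finite pts" and Q: "\<And>z. poly Q z = 0 \<Longrightarrow> z \<in> pts" and deg: "degree N + 2 \<le> degree Q"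
  shows "(\<Sum>x\<in>pts. residue (\<lambda>z. poly N z / poly Q z) x) = 0"
proof -
  define f where "f = (\<lambda>z. poly N z / poly Q z)"
  define s where "s = (\<Sum>x\<in>pts. residue f x)"
  have lim: "((\<lambda>z. poly (pCons 0 N) z / poly Q z) \<longlongrightarrow> 0) at_infinity"
    using deg by (intro poly_divide_tendsto_0_at_infinity) (auto intro: le_less_trans[OF degree_pCons_le])
  have hol: "f holomorphic_on UNIV - pts" unfolding f_def using Q by (intro holomorphic_intros) auto
  have "norm s \<le> \<epsilon>" if e: "0 < \<epsilon>" for \<epsilon>
  proof -
    obtain b where b: "\<And>z. b \<le> norm z \<Longrightarrow> norm (poly (pCons 0 N) z / poly Q z) < \<epsilon>"
      using lim e unfolding Lim_at_infinity dist_norm by auto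
    obtain M where M: "\<And>x. x \<in> pts \<Longrightarrow> norm x \<le> M"
      using finite_imp_bounded[OF pts] by (auto simp: bounded_iff)
    define R where "R = max 1 (max b (M + 1))"
    have R: "R > 0" "b \<le> R" "M < R" by (auto simp: R_def)
    have lt: "norm x < R" if "x \<in> pts" for x using M[OF that] R by simp
    have im: "path_image (circlepath 0 R) \<subseteq> UNIV - pts"
    proof -
      have "x \<notin> pts" if "norm x = R" for x using lt[of x] that by auto
      thus ?thesis using R by (auto simp: dist_norm)
    qed
    have "system_integral {circlepath 0 R} f = 2 * of_real pi * \<i> * (\<Sum>x\<in>pts \<inter> enclosed_by {circlepath 0 R}. residue f x)"
      by (rule system_integral_residues[OF contour_system_circlepath[OF R(1)] open_UNIV convex_UNIV pts hol])
         (use im R in \<open>auto simp: trace_of_circlepath\<close>)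
    also have "pts \<inter> enclosed_by {circlepath 0 R} = pts" using lt R by (auto simp: enclosed_by_circlepath dist_norm)
    finally have ci: "contour_integral (circlepath 0 R) f = 2 * of_real pi * \<i> * s" by (simp add: system_integral_def s_def)
    have "f contour_integrable_on circlepath 0 R"
      by (rule contour_integrable_continuous_circlepath)
         (use R im in \<open>auto intro: holomorphic_on_imp_continuous_on[OF holomorphic_on_subset[OF hol]]\<close>)
    hence "(f has_contour_integral (2 * of_real pi * \<i> * s)) (circlepath 0 R)"
      unfolding ci[symmetric] by (rule has_contour_integral_integral)
    hence "norm (2 * of_real pi * \<i> * s) \<le> (\<epsilon> / R) * (2 * pi * R)"
    proof (rule has_contour_integral_bound_circlepath)
      fix z :: complex assume z: "norm (z - 0) = R"
      have "norm z * norm (f z) = norm (poly (pCons 0 N) z / poly Q z)" by (simp add: f_def norm_mult norm_divide)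
      also have "\<dots> < \<epsilon>" using z R by (intro b) simp
      finally show "norm (f z) \<le> \<epsilon> / R" using z R by (simp add: field_simps)
    qed (use e R in auto)
    also have "\<dots> = 2 * pi * \<epsilon>" using R by simp
    finally show "norm s \<le> \<epsilon>" by (simp add: norm_mult)
  qed
  hence "norm s \<le> 0" by (rule field_le_epsilon[of _ 0, simplified])
  thus ?thesis by (simp add: s_def f_def)
qed

section \<open>The limit function of part (A)\<close>

lemma inj_on_complex_of_real: "inj_on \<xi> A \<Longrightarrow> inj_on (\<lambda>i. complex_of_real (\<xi> i)) A"
  unfolding inj_on_def of_real_eq_iff .

lemma higher_deriv_exp_shift:
  "(deriv ^^ k) (\<lambda>z. exp (- (z - c) * y)) = (\<lambda>z. (- y) ^ k * exp (- (z - c) * (y :: complex)))"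
proof (induction k)
  case (Suc k)
  have "deriv (\<lambda>z. (- y) ^ k * exp (- (z - c) * y)) z = (- y) ^ Suc k * exp (- (z - c) * y)" for z
    by (rule DERIV_imp_deriv) (auto intro!: derivative_eq_intros)
  thus ?case unfolding funpow.simps o_apply Suc.IH by (rule ext)
qed simp

context gamma_system
begin

definition Hp :: "complex set" where "Hp = {z. edge < Re z}"

lemma Hp: "open Hp" "convex Hp"
  unfolding Hp_def by (auto simp: open_halfspace_Re_gt convex_halfspace_Re_gt)

definition W :: "(nat \<Rightarrow> nat) \<Rightarrow> complex \<Rightarrow> complex" where
  "W m z = (\<Prod>h=1..q. (z + of_real (\<rho> h)) powr of_real (d h + real (m h)))"

lemma W_holomorphic: "W m holomorphic_on Hp"
  unfolding W_def Hp_def by (intro holomorphic_intros edge_not_nonpos) auto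

text \<open>The integrand without the exponential and without the factor that is singular at
  \<xi>_i. It is holomorphic on \<open>punctured p \<xi> i\<close>, which contains \<xi>_i if the
  nodes are distinct and lie to the right of \<open>edge\<close>.\<close>

definition gpart :: "nat \<Rightarrow> (nat \<Rightarrow> real) \<Rightarrow> (nat \<Rightarrow> nat) \<Rightarrow> (nat \<Rightarrow> nat) \<Rightarrow> nat \<Rightarrow> complex \<Rightarrow> complex" where
  "gpart p \<xi> n m i z = W m z / (\<Prod>k\<in>{1..p} - {i}. (z - of_real (\<xi> k)) ^ n k)"

definition punctured :: "nat \<Rightarrow> (nat \<Rightarrow> real) \<Rightarrow> nat \<Rightarrow> complex set" where
  "punctured p \<xi> i = Hp - (\<lambda>k. of_real (\<xi> k)) ` ({1..p} - {i})"

lemma punctured_open: "open (punctured p \<xi> i)"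
  unfolding punctured_def by (intro open_Diff Hp finite_imp_closed) auto

lemma gpart_holomorphic: "gpart p \<xi> n m i holomorphic_on punctured p \<xi> i"
  unfolding gpart_def
  by (intro holomorphic_intros holomorphic_on_subset[OF W_holomorphic]) (auto simp: punctured_def)

lemma LII_integrand_split:
  assumes i: "i \<in> {1..p}"
  shows "W m z / (\<Prod>k=1..p. (z - of_real (\<xi> k)) ^ n k) * \<phi> = (gpart p \<xi> n m i z * \<phi>) / (z - of_real (\<xi> i)) ^ n i"
proof -
  have "(\<Prod>k=1..p. (z - of_real (\<xi> k)) ^ n k) = (z - of_real (\<xi> i)) ^ n i * (\<Prod>k\<in>{1..p} - {i}. (z - of_real (\<xi> k)) ^ n k)"
    by (rule prod.remove) (use i in auto)
  moreover have "w / (x * r) * \<phi> = w / r * \<phi> / x" for w x r :: complex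
    by (simp add: divide_inverse mult_ac)
  ultimately show ?thesis unfolding gpart_def by (simp only:)
qed

lemma mem_punctured:
  assumes i: "i \<in> {1..p}" and inj: "inj_on \<xi> {1..p}" and e: "edge < \<xi> i"
  shows "of_real (\<xi> i) \<in> punctured p \<xi> i"
proof -
  have "complex_of_real (\<xi> i) \<noteq> of_real (\<xi> k)" if "k \<in> {1..p} - {i}" for k
    using inj_onD[OF inj, of i k] i that by auto
  hence "complex_of_real (\<xi> i) \<notin> (\<lambda>k. of_real (\<xi> k)) ` ({1..p} - {i})" by blast
  thus ?thesis using e unfolding punctured_def Hp_def by (simp only: Diff_iff mem_Collect_eq Re_complex_of_real simp_thms)
qed

text \<open>The factor \<phi> is left open: it is exp(-zy) for the components and a derivative of
  the transform of F_j in the orthogonality proof. For n_i = 0 there is no pole.\<close>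

lemma residue_LII:
  assumes i: "i \<in> {1..p}" and inj: "inj_on \<xi> {1..p}" and e: "edge < \<xi> i" and \<phi>: "\<phi> holomorphic_on Hp"
  shows "residue (\<lambda>z. W m z / (\<Prod>k=1..p. (z - of_real (\<xi> k)) ^ n k) * \<phi> z) (of_real (\<xi> i)) =
    (if n i = 0 then 0 else (deriv ^^ (n i - 1)) (\<lambda>z. gpart p \<xi> n m i z * \<phi> z) (of_real (\<xi> i)) / fact (n i - 1))"
proof -
  note mem = mem_punctured[OF i inj e]
  have hol: "(\<lambda>z. gpart p \<xi> n m i z * \<phi> z) holomorphic_on punctured p \<xi> i"
    by (intro holomorphic_intros gpart_holomorphic holomorphic_on_subset[OF \<phi>]) (auto simp: punctured_def)
  show ?thesis
  proof (cases "n i = 0")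
    case True
    thus ?thesis unfolding LII_integrand_split[OF i] using residue_holo[OF punctured_open mem hol] by simp
  next
    case False
    then obtain N where N: "n i = Suc N" by (cases "n i") auto
    show ?thesis unfolding LII_integrand_split[OF i] N
      using residue_holomorphic_over_power[OF punctured_open mem hol, of N] by simp
  qed
qed

text \<open>The nodes are enclosed, hence not on the trace, and the value depends on the residues
  only; all admissible contour systems give the same function.\<close>

lemma LII_A_residue_sum:
  assumes G: "LII_contours p q \<rho> \<xi> G" and inj: "inj_on \<xi> {1..p}"
  shows "LII_A p q d \<rho> \<xi> n m G y =
    (-1) ^ msize p n * (\<Sum>i=1..p. residue (\<lambda>z. W m z / (\<Prod>k=1..p. (z - of_real (\<xi> k)) ^ n k) * exp (- z * of_real y)) (of_real (\<xi> i)))"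
proof -
  let ?f = "\<lambda>z. W m z / (\<Prod>k=1..p. (z - of_real (\<xi> k)) ^ n k) * exp (- z * of_real y)"
  let ?pts = "(\<lambda>i. complex_of_real (\<xi> i)) ` {1..p}"
  have cs: "contour_system G" and enc: "?pts \<subseteq> enclosed_by G" and tr: "trace_of G \<subseteq> Hp"
    using G by (auto simp: LII_contours_def Hp_def edge_less_iff)
  have tr': "trace_of G \<subseteq> Hp - ?pts" using tr enc contour_system_trace_disjoint[OF cs] by blast
  have "?f holomorphic_on Hp - ?pts"
    by (intro holomorphic_intros holomorphic_on_subset[OF W_holomorphic]) auto
  from system_integral_residues[OF cs Hp _ this tr']
  have "system_integral G ?f = 2 * of_real pi * \<i> * (\<Sum>x\<in>?pts \<inter> enclosed_by G. residue ?f x)" by simp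
  also have "?pts \<inter> enclosed_by G = ?pts" using enc by blast
  also have "(\<Sum>x\<in>?pts. residue ?f x) = (\<Sum>i=1..p. residue ?f (of_real (\<xi> i)))"
    unfolding sum.reindex[OF inj_on_complex_of_real[OF inj]] o_def ..
  finally have si: "system_integral G ?f = 2 * of_real pi * \<i> * (\<Sum>i=1..p. residue ?f (of_real (\<xi> i)))" .
  have canc: "b \<noteq> 0 \<Longrightarrow> a / b * (b * s) = a * s" for a b s :: complex by simp
  have "LII_A p q d \<rho> \<xi> n m G y = (-1) ^ msize p n / (2 * of_real pi * \<i>) * system_integral G ?f"
    by (simp only: LII_A_def W_def)
  also have "\<dots> = (-1) ^ msize p n * (\<Sum>i=1..p. residue ?f (of_real (\<xi> i)))"
    unfolding si by (rule canc) simp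
  finally show ?thesis .
qed

text \<open>Pulling exp(-\<xi>_i y) out of the residue leaves exp(-(z - \<xi>_i) y), whose
  derivatives at \<xi>_i are powers of -y. This is why the component is a polynomial.\<close>

lemma LII_A_comp_residue:
  assumes i: "i \<in> {1..p}" and inj: "inj_on \<xi> {1..p}" and e: "edge < \<xi> i"
  shows "(-1) ^ msize p n * residue (\<lambda>z. W m z / (\<Prod>k=1..p. (z - of_real (\<xi> k)) ^ n k) * exp (- z * of_real y)) (of_real (\<xi> i)) =
     LII_A_comp p q d \<rho> \<xi> n m i y * of_real (exp (- \<xi> i * y))"
proof (cases "n i = 0")
  case True
  thus ?thesis using residue_LII[OF i inj e, of "\<lambda>z. exp (- z * of_real y)" m n] by (simp add: LII_A_comp_def holomorphic_intros)
next
  case False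
  let ?E = "\<lambda>z. exp (- (z - of_real (\<xi> i)) * of_real y)"
  note mem = mem_punctured[OF i inj e]
  have hol: "(\<lambda>z. gpart p \<xi> n m i z * ?E z) holomorphic_on punctured p \<xi> i"
    by (intro holomorphic_intros gpart_holomorphic)
  have split: "gpart p \<xi> n m i z * exp (- z * of_real y) = of_real (exp (- \<xi> i * y)) * (gpart p \<xi> n m i z * ?E z)" for z
  proof -
    have "exp (- z * of_real y) = of_real (exp (- \<xi> i * y)) * ?E z"
      unfolding exp_of_real[symmetric] by (subst mult_exp_exp) (simp add: algebra_simps)
    thus ?thesis by simp
  qed
  have "residue (\<lambda>z. W m z / (\<Prod>k=1..p. (z - of_real (\<xi> k)) ^ n k) * exp (- z * of_real y)) (of_real (\<xi> i)) =
    (deriv ^^ (n i - 1)) (\<lambda>z. gpart p \<xi> n m i z * exp (- z * of_real y)) (of_real (\<xi> i)) / fact (n i - 1)"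
    using residue_LII[OF i inj e, of "\<lambda>z. exp (- z * of_real y)" m n] False by (simp add: holomorphic_intros)
  also have "(deriv ^^ (n i - 1)) (\<lambda>z. gpart p \<xi> n m i z * exp (- z * of_real y)) (of_real (\<xi> i)) =
      of_real (exp (- \<xi> i * y)) * (deriv ^^ (n i - 1)) (\<lambda>z. gpart p \<xi> n m i z * ?E z) (of_real (\<xi> i))"
    unfolding split by (rule higher_deriv_cmult[OF hol mem punctured_open])
  finally show ?thesis using False by (simp add: LII_A_comp_def gpart_def[abs_def] W_def)
qed

text \<open>The Leibniz expansion of \<open>LII_A_comp\<close> in powers of y. The case n_i = 0 is
  separate, since \<open>n i - 1\<close> would truncate to 0 and the sum would keep a constant
  term.\<close>

definition Qpoly :: "nat \<Rightarrow> (nat \<Rightarrow> real) \<Rightarrow> (nat \<Rightarrow> nat) \<Rightarrow> (nat \<Rightarrow> nat) \<Rightarrow> nat \<Rightarrow> complex poly" where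
  "Qpoly p \<xi> n m i = (if n i = 0 then 0 else
     (\<Sum>r=0..n i - 1. monom ((-1) ^ msize p n / fact (n i - 1) * (of_nat (n i - 1 choose r) * (deriv ^^ r) (gpart p \<xi> n m i) (of_real (\<xi> i)) * (-1) ^ (n i - 1 - r))) (n i - 1 - r)))"

lemma Qpoly_in: "Qpoly p \<xi> n m i \<in> polys_below (n i)"
proof (cases "n i = 0")
  case False
  have "degree (Qpoly p \<xi> n m i) \<le> n i - 1"
    unfolding Qpoly_def using False by (auto intro!: degree_sum_le order.trans[OF degree_monom_le])
  thus ?thesis using False by (auto simp: polys_below_def)
qed (simp add: Qpoly_def polys_below_def)

lemma poly_Qpoly:
  assumes i: "i \<in> {1..p}" and inj: "inj_on \<xi> {1..p}" and e: "edge < \<xi> i"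
  shows "poly (Qpoly p \<xi> n m i) (of_real y) = LII_A_comp p q d \<rho> \<xi> n m i y"
proof (cases "n i = 0")
  case False
  note mem = mem_punctured[OF i inj e]
  have "(deriv ^^ (n i - 1)) (\<lambda>z. gpart p \<xi> n m i z * exp (- (z - of_real (\<xi> i)) * of_real y)) (of_real (\<xi> i)) =
    (\<Sum>r = 0..n i - 1. of_nat (n i - 1 choose r) * (deriv ^^ r) (gpart p \<xi> n m i) (of_real (\<xi> i)) *
       (deriv ^^ (n i - 1 - r)) (\<lambda>z. exp (- (z - of_real (\<xi> i)) * of_real y)) (of_real (\<xi> i)))"
    by (rule higher_deriv_mult[OF gpart_holomorphic _ punctured_open mem]) (intro holomorphic_intros)
  also have "\<dots> = (\<Sum>r = 0..n i - 1. of_nat (n i - 1 choose r) * (deriv ^^ r) (gpart p \<xi> n m i) (of_real (\<xi> i)) * (- of_real y) ^ (n i - 1 - r))"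
    unfolding higher_deriv_exp_shift by simp
  finally have "LII_A_comp p q d \<rho> \<xi> n m i y = (-1) ^ msize p n / fact (n i - 1) *
    (\<Sum>r = 0..n i - 1. of_nat (n i - 1 choose r) * (deriv ^^ r) (gpart p \<xi> n m i) (of_real (\<xi> i)) * (- of_real y) ^ (n i - 1 - r))"
    using False by (simp add: LII_A_comp_def gpart_def[abs_def] W_def)
  also have "\<dots> = poly (Qpoly p \<xi> n m i) (of_real y)"
    unfolding Qpoly_def using False
    by (simp add: poly_sum poly_monom sum_distrib_left power_minus[of "of_real y"] mult_ac)
  finally show ?thesis ..
qed (simp add: Qpoly_def LII_A_comp_def)

lemma LII_A_decomposition:
  assumes G: "LII_contours p q \<rho> \<xi> G" and inj: "inj_on \<xi> {1..p}" and e: "\<And>i. i \<in> {1..p} \<Longrightarrow> edge < \<xi> i"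
  shows "LII_A p q d \<rho> \<xi> n m G y = (\<Sum>i=1..p. poly (Qpoly p \<xi> n m i) (of_real y) * of_real (exp (- \<xi> i * y)))"
  unfolding LII_A_residue_sum[OF G inj] sum_distrib_left
  by (intro sum.cong refl) (simp only: LII_A_comp_residue[OF _ inj e] poly_Qpoly[OF _ inj e])

section \<open>Existence of admissible contours\<close>

text \<open>One disc with real centre suffices. It reaches from the midpoint between
  \<open>edge\<close> and a lower bound of the nodes to 1 beyond an upper bound.\<close>

lemma enclosing_disc:
  fixes p :: nat and \<xi> :: "nat \<Rightarrow> real"
  assumes e: "\<And>i. i \<in> {1..p} \<Longrightarrow> edge < \<xi> i"
  obtains c R where "0 < R" "edge < c - R" "\<And>i. i \<in> {1..p} \<Longrightarrow> \<bar>c - \<xi> i\<bar> < R"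
proof -
  \<comment> \<open>The additional point \<open>edge + 1\<close> keeps the sets nonempty.\<close>
  define a where "a = Min (insert (edge + 1) (\<xi> ` {1..p}))"
  define b where "b = Max (insert (edge + 1) (\<xi> ` {1..p}))"
  have a: "edge < a" unfolding a_def by (rule Min_gr_iff[THEN iffD2]) (use e in auto)
  have ab: "a \<le> \<xi> i" "\<xi> i \<le> b" if "i \<in> {1..p}" for i
    unfolding a_def b_def by (rule Min_le Max_ge; use that in simp)+
  have ab': "a \<le> b"
  proof (rule order.trans)
    show "a \<le> edge + 1" unfolding a_def by (rule Min_le) auto
    show "edge + 1 \<le> b" unfolding b_def by (rule Max_ge) auto
  qed
  define l where "l = (edge + a) / 2"
  define c where "c = (l + (b + 1)) / 2"
  define R where "R = (b + 1 - l) / 2"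
  have l: "edge < l" "l < a" using a by (auto simp: l_def)
  have R: "R > 0" using l ab' by (simp add: R_def)
  have cR: "c - R = l" "c + R = b + 1" by (simp_all add: c_def R_def field_simps)
  show ?thesis
  proof (rule that[OF R])
    show "edge < c - R" using l cR by simp
    show "\<bar>c - \<xi> i\<bar> < R" if "i \<in> {1..p}" for i using ab[OF that] cR l by linarith
  qed
qed

lemma LII_contours_exist:
  assumes e: "\<And>i. i \<in> {1..p} \<Longrightarrow> edge < \<xi> i"
  shows "\<exists>G. LII_contours p q \<rho> \<xi> G"
proof -
  obtain c R where R: "0 < R" "edge < c - R" and \<xi>: "\<And>i. i \<in> {1..p} \<Longrightarrow> \<bar>c - \<xi> i\<bar> < R"
    by (rule enclosing_disc[of p \<xi>]) (use e in blast)+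
  have "LII_contours p q \<rho> \<xi> {circlepath (of_real c) R}"
    unfolding LII_contours_def enclosed_by_circlepath[OF R(1)] trace_of_circlepath[OF R(1)]
  proof (intro conjI ballI contour_system_circlepath R(1))
    fix i assume i: "i \<in> {1..p}"
    have "dist (complex_of_real c) (of_real (\<xi> i)) = \<bar>c - \<xi> i\<bar>"
      by (simp add: dist_norm flip: of_real_diff)
    also have "\<dots> < R" using \<xi>[OF i] .
    finally show "complex_of_real (\<xi> i) \<in> ball (of_real c) R" by simp
  next
    fix z h assume z: "z \<in> sphere (complex_of_real c) R" and h: "h \<in> {1..q}"
    have "\<bar>Re (of_real c - z)\<bar> \<le> R" using abs_Re_le_cmod[of "of_real c - z"] z by (simp add: dist_norm)
    hence "c - R \<le> Re z" by simp
    thus "- \<rho> h < Re z" using R(2) edge_ge[OF h] by linarith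
  qed
  thus ?thesis by blast
qed

section \<open>Orthogonality\<close>

definition row_exp :: "nat \<Rightarrow> nat \<Rightarrow> real" where "row_exp j h = d h + (if h = j then 1 else 0)"

lemma row_exp_pos: "h \<in> {1..q} \<Longrightarrow> 0 < row_exp j h"
  using d[of h] by (auto simp: row_exp_def)

lemma row_F_laplace:
  "laplace_on edge (row_F q d \<rho> j)"
  "edge < Re z \<Longrightarrow> lap (row_F q d \<rho> j) z = (\<Prod>h=1..q. (z + of_real (\<rho> h)) powr (- of_real (row_exp j h)))"
proof -
  have F: "row_F q d \<rho> j = iter_conv q (\<lambda>h. gamma_kernel (\<rho> h) (row_exp j h))"
    by (simp add: row_F_def row_exp_def)
  show "laplace_on edge (row_F q d \<rho> j)"
    "edge < Re z \<Longrightarrow> lap (row_F q d \<rho> j) z = (\<Prod>h=1..q. (z + of_real (\<rho> h)) powr (- of_real (row_exp j h)))"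
    unfolding F using lap_conv_gamma[of "row_exp j"] row_exp_pos by blast+
qed

text \<open>Each differentiation lowers all q exponents by 1. In the term that differentiates factor
  h, the other q - 1 factors make up for this by one linear factor each, so the degree of the
  polynomial grows by at most q - 1.\<close>

lemma higher_deriv_power_product:
  fixes \<epsilon> :: "nat \<Rightarrow> real"
  shows "\<exists>\<Psi>. degree \<Psi> \<le> k * (q - 1) \<and> (\<forall>z\<in>Hp. (deriv ^^ k) (\<lambda>z. \<Prod>h=1..q. (z + of_real (\<rho> h)) powr (- of_real (\<epsilon> h))) z =
      poly \<Psi> z * (\<Prod>h=1..q. (z + of_real (\<rho> h)) powr (- of_real (\<epsilon> h + real k))))"
proof (induction k)
  case 0
  show ?case by (intro exI[of _ 1]) simp
next
  case (Suc k)
  then obtain \<Psi> where deg: "degree \<Psi> \<le> k * (q - 1)" and \<Psi>: "\<And>z. z \<in> Hp \<Longrightarrow>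
     (deriv ^^ k) (\<lambda>z. \<Prod>h=1..q. (z + of_real (\<rho> h)) powr (- of_real (\<epsilon> h))) z =
      poly \<Psi> z * (\<Prod>h=1..q. (z + of_real (\<rho> h)) powr (- of_real (\<epsilon> h + real k)))" by blast
  define V where "V = (\<lambda>A. \<Prod>h\<in>A. [:complex_of_real (\<rho> h), 1:])"
  define \<Psi>' where "\<Psi>' = pderiv \<Psi> * V {1..q} + \<Psi> * (\<Sum>h=1..q. smult (- of_real (\<epsilon> h + real k)) (V ({1..q} - {h})))"
  have degV: "degree (V A) \<le> card A" if "finite A" for A
  proof -
    have "degree (V A) \<le> (\<Sum>h\<in>A. degree [:complex_of_real (\<rho> h), 1:])"
      unfolding V_def by (rule degree_prod_sum_le[OF that, unfolded o_def])
    thus ?thesis by simp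
  qed
  have deg': "degree \<Psi>' \<le> Suc k * (q - 1)"
    unfolding \<Psi>'_def
  proof (rule degree_add_le)
    show "degree (\<Psi> * (\<Sum>h=1..q. smult (- of_real (\<epsilon> h + real k)) (V ({1..q} - {h})))) \<le> Suc k * (q - 1)"
    proof (rule order.trans[OF degree_mult_le])
      have "degree (\<Sum>h=1..q. smult (- of_real (\<epsilon> h + real k)) (V ({1..q} - {h}))) \<le> q - 1"
      proof (rule degree_sum_le)
        fix h assume h: "h \<in> {1..q}"
        have "degree (V ({1..q} - {h})) \<le> q - 1" using degV[of "{1..q} - {h}"] h by simp
        thus "degree (smult (- of_real (\<epsilon> h + real k)) (V ({1..q} - {h}))) \<le> q - 1"
          by (rule order.trans[OF degree_smult_le])
      qed simp
      thus "degree \<Psi> + degree (\<Sum>h=1..q. smult (- of_real (\<epsilon> h + real k)) (V ({1..q} - {h}))) \<le> Suc k * (q - 1)"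
        using deg by simp
    qed
    show "degree (pderiv \<Psi> * V {1..q}) \<le> Suc k * (q - 1)"
    \<comment> \<open>The estimate (degree \<Psi> - 1) + q uses degree \<Psi> >= 1, as the
      subtraction is one of natural numbers; for constant \<Psi> the term vanishes.\<close>
    proof (cases "pderiv \<Psi> = 0")
      case False
      hence "degree \<Psi> \<noteq> 0" by (simp add: pderiv_eq_0_iff)
      moreover have "degree (pderiv \<Psi> * V {1..q}) \<le> (degree \<Psi> - 1) + q"
        using degree_mult_le[of "pderiv \<Psi>" "V {1..q}"] degV[of "{1..q}"] by (simp add: degree_pderiv)
      ultimately show ?thesis using deg q by simp
    qed simp
  qed
  have "(deriv ^^ Suc k) (\<lambda>z. \<Prod>h=1..q. (z + of_real (\<rho> h)) powr (- of_real (\<epsilon> h))) z =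
      poly \<Psi>' z * (\<Prod>h=1..q. (z + of_real (\<rho> h)) powr (- of_real (\<epsilon> h + real (Suc k))))" if z: "z \<in> Hp" for z
  proof -
    let ?pw = "\<lambda>h. (z + of_real (\<rho> h)) powr (- of_real (\<epsilon> h + real k))"
    let ?pw' = "\<lambda>h. (z + of_real (\<rho> h)) powr (- of_real (\<epsilon> h + real (Suc k)))"
    have ze: "edge < Re z" using z by (simp add: Hp_def)
    have nn: "z + of_real (\<rho> h) \<notin> \<real>\<^sub>\<le>\<^sub>0" if "h \<in> {1..q}" for h by (rule edge_not_nonpos[OF ze that])
    have pw: "?pw h = (z + of_real (\<rho> h)) * ?pw' h" if "h \<in> {1..q}" for h
    proof -
      have "(- of_real (\<epsilon> h + real k) :: complex) = 1 + (- of_real (\<epsilon> h + real (Suc k)))" by simp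
      hence "?pw h = (z + of_real (\<rho> h)) powr 1 * ?pw' h" by (simp only: powr_add)
      thus ?thesis by (simp only: powr_to_1)
    qed
    have "(deriv ^^ Suc k) (\<lambda>z. \<Prod>h=1..q. (z + of_real (\<rho> h)) powr (- of_real (\<epsilon> h))) z =
       deriv (\<lambda>z. poly \<Psi> z * (\<Prod>h=1..q. (z + of_real (\<rho> h)) powr (- of_real (\<epsilon> h + real k)))) z"
      unfolding funpow.simps o_apply
    proof (rule deriv_cong_ev[OF _ refl])
      show "\<forall>\<^sub>F z in nhds z. (deriv ^^ k) (\<lambda>z. \<Prod>h=1..q. (z + of_real (\<rho> h)) powr (- of_real (\<epsilon> h))) z =
         poly \<Psi> z * (\<Prod>h=1..q. (z + of_real (\<rho> h)) powr (- of_real (\<epsilon> h + real k)))"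
        using eventually_nhds_in_open[OF Hp(1) z] by eventually_elim (rule \<Psi>)
    qed
    also have "\<dots> = poly (pderiv \<Psi>) z * (\<Prod>h=1..q. ?pw h) + (\<Sum>h=1..q. - of_real (\<epsilon> h + real k) * ?pw' h * (\<Prod>k\<in>{1..q} - {h}. ?pw k)) * poly \<Psi> z"
    proof (rule DERIV_imp_deriv, rule DERIV_mult[OF poly_DERIV has_field_derivative_prod])
      fix h assume h: "h \<in> {1..q}"
      have "((\<lambda>z. (z + of_real (\<rho> h)) powr (- of_real (\<epsilon> h + real k))) has_field_derivative
         - of_real (\<epsilon> h + real k) * (z + of_real (\<rho> h)) powr (- of_real (\<epsilon> h + real k) - 1)) (at z)"
        using nn[OF h] by (auto intro!: derivative_eq_intros)
      moreover have "(- of_real (\<epsilon> h + real k) - 1 :: complex) = - of_real (\<epsilon> h + real (Suc k))" by simp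
      ultimately show "((\<lambda>z. (z + of_real (\<rho> h)) powr (- of_real (\<epsilon> h + real k))) has_field_derivative
         - of_real (\<epsilon> h + real k) * ?pw' h) (at z)" by (simp only:)
    qed
    also have "(\<Sum>h=1..q. - of_real (\<epsilon> h + real k) * ?pw' h * (\<Prod>k\<in>{1..q} - {h}. ?pw k)) =
       (\<Sum>h=1..q. - of_real (\<epsilon> h + real k) * poly (V ({1..q} - {h})) z) * (\<Prod>h=1..q. ?pw' h)"
      unfolding sum_distrib_right
    proof (rule sum.cong[OF refl])
      fix h assume h: "h \<in> {1..q}"
      have "(\<Prod>k\<in>{1..q} - {h}. ?pw k) = (\<Prod>k\<in>{1..q} - {h}. (z + of_real (\<rho> k)) * ?pw' k)"
        by (rule prod.cong[OF refl]) (use pw in blast)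
      also have "\<dots> = poly (V ({1..q} - {h})) z * (\<Prod>k\<in>{1..q} - {h}. ?pw' k)"
        by (simp add: V_def poly_prod prod.distrib add.commute)
      finally have 1: "(\<Prod>k\<in>{1..q} - {h}. ?pw k) = poly (V ({1..q} - {h})) z * (\<Prod>k\<in>{1..q} - {h}. ?pw' k)" .
      have 2: "(\<Prod>h=1..q. ?pw' h) = ?pw' h * (\<Prod>k\<in>{1..q} - {h}. ?pw' k)" using h by (subst prod.remove[of _ h]) auto
      show "- of_real (\<epsilon> h + real k) * ?pw' h * (\<Prod>k\<in>{1..q} - {h}. ?pw k) = - of_real (\<epsilon> h + real k) * poly (V ({1..q} - {h})) z * (\<Prod>h=1..q. ?pw' h)"
        unfolding 1 2 by (simp only: mult_ac)
    qed
    also have "(\<Prod>h=1..q. ?pw h) = poly (V {1..q}) z * (\<Prod>h=1..q. ?pw' h)"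
    proof -
      have "(\<Prod>h=1..q. ?pw h) = (\<Prod>h=1..q. (z + of_real (\<rho> h)) * ?pw' h)" by (rule prod.cong[OF refl]) (rule pw)
      thus ?thesis by (simp add: V_def poly_prod prod.distrib add.commute)
    qed
    also have "poly (pderiv \<Psi>) z * (poly (V {1..q}) z * (\<Prod>h=1..q. ?pw' h)) +
        (\<Sum>h=1..q. - of_real (\<epsilon> h + real k) * poly (V ({1..q} - {h})) z) * (\<Prod>h=1..q. ?pw' h) * poly \<Psi> z =
      poly \<Psi>' z * (\<Prod>h=1..q. ?pw' h)"
    proof -
      have p': "poly \<Psi>' z = poly (pderiv \<Psi>) z * poly (V {1..q}) z + poly \<Psi> z * (\<Sum>h=1..q. - of_real (\<epsilon> h + real k) * poly (V ({1..q} - {h})) z)"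
        by (simp only: \<Psi>'_def poly_add poly_mult poly_sum poly_smult)
      have "a * (b * c) + s * c * u = (a * b + u * s) * c" for a b c s u :: complex
        by (simp add: algebra_simps)
      thus ?thesis unfolding p' .
    qed
    finally show ?thesis .
  qed
  with deg' show ?case by blast
qed

text \<open>Expanded in powers of y, the integral consists of derivatives of the transform of F_j at
  the nodes, which reassemble to residues with the k-th derivative L of that transform in place of
  the exponential. On the half-plane W L is a polynomial of degree at most k(q - 1) + (|m| - kq - 1)
  = |m| - k - 1 <= |n| - 2.\<close>

lemma LII_A_orthogonal:
  assumes G: "LII_contours p q \<rho> \<xi> G" and inj: "inj_on \<xi> {1..p}" and e: "\<And>i. i \<in> {1..p} \<Longrightarrow> edge < \<xi> i"
    and bal: "msize p n = msize q m + 1" and j: "j \<in> {1..q}" "k < m j"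
    and diag: "\<And>h. h \<in> {1..q} \<Longrightarrow> \<bar>int (m h) - int (m j)\<bar> \<le> 1"
  shows "has_lebesgue_integral_on (\<lambda>y. of_real (y ^ k * row_F q d \<rho> j y) * LII_A p q d \<rho> \<xi> n m G y) 0 {0<..}"
proof -
  define F where "F = row_F q d \<rho> j"
  note F = row_F_laplace(1)[of j, folded F_def]
  define Lk where "Lk = (deriv ^^ k) (lap F)"
  have Lk_hol: "Lk holomorphic_on Hp"
    unfolding Lk_def Hp_def by (intro holomorphic_higher_deriv lap_holomorphic F) (simp add: open_halfspace_Re_gt)
  let ?D = "\<lambda>i r. (deriv ^^ r) (gpart p \<xi> n m i) (of_real (\<xi> i))"
  \<comment> \<open>One term of the Leibniz expansion of component i, multiplied by y^k F_j; its
    integral is a moment of F_j with an exponential weight.\<close>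
  define t where "t = (\<lambda>i r y. (-1) ^ msize p n / fact (n i - 1) * (of_nat (n i - 1 choose r) * ?D i r * (-1) ^ (n i - 1 - r)) *
      (exp (- of_real (\<xi> i) * of_real y) * complex_of_real (y ^ (k + (n i - 1 - r)) * F y)))"
  have it: "complex_integrable lborel (t i r)"
    and It: "(LINT y|lborel. t i r y) = (-1) ^ msize p n * (-1) ^ k / fact (n i - 1) * (of_nat (n i - 1 choose r) * ?D i r * (deriv ^^ (n i - 1 - r)) Lk (of_real (\<xi> i)))"
    if i: "i \<in> {1..p}" for i r
  proof -
    let ?s = "n i - 1 - r"
    have on: "laplace_on edge (\<lambda>y. y ^ (k + ?s) * F y)" by (rule laplace_on_times_power[OF F])
    have ei: "edge < Re (of_real (\<xi> i) :: complex)" using e[OF i] by simp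
    show "complex_integrable lborel (t i r)"
      unfolding t_def by (intro integrable_mult_right lap_integrable[OF on ei])
    have "(deriv ^^ ?s) Lk (of_real (\<xi> i)) = (deriv ^^ (?s + k)) (lap F) (of_real (\<xi> i))"
      unfolding Lk_def funpow_add by simp
    also have "\<dots> = (-1) ^ (?s + k) * lap (\<lambda>y. y ^ (?s + k) * F y) (of_real (\<xi> i))" by (rule lap_higher_deriv[OF F ei])
    finally have "lap (\<lambda>y. y ^ (k + ?s) * F y) (of_real (\<xi> i)) = (-1) ^ (?s + k) * (deriv ^^ ?s) Lk (of_real (\<xi> i))"
      by (simp add: add.commute mult.assoc[symmetric] power_add[symmetric])
    moreover have "(LINT y|lborel. t i r y) = (-1) ^ msize p n / fact (n i - 1) * (of_nat (n i - 1 choose r) * ?D i r * (-1) ^ ?s) *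
        lap (\<lambda>y. y ^ (k + ?s) * F y) (of_real (\<xi> i))"
      unfolding t_def lap_def by (rule integral_mult_right_zero)
    moreover have "(-1) ^ ?s * ((-1) ^ (?s + k) * x) = (-1) ^ k * (x :: complex)" for x
      by (simp add: mult.assoc[symmetric] power_add[symmetric]) (simp add: power_add)
    ultimately show "(LINT y|lborel. t i r y) = (-1) ^ msize p n * (-1) ^ k / fact (n i - 1) * (of_nat (n i - 1 choose r) * ?D i r * (deriv ^^ ?s) Lk (of_real (\<xi> i)))"
      by (simp add: mult_ac)
  qed
  \<comment> \<open>Indices with n_i = 0 are left out, because the upper limit
    \<open>n i - 1\<close> would be 0 for them and the inner sum would not be empty.\<close>
  have int: "indicator {0<..} y *\<^sub>R (of_real (y ^ k * F y) * LII_A p q d \<rho> \<xi> n m G y) = (\<Sum>i\<in>{i\<in>{1..p}. 0 < n i}. \<Sum>r=0..n i - 1. t i r y)" for y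
  proof -
    have "indicator {0<..} y *\<^sub>R (of_real (y ^ k * F y) * LII_A p q d \<rho> \<xi> n m G y) = of_real (y ^ k * F y) * LII_A p q d \<rho> \<xi> n m G y"
      using laplace_on_nonpos[OF F, of y] by (cases "0 < y") auto
    also have "\<dots> = (\<Sum>i=1..p. of_real (y ^ k * F y) * (poly (Qpoly p \<xi> n m i) (of_real y) * of_real (exp (- \<xi> i * y))))"
    proof -
      have "LII_A p q d \<rho> \<xi> n m G y = (\<Sum>i=1..p. poly (Qpoly p \<xi> n m i) (of_real y) * of_real (exp (- \<xi> i * y)))"
        by (rule LII_A_decomposition[OF G inj]) (rule e)
      thus ?thesis by (simp only: sum_distrib_left)
    qed
    also have "\<dots> = (\<Sum>i\<in>{i\<in>{1..p}. 0 < n i}. of_real (y ^ k * F y) * (poly (Qpoly p \<xi> n m i) (of_real y) * of_real (exp (- \<xi> i * y))))"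
      by (rule sum.mono_neutral_right) (auto simp: Qpoly_def)
    also have "\<dots> = (\<Sum>i\<in>{i\<in>{1..p}. 0 < n i}. \<Sum>r=0..n i - 1. t i r y)"
      by (intro sum.cong refl)
         (auto simp: Qpoly_def poly_sum poly_monom t_def sum_distrib_left sum_distrib_right power_add exp_of_real[symmetric] mult_ac intro!: sum.cong)
    finally show ?thesis .
  qed
  have integ: "complex_integrable lborel (\<lambda>y. \<Sum>i\<in>{i\<in>{1..p}. 0 < n i}. \<Sum>r=0..n i - 1. t i r y)"
    by (intro Bochner_Integration.integrable_sum it) auto
  \<comment> \<open>Near the diagonal k < m_j implies k <= m_h for every h, so no factor z +
    \<rho>_h is left with a negative exponent.\<close>
  have eps: "h \<in> {1..q} \<Longrightarrow> k + (if h = j then 1 else 0) \<le> m h" for h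
    using diag[of h] j by auto
  have "(LINT y|lborel. (\<Sum>i\<in>{i\<in>{1..p}. 0 < n i}. \<Sum>r=0..n i - 1. t i r y)) =
     (\<Sum>i\<in>{i\<in>{1..p}. 0 < n i}. \<Sum>r=0..n i - 1. (LINT y|lborel. t i r y))"
    by (subst Bochner_Integration.integral_sum, (intro Bochner_Integration.integrable_sum it; force),
        intro sum.cong refl Bochner_Integration.integral_sum it) auto
  also have "\<dots> = (\<Sum>i\<in>{i\<in>{1..p}. 0 < n i}. (-1) ^ msize p n * (-1) ^ k * residue (\<lambda>z. W m z / (\<Prod>k=1..p. (z - of_real (\<xi> k)) ^ n k) * Lk z) (of_real (\<xi> i)))"
  proof (rule sum.cong[OF refl])
    fix i assume "i \<in> {i\<in>{1..p}. 0 < n i}"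
    hence i: "i \<in> {1..p}" "n i \<noteq> 0" by auto
    note mem = mem_punctured[OF i(1) inj e[OF i(1)]]
    have "residue (\<lambda>z. W m z / (\<Prod>k=1..p. (z - of_real (\<xi> k)) ^ n k) * Lk z) (of_real (\<xi> i)) =
      (deriv ^^ (n i - 1)) (\<lambda>z. gpart p \<xi> n m i z * Lk z) (of_real (\<xi> i)) / fact (n i - 1)"
      using residue_LII[OF i(1) inj e[OF i(1)] Lk_hol] i(2) by simp
    also have "(deriv ^^ (n i - 1)) (\<lambda>z. gpart p \<xi> n m i z * Lk z) (of_real (\<xi> i)) =
       (\<Sum>r=0..n i - 1. of_nat (n i - 1 choose r) * ?D i r * (deriv ^^ (n i - 1 - r)) Lk (of_real (\<xi> i)))"
      by (rule higher_deriv_mult[OF gpart_holomorphic _ punctured_open mem])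
         (rule holomorphic_on_subset[OF Lk_hol], auto simp: punctured_def)
    finally show "(\<Sum>r=0..n i - 1. (LINT y|lborel. t i r y)) =
       (-1) ^ msize p n * (-1) ^ k * residue (\<lambda>z. W m z / (\<Prod>k=1..p. (z - of_real (\<xi> k)) ^ n k) * Lk z) (of_real (\<xi> i))"
      unfolding It[OF i(1)] sum_distrib_left[symmetric] by simp
  qed
  \<comment> \<open>Where n_i = 0 the integrand is regular and its residue is 0.\<close>
  also have "\<dots> = (\<Sum>i\<in>{1..p}. (-1) ^ msize p n * (-1) ^ k * residue (\<lambda>z. W m z / (\<Prod>k=1..p. (z - of_real (\<xi> k)) ^ n k) * Lk z) (of_real (\<xi> i)))"
    using residue_LII[OF _ inj e Lk_hol, where n = n and m = m] by (intro sum.mono_neutral_left) auto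
  also have "\<dots> = (-1) ^ msize p n * (-1) ^ k * (\<Sum>i\<in>{1..p}. residue (\<lambda>z. W m z / (\<Prod>k=1..p. (z - of_real (\<xi> k)) ^ n k) * Lk z) (of_real (\<xi> i)))"
    by (rule sum_distrib_left[symmetric])
  also have "(\<Sum>i\<in>{1..p}. residue (\<lambda>z. W m z / (\<Prod>k=1..p. (z - of_real (\<xi> k)) ^ n k) * Lk z) (of_real (\<xi> i))) = 0"
  proof -
    obtain \<Psi> where deg: "degree \<Psi> \<le> k * (q - 1)" and \<Psi>: "\<And>z. z \<in> Hp \<Longrightarrow>
      (deriv ^^ k) (\<lambda>z. \<Prod>h=1..q. (z + of_real (\<rho> h)) powr (- of_real (row_exp j h))) z =
      poly \<Psi> z * (\<Prod>h=1..q. (z + of_real (\<rho> h)) powr (- of_real (row_exp j h + real k)))"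
      using higher_deriv_power_product[of k "row_exp j"] by blast
    define u where "u = (\<lambda>h. m h - (k + (if h = j then 1 else 0)))"
    define N where "N = \<Psi> * (\<Prod>h=1..q. [:of_real (\<rho> h), 1:] ^ u h)"
    define Q where "Q = (\<Prod>k=1..p. [:- complex_of_real (\<xi> k), 1:] ^ n k)"
    have WN: "W m z * Lk z = poly N z" if z: "z \<in> Hp" for z
    proof -
      have ze: "edge < Re z" using z by (simp add: Hp_def)
      have "Lk z = (deriv ^^ k) (\<lambda>z. \<Prod>h=1..q. (z + of_real (\<rho> h)) powr (- of_real (row_exp j h))) z"
        unfolding Lk_def
      proof (rule higher_deriv_transform_within_open[OF _ _ Hp(1) z])
        show "lap F holomorphic_on Hp" unfolding Hp_def by (rule lap_holomorphic[OF F])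
        show "(\<lambda>z. \<Prod>h=1..q. (z + of_real (\<rho> h)) powr (- of_real (row_exp j h))) holomorphic_on Hp"
          unfolding Hp_def by (intro holomorphic_intros edge_not_nonpos) auto
        show "lap F z = (\<Prod>h=1..q. (z + of_real (\<rho> h)) powr (- of_real (row_exp j h)))" if "z \<in> Hp" for z
          using row_F_laplace(2)[of z j] that by (simp add: F_def Hp_def)
      qed
      also note \<Psi>[OF z]
      finally have "W m z * Lk z = poly \<Psi> z * (\<Prod>h=1..q. (z + of_real (\<rho> h)) powr of_real (d h + real (m h)) * (z + of_real (\<rho> h)) powr (- of_real (row_exp j h + real k)))"
        by (simp add: W_def prod.distrib)
      also have "(\<Prod>h=1..q. (z + of_real (\<rho> h)) powr of_real (d h + real (m h)) * (z + of_real (\<rho> h)) powr (- of_real (row_exp j h + real k))) =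
        (\<Prod>h=1..q. (z + of_real (\<rho> h)) ^ u h)"
      proof (rule prod.cong[OF refl])
        fix h assume h: "h \<in> {1..q}"
        have nz: "z + of_real (\<rho> h) \<noteq> 0" using edge_not_nonpos[OF ze h] by auto
        have "of_real (d h + real (m h)) + (- of_real (row_exp j h + real k)) = (of_nat (u h) :: complex)"
          using eps[OF h] by (auto simp: u_def row_exp_def of_nat_diff)
        hence "(z + of_real (\<rho> h)) powr of_real (d h + real (m h)) * (z + of_real (\<rho> h)) powr (- of_real (row_exp j h + real k)) =
            (z + of_real (\<rho> h)) powr of_nat (u h)" by (simp only: powr_add[symmetric])
        thus "(z + of_real (\<rho> h)) powr of_real (d h + real (m h)) * (z + of_real (\<rho> h)) powr (- of_real (row_exp j h + real k)) = (z + of_real (\<rho> h)) ^ u h"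
          using nz by (simp only: powr_nat) simp
      qed
      finally show ?thesis by (simp add: N_def poly_prod poly_power add.commute)
    qed
    have Qz: "poly Q z = (\<Prod>k=1..p. (z - of_real (\<xi> k)) ^ n k)" for z by (simp add: Q_def poly_prod poly_power)
    have degQ: "degree Q = msize p n"
      unfolding Q_def msize_def by (subst degree_prod_eq_sum_degree) (auto simp: degree_power_eq)
    have "(\<Sum>h=1..q. u h) + (k * q + 1) = msize q m"
    proof -
      have "(\<Sum>h=1..q. u h) + (\<Sum>h=1..q. k + (if h = j then 1 else 0)) = (\<Sum>h=1..q. m h)"
        unfolding sum.distrib[symmetric] using eps by (intro sum.cong refl) (auto simp: u_def)
      moreover have "(\<Sum>h=1..q. k + (if h = j then 1 else 0)) = k * q + 1"
        using j by (simp add: sum.distrib)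
      ultimately show ?thesis by (simp add: msize_def)
    qed
    moreover have "degree N \<le> k * (q - 1) + (\<Sum>h=1..q. u h)"
    proof -
      have "degree (\<Prod>h=1..q. [:complex_of_real (\<rho> h), 1:] ^ u h) = (\<Sum>h=1..q. u h)"
        by (subst degree_prod_eq_sum_degree) (auto simp: degree_power_eq)
      thus ?thesis using degree_mult_le[of \<Psi> "\<Prod>h=1..q. [:complex_of_real (\<rho> h), 1:] ^ u h"] deg by (simp add: N_def)
    qed
    moreover have "k * (q - 1) \<le> k * q" by simp
    ultimately have "degree N + 2 \<le> degree Q" unfolding degQ bal by linarith
    hence "(\<Sum>x\<in>(\<lambda>i. complex_of_real (\<xi> i)) ` {1..p}. residue (\<lambda>z. poly N z / poly Q z) x) = 0"
      by (intro rational_residue_sum_eq_0) (auto simp: Qz)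
    hence "(\<Sum>i\<in>{1..p}. residue (\<lambda>z. poly N z / poly Q z) (of_real (\<xi> i))) = 0"
      unfolding sum.reindex[OF inj_on_complex_of_real[OF inj]] o_def .
    \<comment> \<open>The identity with a rational function holds on the half-plane only, but a
      residue sees just a neighbourhood of its point; the rational function may then be used in the
      whole plane.\<close>
    moreover have "residue (\<lambda>z. W m z / (\<Prod>k=1..p. (z - of_real (\<xi> k)) ^ n k) * Lk z) (of_real (\<xi> i)) = residue (\<lambda>z. poly N z / poly Q z) (of_real (\<xi> i))"
      if "i \<in> {1..p}" for i
    proof (rule residue_cong[OF _ refl])
      have "\<forall>\<^sub>F z in at (of_real (\<xi> i)). z \<in> Hp"
        using eventually_at_in_open'[OF Hp(1), of "of_real (\<xi> i)"] e[OF that] by (simp add: Hp_def)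
      thus "\<forall>\<^sub>F z in at (of_real (\<xi> i)). W m z / (\<Prod>k=1..p. (z - of_real (\<xi> k)) ^ n k) * Lk z = poly N z / poly Q z"
        by eventually_elim (use WN Qz in \<open>simp\<close>)
    qed
    ultimately show ?thesis by simp
  qed
  finally show ?thesis
    unfolding has_lebesgue_integral_on_def set_integrable_def set_lebesgue_integral_def F_def[symmetric] int
    using integ by simp
qed

end

section \<open>Convergence of the Jacobi functions \<open>B\<close>\<close>

lemma laplace_onI_complex:
  assumes "\<And>y. y \<le> 0 \<Longrightarrow> f y = 0"
    and int: "\<And>z. r < Re z \<Longrightarrow> complex_integrable lborel (\<lambda>y. exp (- z * of_real y) * of_real (f y))"
  shows "laplace_on r f"
  unfolding laplace_on_def
proof (intro conjI allI impI)
  fix w assume "r < w"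
  hence "complex_integrable lborel (\<lambda>y. exp (- of_real w * of_real y) * of_real (f y))"
    using int[of "of_real w"] by simp
  also have "(\<lambda>y. exp (- of_real w * of_real y) * complex_of_real (f y)) = (\<lambda>y. complex_of_real (exp (- w * y) * f y))"
    by (simp add: exp_of_real[symmetric])
  finally show "integrable lborel (\<lambda>y. exp (- w * y) * f y)" by (simp only: complex_of_real_integrable_eq)
qed (use assms in simp)

lemma integrable_cmult_iff:
  fixes c :: complex assumes c: "c \<noteq> 0"
  shows "integrable M (\<lambda>x. c * f x) \<longleftrightarrow> integrable M f"
proof
  assume "integrable M (\<lambda>x. c * f x)"
  from integrable_mult_right[OF this, of "1 / c"] show "integrable M f" using c by simp
qed (rule integrable_mult_right)

lemma exp_scaled_argument:
  fixes v \<tau> :: real assumes "0 < v" "0 < \<tau>"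
  shows "0 \<le> \<tau> * (1 - exp (- v / \<tau>))" "\<tau> * (1 - exp (- v / \<tau>)) \<le> v"
proof -
  have "exp (- v / \<tau>) \<le> 1" using assms by simp
  thus "0 \<le> \<tau> * (1 - exp (- v / \<tau>))" using assms by simp
  have "1 - exp (- v / \<tau>) \<le> v / \<tau>" using exp_ge_add_one_self[of "- v / \<tau>"] by simp
  hence "\<tau> * (1 - exp (- v / \<tau>)) \<le> \<tau> * (v / \<tau>)" using assms by (intro mult_left_mono) auto
  thus "\<tau> * (1 - exp (- v / \<tau>)) \<le> v" using assms by simp
qed

text \<open>Convergence is known in the variable v of x = exp(-v/\<tau>), whereas test functions act
  in y with x = 1 - y/\<tau>. Hence y = \<tau>(1 - exp(-v/\<tau>)) and dy = exp(-v/\<tau>) dv, which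
  is the origin of \<psi>. The weighted norm controls the part with H - h, and dominated convergence
  the replacement of \<psi> by \<phi>.\<close>

lemma laplace_tendsto_test:
  fixes \<phi> :: "real \<Rightarrow> complex"
  assumes H: "laplace_tendsto r H h" and r: "r < 0" and w: "r < w"
    and \<phi>: "continuous_on UNIV \<phi>" and b: "\<And>y. 0 \<le> y \<Longrightarrow> norm (\<phi> y) \<le> M * exp (- w * y)"
  defines "\<psi> \<equiv> \<lambda>\<tau> v. of_real (exp (- v / \<tau>)) * \<phi> (\<tau> * (1 - exp (- v / \<tau>)))"
  shows "\<forall>\<^sub>F \<tau> in at_top. complex_integrable lborel (\<lambda>v. of_real (H \<tau> v) * \<psi> \<tau> v)"
    and "complex_integrable lborel (\<lambda>v. of_real (h v) * \<phi> v)"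
    and "((\<lambda>\<tau>. LINT v|lborel. of_real (H \<tau> v) * \<psi> \<tau> v) \<longlongrightarrow> (LINT v|lborel. of_real (h v) * \<phi> v)) at_top"
proof -
  \<comment> \<open>Because y <= v, a bound exp(-w0 y) carries over to exp(-w0 v) if w0 <= 0; r < 0
    leaves room for such a w0.\<close>
  define w0 where "w0 = min w 0"
  have w0: "r < w0" "w0 \<le> 0" "w0 \<le> w" using r w by (auto simp: w0_def)
  have "0 \<le> norm (\<phi> 0)" by simp
  also have "\<dots> \<le> M" using b[of 0] by simp
  finally have M: "M \<ge> 0" .
  note h = laplace_tendsto_on[OF H]
  have [measurable]: "\<phi> \<in> borel_measurable borel" by (rule borel_measurable_continuous_onI[OF \<phi>])
  have [measurable]: "h \<in> borel_measurable borel" by (rule laplace_on_measurable[OF h])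
  have [measurable]: "\<psi> \<tau> \<in> borel_measurable borel" for \<tau> unfolding \<psi>_def by measurable
  have \<phi>b: "norm (\<phi> v) \<le> M * exp (- w0 * v)" if "0 \<le> v" for v
    by (rule order.trans[OF b[OF that]]) (use w0 that M in \<open>intro mult_left_mono, auto intro: mult_right_mono\<close>)
  have \<psi>b: "norm (\<psi> \<tau> v) \<le> M * exp (- w0 * v)" if "0 < v" "0 < \<tau>" for v \<tau>
  proof -
    have "norm (\<psi> \<tau> v) = exp (- v / \<tau>) * norm (\<phi> (\<tau> * (1 - exp (- v / \<tau>))))" by (simp add: \<psi>_def norm_mult)
    also have "\<dots> \<le> 1 * (M * exp (- w0 * (\<tau> * (1 - exp (- v / \<tau>)))))"
      using that by (intro mult_mono \<phi>b exp_scaled_argument) auto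
    also have "\<dots> \<le> 1 * (M * exp (- w0 * v))"
      using w0 M exp_scaled_argument[OF that] by (intro mult_left_mono) (auto intro: mult_left_mono_neg)
    finally show ?thesis by simp
  qed
  have int_bound: "complex_integrable lborel (\<lambda>v. of_real (f v) * g v)"
    if f: "laplace_on s f" "s < w0" and m: "g \<in> borel_measurable borel" and g: "\<And>v. 0 < v \<Longrightarrow> norm (g v) \<le> M * exp (- w0 * v)" for f g s
  proof (rule Bochner_Integration.integrable_bound)
    show "integrable lborel (\<lambda>v. M * (exp (- w0 * v) * \<bar>f v\<bar>))"
      by (intro integrable_mult_right laplace_on_integrable_abs[OF f])
    note [measurable] = laplace_on_measurable[OF f(1)] m
    show "(\<lambda>v. of_real (f v) * g v) \<in> borel_measurable lborel" by measurable
    show "AE v in lborel. norm (of_real (f v) * g v) \<le> norm (M * (exp (- w0 * v) * \<bar>f v\<bar>))"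
    proof (rule AE_I2)
      fix v
      show "norm (of_real (f v) * g v) \<le> norm (M * (exp (- w0 * v) * \<bar>f v\<bar>))"
      proof (cases "0 < v")
        case True
        have "norm (of_real (f v) * g v) \<le> \<bar>f v\<bar> * (M * exp (- w0 * v))"
          unfolding norm_mult norm_of_real by (intro mult_left_mono g True) auto
        thus ?thesis using M by (simp add: abs_mult mult_ac)
      qed (use laplace_on_nonpos[OF f(1)] in auto)
    qed
  qed
  show i\<phi>: "complex_integrable lborel (\<lambda>v. of_real (h v) * \<phi> v)"
    by (rule int_bound[OF h w0(1)]) (use \<phi>b in auto)
  have ih\<psi>: "complex_integrable lborel (\<lambda>v. of_real (h v) * \<psi> \<tau> v)" if "0 < \<tau>" for \<tau>
    by (rule int_bound[OF h w0(1)]) (use \<psi>b that in auto)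
  have iH\<psi>: "complex_integrable lborel (\<lambda>v. of_real (H \<tau> v) * \<psi> \<tau> v)" if "0 < \<tau>" "r + 1 / \<tau> < w0" for \<tau>
    by (rule int_bound[OF laplace_tendsto_family[OF H that(1)] that(2)]) (use \<psi>b that in auto)
  show "\<forall>\<^sub>F \<tau> in at_top. complex_integrable lborel (\<lambda>v. of_real (H \<tau> v) * \<psi> \<tau> v)"
    using eventually_half_plane[OF w0(1)] by eventually_elim (use iH\<psi> in auto)
  have lim1: "((\<lambda>\<tau>. LINT v|lborel. of_real (h v) * \<psi> \<tau> v) \<longlongrightarrow> (LINT v|lborel. of_real (h v) * \<phi> v)) at_top"
  proof (rule integral_dominated_convergence_at_top[where w = "\<lambda>v. M * (exp (- w0 * v) * \<bar>h v\<bar>)"])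
    show "integrable lborel (\<lambda>v. M * (exp (- w0 * v) * \<bar>h v\<bar>))"
      by (intro integrable_mult_right laplace_on_integrable_abs[OF h] w0)
    show "AE v in lborel. ((\<lambda>\<tau>. of_real (h v) * \<psi> \<tau> v) \<longlongrightarrow> of_real (h v) * \<phi> v) at_top"
    proof (rule AE_I2)
      fix v :: real
      show "((\<lambda>\<tau>. of_real (h v) * \<psi> \<tau> v) \<longlongrightarrow> of_real (h v) * \<phi> v) at_top"
      proof (cases "0 < v")
        case True
        have l1: "((\<lambda>\<tau>. \<tau> * (1 - exp (- v / \<tau>))) \<longlongrightarrow> v) at_top" using True by real_asymp
        have l2: "((\<lambda>\<tau>. exp (- v / \<tau>)) \<longlongrightarrow> 1) at_top" using True by real_asymp
        have "((\<lambda>\<tau>. \<phi> (\<tau> * (1 - exp (- v / \<tau>)))) \<longlongrightarrow> \<phi> v) at_top"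
          using \<phi> by (intro isCont_tendsto_compose[OF _ l1]) (simp add: continuous_on_eq_continuous_at)
        from tendsto_mult[OF tendsto_of_real[OF l2] this] have "((\<lambda>\<tau>. \<psi> \<tau> v) \<longlongrightarrow> \<phi> v) at_top"
          by (simp add: \<psi>_def)
        thus ?thesis by (intro tendsto_mult tendsto_const)
      qed (use laplace_on_nonpos[OF h] in auto)
    qed
    show "\<forall>\<^sub>F \<tau> in at_top. AE v in lborel. norm (of_real (h v) * \<psi> \<tau> v) \<le> M * (exp (- w0 * v) * \<bar>h v\<bar>)"
      using eventually_gt_at_top[of 0]
    proof eventually_elim
      case (elim \<tau>)
      show ?case
      proof (rule AE_I2)
        fix v :: real
        show "norm (of_real (h v) * \<psi> \<tau> v) \<le> M * (exp (- w0 * v) * \<bar>h v\<bar>)"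
        proof (cases "0 < v")
          case True
          have "norm (of_real (h v) * \<psi> \<tau> v) \<le> \<bar>h v\<bar> * (M * exp (- w0 * v))"
            unfolding norm_mult norm_of_real by (intro mult_left_mono \<psi>b True elim) auto
          thus ?thesis by (simp add: mult_ac)
        qed (use laplace_on_nonpos[OF h] in auto)
      qed
    qed
  qed measurable
  have lim2: "((\<lambda>\<tau>. (LINT v|lborel. of_real (H \<tau> v) * \<psi> \<tau> v) - (LINT v|lborel. of_real (h v) * \<psi> \<tau> v)) \<longlongrightarrow> 0) at_top"
  proof (rule Lim_null_comparison)
    show "((\<lambda>\<tau>. M * (LINT v|lborel. exp (- w0 * v) * \<bar>H \<tau> v - h v\<bar>)) \<longlongrightarrow> 0) at_top"
      using tendsto_mult[OF tendsto_const[of M] laplace_tendsto_norm[OF H w0(1)]] by simp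
    show "\<forall>\<^sub>F \<tau> in at_top. norm ((LINT v|lborel. of_real (H \<tau> v) * \<psi> \<tau> v) - (LINT v|lborel. of_real (h v) * \<psi> \<tau> v)) \<le>
       M * (LINT v|lborel. exp (- w0 * v) * \<bar>H \<tau> v - h v\<bar>)"
      using eventually_half_plane[OF w0(1)]
    proof eventually_elim
      case (elim \<tau>)
      hence \<tau>: "0 < \<tau>" "r + 1 / \<tau> < w0" by auto
      have "(LINT v|lborel. of_real (H \<tau> v) * \<psi> \<tau> v) - (LINT v|lborel. of_real (h v) * \<psi> \<tau> v) =
        (LINT v|lborel. of_real (H \<tau> v) * \<psi> \<tau> v - of_real (h v) * \<psi> \<tau> v)"
        by (rule Bochner_Integration.integral_diff[symmetric]) (rule iH\<psi>[OF \<tau>] ih\<psi>[OF \<tau>(1)])+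
      also have "norm \<dots> \<le> (LINT v|lborel. M * (exp (- w0 * v) * \<bar>H \<tau> v - h v\<bar>))"
      proof (rule order.trans[OF integral_norm_bound], rule integral_mono)
        show "integrable lborel (\<lambda>v. norm (of_real (H \<tau> v) * \<psi> \<tau> v - of_real (h v) * \<psi> \<tau> v))"
          by (intro integrable_norm Bochner_Integration.integrable_diff iH\<psi>[OF \<tau>] ih\<psi>[OF \<tau>(1)])
        show "integrable lborel (\<lambda>v. M * (exp (- w0 * v) * \<bar>H \<tau> v - h v\<bar>))"
          by (intro integrable_mult_right laplace_tendsto_diff_integrable[OF H \<tau>])
        fix v :: real
        show "norm (of_real (H \<tau> v) * \<psi> \<tau> v - of_real (h v) * \<psi> \<tau> v) \<le> M * (exp (- w0 * v) * \<bar>H \<tau> v - h v\<bar>)"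
        proof (cases "0 < v")
          case True
          have "norm (of_real (H \<tau> v) * \<psi> \<tau> v - of_real (h v) * \<psi> \<tau> v) = \<bar>H \<tau> v - h v\<bar> * norm (\<psi> \<tau> v)"
            by (simp only: left_diff_distrib[symmetric] norm_mult of_real_diff[symmetric] norm_of_real)
          also have "\<dots> \<le> \<bar>H \<tau> v - h v\<bar> * (M * exp (- w0 * v))"
            by (intro mult_left_mono \<psi>b True \<tau>) auto
          finally show ?thesis by (simp add: mult_ac)
        next
          case False
          thus ?thesis using laplace_on_nonpos[OF h] laplace_on_nonpos[OF laplace_tendsto_family[OF H \<tau>(1)]] by simp
        qed
      qed
      finally show ?case by simp
    qed
  qed
  show "((\<lambda>\<tau>. LINT v|lborel. of_real (H \<tau> v) * \<psi> \<tau> v) \<longlongrightarrow> (LINT v|lborel. of_real (h v) * \<phi> v)) at_top"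
    using tendsto_add[OF lim2 lim1] by simp
qed

text \<open>At the Mellin argument \<tau> z the expression x^(\<tau> z - 1) dx becomes exp(-zv) dv /
  \<tau>.\<close>

lemma
  fixes B :: "real \<Rightarrow> real" and z :: complex
  assumes \<tau>: "0 < \<tau>"
    and m: "(\<lambda>x. indicator {0<..<1} x *\<^sub>R (of_real x powr (of_real \<tau> * z - 1) * complex_of_real (B x))) \<in> borel_measurable borel"
  shows mellin_laplace_integrable: "complex_integrable lborel (\<lambda>x. indicator {0<..<1} x *\<^sub>R (of_real x powr (of_real \<tau> * z - 1) * of_real (B x))) \<longleftrightarrow>
      complex_integrable lborel (\<lambda>v. exp (- z * of_real v) * of_real (indicator {0<..} v * B (exp (- v / \<tau>))))"
    and mellin_laplace: "(LINT x|lborel. indicator {0<..<1} x *\<^sub>R (of_real x powr (of_real \<tau> * z - 1) * of_real (B x))) =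
      of_real (1 / \<tau>) * lap (\<lambda>v. indicator {0<..} v * B (exp (- v / \<tau>))) z"
proof -
  have e: "indicator {0<..} v *\<^sub>R ((exp (- v / \<tau>) / \<tau>) *\<^sub>R (of_real (exp (- v / \<tau>)) powr (of_real \<tau> * z - 1) * complex_of_real (B (exp (- v / \<tau>))))) =
     of_real (1 / \<tau>) * (exp (- z * of_real v) * of_real (indicator {0<..} v * B (exp (- v / \<tau>))))" for v
  proof -
    have "complex_of_real (exp (- v / \<tau>)) powr (of_real \<tau> * z - 1) = exp ((of_real \<tau> * z - 1) * of_real (- v / \<tau>))"
      by (simp add: powr_def Ln_of_real)
    moreover have "complex_of_real (exp (- v / \<tau>)) * exp ((of_real \<tau> * z - 1) * of_real (- v / \<tau>)) = exp (- z * of_real v)"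
      unfolding exp_of_real[symmetric] by (subst mult_exp_exp) (use \<tau> in \<open>simp add: field_simps\<close>)
    ultimately have "complex_of_real (exp (- v / \<tau>)) * complex_of_real (exp (- v / \<tau>)) powr (of_real \<tau> * z - 1) = exp (- z * of_real v)"
      by simp
    thus ?thesis using \<tau> by (auto simp: indicator_def scaleR_conv_of_real field_simps)
  qed
  have "complex_integrable lborel (\<lambda>x. indicator {0<..<1} x *\<^sub>R (of_real x powr (of_real \<tau> * z - 1) * of_real (B x))) \<longleftrightarrow>
    complex_integrable lborel (\<lambda>v. of_real (1 / \<tau>) * (exp (- z * of_real v) * of_real (indicator {0<..} v * B (exp (- v / \<tau>)))))"
    unfolding integrable_exp_substitution[OF \<tau> m] e ..
  also have "\<dots> \<longleftrightarrow> complex_integrable lborel (\<lambda>v. exp (- z * of_real v) * of_real (indicator {0<..} v * B (exp (- v / \<tau>))))"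
    by (rule integrable_cmult_iff) (use \<tau> in simp)
  finally show "complex_integrable lborel (\<lambda>x. indicator {0<..<1} x *\<^sub>R (of_real x powr (of_real \<tau> * z - 1) * of_real (B x))) \<longleftrightarrow>
      complex_integrable lborel (\<lambda>v. exp (- z * of_real v) * of_real (indicator {0<..} v * B (exp (- v / \<tau>))))" .
  show "(LINT x|lborel. indicator {0<..<1} x *\<^sub>R (of_real x powr (of_real \<tau> * z - 1) * of_real (B x))) =
      of_real (1 / \<tau>) * lap (\<lambda>v. indicator {0<..} v * B (exp (- v / \<tau>))) z"
    unfolding integral_exp_substitution[OF \<tau> m] e lap_def by (rule integral_mult_right_zero)
qed

context gamma_system
begin

section \<open>The gamma quotients in the scaled variable\<close>

text \<open>Up to a power of \<tau> this is the gamma quotient of the Mellin transform at \<tau> z.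
  Each factor is the transform of a beta kernel with s = \<rho>_h - 1/\<tau>, because a_h =
  \<tau>(\<rho>_h - 1/\<tau>).\<close>

definition T :: "real \<Rightarrow> (nat \<Rightarrow> nat) \<Rightarrow> complex \<Rightarrow> complex" where
  "T \<tau> m z = (\<Prod>h=1..q. of_real (\<tau> powr (d h + real (m h))) * Gamma (of_real \<tau> * (z + of_real (\<rho> h - 1 / \<tau>)))
     * rGamma (of_real \<tau> * (z + of_real (\<rho> h - 1 / \<tau>)) + of_real (d h + real (m h))))"

text \<open>The recurrence rGamma(w) = w rGamma(w + 1) at w = \<tau>(z + \<rho>_h) + d_h + m_h - 2;
  the factor \<tau> taken out of w adjusts the power of \<tau>.\<close>

lemma T_lower:
  assumes h: "h \<in> {1..q}" "0 < m h" and \<tau>: "0 < \<tau>"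
  shows "T \<tau> (m(h := m h - 1)) z = (z + of_real (\<rho> h + (d h + real (m h) - 2) / \<tau>)) * T \<tau> m z"
proof -
  define t where "t = (\<lambda>k a. of_real (\<tau> powr a) * Gamma (of_real \<tau> * (z + of_real (\<rho> k - 1 / \<tau>)))
     * rGamma (of_real \<tau> * (z + of_real (\<rho> k - 1 / \<tau>)) + of_real a))"
  have T: "T \<tau> m z = (\<Prod>k=1..q. t k (d k + real (m k)))" for m by (simp only: T_def t_def)
  have t: "t h (d h + real (m h - 1)) = (z + of_real (\<rho> h + (d h + real (m h) - 2) / \<tau>)) * t h (d h + real (m h))"
  proof -
    define w where "w = of_real \<tau> * (z + of_real (\<rho> h - 1 / \<tau>)) + complex_of_real (d h + real (m h - 1))"
    have m: "d h + real (m h) = (d h + real (m h - 1)) + 1" using h by simp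
    have "rGamma w = w * rGamma (w + 1)" by (rule rGamma_plus1[symmetric])
    also have "w + 1 = of_real \<tau> * (z + of_real (\<rho> h - 1 / \<tau>)) + complex_of_real (d h + real (m h))"
      unfolding w_def m by simp
    finally have r: "rGamma w = w * rGamma (of_real \<tau> * (z + of_real (\<rho> h - 1 / \<tau>)) + complex_of_real (d h + real (m h)))" .
    have "\<tau> powr (d h + real (m h)) = \<tau> powr (d h + real (m h - 1)) * \<tau>"
      unfolding m powr_add using \<tau> by simp
    moreover have "w = of_real \<tau> * (z + of_real (\<rho> h + (d h + real (m h) - 2) / \<tau>))"
      using \<tau> h unfolding w_def by (simp add: of_nat_diff field_simps)
    ultimately show ?thesis unfolding t_def w_def[symmetric] r by simp
  qed
  have "T \<tau> (m(h := m h - 1)) z = t h (d h + real (m h - 1)) * (\<Prod>k\<in>{1..q} - {h}. t k (d k + real (m k)))"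
    unfolding T using h by (subst prod.remove[of _ h]) (auto intro!: arg_cong2[where f = "(*)"] prod.cong)
  moreover have "T \<tau> m z = t h (d h + real (m h)) * (\<Prod>k\<in>{1..q} - {h}. t k (d k + real (m k)))"
    unfolding T by (rule prod.remove) (use h in auto)
  ultimately show ?thesis using t by simp
qed

lemma edge_shift_iff: "0 < \<tau> \<Longrightarrow> edge + 1 / \<tau> < x \<longleftrightarrow> (\<forall>h\<in>{1..q}. - (\<rho> h - 1 / \<tau>) < x)"
  using edge_less_iff[of "x - 1 / \<tau>"] by (auto simp: algebra_simps)

text \<open>A factor \<eta> - z is a real coefficient minus the factor of \<open>T_lower\<close>, so
  the new family is a combination of those for \<open>m\<close> and for \<open>m\<close> with one
  entry lowered. The coefficient tends to \<eta>0 + \<rho>_h, and the limits combine in the same way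
  through \<open>P_lower\<close>. Each factor costs one unit of |m|, hence the bound on the
  cardinality and the induction over all m.\<close>

lemma scaled_family:
  assumes "finite I" "card I < msize q m" and "\<And>i. i \<in> I \<Longrightarrow> (\<eta> i \<longlongrightarrow> \<eta>0 i) at_top"
  shows "\<exists>H h. laplace_tendsto edge H h \<and>
     (\<forall>\<tau> z. 0 < \<tau> \<longrightarrow> edge + 1 / \<tau> < Re z \<longrightarrow> lap (H \<tau>) z = (\<Prod>i\<in>I. of_real (\<eta> i \<tau>) - z) * T \<tau> m z) \<and>
     (\<forall>z. edge < Re z \<longrightarrow> lap h z = (\<Prod>i\<in>I. of_real (\<eta>0 i) - z) * P m z)"
  using assms
proof (induction I arbitrary: m rule: finite_induct)
  case empty
  let ?F = "\<lambda>\<tau> h. beta_kernel \<tau> (\<rho> h - 1 / \<tau>) (d h + real (m h))"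
  have A: "0 < d h + real (m h)" if "h \<in> {1..q}" for h using d[OF that] by simp
  have tend: "laplace_tendsto edge (\<lambda>\<tau>. iter_conv q (?F \<tau>)) (iter_conv q (\<lambda>h. gamma_kernel (\<rho> h) (d h + real (m h))))"
  proof (rule laplace_tendsto_iter_conv[OF q])
    fix h assume h: "h \<in> {1..q}"
    have "((\<lambda>\<tau>. \<rho> h - 1 / \<tau>) \<longlongrightarrow> \<rho> h) at_top" by real_asymp
    hence "laplace_tendsto (- \<rho> h) (\<lambda>\<tau>. ?F \<tau> h) (gamma_kernel (\<rho> h) (d h + real (m h)))"
      by (rule laplace_tendsto_beta_kernel[OF A[OF h]]) simp
    thus "laplace_tendsto edge (\<lambda>\<tau>. ?F \<tau> h) (gamma_kernel (\<rho> h) (d h + real (m h)))"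
      by (rule laplace_tendsto_mono) (rule edge_ge[OF h])
  qed
  moreover have "lap (iter_conv q (?F \<tau>)) z = T \<tau> m z" if \<tau>: "0 < \<tau>" and z: "edge + 1 / \<tau> < Re z" for \<tau> z
  proof -
    have "lap (iter_conv q (?F \<tau>)) z = (\<Prod>h=1..q. lap (?F \<tau> h) z)"
    proof (rule lap_iter_conv[OF q _ z])
      fix h assume h: "h \<in> {1..q}"
      show "laplace_on (edge + 1 / \<tau>) (?F \<tau> h)"
        by (rule laplace_on_mono[OF laplace_on_beta_kernel[OF \<tau> A[OF h]]]) (use edge_ge[OF h] in simp)
    qed
    also have "\<dots> = T \<tau> m z"
      unfolding T_def using z \<tau> by (intro prod.cong refl lap_beta_kernel A) (auto simp: edge_shift_iff)
    finally show ?thesis .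
  qed
  moreover have "lap (iter_conv q (\<lambda>h. gamma_kernel (\<rho> h) (d h + real (m h)))) z = P m z" if "edge < Re z" for z
    using lap_conv_gamma(2)[OF A that] by (simp only: P_def)
  ultimately show ?case
    by (intro exI[of _ "\<lambda>\<tau>. iter_conv q (?F \<tau>)"] exI[of _ "iter_conv q (\<lambda>h. gamma_kernel (\<rho> h) (d h + real (m h)))"]) simp
next
  case (insert i I)
  have "\<exists>h\<in>{1..q}. 0 < m h"
  proof (rule ccontr)
    assume "\<not> ?thesis" hence "msize q m = 0" by (auto simp: msize_def)
    thus False using insert.prems by simp
  qed
  then obtain h where h: "h \<in> {1..q}" "0 < m h" by blast
  define m' where "m' = m(h := m h - 1)"
  have ms: "msize q m = Suc (msize q m')" unfolding m'_def by (rule msize_lower[of h m, OF h])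
  have c1: "card I < msize q m" and c2: "card I < msize q m'" using insert ms by auto
  obtain H1 h1 where 1: "laplace_tendsto edge H1 h1"
     "\<And>\<tau> z. 0 < \<tau> \<Longrightarrow> edge + 1 / \<tau> < Re z \<Longrightarrow> lap (H1 \<tau>) z = (\<Prod>i\<in>I. of_real (\<eta> i \<tau>) - z) * T \<tau> m z"
     "\<And>z. edge < Re z \<Longrightarrow> lap h1 z = (\<Prod>i\<in>I. of_real (\<eta>0 i) - z) * P m z"
    using insert.IH[OF c1] insert.prems by auto
  obtain H2 h2 where 2: "laplace_tendsto edge H2 h2"
     "\<And>\<tau> z. 0 < \<tau> \<Longrightarrow> edge + 1 / \<tau> < Re z \<Longrightarrow> lap (H2 \<tau>) z = (\<Prod>i\<in>I. of_real (\<eta> i \<tau>) - z) * T \<tau> m' z"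
     "\<And>z. edge < Re z \<Longrightarrow> lap h2 z = (\<Prod>i\<in>I. of_real (\<eta>0 i) - z) * P m' z"
    using insert.IH[OF c2] insert.prems by auto
  define c where "c = (\<lambda>\<tau>. \<eta> i \<tau> + (\<rho> h + (d h + real (m h) - 2) / \<tau>))"
  have "((\<lambda>\<tau>. \<rho> h + (d h + real (m h) - 2) / \<tau>) \<longlongrightarrow> \<rho> h) at_top" by real_asymp
  hence c: "(c \<longlongrightarrow> \<eta>0 i + \<rho> h) at_top" unfolding c_def using insert.prems by (intro tendsto_add) auto
  define H where "H = (\<lambda>\<tau> y. c \<tau> * H1 \<tau> y + (-1) * H2 \<tau> y)"
  define h' where "h' = (\<lambda>y. (\<eta>0 i + \<rho> h) * h1 y + (-1) * h2 y)"
  have "laplace_tendsto edge H h'"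
    unfolding H_def h'_def by (intro laplace_tendsto_add laplace_tendsto_cmult 1 2 c tendsto_const)
  moreover have "lap (H \<tau>) z = (\<Prod>i\<in>insert i I. of_real (\<eta> i \<tau>) - z) * T \<tau> m z"
    if \<tau>: "0 < \<tau>" and z: "edge + 1 / \<tau> < Re z" for \<tau> z
  proof -
    have "lap (H \<tau>) z = of_real (c \<tau>) * lap (H1 \<tau>) z + of_real (-1) * lap (H2 \<tau>) z"
      unfolding H_def
      by (subst lap_add[OF _ _ z], (intro laplace_on_cmult laplace_tendsto_family[OF 1(1) \<tau>] laplace_tendsto_family[OF 2(1) \<tau>])+)
         (simp only: lap_cmult)
    also have "\<dots> = (\<Prod>i\<in>I. of_real (\<eta> i \<tau>) - z) * (of_real (c \<tau>) * T \<tau> m z - T \<tau> m' z)"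
      by (simp add: 1(2)[OF \<tau> z] 2(2)[OF \<tau> z] algebra_simps)
    also have "T \<tau> m' z = (z + of_real (\<rho> h + (d h + real (m h) - 2) / \<tau>)) * T \<tau> m z"
      unfolding m'_def by (rule T_lower[of h m, OF h \<tau>])
    also have "of_real (c \<tau>) * T \<tau> m z - (z + of_real (\<rho> h + (d h + real (m h) - 2) / \<tau>)) * T \<tau> m z = (of_real (\<eta> i \<tau>) - z) * T \<tau> m z"
      unfolding c_def of_real_add[of "\<eta> i \<tau>"] by (simp only: left_diff_distrib distrib_right) simp
    finally show ?thesis using insert by (simp add: mult_ac)
  qed
  moreover have "lap h' z = (\<Prod>i\<in>insert i I. of_real (\<eta>0 i) - z) * P m z" if z: "edge < Re z" for z
  proof -
    have "lap h' z = of_real (\<eta>0 i + \<rho> h) * lap h1 z + of_real (-1) * lap h2 z"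
      unfolding h'_def
      by (subst lap_add[OF _ _ z], (intro laplace_on_cmult laplace_tendsto_on[OF 1(1)] laplace_tendsto_on[OF 2(1)])+)
         (simp only: lap_cmult)
    also have "\<dots> = (\<Prod>i\<in>I. of_real (\<eta>0 i) - z) * (of_real (\<eta>0 i + \<rho> h) * P m z - P m' z)"
      by (simp add: 1(3)[OF z] 2(3)[OF z] algebra_simps)
    also have "P m' z = (z + of_real (\<rho> h)) * P m z" unfolding m'_def by (rule P_lower[of h m z, OF h z])
    finally show ?thesis using insert by (simp add: algebra_simps)
  qed
  ultimately show ?case by blast
qed

section \<open>Mellin transforms rewritten as Laplace transforms\<close>

definition scaled_B :: "real \<Rightarrow> (real \<Rightarrow> real) \<Rightarrow> real \<Rightarrow> real" where
  "scaled_B \<tau> B v = indicator {0<..} v * (\<tau> powr (\<Sum>h=1..q. d h) * B (exp (- v / \<tau>)))"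

text \<open>At the argument \<alpha>_i + 1 - \<tau> z the Pochhammer symbol of length n_i has the
  factors \<tau>(\<xi>_i + (1 + s)/\<tau> - z), s < n_i.\<close>

definition factor :: "(nat \<Rightarrow> real) \<Rightarrow> nat \<times> nat \<Rightarrow> real \<Rightarrow> real" where
  "factor \<xi> = (\<lambda>(i, s) \<tau>. \<xi> i + (1 + real s) / \<tau>)"

text \<open>The powers of \<tau> add up to -(D + |m|) + |n| = -D - 1. The part -D is what the
  normalisation removes, and the remaining 1/\<tau> is the Jacobian of the substitution.\<close>

lemma jacobi_value:
  assumes \<tau>: "0 < \<tau>" and bal: "msize q m = msize p n + 1"
  shows "(\<Prod>h=1..q. Gamma (of_real \<tau> * z + of_real (\<tau> * \<rho> h - 1)) / Gamma (of_real \<tau> * z + of_real (\<tau> * \<rho> h + d h - 1) + of_nat (m h)))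
     * (\<Prod>i=1..p. pochhammer (of_real (\<tau> * \<xi> i) + 1 - of_real \<tau> * z) (n i)) =
    of_real (\<tau> powr (- (\<Sum>h=1..q. d h) - 1)) * ((\<Prod>x\<in>(SIGMA i:{1..p}. {..<n i}). of_real (factor \<xi> x \<tau>) - z) * T \<tau> m z)"
proof -
  have 1: "(\<Prod>h=1..q. Gamma (of_real \<tau> * z + of_real (\<tau> * \<rho> h - 1)) / Gamma (of_real \<tau> * z + of_real (\<tau> * \<rho> h + d h - 1) + of_nat (m h)))
     = of_real (\<tau> powr (- (\<Sum>h=1..q. d h) - real (msize q m))) * T \<tau> m z"
  proof -
    have "of_real (\<tau> powr (- (\<Sum>h=1..q. d h) - real (msize q m))) = (\<Prod>h=1..q. complex_of_real (\<tau> powr (- (d h + real (m h)))))"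
    proof -
      have "- (\<Sum>h=1..q. d h) - real (msize q m) = (\<Sum>h=1..q. - (d h + real (m h)))"
        by (simp add: msize_def sum_negf sum.distrib sum_subtractf)
      thus ?thesis using \<tau> by (simp only: powr_sum of_real_prod)
    qed
    moreover have "Gamma (of_real \<tau> * z + of_real (\<tau> * \<rho> h - 1)) / Gamma (of_real \<tau> * z + of_real (\<tau> * \<rho> h + d h - 1) + of_nat (m h)) =
       of_real (\<tau> powr (- (d h + real (m h)))) * (of_real (\<tau> powr (d h + real (m h))) * Gamma (of_real \<tau> * (z + of_real (\<rho> h - 1 / \<tau>)))
         * rGamma (of_real \<tau> * (z + of_real (\<rho> h - 1 / \<tau>)) + of_real (d h + real (m h))))" for h
    proof -
      have a: "of_real \<tau> * z + of_real (\<tau> * \<rho> h - 1) = of_real \<tau> * (z + of_real (\<rho> h - 1 / \<tau>))"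
        using \<tau> by (simp add: field_simps)
      have b: "of_real \<tau> * z + of_real (\<tau> * \<rho> h + d h - 1) + of_nat (m h) = of_real \<tau> * (z + of_real (\<rho> h - 1 / \<tau>)) + complex_of_real (d h + real (m h))"
        using \<tau> by (simp add: field_simps)
      have c: "complex_of_real (\<tau> powr (- (d h + real (m h)))) * of_real (\<tau> powr (d h + real (m h))) = 1"
        unfolding of_real_mult[symmetric] powr_add[symmetric] using \<tau> by simp
      show ?thesis unfolding a b rGamma_inverse_Gamma divide_inverse mult.assoc[symmetric] c by simp
    qed
    ultimately show ?thesis unfolding T_def by (simp only: prod.distrib[symmetric])
  qed
  have 2: "(\<Prod>i=1..p. pochhammer (of_real (\<tau> * \<xi> i) + 1 - of_real \<tau> * z) (n i)) =
     of_real (\<tau> ^ msize p n) * (\<Prod>x\<in>(SIGMA i:{1..p}. {..<n i}). of_real (factor \<xi> x \<tau>) - z)"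
  proof -
    have "pochhammer (of_real (\<tau> * \<xi> i) + 1 - of_real \<tau> * z) (n i) = of_real (\<tau> ^ n i) * (\<Prod>s\<in>{..<n i}. of_real (factor \<xi> (i, s) \<tau>) - z)" for i
    proof -
      have "pochhammer (of_real (\<tau> * \<xi> i) + 1 - of_real \<tau> * z) (n i) = (\<Prod>s\<in>{..<n i}. of_real \<tau> * (of_real (factor \<xi> (i, s) \<tau>) - z))"
        unfolding pochhammer_prod atLeast0LessThan using \<tau> by (intro prod.cong refl) (simp add: factor_def field_simps)
      thus ?thesis by (simp add: prod.distrib)
    qed
    hence "(\<Prod>i=1..p. pochhammer (of_real (\<tau> * \<xi> i) + 1 - of_real \<tau> * z) (n i)) =
       (\<Prod>i=1..p. of_real (\<tau> ^ n i)) * (\<Prod>i=1..p. \<Prod>s\<in>{..<n i}. of_real (factor \<xi> (i, s) \<tau>) - z)"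
      by (simp only: prod.distrib)
    also have "(\<Prod>i=1..p. \<Prod>s\<in>{..<n i}. of_real (factor \<xi> (i, s) \<tau>) - z) = (\<Prod>x\<in>(SIGMA i:{1..p}. {..<n i}). of_real (factor \<xi> x \<tau>) - z)"
      by (subst prod.Sigma) (auto simp: case_prod_unfold)
    also have "(\<Prod>i=1..p. complex_of_real (\<tau> ^ n i)) = of_real (\<tau> ^ msize p n)"
      unfolding msize_def power_sum of_real_prod ..
    finally show ?thesis .
  qed
  have 3: "complex_of_real (\<tau> powr (- (\<Sum>h=1..q. d h) - real (msize q m))) * of_real (\<tau> ^ msize p n) = of_real (\<tau> powr (- (\<Sum>h=1..q. d h) - 1))"
  proof -
    have "\<tau> powr (- (\<Sum>h=1..q. d h) - real (msize q m)) * \<tau> ^ msize p n = \<tau> powr (- (\<Sum>h=1..q. d h) - real (msize q m) + real (msize p n))"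
      using \<tau> by (simp only: powr_realpow[symmetric] powr_add)
    thus ?thesis unfolding of_real_mult[symmetric] using bal by simp
  qed
  show ?thesis unfolding 1 2 3[symmetric] by (simp only: mult_ac)
qed

lemma jacobi_half_plane:
  assumes \<tau>: "0 < \<tau>"
  shows "(\<forall>h\<in>{1..q}. - (\<tau> * \<rho> h - 1) < Re (of_real \<tau> * z)) \<longleftrightarrow> edge + 1 / \<tau> < Re z"
proof -
  have "- (\<tau> * \<rho> h - 1) < Re (of_real \<tau> * z) \<longleftrightarrow> - (\<rho> h - 1 / \<tau>) < Re z" for h
    using \<tau> by (simp add: field_simps)
  thus ?thesis unfolding edge_shift_iff[OF \<tau>] by simp
qed

lemma lap_scaled_B:
  "lap (scaled_B \<tau> B) z = of_real (\<tau> powr (\<Sum>h=1..q. d h)) * lap (\<lambda>v. indicator {0<..} v * B (exp (- v / \<tau>))) z"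
  unfolding scaled_B_def lap_cmult[symmetric] by (simp only: mult_ac)

text \<open>The powers of \<tau> cancel as D + 1 + (-D - 1) = 0, so up to sign the rescaled function
  has exactly the transform of the family from \<open>scaled_family\<close>.\<close>

lemma is_jacobi_B_laplace:
  assumes \<tau>: "0 < \<tau>" and bal: "msize q m = msize p n + 1"
    and B: "is_jacobi_B p q (\<lambda>h. \<tau> * \<rho> h - 1) (\<lambda>h. \<tau> * \<rho> h + d h - 1) (\<lambda>i. \<tau> * \<xi> i) n m B"
  shows "laplace_on (edge + 1 / \<tau>) (scaled_B \<tau> B)"
    and "edge + 1 / \<tau> < Re z \<Longrightarrow> lap (scaled_B \<tau> B) z = - ((\<Prod>x\<in>(SIGMA i:{1..p}. {..<n i}). of_real (factor \<xi> x \<tau>) - z) * T \<tau> m z)"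
proof -
  let ?f = "\<lambda>z x. indicator {0<..<1} x *\<^sub>R (complex_of_real x powr (of_real \<tau> * z - 1) * of_real (B x))"
  let ?b = "\<lambda>v. indicator {0<..} v * B (exp (- v / \<tau>))"
  let ?D = "\<Sum>h=1..q. d h"
  have int: "complex_integrable lborel (?f z)"
    and val: "(LINT x|lborel. ?f z x) = - (of_real (\<tau> powr (- ?D - 1)) * ((\<Prod>x\<in>(SIGMA i:{1..p}. {..<n i}). of_real (factor \<xi> x \<tau>) - z) * T \<tau> m z))"
    if z: "edge + 1 / \<tau> < Re z" for z
    using B z unfolding is_jacobi_B_def jacobi_half_plane[OF \<tau>, symmetric] has_lebesgue_integral_on_def set_integrable_def set_lebesgue_integral_def
      jacobi_value[OF \<tau> bal, symmetric] by blast+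
  have m: "?f z \<in> borel_measurable borel" if "edge + 1 / \<tau> < Re z" for z
    using borel_measurable_integrable[OF int[OF that]] by simp
  have "laplace_on (edge + 1 / \<tau>) ?b"
    by (rule laplace_onI_complex) (use mellin_laplace_integrable[OF \<tau> m] int in auto)
  from laplace_on_cmult[OF this, of "\<tau> powr ?D"] show "laplace_on (edge + 1 / \<tau>) (scaled_B \<tau> B)"
    unfolding scaled_B_def by (simp only: mult_ac)
  assume z: "edge + 1 / \<tau> < Re z"
  have "lap ?b z = of_real \<tau> * (of_real (1 / \<tau>) * lap ?b z)" using \<tau> by simp
  also have "of_real (1 / \<tau>) * lap ?b z = - (of_real (\<tau> powr (- ?D - 1)) * ((\<Prod>x\<in>(SIGMA i:{1..p}. {..<n i}). of_real (factor \<xi> x \<tau>) - z) * T \<tau> m z))"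
    unfolding mellin_laplace[OF \<tau> m[OF z], symmetric] by (rule val[OF z])
  finally have l: "lap ?b z = of_real \<tau> * - (of_real (\<tau> powr (- ?D - 1)) * ((\<Prod>x\<in>(SIGMA i:{1..p}. {..<n i}). of_real (factor \<xi> x \<tau>) - z) * T \<tau> m z))" .
  have one: "complex_of_real (\<tau> powr ?D) * (of_real \<tau> * of_real (\<tau> powr (- ?D - 1))) = 1"
  proof -
    have "\<tau> powr ?D * (\<tau> * \<tau> powr (- ?D - 1)) = \<tau> powr (?D + (1 + (- ?D - 1)))"
      unfolding powr_add using \<tau> by simp
    thus ?thesis unfolding of_real_mult[symmetric] using \<tau> by simp
  qed
  have "lap (scaled_B \<tau> B) z = - ((complex_of_real (\<tau> powr ?D) * (of_real \<tau> * of_real (\<tau> powr (- ?D - 1)))) * ((\<Prod>x\<in>(SIGMA i:{1..p}. {..<n i}). of_real (factor \<xi> x \<tau>) - z) * T \<tau> m z))"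
    unfolding lap_scaled_B l by simp
  thus "lap (scaled_B \<tau> B) z = - ((\<Prod>x\<in>(SIGMA i:{1..p}. {..<n i}). of_real (factor \<xi> x \<tau>) - z) * T \<tau> m z)"
    unfolding one by simp
qed

text \<open>The substitution is run backwards on a member of the constructed family; the convergence
  statements are thereby not void.\<close>

lemma is_jacobi_B_exists:
  assumes \<tau>: "0 < \<tau>" and bal: "msize q m = msize p n + 1"
    and H: "laplace_on (edge + 1 / \<tau>) H"
    and lH: "\<And>z. edge + 1 / \<tau> < Re z \<Longrightarrow> lap H z = (\<Prod>x\<in>(SIGMA i:{1..p}. {..<n i}). of_real (factor \<xi> x \<tau>) - z) * T \<tau> m z"
  shows "is_jacobi_B p q (\<lambda>h. \<tau> * \<rho> h - 1) (\<lambda>h. \<tau> * \<rho> h + d h - 1) (\<lambda>i. \<tau> * \<xi> i) n m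
     (\<lambda>x. - (\<tau> powr (- (\<Sum>h=1..q. d h))) * H (- \<tau> * ln x))"
proof -
  let ?D = "\<Sum>h=1..q. d h"
  define B where "B = (\<lambda>x. - (\<tau> powr (- ?D)) * H (- \<tau> * ln x))"
  have [measurable]: "H \<in> borel_measurable borel" by (rule laplace_on_measurable[OF H])
  have [measurable]: "B \<in> borel_measurable borel" unfolding B_def by measurable
  have b: "indicator {0<..} v * B (exp (- v / \<tau>)) = - (\<tau> powr (- ?D)) * H v" for v
    using \<tau> laplace_on_nonpos[OF H, of v] by (cases "0 < v") (auto simp: B_def)
  have "is_jacobi_B p q (\<lambda>h. \<tau> * \<rho> h - 1) (\<lambda>h. \<tau> * \<rho> h + d h - 1) (\<lambda>i. \<tau> * \<xi> i) n m B"
    unfolding is_jacobi_B_def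
  proof (intro allI impI)
    fix Z :: complex assume Z: "\<forall>h\<in>{1..q}. - (\<tau> * \<rho> h - 1) < Re Z"
    define z where "z = Z / of_real \<tau>"
    have Zz: "Z = of_real \<tau> * z" using \<tau> by (simp add: z_def)
    have z: "edge + 1 / \<tau> < Re z" using Z unfolding Zz jacobi_half_plane[OF \<tau>] .
    let ?f = "\<lambda>x. indicator {0<..<1} x *\<^sub>R (complex_of_real x powr (of_real \<tau> * z - 1) * of_real (B x))"
    have m: "?f \<in> borel_measurable borel"
    proof -
      have "?f = (\<lambda>x. indicator {0<..<1} x *\<^sub>R (exp ((of_real \<tau> * z - 1) * of_real (ln x)) * complex_of_real (B x)))"
        by (auto simp: fun_eq_iff indicator_def powr_def Ln_of_real)
      also have "\<dots> \<in> borel_measurable borel" by measurable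
      finally show ?thesis .
    qed
    have "laplace_on (edge + 1 / \<tau>) (\<lambda>v. indicator {0<..} v * B (exp (- v / \<tau>)))"
      unfolding b by (rule laplace_on_cmult[OF H])
    hence int: "complex_integrable lborel ?f"
      unfolding mellin_laplace_integrable[OF \<tau> m] by (rule lap_integrable[OF _ z])
    have "(LINT x|lborel. ?f x) = of_real (1 / \<tau>) * (of_real (- (\<tau> powr (- ?D))) * ((\<Prod>x\<in>(SIGMA i:{1..p}. {..<n i}). of_real (factor \<xi> x \<tau>) - z) * T \<tau> m z))"
      unfolding mellin_laplace[OF \<tau> m] b lap_cmult lH[OF z] ..
    also have "\<dots> = - (of_real (1 / \<tau> * \<tau> powr (- ?D)) * ((\<Prod>x\<in>(SIGMA i:{1..p}. {..<n i}). of_real (factor \<xi> x \<tau>) - z) * T \<tau> m z))"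
      by simp
    also have "1 / \<tau> * \<tau> powr (- ?D) = \<tau> powr (- ?D - 1)"
      using \<tau> by (simp add: powr_diff)
    finally have val: "(LINT x|lborel. ?f x) = - (of_real (\<tau> powr (- ?D - 1)) * ((\<Prod>x\<in>(SIGMA i:{1..p}. {..<n i}). of_real (factor \<xi> x \<tau>) - z) * T \<tau> m z))" .
    show "has_lebesgue_integral_on (\<lambda>x. of_real x powr (Z - 1) * of_real (B x))
       (- ((\<Prod>h=1..q. Gamma (Z + of_real (\<tau> * \<rho> h - 1)) / Gamma (Z + of_real (\<tau> * \<rho> h + d h - 1) + of_nat (m h))) *
           (\<Prod>i=1..p. pochhammer (of_real (\<tau> * \<xi> i) + 1 - Z) (n i)))) {0<..<1}"
      unfolding has_lebesgue_integral_on_def set_integrable_def set_lebesgue_integral_def Zz jacobi_value[OF \<tau> bal]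
      using int val by blast
  qed
  thus ?thesis by (simp only: B_def)
qed

text \<open>The factors are indexed by the pairs (i, s) with s < n_i; in the limit those with the
  same i merge into the power of \<xi>_i - z.\<close>

lemma factor_family:
  assumes bal: "msize q m = msize p n + 1"
  obtains H h where "laplace_tendsto edge H h"
     "\<And>\<tau> z. 0 < \<tau> \<Longrightarrow> edge + 1 / \<tau> < Re z \<Longrightarrow> lap (H \<tau>) z = (\<Prod>x\<in>(SIGMA i:{1..p}. {..<n i}). of_real (factor \<xi> x \<tau>) - z) * T \<tau> m z"
     "\<And>z. edge < Re z \<Longrightarrow> lap h z = (\<Prod>i=1..p. (of_real (\<xi> i) - z) ^ n i) * P m z"
proof -
  let ?I = "SIGMA i:{1..p}. {..<n i}"
  have card: "card ?I < msize q m" using bal by (simp add: msize_def)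
  have lim: "(factor \<xi> x \<longlongrightarrow> \<xi> (fst x)) at_top" for x
    unfolding factor_def case_prod_unfold by real_asymp
  have pr: "(\<Prod>x\<in>?I. of_real (\<xi> (fst x)) - z) = (\<Prod>i=1..p. (of_real (\<xi> i) - z) ^ n i)" for z :: complex
  proof -
    have "(\<Prod>i=1..p. \<Prod>s\<in>{..<n i}. of_real (\<xi> i) - z) = (\<Prod>(i, s)\<in>?I. of_real (\<xi> i) - z)"
      by (rule prod.Sigma) auto
    thus ?thesis by (simp add: case_prod_unfold)
  qed
  show thesis using scaled_family[of ?I m "factor \<xi>" "\<lambda>x. \<xi> (fst x)"] card lim pr that by auto
qed

lemma jacobi_B_eventually_exists:
  assumes bal: "msize q m = msize p n + 1"
  shows "\<forall>\<^sub>F \<tau> in at_top. \<exists>BJ. is_jacobi_B p q (\<lambda>h. \<tau> * \<rho> h - 1) (\<lambda>h. \<tau> * \<rho> h + d h - 1) (\<lambda>i. \<tau> * \<xi> i) n m BJ"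
proof -
  obtain H h where H: "laplace_tendsto edge H h"
     "\<And>\<tau> z. 0 < \<tau> \<Longrightarrow> edge + 1 / \<tau> < Re z \<Longrightarrow> lap (H \<tau>) z = (\<Prod>x\<in>(SIGMA i:{1..p}. {..<n i}). of_real (factor \<xi> x \<tau>) - z) * T \<tau> m z"
    by (rule factor_family[OF bal, where \<xi> = \<xi>]) blast
  show ?thesis using eventually_gt_at_top[of 0]
  proof eventually_elim
    case (elim \<tau>)
    from is_jacobi_B_exists[OF elim bal laplace_tendsto_family[OF H(1) elim] H(2)[OF elim]] show ?case by blast
  qed
qed

text \<open>By uniqueness of the transform the given functions agree almost everywhere with the
  constructed family and its limit, and integrals do not see the difference. The growth rate w >
  \<open>edge\<close> of \<phi> covers bounded test functions as well as the weights of the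
  moments.\<close>

lemma jacobi_B_convergence:
  fixes \<phi> :: "real \<Rightarrow> complex"
  assumes bal: "msize q m = msize p n + 1" and e0: "edge < 0"
    and B: "is_LII_B p q d \<rho> \<xi> n m B"
    and BJ: "\<forall>\<^sub>F \<tau> in at_top. is_jacobi_B p q (\<lambda>h. \<tau> * \<rho> h - 1) (\<lambda>h. \<tau> * \<rho> h + d h - 1) (\<lambda>i. \<tau> * \<xi> i) n m (BJ \<tau>)"
    and \<phi>: "continuous_on UNIV \<phi>" and w: "edge < w" and b: "\<And>y. 0 \<le> y \<Longrightarrow> norm (\<phi> y) \<le> M * exp (- w * y)"
  defines "BE \<equiv> \<lambda>y. indicator {0<..} y * B y"
    and "BJE \<equiv> \<lambda>\<tau> y. indicator {0<..<\<tau>} y * (\<tau> powr (\<Sum>h=1..q. d h) * BJ \<tau> (1 - y / \<tau>))"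
  shows "\<forall>\<^sub>F \<tau> in at_top. complex_integrable lborel (\<lambda>y. of_real (BJE \<tau> y) * \<phi> y)"
    and "complex_integrable lborel (\<lambda>y. of_real (BE y) * \<phi> y)"
    and "((\<lambda>\<tau>. LINT y|lborel. of_real (BJE \<tau> y) * \<phi> y) \<longlongrightarrow> (LINT y|lborel. of_real (BE y) * \<phi> y)) at_top"
proof -
  obtain H0 h0 where H0: "laplace_tendsto edge H0 h0"
     "\<And>\<tau> z. 0 < \<tau> \<Longrightarrow> edge + 1 / \<tau> < Re z \<Longrightarrow> lap (H0 \<tau>) z = (\<Prod>x\<in>(SIGMA i:{1..p}. {..<n i}). of_real (factor \<xi> x \<tau>) - z) * T \<tau> m z"
     "\<And>z. edge < Re z \<Longrightarrow> lap h0 z = (\<Prod>i=1..p. (of_real (\<xi> i) - z) ^ n i) * P m z"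
    by (rule factor_family[OF bal, where \<xi> = \<xi>]) blast
  define H where "H = (\<lambda>\<tau> y. (-1) * H0 \<tau> y)"
  define h where "h = (\<lambda>y. (-1) * h0 y)"
  have H: "laplace_tendsto edge H h" unfolding H_def h_def by (rule laplace_tendsto_cmult[OF H0(1) tendsto_const])
  let ?D = "\<Sum>h=1..q. d h"
  let ?\<psi> = "\<lambda>\<tau> v. of_real (exp (- v / \<tau>)) * \<phi> (\<tau> * (1 - exp (- v / \<tau>)))"
  have lim: "\<forall>\<^sub>F \<tau> in at_top. complex_integrable lborel (\<lambda>v. of_real (H \<tau> v) * ?\<psi> \<tau> v)"
    "complex_integrable lborel (\<lambda>v. of_real (h v) * \<phi> v)"
    "((\<lambda>\<tau>. LINT v|lborel. of_real (H \<tau> v) * ?\<psi> \<tau> v) \<longlongrightarrow> (LINT v|lborel. of_real (h v) * \<phi> v)) at_top"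
    by (rule laplace_tendsto_test[OF H e0 w \<phi>], erule b)+
  have [measurable]: "\<phi> \<in> borel_measurable borel" by (rule borel_measurable_continuous_onI[OF \<phi>])
  have [measurable]: "h \<in> borel_measurable borel" by (rule laplace_on_measurable[OF laplace_tendsto_on[OF H]])
  have BE: "laplace_on edge BE" "edge < Re z \<Longrightarrow> lap BE z = - ((\<Prod>i=1..p. (of_real (\<xi> i) - z) ^ n i) * P m z)" for z
    using B unfolding is_LII_B_iff BE_def by auto
  have [measurable]: "BE \<in> borel_measurable borel" by (rule laplace_on_measurable[OF BE(1)])
  have "AE y in lborel. BE y = h y"
    by (rule laplace_unique[OF BE(1) laplace_tendsto_on[OF H]]) (simp add: BE(2) h_def lap_cmult[of "-1", simplified] H0(3))
  hence ae: "AE y in lborel. of_real (BE y) * \<phi> y = of_real (h y) * \<phi> y" by eventually_elim simp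
  show "complex_integrable lborel (\<lambda>y. of_real (BE y) * \<phi> y)"
    by (subst integrable_cong_AE[OF _ _ ae]) (use lim(2) in measurable)
  have IE: "(LINT y|lborel. of_real (BE y) * \<phi> y) = (LINT y|lborel. of_real (h y) * \<phi> y)"
    by (rule integral_cong_AE[OF _ _ ae]) measurable
  \<comment> \<open>Two changes of variables, y = \<tau>(1 - x) and then x = exp(-v/\<tau>).\<close>
  have key: "(complex_integrable lborel (\<lambda>v. of_real (H \<tau> v) * ?\<psi> \<tau> v) \<longrightarrow> complex_integrable lborel (\<lambda>y. of_real (BJE \<tau> y) * \<phi> y)) \<and>
     (LINT y|lborel. of_real (BJE \<tau> y) * \<phi> y) = (LINT v|lborel. of_real (H \<tau> v) * ?\<psi> \<tau> v)"
    if \<tau>: "0 < \<tau>" and J: "is_jacobi_B p q (\<lambda>h. \<tau> * \<rho> h - 1) (\<lambda>h. \<tau> * \<rho> h + d h - 1) (\<lambda>i. \<tau> * \<xi> i) n m (BJ \<tau>)" for \<tau>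
  proof -
    define k where "k = scaled_B \<tau> (BJ \<tau>)"
    note k = is_jacobi_B_laplace[OF \<tau> bal J, folded k_def]
    have [measurable]: "k \<in> borel_measurable borel" by (rule laplace_on_measurable[OF k(1)])
    note H\<tau> = laplace_tendsto_family[OF H \<tau>]
    have [measurable]: "H \<tau> \<in> borel_measurable borel" by (rule laplace_on_measurable[OF H\<tau>])
    have "AE v in lborel. k v = H \<tau> v"
      by (rule laplace_unique[OF k(1) H\<tau>]) (simp add: k(2) H_def lap_cmult[of "-1", simplified] H0(2)[OF \<tau>])
    hence aek: "AE v in lborel. of_real (k v) * ?\<psi> \<tau> v = of_real (H \<tau> v) * ?\<psi> \<tau> v" by eventually_elim simp
    define f where "f = (\<lambda>x. of_real \<tau> * (of_real (\<tau> powr ?D * BJ \<tau> x) * \<phi> (\<tau> * (1 - x))))"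
    \<comment> \<open>Measurability of \<open>BJ \<tau>\<close> on (0, 1) is read off from
      \<open>k\<close>, which is measurable because it has a Laplace transform.\<close>
    have m: "(\<lambda>x. indicator {0<..<1} x *\<^sub>R f x) \<in> borel_measurable borel"
    proof -
      have "(\<lambda>x. indicator {0<..<1} x *\<^sub>R f x) = (\<lambda>x. indicator {0<..<1} x *\<^sub>R (of_real \<tau> * (of_real (k (- \<tau> * ln x)) * \<phi> (\<tau> * (1 - x)))))"
        using \<tau> by (auto simp: fun_eq_iff f_def k_def scaled_B_def indicator_def mult_less_0_iff)
      also have "\<dots> \<in> borel_measurable borel" by measurable
      finally show ?thesis .
    qed
    have e1: "indicator {0<..} v *\<^sub>R ((exp (- v / \<tau>) / \<tau>) *\<^sub>R f (exp (- v / \<tau>))) = of_real (k v) * ?\<psi> \<tau> v" for v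
      using \<tau> by (simp add: f_def k_def scaled_B_def indicator_def scaleR_conv_of_real)
    let ?g = "\<lambda>y. of_real (BJE \<tau> y) * \<phi> y"
    have e2: "of_real \<tau> * ?g (\<tau> + (- \<tau>) * x) = indicator {0<..<1} x *\<^sub>R f x" for x
    proof -
      have "\<tau> + (- \<tau>) * x \<in> {0<..<\<tau>} \<longleftrightarrow> x \<in> {0<..<1}"
      proof -
        have "\<tau> + (- \<tau>) * x = \<tau> * (1 - x)" by (simp add: algebra_simps)
        thus ?thesis using \<tau> mult_less_cancel_left_pos[OF \<tau>, of "1 - x" 1] by (simp add: zero_less_mult_iff) auto
      qed
      moreover have "1 - (\<tau> + (- \<tau>) * x) / \<tau> = x" "\<tau> + (- \<tau>) * x = \<tau> * (1 - x)" using \<tau> by (simp_all add: field_simps)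
      ultimately show ?thesis unfolding BJE_def f_def by (auto simp: indicator_def)
    qed
    have int1: "complex_integrable lborel ?g \<longleftrightarrow> complex_integrable lborel (\<lambda>x. indicator {0<..<1} x *\<^sub>R f x)"
    proof -
      have "complex_integrable lborel ?g \<longleftrightarrow> complex_integrable lborel (\<lambda>x. ?g (\<tau> + (- \<tau>) * x))"
        by (rule lborel_integrable_real_affine_iff[symmetric]) (use \<tau> in auto)
      also have "\<dots> \<longleftrightarrow> complex_integrable lborel (\<lambda>x. of_real \<tau> * ?g (\<tau> + (- \<tau>) * x))"
        by (rule integrable_cmult_iff[symmetric]) (use \<tau> in simp)
      finally show ?thesis unfolding e2 .
    qed
    have "(LINT y|lborel. ?g y) = \<bar>- \<tau>\<bar> *\<^sub>R (LINT x|lborel. ?g (\<tau> + (- \<tau>) * x))"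
      by (rule lborel_integral_real_affine) (use \<tau> in auto)
    also have "\<dots> = (LINT x|lborel. of_real \<tau> * ?g (\<tau> + (- \<tau>) * x))"
      unfolding integral_mult_right_zero using \<tau> by (simp add: scaleR_conv_of_real)
    also have "\<dots> = (LINT v|lborel. of_real (k v) * ?\<psi> \<tau> v)"
      unfolding e2 integral_exp_substitution[OF \<tau> m] e1 ..
    also have "\<dots> = (LINT v|lborel. of_real (H \<tau> v) * ?\<psi> \<tau> v)"
      by (rule integral_cong_AE[OF _ _ aek]) measurable
    finally have "(LINT y|lborel. ?g y) = (LINT v|lborel. of_real (H \<tau> v) * ?\<psi> \<tau> v)" .
    moreover have "complex_integrable lborel (\<lambda>v. of_real (H \<tau> v) * ?\<psi> \<tau> v) \<longleftrightarrow> complex_integrable lborel (\<lambda>v. of_real (k v) * ?\<psi> \<tau> v)"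
      by (rule integrable_cong_AE[symmetric, OF _ _ aek]) measurable
    ultimately show ?thesis unfolding int1 integrable_exp_substitution[OF \<tau> m] e1 by blast
  qed
  show "\<forall>\<^sub>F \<tau> in at_top. complex_integrable lborel (\<lambda>y. of_real (BJE \<tau> y) * \<phi> y)"
    using lim(1) BJ eventually_gt_at_top[of 0] by eventually_elim (use key in blast)
  have "\<forall>\<^sub>F \<tau> in at_top. (LINT v|lborel. of_real (H \<tau> v) * ?\<psi> \<tau> v) = (LINT y|lborel. of_real (BJE \<tau> y) * \<phi> y)"
    using BJ eventually_gt_at_top[of 0] by eventually_elim (use key in simp)
  from tendsto_cong[THEN iffD1, OF this lim(3)] show "((\<lambda>\<tau>. LINT y|lborel. of_real (BJE \<tau> y) * \<phi> y) \<longlongrightarrow> (LINT y|lborel. of_real (BE y) * \<phi> y)) at_top"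
    unfolding IE .
qed

end

section \<open>Contour integrals of meromorphic functions\<close>

text \<open>A simple path meets finitely many points at finitely many parameters; 0 is set aside
  because a closed simple path is injective on (0, 1] only. It permits changes of the integrand
  where the kernel has a conventional value instead of its limit.\<close>

lemma contour_integral_spike_finite:
  assumes \<gamma>: "simple_path \<gamma>" and N: "finite N" and eq: "\<And>z. z \<in> path_image \<gamma> - N \<Longrightarrow> f z = g z"
  shows "contour_integral \<gamma> f = contour_integral \<gamma> g"
  unfolding contour_integral_integral
proof (rule integral_spike)
  have "inj_on \<gamma> {0<..1}"
    using \<gamma> by (fastforce simp: simple_path_def loop_free_def inj_on_def)
  hence "finite (\<gamma> -` N \<inter> {0<..1})" by (rule finite_vimage_IntI[OF N])
  thus "negligible (insert 0 (\<gamma> -` N \<inter> {0<..1}))" by (intro negligible_finite) simp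
next
  fix x assume x: "x \<in> {0..1} - insert 0 (\<gamma> -` N \<inter> {0<..1})"
  hence "\<gamma> x \<in> path_image \<gamma> - N" by (auto simp: path_image_def)
  thus "g (\<gamma> x) * vector_derivative \<gamma> (at x) = f (\<gamma> x) * vector_derivative \<gamma> (at x)" using eq by simp
qed

lemma contour_integral_circlepath_scale:
  assumes "0 < \<tau>"
  shows "contour_integral (circlepath (of_real \<tau> * c) (\<tau> * r)) f =
    contour_integral (circlepath c r) (\<lambda>z. of_real \<tau> * f (of_real \<tau> * z))"
  unfolding contour_integral_integral vector_derivative_circlepath
  by (intro integral_cong) (simp add: circlepath algebra_simps)

text \<open>A singularity that is neither essential nor a pole has a limit, hence is
  removable.\<close>

lemma meromorphic_remove_sings_analytic_at:
  assumes f: "f meromorphic_on UNIV" and z: "\<not> is_pole f z"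
  shows "remove_sings f analytic_on {z}"
proof -
  have "f meromorphic_on {z}" by (rule meromorphic_on_subset[OF f]) simp
  hence iso: "isolated_singularity_at f z" and "not_essential f z" by (simp_all add: meromorphic_at_iff)
  then obtain c where "f \<midarrow>z\<rightarrow> c" using z by (auto simp: not_essential_def)
  thus ?thesis by (rule remove_sings_analytic_at[OF iso])
qed

text \<open>The kernel may have removable singularities on or inside the contours, where Gamma = 0
  at its poles and division by 0 give conventional values. After \<open>remove_sings\<close> it is
  holomorphic off its poles, which are finitely many in a disc around the contours, and the residues
  are unchanged.\<close>

lemma system_integral_meromorphic:
  assumes G: "contour_system G" and f: "f meromorphic_on UNIV" and N: "finite N" "N \<subseteq> enclosed_by G"
    and poles: "\<And>z. z \<in> enclosed_by G \<union> trace_of G \<Longrightarrow> is_pole f z \<Longrightarrow> z \<in> N"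
  shows "system_integral G f = 2 * of_real pi * \<i> * (\<Sum>x\<in>N. residue f x)"
proof -
  define F where "F = remove_sings f"
  have "compact (trace_of G)"
    unfolding trace_of_def using G
    by (intro compact_UN) (auto simp: contour_system_def intro: compact_valid_path_image)
  hence "bounded (trace_of G \<union> N)" using N by (simp add: compact_imp_bounded finite_imp_bounded)
  then obtain R where R: "trace_of G \<union> N \<subseteq> ball 0 R" using bounded_subset_ballD by blast
  \<comment> \<open>Finite, since the singularities of a meromorphic function are sparse. In the
    closed disc it contains all poles and all points where \<open>remove_sings\<close> changes the
    value.\<close>
  define E where "E = cball 0 R \<inter> {z. \<not> f analytic_on {z}}"
  have E: "finite E" unfolding E_def
    by (rule sparse_in_compact_finite[OF sparse_in_subset[OF meromorphic_on_imp_sparse_singularities[OF f]]]) auto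
  define pts where "pts = {z \<in> ball 0 R. is_pole f z}"
  have "pts \<subseteq> E" using analytic_at_imp_no_pole by (auto simp: pts_def E_def)
  hence pts: "finite pts" using E finite_subset by blast
  have hol: "F holomorphic_on ball 0 R - pts"
  proof (rule analytic_imp_holomorphic, subst analytic_on_analytic_at, intro ballI)
    fix z assume "z \<in> ball 0 R - pts"
    hence "\<not> is_pole f z" by (simp add: pts_def)
    thus "F analytic_on {z}" unfolding F_def by (rule meromorphic_remove_sings_analytic_at[OF f])
  qed
  have tr: "trace_of G \<subseteq> ball 0 R - pts"
    using R poles N(2) contour_system_trace_disjoint[OF G] by (auto simp: pts_def)
  have iso: "isolated_singularity_at f z" for z
    using meromorphic_on_subset[OF f, of "{z}"] by (simp add: meromorphic_at_iff)
  have "system_integral G f = system_integral G F"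
    unfolding system_integral_def
  proof (rule sum.cong[OF refl], rule contour_integral_spike_finite[OF _ E])
    fix \<gamma> assume g: "\<gamma> \<in> G"
    thus "simple_path \<gamma>" using G by (simp add: contour_system_def)
    fix z assume z: "z \<in> path_image \<gamma> - E"
    hence "z \<in> trace_of G" using g by (auto simp: trace_of_def)
    hence "z \<in> cball 0 R" using R by auto
    thus "f z = F z" using z by (auto simp: E_def F_def)
  qed
  also have "\<dots> = 2 * of_real pi * \<i> * (\<Sum>x\<in>pts \<inter> enclosed_by G. residue F x)"
    by (rule system_integral_residues[OF G open_ball convex_ball pts hol tr])
  also have "(\<Sum>x\<in>pts \<inter> enclosed_by G. residue F x) = (\<Sum>x\<in>N. residue F x)"
  proof (rule sum.mono_neutral_left[OF N(1)])
    show "pts \<inter> enclosed_by G \<subseteq> N" using poles by (auto simp: pts_def)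
    \<comment> \<open>A point of \<open>N\<close> need not be a pole; its residue is then 0.\<close>
    show "\<forall>x\<in>N - pts \<inter> enclosed_by G. residue F x = 0"
    proof
      fix x assume x: "x \<in> N - pts \<inter> enclosed_by G"
      hence "\<not> is_pole f x" using N R by (auto simp: pts_def)
      hence "F analytic_on {x}" unfolding F_def by (rule meromorphic_remove_sings_analytic_at[OF f])
      then obtain s where "open s" "x \<in> s" "F holomorphic_on s" by (auto simp: analytic_at)
      thus "residue F x = 0" by (rule residue_holo)
    qed
  qed
  also have "(\<Sum>x\<in>N. residue F x) = (\<Sum>x\<in>N. residue f x)"
    unfolding F_def using iso by (intro sum.cong) auto
  finally show ?thesis .
qed

section \<open>Coefficients of pointwise convergent polynomials\<close>

text \<open>Synthetic division at a point c of X lowers the degree bound, and the quotients still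
  tend to 0 on X without c. The coefficients are recovered from those of the quotient and from the
  value at c.\<close>

lemma coeff_tendsto_0:
  fixes R :: "'b \<Rightarrow> 'a::real_normed_field poly"
  assumes "infinite X" and "\<And>x. x \<in> X \<Longrightarrow> ((\<lambda>\<tau>. poly (R \<tau>) x) \<longlongrightarrow> 0) F" and "\<And>\<tau>. degree (R \<tau>) \<le> N"
  shows "((\<lambda>\<tau>. coeff (R \<tau>) k) \<longlongrightarrow> 0) F"
  using assms
proof (induction N arbitrary: R X k)
  case 0
  have R: "R \<tau> = [:coeff (R \<tau>) 0:]" for \<tau>
    using 0(3)[of \<tau>] degree_eq_zeroE[of "R \<tau>"] by force
  obtain x where x: "x \<in> X" using 0(1) by fastforce
  have p: "poly (R \<tau>) x = coeff (R \<tau>) 0" for \<tau> by (subst R) simp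
  show ?case
  proof (cases k)
    case 0
    thus ?thesis using "0.prems"(2)[OF x] by (simp add: p)
  next
    case (Suc j)
    have "coeff (R \<tau>) k = 0" for \<tau> using "0.prems"(3)[of \<tau>] Suc by (intro coeff_eq_0) simp
    thus ?thesis by simp
  qed
next
  case (Suc N)
  obtain c where c: "c \<in> X" using Suc.prems(1) by fastforce
  define S where "S = (\<lambda>\<tau>. synthetic_div (R \<tau>) c)"
  have R: "R \<tau> = [:-c, 1:] * S \<tau> + [:poly (R \<tau>) c:]" for \<tau>
    unfolding S_def by (rule synthetic_div_correct'[symmetric])
  have S: "((\<lambda>\<tau>. coeff (S \<tau>) j) \<longlongrightarrow> 0) F" for j
  proof (rule Suc.IH)
    show "infinite (X - {c})" using Suc.prems(1) by simp
    show "degree (S \<tau>) \<le> N" for \<tau> using Suc.prems(3)[of \<tau>] by (simp add: S_def degree_synthetic_div)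
    fix x assume x: "x \<in> X - {c}"
    have "poly (S \<tau>) x = (poly (R \<tau>) x - poly (R \<tau>) c) / (x - c)" for \<tau>
    proof -
      have "poly (R \<tau>) x = (x - c) * poly (S \<tau>) x + poly (R \<tau>) c" by (subst R) (simp add: algebra_simps)
      thus ?thesis using x by (simp add: field_simps)
    qed
    moreover have "((\<lambda>\<tau>. (poly (R \<tau>) x - poly (R \<tau>) c) / (x - c)) \<longlongrightarrow> (0 - 0) / (x - c)) F"
      using x c by (intro tendsto_intros Suc.prems) auto
    ultimately show "((\<lambda>\<tau>. poly (S \<tau>) x) \<longlongrightarrow> 0) F" by simp
  qed
  have Rk: "coeff (R \<tau>) k = - c * coeff (S \<tau>) k + (case k of 0 \<Rightarrow> poly (R \<tau>) c | Suc j \<Rightarrow> coeff (S \<tau>) j)" for \<tau>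
    by (subst R) (simp add: coeff_pCons split: nat.split)
  have "((\<lambda>\<tau>. case k of 0 \<Rightarrow> poly (R \<tau>) c | Suc j \<Rightarrow> coeff (S \<tau>) j) \<longlongrightarrow> 0) F"
    by (cases k) (auto intro: S Suc.prems(2)[OF c])
  from tendsto_add[OF tendsto_mult[OF tendsto_const[of "- c"] S[of k]] this] show ?case
    unfolding Rk by simp
qed

section \<open>The Jacobi function of part (A)\<close>

definition node_index :: "nat \<Rightarrow> (nat \<Rightarrow> nat) \<Rightarrow> (nat \<times> nat) set" where
  "node_index p n = (SIGMA i:{1..p}. {..<n i})"

lemma finite_node_index [simp]: "finite (node_index p n)"
  unfolding node_index_def by (intro finite_SigmaI) auto

lemma card_node_index: "card (node_index p n) = msize p n"
  unfolding node_index_def msize_def by (subst card_SigmaI) auto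

lemma jacobi_nodes_eq:
  "jacobi_nodes p \<alpha> n = (\<lambda>(i, s). of_real (\<alpha> i + real s)) ` node_index p n"
  unfolding jacobi_nodes_def node_index_def by force

text \<open>The factors of the Pochhammer symbol run through the nodes in reverse order.\<close>

lemma pochhammer_nodes:
  "pochhammer (t + 1 - of_real a - of_nat N) N = (\<Prod>s<N. (t - of_real (a + real s) :: complex))"
proof -
  have "pochhammer (t + 1 - of_real a - of_nat N) N = (\<Prod>s<N. t + 1 - of_real a - of_nat N + of_nat s)"
    by (simp add: pochhammer_prod lessThan_atLeast0)
  also have "\<dots> = (\<Prod>s<N. t + 1 - of_real a - of_nat N + of_nat (N - Suc s))"
    by (rule prod.nat_diff_reindex[symmetric])
  also have "\<dots> = (\<Prod>s<N. (t - of_real (a + real s)))"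
    by (intro prod.cong refl) (auto simp: of_nat_diff)
  finally show ?thesis .
qed

text \<open>Meromorphy in the whole plane is wanted because the traces of admissible contours may
  pass between the poles of the gamma factors.\<close>

lemma jacobi_kernel_meromorphic: "jacobi_kernel p q a b \<alpha> n m meromorphic_on UNIV"
proof -
  have ent: "(\<lambda>t::complex. rGamma (t + c)) meromorphic_on UNIV" for c
    by (intro analytic_on_imp_meromorphic_on analytic_intros)
  have G: "(\<lambda>t::complex. Gamma (t + c)) meromorphic_on UNIV" for c
    unfolding Gamma_def by (intro meromorphic_intros ent)
  have p: "(\<lambda>t::complex. pochhammer (t + c) N) meromorphic_on UNIV" for c N
    unfolding pochhammer_prod by (intro meromorphic_intros)
  have e: "t + 1 + c = t + (1 + c)" "t + 1 - c - c' = t + (1 - c - c')" "t + c + 1 = t + (c + 1)" for t c c' :: complex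
    by simp_all
  show ?thesis
    unfolding jacobi_kernel_def[abs_def] e by (intro meromorphic_intros G p)
qed

lemma of_real_powr_complex: "0 < x \<Longrightarrow> complex_of_real x powr t = exp (t * of_real (ln x))"
  by (simp add: powr_def Ln_of_real)

text \<open>x^t is entire without zeros, so it neither adds nor removes poles, and the integral is
  determined by the residues at the nodes.\<close>

lemma jacobi_A_residues:
  assumes J: "jacobi_contours p q a b \<alpha> n m G" and x: "0 < x"
    and inj: "inj_on (\<lambda>(i, s). \<alpha> i + real s) (node_index p n)"
  shows "jacobi_A p q a b \<alpha> n m G x = (-1) ^ msize p n *
    (\<Sum>(i, s)\<in>node_index p n. residue (\<lambda>t. jacobi_kernel p q a b \<alpha> n m t * of_real x powr t) (of_real (\<alpha> i + real s)))"
proof -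
  let ?f = "\<lambda>t. jacobi_kernel p q a b \<alpha> n m t * of_real x powr t"
  have ent: "(\<lambda>t. complex_of_real x powr t) analytic_on {z}" for z
    unfolding of_real_powr_complex[OF x] by (intro analytic_intros)
  have mer: "?f meromorphic_on UNIV"
    unfolding of_real_powr_complex[OF x]
    by (intro meromorphic_intros jacobi_kernel_meromorphic analytic_on_imp_meromorphic_on analytic_intros)
  have pole: "is_pole ?f z \<longleftrightarrow> is_pole (jacobi_kernel p q a b \<alpha> n m) z" for z
    by (rule is_pole_mult_analytic_nonzero2_iff[OF ent]) (use x in auto)
  have inj': "inj_on (\<lambda>(i, s). complex_of_real (\<alpha> i + real s)) (node_index p n)"
    using inj unfolding inj_on_def split_beta of_real_eq_iff .
  have "system_integral G ?f = 2 * of_real pi * \<i> * (\<Sum>x\<in>jacobi_nodes p \<alpha> n. residue ?f x)"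
  proof (rule system_integral_meromorphic[OF _ mer])
    show "finite (jacobi_nodes p \<alpha> n)" by (simp add: jacobi_nodes_eq)
  qed (use J in \<open>auto simp: jacobi_contours_def pole\<close>)
  also have "(\<Sum>x\<in>jacobi_nodes p \<alpha> n. residue ?f x) = (\<Sum>(i, s)\<in>node_index p n. residue ?f (of_real (\<alpha> i + real s)))"
    unfolding jacobi_nodes_eq sum.reindex[OF inj'] o_def split_beta ..
  finally have si: "system_integral G ?f = 2 * of_real pi * \<i> * (\<Sum>(i, s)\<in>node_index p n. residue ?f (of_real (\<alpha> i + real s)))" .
  have canc: "b \<noteq> 0 \<Longrightarrow> a / b * (b * s) = a * s" for a b s :: complex by simp
  show ?thesis unfolding jacobi_A_def si by (rule canc) simp
qed

section \<open>Uniform convergence on compact sets\<close>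

lemma uniform_limit_inverse_compact:
  fixes l :: "'a::topological_space \<Rightarrow> complex"
  assumes lim: "uniform_limit S f l F" and S: "compact S" and l: "continuous_on S l" "\<And>z. z \<in> S \<Longrightarrow> l z \<noteq> 0"
  shows "uniform_limit S (\<lambda>\<tau> z. inverse (f \<tau> z)) (\<lambda>z. inverse (l z)) F"
proof (cases "S = {}")
  case False
  have "continuous_on S (\<lambda>z. norm (l z))" by (intro continuous_intros l)
  from continuous_attains_inf[OF S False this]
  obtain z0 where z0: "z0 \<in> S" "\<And>z. z \<in> S \<Longrightarrow> norm (l z0) \<le> norm (l z)" by blast
  show ?thesis using uniform_lim_inverse[OF lim z0(2)] l(2)[OF z0(1)] by (simp add: o_def)
qed (simp add: uniform_limit_iff)

lemma uniform_limit_prod_compact: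
  fixes l :: "'b \<Rightarrow> 'a::topological_space \<Rightarrow> complex"
  assumes I: "finite I" and S: "compact S"
    and lim: "\<And>i. i \<in> I \<Longrightarrow> uniform_limit S (\<lambda>\<tau>. f \<tau> i) (l i) F" and l: "\<And>i. i \<in> I \<Longrightarrow> continuous_on S (l i)"
  shows "uniform_limit S (\<lambda>\<tau> z. \<Prod>i\<in>I. f \<tau> i z) (\<lambda>z. \<Prod>i\<in>I. l i z) F"
  using I lim l
proof (induction I rule: finite_induct)
  case (insert i I)
  have "uniform_limit S (\<lambda>\<tau> z. f \<tau> i z * (\<Prod>i\<in>I. f \<tau> i z)) (\<lambda>z. l i z * (\<Prod>i\<in>I. l i z)) F"
  proof (rule uniform_lim_mult)
    show "bounded (l i ` S)"
      by (intro compact_imp_bounded compact_continuous_image S insert.prems) simp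
    have "continuous_on S (\<lambda>z. \<Prod>i\<in>I. l i z)" by (intro continuous_intros insert.prems) auto
    thus "bounded ((\<lambda>z. \<Prod>i\<in>I. l i z) ` S)" by (intro compact_imp_bounded compact_continuous_image S)
  qed (use insert in auto)
  thus ?case using insert.hyps by simp
qed (simp add: uniform_limit_const)

lemma uniform_limit_exp_mult:
  assumes S: "bounded S" and c: "(c \<longlongrightarrow> c0) F"
  shows "uniform_limit S (\<lambda>\<tau> z. exp (c \<tau> * z)) (\<lambda>z::complex. exp (c0 * z)) F"
proof -
  obtain M where M: "\<And>z. z \<in> S \<Longrightarrow> norm z \<le> M" using S by (auto simp: bounded_iff)
  define B where "B = (norm c0 + 1) * \<bar>M\<bar>"
  have ev: "\<forall>\<^sub>F \<tau> in F. norm (c \<tau>) < norm c0 + 1"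
    using tendsto_norm[OF c] by (rule order_tendstoD) simp
  have "uniform_limit S (\<lambda>\<tau> z. c \<tau> * z) (\<lambda>z. c0 * z) F"
  proof (rule uniform_lim_mult)
    show "uniform_limit S (\<lambda>\<tau> z. c \<tau>) (\<lambda>z. c0) F"
      unfolding uniform_limit_iff using c by (auto dest: tendstoD elim: eventually_mono)
    show "bounded ((\<lambda>z. c0) ` S)" by (rule bounded_subset[of "{c0}"]) auto
  qed (use S in \<open>auto intro: uniform_limit_const\<close>)
  moreover have "uniformly_continuous_on (cball 0 B) (exp :: complex \<Rightarrow> complex)"
    by (intro compact_uniformly_continuous continuous_intros compact_cball)
  moreover have "\<forall>\<^sub>F \<tau> in F. \<forall>z\<in>S. c \<tau> * z \<in> cball 0 B"
    using ev
  proof eventually_elim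
    case (elim \<tau>)
    have "norm (c \<tau>) * norm z \<le> B" if "z \<in> S" for z
      unfolding B_def using M[OF that] elim by (intro mult_mono) auto
    thus ?case by (simp add: norm_mult)
  qed
  ultimately show ?thesis by (rule uniform_limit_compose_uniformly_continuous_on) simp
qed

text \<open>For Re z >= w and y > 0 the modulus of exp(-zy) is at most exp(-wy), so a single
  weighted norm bounds the difference for all z at once.\<close>

lemma laplace_tendsto_uniform:
  assumes F: "laplace_tendsto r F f" and w: "r < w" and S: "\<And>z. z \<in> S \<Longrightarrow> w \<le> Re z"
  shows "uniform_limit S (\<lambda>\<tau>. lap (F \<tau>)) (lap f) at_top"
proof (rule uniform_limitI)
  fix e :: real assume e: "0 < e"
  have "\<forall>\<^sub>F \<tau> in at_top. (LINT y|lborel. exp (- w * y) * \<bar>F \<tau> y - f y\<bar>) < e"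
    by (rule order_tendstoD(2)[OF laplace_tendsto_norm[OF F w] e])
  with eventually_half_plane[OF w] show "\<forall>\<^sub>F \<tau> in at_top. \<forall>z\<in>S. dist (lap (F \<tau>) z) (lap f z) < e"
  proof eventually_elim
    case (elim \<tau>)
    hence \<tau>: "0 < \<tau>" "r + 1 / \<tau> < w" by auto
    note int = laplace_tendsto_diff_integrable[OF F \<tau>]
    note Fo = laplace_tendsto_family[OF F \<tau>(1)] and fo = laplace_tendsto_on[OF F]
    show ?case
    proof
      fix z assume z: "z \<in> S"
      have re: "r + 1 / \<tau> < Re z" "r < Re z" using S[OF z] \<tau> w by auto
      have ints: "complex_integrable lborel (\<lambda>y. exp (- z * of_real y) * of_real (F \<tau> y))"
        "complex_integrable lborel (\<lambda>y. exp (- z * of_real y) * of_real (f y))"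
        by (rule lap_integrable[OF Fo re(1)] lap_integrable[OF fo re(2)])+
      have "lap (F \<tau>) z - lap f z = (LINT y|lborel. exp (- z * of_real y) * of_real (F \<tau> y) - exp (- z * of_real y) * of_real (f y))"
        unfolding lap_def by (rule Bochner_Integration.integral_diff[OF ints, symmetric])
      also have "norm \<dots> \<le> (LINT y|lborel. exp (- w * y) * \<bar>F \<tau> y - f y\<bar>)"
      proof (rule Bochner_Integration.integral_norm_bound_integral)
        show "complex_integrable lborel (\<lambda>y. exp (- z * of_real y) * of_real (F \<tau> y) - exp (- z * of_real y) * of_real (f y))"
          by (rule Bochner_Integration.integrable_diff[OF ints])
        fix y :: real
        have "norm (exp (- z * of_real y) * of_real (F \<tau> y) - exp (- z * of_real y) * of_real (f y)) = exp (- Re z * y) * \<bar>F \<tau> y - f y\<bar>"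
          by (simp add: right_diff_distrib[symmetric] norm_mult of_real_diff[symmetric] del: of_real_diff)
        also have "\<dots> \<le> exp (- w * y) * \<bar>F \<tau> y - f y\<bar>"
        proof (cases "0 < y")
          case True thus ?thesis using S[OF z] by (intro mult_right_mono) auto
        next
          case False thus ?thesis using laplace_on_nonpos[OF Fo, of y] laplace_on_nonpos[OF fo, of y] by simp
        qed
        finally show "norm (exp (- z * of_real y) * of_real (F \<tau> y) - exp (- z * of_real y) * of_real (f y)) \<le> exp (- w * y) * \<bar>F \<tau> y - f y\<bar>" .
      qed (rule int)
      also note elim(2)
      finally show "dist (lap (F \<tau>) z) (lap f z) < e" by (simp add: dist_norm)
    qed
  qed
qed

lemma Re_pos_not_nonpos_Int: "0 < Re z \<Longrightarrow> z \<notin> \<int>\<^sub>\<le>\<^sub>0"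
  by (auto elim!: nonpos_Ints_cases)

context gamma_system
begin

section \<open>The Jacobi kernel to the right of the gamma poles\<close>

definition JK :: "nat \<Rightarrow> (nat \<Rightarrow> real) \<Rightarrow> (nat \<Rightarrow> nat) \<Rightarrow> (nat \<Rightarrow> nat) \<Rightarrow> real \<Rightarrow> complex \<Rightarrow> complex" where
  "JK p \<xi> n m \<tau> = jacobi_kernel p q (\<lambda>h. \<tau> * \<rho> h - 1) (\<lambda>h. \<tau> * \<rho> h + d h - 1) (\<lambda>i. \<tau> * \<xi> i) n m"

text \<open>To the right of \<open>\<tau> * edge\<close> the Pochhammer symbol of u = t + \<tau>
  \<rho>_h + d_h and Gamma(u) merge into Gamma(u + m_h). This numerator is holomorphic there, so all
  singularities come from the nodes.\<close>

definition Jnum :: "(nat \<Rightarrow> nat) \<Rightarrow> real \<Rightarrow> complex \<Rightarrow> complex" where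
  "Jnum m \<tau> t = (\<Prod>h=1..q. Gamma (t + of_real (\<tau> * \<rho> h) + of_real (d h + real (m h))) * rGamma (t + of_real (\<tau> * \<rho> h)))"

lemma Re_scaled_pos:
  assumes "0 < \<tau>" "\<tau> * edge < Re t" "h \<in> {1..q}" "0 \<le> c"
  shows "0 < Re (t + of_real (\<tau> * \<rho> h) + of_real c)"
proof -
  have "\<tau> * - \<rho> h \<le> \<tau> * edge" using assms edge_ge[of h] by (intro mult_left_mono) auto
  thus ?thesis using assms by simp
qed

lemma JK_eq:
  assumes \<tau>: "0 < \<tau>" and t: "\<tau> * edge < Re t"
  shows "JK p \<xi> n m \<tau> t = Jnum m \<tau> t / (\<Prod>(i, s)\<in>node_index p n. t - of_real (\<tau> * \<xi> i + real s))"
proof -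
  have den: "(\<Prod>i=1..p. pochhammer (t + 1 - of_real (\<tau> * \<xi> i) - of_nat (n i)) (n i)) =
      (\<Prod>(i, s)\<in>node_index p n. t - of_real (\<tau> * \<xi> i + real s))"
    unfolding pochhammer_nodes node_index_def by (rule prod.Sigma) auto
  have num: "(\<Prod>h=1..q. pochhammer (t + 1 + of_real (\<tau> * \<rho> h + d h - 1)) (m h)) *
      (\<Prod>h=1..q. Gamma (t + of_real (\<tau> * \<rho> h + d h - 1) + 1) / Gamma (t + of_real (\<tau> * \<rho> h - 1) + 1)) = Jnum m \<tau> t"
    unfolding prod.distrib[symmetric] Jnum_def
  proof (rule prod.cong[OF refl])
    fix h assume h: "h \<in> {1..q}"
    define u where "u = t + of_real (\<tau> * \<rho> h) + of_real (d h)"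
    have "0 < Re u" unfolding u_def using Re_scaled_pos[OF \<tau> t h, of "d h"] d[OF h] by simp
    hence u: "u \<notin> \<int>\<^sub>\<le>\<^sub>0" by (rule Re_pos_not_nonpos_Int)
    have e: "t + 1 + of_real (\<tau> * \<rho> h + d h - 1) = u" "t + of_real (\<tau> * \<rho> h + d h - 1) + 1 = u"
      "t + of_real (\<tau> * \<rho> h) + of_real (d h + real (m h)) = u + of_nat (m h)"
      "t + of_real (\<tau> * \<rho> h - 1) + 1 = t + of_real (\<tau> * \<rho> h)"
      by (simp_all add: u_def)
    have "Gamma u \<noteq> 0" using u by (simp add: Gamma_eq_zero_iff)
    thus "pochhammer (t + 1 + of_real (\<tau> * \<rho> h + d h - 1)) (m h) *
        (Gamma (t + of_real (\<tau> * \<rho> h + d h - 1) + 1) / Gamma (t + of_real (\<tau> * \<rho> h - 1) + 1)) =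
        Gamma (t + of_real (\<tau> * \<rho> h) + of_real (d h + real (m h))) * rGamma (t + of_real (\<tau> * \<rho> h))"
      unfolding e pochhammer_Gamma[OF u] by (simp add: rGamma_inverse_Gamma divide_inverse)
  qed
  have "a / b * c = a * c / b" for a b c :: complex by simp
  thus ?thesis unfolding JK_def jacobi_kernel_def den num[symmetric] .
qed

lemma Jnum_holomorphic:
  assumes \<tau>: "0 < \<tau>" shows "Jnum m \<tau> holomorphic_on {t. \<tau> * edge < Re t}"
  unfolding Jnum_def
proof (intro holomorphic_intros)
  fix h t assume h: "h \<in> {1..q}" and t: "t \<in> {t. \<tau> * edge < Re t}"
  have "0 < Re (t + of_real (\<tau> * \<rho> h) + of_real (d h + real (m h)))"
    using Re_scaled_pos[OF \<tau> _ h] t d[OF h] by simp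
  thus "t + of_real (\<tau> * \<rho> h) + of_real (d h + real (m h)) \<notin> \<int>\<^sub>\<le>\<^sub>0"
    by (rule Re_pos_not_nonpos_Int)
qed

lemma JK_holomorphic:
  assumes \<tau>: "0 < \<tau>"
  shows "JK p \<xi> n m \<tau> holomorphic_on {t. \<tau> * edge < Re t} - jacobi_nodes p (\<lambda>i. \<tau> * \<xi> i) n"
proof (rule holomorphic_transform)
  show "(\<lambda>t. Jnum m \<tau> t / (\<Prod>(i, s)\<in>node_index p n. t - of_real (\<tau> * \<xi> i + real s)))
     holomorphic_on {t. \<tau> * edge < Re t} - jacobi_nodes p (\<lambda>i. \<tau> * \<xi> i) n"
    unfolding split_beta jacobi_nodes_eq
    by (intro holomorphic_intros holomorphic_on_subset[OF Jnum_holomorphic[OF \<tau>]]) auto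
qed (use JK_eq[OF \<tau>] in auto)

text \<open>Distinct nodes are at most simple poles, so an entire factor enters the residue through
  its value at the node.\<close>

lemma residue_JK_mult:
  assumes \<tau>: "0 < \<tau>" and inj: "inj_on (\<lambda>(i, s). \<tau> * \<xi> i + real s) (node_index p n)"
    and e: "edge < \<xi> i" and mem_is: "(i, s) \<in> node_index p n" and \<phi>: "\<phi> holomorphic_on UNIV"
  shows "residue (\<lambda>t. JK p \<xi> n m \<tau> t * \<phi> t) (of_real (\<tau> * \<xi> i + real s)) =
    residue (JK p \<xi> n m \<tau>) (of_real (\<tau> * \<xi> i + real s)) * \<phi> (of_real (\<tau> * \<xi> i + real s))"
proof -
  define u where "u = (\<lambda>v :: nat \<times> nat. complex_of_real (case v of (i, s) \<Rightarrow> \<tau> * \<xi> i + real s))"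
  have inju: "inj_on u (node_index p n)" unfolding u_def using inj by (simp only: inj_on_def of_real_eq_iff)
  define H where "H = {t. \<tau> * edge < Re t} - u ` (node_index p n - {(i, s)})"
  have H: "open H" unfolding H_def
    by (intro open_Diff finite_imp_closed) (auto simp: open_halfspace_Re_gt)
  have mem: "u (i, s) \<in> H"
  proof -
    have "\<tau> * edge < \<tau> * \<xi> i" using \<tau> e by simp
    moreover have "u (i, s) \<notin> u ` (node_index p n - {(i, s)})" using mem_is inj_onD[OF inju] by blast
    ultimately show ?thesis by (auto simp: H_def u_def)
  qed
  define r where "r = (\<lambda>t. Jnum m \<tau> t / (\<Prod>v\<in>node_index p n - {(i, s)}. t - u v))"
  have r: "r holomorphic_on H" unfolding r_def H_def
    by (intro holomorphic_intros holomorphic_on_subset[OF Jnum_holomorphic[OF \<tau>]]) auto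
  have JKr: "JK p \<xi> n m \<tau> t = r t / (t - u (i, s))" if t: "t \<in> H" for t
  proof -
    have "(\<Prod>(i, s)\<in>node_index p n. t - of_real (\<tau> * \<xi> i + real s)) = (\<Prod>v\<in>node_index p n. t - u v)"
      by (simp add: u_def split_beta)
    also have "\<dots> = (t - u (i, s)) * (\<Prod>v\<in>node_index p n - {(i, s)}. t - u v)"
      by (rule prod.remove) (use mem_is in auto)
    finally show ?thesis using JK_eq[OF \<tau>, of t p \<xi> n m] t by (simp add: r_def H_def mult.commute)
  qed
  have res: "residue (\<lambda>t. JK p \<xi> n m \<tau> t * \<psi> t) (u (i, s)) = r (u (i, s)) * \<psi> (u (i, s))" if \<psi>: "\<psi> holomorphic_on UNIV" for \<psi>
  proof -
    have "residue (\<lambda>t. JK p \<xi> n m \<tau> t * \<psi> t) (u (i, s)) = residue (\<lambda>t. (r t * \<psi> t) / (t - u (i, s))) (u (i, s))"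
    proof (rule residue_cong[OF _ refl])
      show "\<forall>\<^sub>F t in at (u (i, s)). JK p \<xi> n m \<tau> t * \<psi> t = r t * \<psi> t / (t - u (i, s))"
        using eventually_at_in_open'[OF H mem] by eventually_elim (simp add: JKr)
    qed
    also have "\<dots> = r (u (i, s)) * \<psi> (u (i, s))"
      by (rule residue_simple[OF H mem]) (intro holomorphic_intros r holomorphic_on_subset[OF \<psi>], simp)
    finally show ?thesis .
  qed
  show ?thesis using res[OF \<phi>] res[of "\<lambda>_. 1"] by (simp add: u_def)
qed

text \<open>At the node \<tau> \<xi>_i + s the factor x^t splits into x^s, which belongs to the
  polynomial, and the power x^(\<tau> \<xi>_i) common to the component.\<close>

lemma jacobi_component:
  assumes \<tau>: "0 < \<tau>" and inj: "inj_on (\<lambda>(i, s). \<tau> * \<xi> i + real s) (node_index p n)"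
    and e: "edge < \<xi> i" and i: "i \<in> {1..p}" and x: "0 < x"
  shows "poly (jacobi_A_poly p q (\<lambda>h. \<tau> * \<rho> h - 1) (\<lambda>h. \<tau> * \<rho> h + d h - 1) (\<lambda>i. \<tau> * \<xi> i) n m i) (of_real x) * of_real (x powr (\<tau> * \<xi> i)) =
    (-1) ^ msize p n * (\<Sum>s<n i. residue (\<lambda>t. JK p \<xi> n m \<tau> t * of_real x powr t) (of_real (\<tau> * \<xi> i + real s)))"
proof -
  have ent: "(\<lambda>t. complex_of_real x powr t) holomorphic_on UNIV"
    unfolding of_real_powr_complex[OF x] by (intro holomorphic_intros)
  have pw: "complex_of_real x powr (of_real (\<tau> * \<xi> i + real s)) = of_real x ^ s * of_real (x powr (\<tau> * \<xi> i))" for s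
  proof -
    have "complex_of_real x powr (of_real (\<tau> * \<xi> i + real s)) = of_real (x powr (\<tau> * \<xi> i + real s))"
      using x by (intro powr_of_real) simp
    also have "x powr (\<tau> * \<xi> i + real s) = x ^ s * x powr (\<tau> * \<xi> i)" using x by (simp add: powr_add powr_realpow)
    finally show ?thesis by simp
  qed
  have "residue (\<lambda>t. JK p \<xi> n m \<tau> t * of_real x powr t) (of_real (\<tau> * \<xi> i + real s)) =
     residue (JK p \<xi> n m \<tau>) (of_real (\<tau> * \<xi> i + real s)) * (of_real x ^ s * of_real (x powr (\<tau> * \<xi> i)))" if "s < n i" for s
    unfolding pw[symmetric]
    by (rule residue_JK_mult[OF \<tau> inj e _ ent]) (use i that in \<open>auto simp: node_index_def\<close>)
  hence "(\<Sum>s<n i. residue (\<lambda>t. JK p \<xi> n m \<tau> t * of_real x powr t) (of_real (\<tau> * \<xi> i + real s))) =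
    (\<Sum>s<n i. residue (JK p \<xi> n m \<tau>) (of_real (\<tau> * \<xi> i + real s)) * (of_real x ^ s * of_real (x powr (\<tau> * \<xi> i))))"
    by (intro sum.cong) auto
  thus ?thesis
    unfolding jacobi_A_poly_def poly_sum poly_monom JK_def[symmetric]
    by (simp only: sum_distrib_left sum_distrib_right mult_ac)
qed

lemma jacobi_A_decomposition:
  assumes \<tau>: "0 < \<tau>" and inj: "inj_on (\<lambda>(i, s). \<tau> * \<xi> i + real s) (node_index p n)"
    and e: "\<And>i. i \<in> {1..p} \<Longrightarrow> edge < \<xi> i" and x: "0 < x"
    and J: "jacobi_contours p q (\<lambda>h. \<tau> * \<rho> h - 1) (\<lambda>h. \<tau> * \<rho> h + d h - 1) (\<lambda>i. \<tau> * \<xi> i) n m G"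
  shows "jacobi_A p q (\<lambda>h. \<tau> * \<rho> h - 1) (\<lambda>h. \<tau> * \<rho> h + d h - 1) (\<lambda>i. \<tau> * \<xi> i) n m G x =
    (\<Sum>i=1..p. poly (jacobi_A_poly p q (\<lambda>h. \<tau> * \<rho> h - 1) (\<lambda>h. \<tau> * \<rho> h + d h - 1) (\<lambda>i. \<tau> * \<xi> i) n m i) (of_real x) * of_real (x powr (\<tau> * \<xi> i)))"
proof -
  have "(\<Sum>(i, s)\<in>node_index p n. residue (\<lambda>t. JK p \<xi> n m \<tau> t * of_real x powr t) (of_real (\<tau> * \<xi> i + real s))) =
     (\<Sum>i=1..p. \<Sum>s<n i. residue (\<lambda>t. JK p \<xi> n m \<tau> t * of_real x powr t) (of_real (\<tau> * \<xi> i + real s)))"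
    unfolding node_index_def by (rule sum.Sigma[symmetric]) auto
  thus ?thesis
    unfolding jacobi_A_residues[OF J x inj] JK_def[symmetric] 
    by (simp only: sum_distrib_left jacobi_component[OF \<tau> inj e _ x] cong: sum.cong)
qed

section \<open>Distinct nodes and contours for large \<tau>\<close>

lemma jacobi_nodes_distinct:
  assumes inj: "inj_on \<xi> {1..p}"
  shows "\<forall>\<^sub>F \<tau> in at_top. inj_on (\<lambda>(i, s). \<tau> * \<xi> i + real s) (node_index p n)"
proof -
  let ?u = "\<lambda>\<tau> (i, s). \<tau> * \<xi> i + real s"
  have "\<forall>\<^sub>F \<tau> in at_top. \<forall>v\<in>node_index p n. \<forall>w\<in>node_index p n. ?u \<tau> v = ?u \<tau> w \<longrightarrow> v = w"
  proof (intro eventually_ball_finite ballI finite_node_index)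
    fix v w assume vw: "v \<in> node_index p n" "w \<in> node_index p n"
    obtain i s k r where eq: "v = (i, s)" "w = (k, r)" by (cases v, cases w)
    show "\<forall>\<^sub>F \<tau> in at_top. ?u \<tau> v = ?u \<tau> w \<longrightarrow> v = w"
    proof (cases "i = k")
      case True thus ?thesis by (simp add: eq)
    next
      case False
      hence ne: "\<xi> i \<noteq> \<xi> k" using inj_onD[OF inj, of i k] vw by (auto simp: eq node_index_def)
      \<comment> \<open>For i \<noteq> k two given nodes collide at one value of \<tau>
        only.\<close>
      from eventually_gt_at_top[of "(real r - real s) / (\<xi> i - \<xi> k)"] show ?thesis
      proof eventually_elim
        case (elim \<tau>)
        have "\<tau> * \<xi> i + real s \<noteq> \<tau> * \<xi> k + real r"
        proof
          assume "\<tau> * \<xi> i + real s = \<tau> * \<xi> k + real r"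
          hence "\<tau> = (real r - real s) / (\<xi> i - \<xi> k)" using ne by (simp add: field_simps)
          thus False using elim by simp
        qed
        thus ?case by (simp add: eq)
      qed
    qed
  qed
  thus ?thesis by eventually_elim (auto simp: inj_on_def split_beta)
qed

text \<open>After division by \<tau> the nodes of component i cluster at \<xi>_i, and there are
  finitely many of them.\<close>

lemma eventually_node_in:
  fixes U :: "real set"
  assumes U: "open U" and \<xi>: "\<And>i s. (i, s) \<in> I \<Longrightarrow> \<xi> i \<in> U" and I: "finite I"
  shows "\<forall>\<^sub>F \<tau> in at_top. \<forall>(i, s)\<in>I. \<xi> i + real s / \<tau> \<in> U"
proof (intro eventually_ball_finite ballI I, clarify)
  fix i s assume mem_is: "(i, s) \<in> I"
  have "((\<lambda>\<tau>. \<xi> i + real s / \<tau>) \<longlongrightarrow> \<xi> i) at_top" by real_asymp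
  thus "\<forall>\<^sub>F \<tau> in at_top. \<xi> i + real s / \<tau> \<in> U" using U \<xi>[OF mem_is] by (rule topological_tendstoD)
qed

text \<open>The disc of the limit case dilated by \<tau>: it eventually contains all nodes and stays
  to the right of \<open>\<tau> * edge\<close>, where the kernel has no other poles.\<close>

lemma jacobi_contours_exist:
  assumes e: "\<And>i. i \<in> {1..p} \<Longrightarrow> edge < \<xi> i"
  shows "\<forall>\<^sub>F \<tau> in at_top. \<exists>G. jacobi_contours p q (\<lambda>h. \<tau> * \<rho> h - 1) (\<lambda>h. \<tau> * \<rho> h + d h - 1) (\<lambda>i. \<tau> * \<xi> i) n m G"
proof -
  obtain c R where R: "0 < R" "edge < c - R" and \<xi>: "\<And>i. i \<in> {1..p} \<Longrightarrow> \<bar>c - \<xi> i\<bar> < R"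
    by (rule enclosing_disc[of p \<xi>]) (use e in blast)+
  have "\<forall>\<^sub>F \<tau> in at_top. \<forall>(i, s)\<in>node_index p n. \<xi> i + real s / \<tau> \<in> ball c R"
    by (rule eventually_node_in) (auto simp: node_index_def dist_real_def intro!: \<xi>)
  with eventually_gt_at_top[of 0] show ?thesis
  proof eventually_elim
    case (elim \<tau>)
    have R': "0 < \<tau> * R" using R elim by simp
    let ?G = "{circlepath (of_real (\<tau> * c)) (\<tau> * R)}"
    have "jacobi_contours p q (\<lambda>h. \<tau> * \<rho> h - 1) (\<lambda>h. \<tau> * \<rho> h + d h - 1) (\<lambda>i. \<tau> * \<xi> i) n m ?G"
      unfolding jacobi_contours_def JK_def[symmetric] enclosed_by_circlepath[OF R'] trace_of_circlepath[OF R']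
    proof (intro conjI ballI impI contour_system_circlepath[OF R'] subsetI)
      fix t assume "t \<in> jacobi_nodes p (\<lambda>i. \<tau> * \<xi> i) n"
      then obtain i s where mem_is: "(i, s) \<in> node_index p n" and t: "t = of_real (\<tau> * \<xi> i + real s)"
        by (auto simp: jacobi_nodes_eq)
      have "\<bar>c - (\<xi> i + real s / \<tau>)\<bar> < R" using elim(2) mem_is by (auto simp: dist_real_def)
      hence "\<tau> * \<bar>c - (\<xi> i + real s / \<tau>)\<bar> < \<tau> * R" using elim by simp
      also have "\<tau> * \<bar>c - (\<xi> i + real s / \<tau>)\<bar> = \<bar>\<tau> * c - (\<tau> * \<xi> i + real s)\<bar>"
        using elim by (simp add: abs_mult_pos' field_simps)
      finally show "t \<in> ball (of_real (\<tau> * c)) (\<tau> * R)"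
        unfolding t by (simp add: dist_norm flip: of_real_diff of_real_add of_real_mult)
    next
      fix t assume t: "t \<in> ball (of_real (\<tau> * c)) (\<tau> * R) \<union> sphere (of_real (\<tau> * c)) (\<tau> * R)"
        and pole: "is_pole (JK p \<xi> n m \<tau>) t"
      have "\<bar>Re (of_real (\<tau> * c) - t)\<bar> \<le> \<tau> * R"
        using abs_Re_le_cmod[of "of_real (\<tau> * c) - t"] t by (auto simp: dist_norm)
      hence "\<tau> * (c - R) \<le> Re t" by (simp add: algebra_simps)
      moreover have "\<tau> * edge < \<tau> * (c - R)" using R elim by simp
      ultimately have t': "\<tau> * edge < Re t" by linarith
      let ?H = "{t. \<tau> * edge < Re t} - jacobi_nodes p (\<lambda>i. \<tau> * \<xi> i) n"
      have "open ?H" by (intro open_Diff finite_imp_closed) (auto simp: jacobi_nodes_eq open_halfspace_Re_gt)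
      hence "JK p \<xi> n m \<tau> analytic_on ?H"
        using JK_holomorphic[OF elim(1)] by (simp add: analytic_on_open)
      hence "t \<notin> ?H" using pole analytic_at_imp_no_pole analytic_on_subset[of _ ?H "{t}"] by blast
      thus "t \<in> jacobi_nodes p (\<lambda>i. \<tau> * \<xi> i) n" using t' by auto
    qed
    thus ?case by blast
  qed
qed

text \<open>The gamma factors are reciprocals of transforms of beta kernels, here with s = \<rho>_h,
  since the denominators are Gamma(t + a_h + 1). The powers of \<tau> cancel by the balance: -D + 1
  + (D + |m|) - |n| = 0.\<close>

lemma JK_scaled:
  assumes \<tau>: "0 < \<tau>" and bal: "msize p n = msize q m + 1" and z: "edge < Re z"
  shows "of_real (\<tau> powr (- (\<Sum>h=1..q. d h))) * (of_real \<tau> * JK p \<xi> n m \<tau> (of_real \<tau> * z)) =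
    (\<Prod>h=1..q. inverse (lap (beta_kernel \<tau> (\<rho> h) (d h + real (m h))) z)) *
    (\<Prod>(i, s)\<in>node_index p n. inverse (z - of_real (\<xi> i + real s / \<tau>)))"
proof -
  have "\<tau> * edge < Re (of_real \<tau> * z)" using \<tau> z by simp
  from JK_eq[OF \<tau> this] have "JK p \<xi> n m \<tau> (of_real \<tau> * z) =
    Jnum m \<tau> (of_real \<tau> * z) / (\<Prod>(i, s)\<in>node_index p n. of_real \<tau> * z - of_real (\<tau> * \<xi> i + real s))" .
  also have "Jnum m \<tau> (of_real \<tau> * z) = (\<Prod>h=1..q. of_real (\<tau> powr (d h + real (m h))) * inverse (lap (beta_kernel \<tau> (\<rho> h) (d h + real (m h))) z))"
    unfolding Jnum_def
  proof (rule prod.cong[OF refl])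
    fix h assume h: "h \<in> {1..q}"
    have A: "0 < d h + real (m h)" and z': "- \<rho> h < Re z" using d[OF h] z h by (auto simp: edge_less_iff)
    have e: "of_real \<tau> * z + of_real (\<tau> * \<rho> h) = of_real \<tau> * (z + of_real (\<rho> h))" by (simp add: algebra_simps)
    have "of_real (\<tau> powr (d h + real (m h))) \<noteq> (0::complex)" using \<tau> by simp
    thus "Gamma (of_real \<tau> * z + of_real (\<tau> * \<rho> h) + of_real (d h + real (m h))) * rGamma (of_real \<tau> * z + of_real (\<tau> * \<rho> h)) =
      of_real (\<tau> powr (d h + real (m h))) * inverse (lap (beta_kernel \<tau> (\<rho> h) (d h + real (m h))) z)"
      unfolding e lap_beta_kernel[OF \<tau> A z'] by (simp add: rGamma_inverse_Gamma)
  qed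
  also have "\<dots> = of_real (\<tau> powr (\<Sum>h=1..q. d h + real (m h))) * (\<Prod>h=1..q. inverse (lap (beta_kernel \<tau> (\<rho> h) (d h + real (m h))) z))"
    using \<tau> by (simp add: prod.distrib powr_sum of_real_prod)
  also have "(\<Prod>(i, s)\<in>node_index p n. of_real \<tau> * z - of_real (\<tau> * \<xi> i + real s)) =
     (\<Prod>(i, s)\<in>node_index p n. of_real \<tau> * (z - of_real (\<xi> i + real s / \<tau>)))"
    using \<tau> by (intro prod.cong refl) (auto simp: algebra_simps)
  also have "\<dots> = of_real (\<tau> powr real (msize p n)) * (\<Prod>(i, s)\<in>node_index p n. z - of_real (\<xi> i + real s / \<tau>))"
    using \<tau> by (simp add: split_beta prod.distrib card_node_index powr_realpow)
  finally have "JK p \<xi> n m \<tau> (of_real \<tau> * z) =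
    of_real (\<tau> powr (\<Sum>h=1..q. d h + real (m h))) * (\<Prod>h=1..q. inverse (lap (beta_kernel \<tau> (\<rho> h) (d h + real (m h))) z)) /
    (of_real (\<tau> powr real (msize p n)) * (\<Prod>(i, s)\<in>node_index p n. z - of_real (\<xi> i + real s / \<tau>)))" .
  moreover have "(\<Prod>(i, s)\<in>node_index p n. inverse (z - of_real (\<xi> i + real s / \<tau>))) = inverse (\<Prod>(i, s)\<in>node_index p n. z - of_real (\<xi> i + real s / \<tau>))"
    unfolding split_beta by (rule prod_inversef[unfolded o_def])
  moreover have "of_real (\<tau> powr (- (\<Sum>h=1..q. d h))) * (of_real \<tau> * (of_real (\<tau> powr (\<Sum>h=1..q. d h + real (m h))) * X / (of_real (\<tau> powr real (msize p n)) * Y))) = X * inverse Y" for X Y :: complex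
  proof -
    have "\<tau> powr (- (\<Sum>h=1..q. d h)) * (\<tau> * \<tau> powr (\<Sum>h=1..q. d h + real (m h))) = \<tau> powr (- (\<Sum>h=1..q. d h) + (1 + (\<Sum>h=1..q. d h + real (m h))))"
      using \<tau> by (simp only: powr_add) simp
    also have "- (\<Sum>h=1..q. d h) + (1 + (\<Sum>h=1..q. d h + real (m h))) = real (msize p n)"
      unfolding bal by (simp add: msize_def sum.distrib)
    finally have pw: "\<tau> powr (- (\<Sum>h=1..q. d h)) * (\<tau> * \<tau> powr (\<Sum>h=1..q. d h + real (m h))) = \<tau> powr real (msize p n)" .
    have alg: "a * (b * (c * X / (e * Y))) = (a * (b * c)) / e * (X * inverse Y)" for a b c e :: complex
      by (simp add: divide_inverse)
    show ?thesis unfolding alg of_real_mult[symmetric] pw using \<tau> by simp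
  qed
  ultimately show ?thesis by (simp only:)
qed

end

section \<open>Limits of powers of 1 - y/\<tau>\<close>

lemma scaled_log_tendsto:
  fixes y :: real assumes y: "0 < y"
  shows "((\<lambda>\<tau>. \<tau> * ln (1 - y / \<tau>)) \<longlongrightarrow> - y) at_top"
  using y by real_asymp

lemma uniform_limit_scaled_log:
  fixes K :: "real set"
  assumes K: "bounded K"
  shows "uniform_limit K (\<lambda>\<tau> y. \<tau> * ln (1 - y / \<tau>)) (\<lambda>y. - y) at_top"
proof (rule uniform_limitI)
  fix e :: real assume e: "0 < e"
  obtain M where M: "\<And>y. y \<in> K \<Longrightarrow> \<bar>y\<bar> \<le> M" using K by (auto simp: bounded_iff)
  \<comment> \<open>The threshold 2M gives |y/\<tau>| <= 1/2, where |ln(1 + x) - x| <= 2 x^2; the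
    last threshold makes the resulting error 2 M^2/\<tau> smaller than e.\<close>
  from eventually_gt_at_top[of 0] eventually_gt_at_top[of "2 * M"] eventually_gt_at_top[of "2 * M\<^sup>2 / e"]
  show "\<forall>\<^sub>F \<tau> in at_top. \<forall>y\<in>K. dist (\<tau> * ln (1 - y / \<tau>)) (- y) < e"
  proof eventually_elim
    case (elim \<tau>)
    show ?case
    proof
      fix y assume y: "y \<in> K"
      have "\<bar>- y / \<tau>\<bar> \<le> 1 / 2" using M[OF y] elim by (simp add: field_simps)
      hence "\<bar>ln (1 + - y / \<tau>) - (- y / \<tau>)\<bar> \<le> 2 * (- y / \<tau>)\<^sup>2"
        by (rule abs_ln_one_plus_x_minus_x_bound)
      hence "\<tau> * \<bar>ln (1 + - y / \<tau>) - (- y / \<tau>)\<bar> \<le> \<tau> * (2 * (- y / \<tau>)\<^sup>2)" using elim by simp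
      moreover have "\<tau> * \<bar>ln (1 + - y / \<tau>) - (- y / \<tau>)\<bar> = \<bar>\<tau> * ln (1 - y / \<tau>) - (- y)\<bar>"
        using elim by (simp add: abs_mult_pos' algebra_simps)
      moreover have "\<tau> * (2 * (- y / \<tau>)\<^sup>2) = 2 * y\<^sup>2 / \<tau>" using elim by (simp add: field_simps power2_eq_square)
      moreover have "y\<^sup>2 \<le> M\<^sup>2" using M[OF y] by (metis abs_ge_zero power2_abs power_mono)
      hence "2 * y\<^sup>2 / \<tau> \<le> 2 * M\<^sup>2 / \<tau>" using elim by (simp add: divide_right_mono)
      moreover have "2 * M\<^sup>2 / \<tau> < e" using elim e by (simp add: field_simps)
      ultimately show "dist (\<tau> * ln (1 - y / \<tau>)) (- y) < e" unfolding dist_real_def by linarith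
    qed
  qed
qed

text \<open>\<open>exp\<close> is uniformly continuous on bounded sets only, so the exponents are
  first confined to an interval; the 1 in M + 1 is the error that uniform convergence of the
  logarithms allows.\<close>

lemma uniform_limit_scaled_powr:
  fixes K :: "real set"
  assumes K: "bounded K"
  shows "uniform_limit K (\<lambda>\<tau> y. (1 - y / \<tau>) powr (\<tau> * a)) (\<lambda>y. exp (- a * y)) at_top"
proof -
  obtain M where M: "0 < M" "\<And>y. y \<in> K \<Longrightarrow> \<bar>y\<bar> \<le> M" using K by (auto simp: bounded_pos)
  have log: "uniform_limit K (\<lambda>\<tau> y. \<tau> * ln (1 - y / \<tau>)) (\<lambda>y. - y) at_top"
    by (rule uniform_limit_scaled_log[OF K])
  have "uniform_limit K (\<lambda>\<tau> y. a * (\<tau> * ln (1 - y / \<tau>))) (\<lambda>y. a * - y) at_top"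
    by (rule bounded_linear.uniform_limit[OF bounded_linear_mult_right log])
  moreover have "uniformly_continuous_on (cball 0 (\<bar>a\<bar> * (M + 1))) (exp :: real \<Rightarrow> real)"
    by (intro compact_uniformly_continuous continuous_intros compact_cball)
  moreover have "\<forall>\<^sub>F \<tau> in at_top. \<forall>y\<in>K. a * (\<tau> * ln (1 - y / \<tau>)) \<in> cball 0 (\<bar>a\<bar> * (M + 1))"
    using uniform_limitD[OF log zero_less_one]
  proof eventually_elim
    case (elim \<tau>)
    show ?case
    proof
      fix y assume y: "y \<in> K"
      have "\<bar>\<tau> * ln (1 - y / \<tau>)\<bar> \<le> M + 1" using elim y M(2)[OF y] by (force simp: dist_real_def)
      thus "a * (\<tau> * ln (1 - y / \<tau>)) \<in> cball 0 (\<bar>a\<bar> * (M + 1))" by (simp add: abs_mult mult_left_mono)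
    qed
  qed
  ultimately have "uniform_limit K (\<lambda>\<tau> y. exp (a * (\<tau> * ln (1 - y / \<tau>)))) (\<lambda>y. exp (a * - y)) at_top"
    by (rule uniform_limit_compose_uniformly_continuous_on) simp
  also have "?this \<longleftrightarrow> ?thesis"
  proof (rule uniform_limit_cong)
    from eventually_gt_at_top[of M]
    show "\<forall>\<^sub>F \<tau> in at_top. \<forall>y\<in>K. exp (a * (\<tau> * ln (1 - y / \<tau>))) = (1 - y / \<tau>) powr (\<tau> * a)"
    proof eventually_elim
      case (elim \<tau>)
      have "1 - y / \<tau> \<noteq> 0" if "y \<in> K" for y using M elim M(2)[OF that] by (auto simp: field_simps)
      thus ?case by (simp add: powr_def mult_ac)
    qed
  qed simp
  finally show ?thesis .
qed

lemma uniform_limit_poly: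
  fixes R :: "'b \<Rightarrow> 'a::real_normed_field poly"
  assumes lim: "\<And>k. ((\<lambda>\<tau>. coeff (R \<tau>) k) \<longlongrightarrow> coeff Q k) F"
    and deg: "\<And>\<tau>. degree (R \<tau>) \<le> N" "degree Q \<le> N" and K: "bounded K"
  shows "uniform_limit K (\<lambda>\<tau>. poly (R \<tau>)) (poly Q) F"
proof -
  have "uniform_limit K (\<lambda>\<tau> x. \<Sum>k\<in>I. coeff (R \<tau>) k * x ^ k) (\<lambda>x. \<Sum>k\<in>I. coeff Q k * x ^ k) F" if "finite I" for I
    using that
  proof (induction I rule: finite_induct)
    case (insert k I)
    have "uniform_limit K (\<lambda>\<tau> x. coeff (R \<tau>) k * x ^ k) (\<lambda>x. coeff Q k * x ^ k) F"
    proof (rule uniform_lim_mult)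
      show "uniform_limit K (\<lambda>\<tau> x. coeff (R \<tau>) k) (\<lambda>x. coeff Q k) F"
        unfolding uniform_limit_iff using lim[of k] by (auto dest: tendstoD elim: eventually_mono)
      show "bounded ((\<lambda>x. coeff Q k) ` K)" by (rule bounded_subset[of "{coeff Q k}"]) auto
      obtain M where M: "\<And>x. x \<in> K \<Longrightarrow> norm x \<le> M" using K by (auto simp: bounded_iff)
      show "bounded ((\<lambda>x. x ^ k) ` K)"
        unfolding bounded_iff by (rule exI[of _ "M ^ k"]) (use M in \<open>auto simp: norm_power intro!: power_mono\<close>)
    qed (rule uniform_limit_const)
    thus ?case using insert by (simp add: uniform_limit_add)
  qed (simp add: uniform_limit_const)
  from this[of "{..N}"] have "uniform_limit K (\<lambda>\<tau> x. \<Sum>k\<le>N. coeff (R \<tau>) k * x ^ k) (\<lambda>x. \<Sum>k\<le>N. coeff Q k * x ^ k) F" by simp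
  moreover have p: "poly p = (\<lambda>x. \<Sum>k\<le>N. coeff p k * x ^ k)" if "degree p \<le> N" for p :: "'a poly"
    by (subst poly_as_sum_of_monoms'[OF that, symmetric]) (simp add: poly_sum poly_monom fun_eq_iff)
  ultimately show ?thesis by (simp only: p[OF deg(1)] p[OF deg(2)])
qed

context gamma_system
begin

abbreviation Jpoly :: "nat \<Rightarrow> (nat \<Rightarrow> real) \<Rightarrow> (nat \<Rightarrow> nat) \<Rightarrow> (nat \<Rightarrow> nat) \<Rightarrow> nat \<Rightarrow> real \<Rightarrow> complex poly" where
  "Jpoly p \<xi> n m i \<tau> \<equiv> jacobi_A_poly p q (\<lambda>h. \<tau> * \<rho> h - 1) (\<lambda>h. \<tau> * \<rho> h + d h - 1) (\<lambda>i. \<tau> * \<xi> i) n m i"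

section \<open>Convergence of the components\<close>

lemma isolating_radius:
  fixes p :: nat and \<xi> :: "nat \<Rightarrow> real"
  assumes inj: "inj_on \<xi> {1..p}" and i: "i \<in> {1..p}" and e: "edge < \<xi> i"
  obtains \<delta> where "0 < \<delta>" "edge < \<xi> i - \<delta>" "\<And>k. k \<in> {1..p} \<Longrightarrow> k \<noteq> i \<Longrightarrow> \<delta> < \<bar>\<xi> k - \<xi> i\<bar>"
proof -
  define A where "A = insert (\<xi> i - edge) ((\<lambda>k. \<bar>\<xi> k - \<xi> i\<bar>) ` ({1..p} - {i}))"
  have A: "finite A" "A \<noteq> {}" by (auto simp: A_def)
  have pos: "\<forall>x\<in>A. 0 < x"
    using e inj_onD[OF inj, of _ i] i by (auto simp: A_def)
  \<comment> \<open>Half of the least distance of \<xi>_i to \<open>edge\<close> and to the other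
    nodes.\<close>
  define \<delta> where "\<delta> = Min A / 2"
  have m: "0 < Min A" using A pos by simp
  have lt: "\<delta> < x" if "x \<in> A" for x using Min_le[OF A(1) that] m by (simp add: \<delta>_def)
  show ?thesis
  proof (rule that[of \<delta>])
    show "edge < \<xi> i - \<delta>" using lt[of "\<xi> i - edge"] by (simp add: A_def)
    show "\<delta> < \<bar>\<xi> k - \<xi> i\<bar>" if "k \<in> {1..p}" "k \<noteq> i" for k by (rule lt) (use that in \<open>auto simp: A_def\<close>)
  qed (use m in \<open>simp add: \<delta>_def\<close>)
qed

text \<open>Brings the numerator of the limit integrand into the form that it has in
  \<open>JK_scaled\<close>.\<close>

lemma W_eq_inverse_lap:
  assumes z: "edge < Re z"
  shows "W m z = (\<Prod>h=1..q. inverse (lap (gamma_kernel (\<rho> h) (d h + real (m h))) z))"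
  unfolding W_def
proof (rule prod.cong[OF refl])
  fix h assume h: "h \<in> {1..q}"
  have "0 < d h + real (m h)" "- \<rho> h < Re z" using d[OF h] z h by (auto simp: edge_less_iff)
  from lap_gamma_kernel[OF this] show "(z + of_real (\<rho> h)) powr of_real (d h + real (m h)) = inverse (lap (gamma_kernel (\<rho> h) (d h + real (m h))) z)"
    by (simp only: powr_minus inverse_inverse_eq)
qed

text \<open>Uniform limits of transforms on a compact set pass to reciprocals, as the limit
  transforms have no zeros, and to finite products. The node factors are treated in the same way,
  their limits \<xi>_i being off S.\<close>

lemma uniform_limit_JK:
  assumes bal: "msize p n = msize q m + 1" and S: "compact S" "S \<subseteq> Hp"
    and nz: "\<And>i z. i \<in> {1..p} \<Longrightarrow> z \<in> S \<Longrightarrow> z \<noteq> of_real (\<xi> i)"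
  shows "uniform_limit S (\<lambda>\<tau> z. of_real (\<tau> powr (- (\<Sum>h=1..q. d h))) * (of_real \<tau> * JK p \<xi> n m \<tau> (of_real \<tau> * z)))
    (\<lambda>z. W m z / (\<Prod>i=1..p. (z - of_real (\<xi> i)) ^ n i)) at_top"
proof (cases "S = {}")
  case False
  have bS: "bounded S" by (rule compact_imp_bounded[OF S(1)])
  \<comment> \<open>A leftmost point of S provides one abscissa for all of S.\<close>
  obtain z0 where z0: "z0 \<in> S" "\<And>z. z \<in> S \<Longrightarrow> Re z0 \<le> Re z"
    using continuous_attains_inf[OF S(1) False continuous_on_Re[OF continuous_on_id]] by (auto simp: id_def)
  have w: "edge < Re z0" using z0 S by (auto simp: Hp_def)
  let ?L = "\<lambda>h. lap (gamma_kernel (\<rho> h) (d h + real (m h)))"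
  have laps: "uniform_limit S (\<lambda>\<tau> z. inverse (lap (beta_kernel \<tau> (\<rho> h) (d h + real (m h))) z)) (\<lambda>z. inverse (?L h z)) at_top"
    and cont: "continuous_on S (\<lambda>z. inverse (?L h z))" if h: "h \<in> {1..q}" for h
  proof -
    have A: "0 < d h + real (m h)" using d[OF h] by simp
    have tend: "laplace_tendsto (- \<rho> h) (\<lambda>\<tau>. beta_kernel \<tau> (\<rho> h) (d h + real (m h))) (gamma_kernel (\<rho> h) (d h + real (m h)))"
      by (rule laplace_tendsto_beta_kernel[OF A tendsto_const]) simp
    have "- \<rho> h < Re z0" using w edge_ge[OF h] by linarith
    hence u: "uniform_limit S (\<lambda>\<tau>. lap (beta_kernel \<tau> (\<rho> h) (d h + real (m h)))) (?L h) at_top"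
      by (rule laplace_tendsto_uniform[OF tend]) (rule z0)
    have sub: "S \<subseteq> {z. - \<rho> h < Re z}" using S edge_ge[OF h] by (auto simp: Hp_def)
    have c: "continuous_on S (?L h)"
      by (rule continuous_on_subset[OF holomorphic_on_imp_continuous_on[OF lap_holomorphic[OF laplace_on_gamma_kernel[OF A]]] sub])
    have nz: "?L h z \<noteq> 0" if "z \<in> S" for z
    proof -
      have "z + of_real (\<rho> h) \<noteq> 0" using edge_Re_pos[OF _ h, of z] that S by (force simp: Hp_def)
      thus ?thesis using lap_gamma_kernel[OF A, of "\<rho> h" z] sub that by auto
    qed
    show "uniform_limit S (\<lambda>\<tau> z. inverse (lap (beta_kernel \<tau> (\<rho> h) (d h + real (m h))) z)) (\<lambda>z. inverse (?L h z)) at_top"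
      by (rule uniform_limit_inverse_compact[OF u S(1) c nz])
    show "continuous_on S (\<lambda>z. inverse (?L h z))" by (intro continuous_intros c) (use nz in blast)
  qed
  have num: "uniform_limit S (\<lambda>\<tau> z. \<Prod>h=1..q. inverse (lap (beta_kernel \<tau> (\<rho> h) (d h + real (m h))) z)) (\<lambda>z. \<Prod>h=1..q. inverse (?L h z)) at_top"
    by (rule uniform_limit_prod_compact[OF _ S(1) laps cont]) simp_all
  let ?l = "\<lambda>v z. inverse (z - complex_of_real (\<xi> (fst v)))"
  have nodes: "uniform_limit S (\<lambda>\<tau> z. inverse (z - of_real (\<xi> (fst v) + real (snd v) / \<tau>))) (?l v) at_top"
    and contn: "continuous_on S (?l v)" if v: "v \<in> node_index p n" for v
  proof -
    have nz': "z - complex_of_real (\<xi> (fst v)) \<noteq> 0" if "z \<in> S" for z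
      using nz[OF _ that, of "fst v"] v by (auto simp: node_index_def)
    show "continuous_on S (?l v)" by (intro continuous_intros) (use nz' in blast)
    show "uniform_limit S (\<lambda>\<tau> z. inverse (z - of_real (\<xi> (fst v) + real (snd v) / \<tau>))) (?l v) at_top"
    proof (rule uniform_limit_inverse_compact[OF _ S(1) _ nz'])
      show "continuous_on S (\<lambda>z. z - complex_of_real (\<xi> (fst v)))" by (intro continuous_intros)
      have "((\<lambda>\<tau>. real (snd v) / \<tau>) \<longlongrightarrow> 0) at_top" by real_asymp
      hence "((\<lambda>\<tau>. complex_of_real (\<xi> (fst v) + real (snd v) / \<tau>)) \<longlongrightarrow> of_real (\<xi> (fst v) + 0)) at_top"
        by (intro tendsto_intros)
      hence "uniform_limit S (\<lambda>\<tau> z. complex_of_real (\<xi> (fst v) + real (snd v) / \<tau>)) (\<lambda>z. of_real (\<xi> (fst v))) at_top"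
        unfolding uniform_limit_iff by (auto dest: tendstoD elim: eventually_mono)
      thus "uniform_limit S (\<lambda>\<tau> z. z - complex_of_real (\<xi> (fst v) + real (snd v) / \<tau>)) (\<lambda>z. z - of_real (\<xi> (fst v))) at_top"
        by (intro uniform_limit_minus uniform_limit_const)
    qed
  qed
  have den: "uniform_limit S (\<lambda>\<tau> z. \<Prod>v\<in>node_index p n. inverse (z - of_real (\<xi> (fst v) + real (snd v) / \<tau>))) (\<lambda>z. \<Prod>v\<in>node_index p n. ?l v z) at_top"
    by (rule uniform_limit_prod_compact[OF _ S(1) nodes contn]) simp_all
  have cts: "continuous_on S (\<lambda>z. \<Prod>h=1..q. inverse (?L h z))" "continuous_on S (\<lambda>z. \<Prod>v\<in>node_index p n. ?l v z)"
    by (rule continuous_on_prod[OF cont] continuous_on_prod[OF contn], assumption)+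
  have "bounded ((\<lambda>z. \<Prod>h=1..q. inverse (?L h z)) ` S)" "bounded ((\<lambda>z. \<Prod>v\<in>node_index p n. ?l v z) ` S)"
    by (rule compact_imp_bounded[OF compact_continuous_image[OF cts(1) S(1)]] compact_imp_bounded[OF compact_continuous_image[OF cts(2) S(1)]])+
  from uniform_lim_mult[OF num den this]
  show ?thesis
  proof (rule uniform_limit_cong[THEN iffD1, rotated -1])
    from eventually_gt_at_top[of 0]
    show "\<forall>\<^sub>F \<tau> in at_top. \<forall>z\<in>S. (\<Prod>h=1..q. inverse (lap (beta_kernel \<tau> (\<rho> h) (d h + real (m h))) z)) *
       (\<Prod>v\<in>node_index p n. inverse (z - of_real (\<xi> (fst v) + real (snd v) / \<tau>))) =
       of_real (\<tau> powr (- (\<Sum>h=1..q. d h))) * (of_real \<tau> * JK p \<xi> n m \<tau> (of_real \<tau> * z))"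
    proof eventually_elim
      case (elim \<tau>)
      show ?case
      proof
        fix z assume "z \<in> S"
        hence z: "edge < Re z" using S by (auto simp: Hp_def)
        show "(\<Prod>h=1..q. inverse (lap (beta_kernel \<tau> (\<rho> h) (d h + real (m h))) z)) *
       (\<Prod>v\<in>node_index p n. inverse (z - of_real (\<xi> (fst v) + real (snd v) / \<tau>))) =
       of_real (\<tau> powr (- (\<Sum>h=1..q. d h))) * (of_real \<tau> * JK p \<xi> n m \<tau> (of_real \<tau> * z))"
          unfolding JK_scaled[OF elim bal z] by (simp add: case_prod_unfold)
      qed
    qed
    fix z assume "z \<in> S"
    hence z: "edge < Re z" using S by (auto simp: Hp_def)
    have "(\<Prod>v\<in>node_index p n. ?l v z) = (\<Prod>i=1..p. \<Prod>s<n i. inverse (z - of_real (\<xi> i)))"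
      unfolding node_index_def by (subst prod.Sigma) (auto simp: split_beta)
    also have "\<dots> = inverse (\<Prod>i=1..p. (z - of_real (\<xi> i)) ^ n i)"
      by (simp add: prod_inversef[symmetric] power_inverse o_def)
    finally show "(\<Prod>h=1..q. inverse (?L h z)) * (\<Prod>v\<in>node_index p n. ?l v z) = W m z / (\<Prod>i=1..p. (z - of_real (\<xi> i)) ^ n i)"
      unfolding W_eq_inverse_lap[OF z] by (simp add: divide_inverse)
  qed
qed (simp add: uniform_limit_iff)

text \<open>In the variable t = \<tau> z the circle has radius \<tau> \<delta> about \<tau> \<xi>_i.
  By \<open>near\<close> and \<open>far\<close> it encloses exactly the nodes of component i; the
  leading factor \<tau> of f is dt/dz.\<close>

lemma jacobi_component_contour:
  fixes m :: "nat \<Rightarrow> nat"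
  assumes \<tau>: "0 < \<tau>" and \<delta>: "0 < \<delta>" and edge: "edge < \<xi> i - \<delta>" and i: "i \<in> {1..p}"
    and inj: "inj_on (\<lambda>(i, s). \<tau> * \<xi> i + real s) (node_index p n)" and x: "0 < x"
    and near: "\<And>s. s < n i \<Longrightarrow> real s / \<tau> < \<delta>"
    and far: "\<And>k s. (k, s) \<in> node_index p n \<Longrightarrow> k \<noteq> i \<Longrightarrow> \<delta> < \<bar>\<xi> k + real s / \<tau> - \<xi> i\<bar>"
  defines "f \<equiv> \<lambda>z. of_real \<tau> * (JK p \<xi> n m \<tau> (of_real \<tau> * z) * of_real x powr (of_real \<tau> * z))"
  shows "f contour_integrable_on circlepath (of_real (\<xi> i)) \<delta>" (is ?I)
    and "contour_integral (circlepath (of_real (\<xi> i)) \<delta>) f = 2 * of_real pi * \<i> *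
      (\<Sum>s<n i. residue (\<lambda>t. JK p \<xi> n m \<tau> t * of_real x powr t) (of_real (\<tau> * \<xi> i + real s)))" (is ?E)
proof -
  let ?c = "complex_of_real (\<xi> i)"
  let ?g = "\<lambda>t. JK p \<xi> n m \<tau> t * complex_of_real x powr t"
  let ?N = "jacobi_nodes p (\<lambda>i. \<tau> * \<xi> i) n" and ?S = "{t. \<tau> * edge < Re t}"
  have sc: "of_real \<tau> * ?c = of_real (\<tau> * \<xi> i)" by simp
  have r: "0 < \<tau> * \<delta>" using \<tau> \<delta> by simp
  have dst: "dist (of_real \<tau> * ?c) (of_real (\<tau> * \<xi> k + real s)) = \<tau> * \<bar>\<xi> k + real s / \<tau> - \<xi> i\<bar>" for k s
  proof -
    have "dist (of_real \<tau> * ?c) (of_real (\<tau> * \<xi> k + real s)) = \<bar>\<tau> * \<xi> i - (\<tau> * \<xi> k + real s)\<bar>"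
      unfolding dist_norm sc of_real_diff[symmetric] norm_of_real by simp
    also have "\<tau> * \<xi> i - (\<tau> * \<xi> k + real s) = \<tau> * - (\<xi> k + real s / \<tau> - \<xi> i)"
      using \<tau> by (simp add: algebra_simps)
    also have "\<bar>\<dots>\<bar> = \<tau> * \<bar>\<xi> k + real s / \<tau> - \<xi> i\<bar>"
      using \<tau> by (simp only: abs_mult abs_minus_cancel abs_of_pos)
    finally show ?thesis .
  qed
  have in_ball: "dist (of_real \<tau> * ?c) (of_real (\<tau> * \<xi> i + real s)) < \<tau> * \<delta>" if "s < n i" for s
    unfolding dst using near[OF that] \<tau> by (simp add: field_simps)
  have out: "\<tau> * \<delta> < dist (of_real \<tau> * ?c) (of_real (\<tau> * \<xi> k + real s))" if "(k, s) \<in> node_index p n" "k \<noteq> i" for k s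
    unfolding dst using far[OF that] \<tau> by simp
  have sph: "sphere (of_real \<tau> * ?c) (\<tau> * \<delta>) \<subseteq> ?S - ?N"
  proof
    fix t assume t: "t \<in> sphere (of_real \<tau> * ?c) (\<tau> * \<delta>)"
    have "\<bar>Re (of_real \<tau> * ?c - t)\<bar> \<le> \<tau> * \<delta>" using abs_Re_le_cmod[of "of_real \<tau> * ?c - t"] t by (simp add: dist_norm)
    hence "\<tau> * (\<xi> i - \<delta>) \<le> Re t" by (simp add: algebra_simps)
    moreover have "\<tau> * edge < \<tau> * (\<xi> i - \<delta>)" using edge \<tau> by simp
    ultimately have "\<tau> * edge < Re t" by linarith
    moreover have "t \<noteq> of_real (\<tau> * \<xi> k + real s)" if "(k, s) \<in> node_index p n" for k s
    proof (cases "k = i")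
      case True
      have "s < n i" using that True by (simp add: node_index_def)
      from in_ball[OF this] show ?thesis using t True by auto
    next
      case False
      from out[OF that this] show ?thesis using t by auto
    qed
    hence "t \<notin> ?N" by (auto simp: jacobi_nodes_eq)
    ultimately show "t \<in> ?S - ?N" by simp
  qed
  have g: "?g holomorphic_on ?S - ?N"
    unfolding of_real_powr_complex[OF x] by (intro holomorphic_intros JK_holomorphic[OF \<tau>])
  have f_eq: "f = (\<lambda>z. of_real \<tau> * ?g (of_real \<tau> * z))" by (simp add: f_def)
  show ?I
  proof (rule contour_integrable_continuous_circlepath)
    have "continuous_on (path_image (circlepath ?c \<delta>)) (\<lambda>z. ?g (of_real \<tau> * z))"
    proof (rule continuous_on_compose2[OF holomorphic_on_imp_continuous_on[OF g]])
      show "(\<lambda>z. of_real \<tau> * z) ` path_image (circlepath ?c \<delta>) \<subseteq> ?S - ?N"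
      proof (rule order.trans[OF _ sph], rule image_subsetI)
        fix z assume "z \<in> path_image (circlepath ?c \<delta>)"
        hence "dist ?c z = \<delta>" using \<delta> by simp
        moreover have "dist (of_real \<tau> * ?c) (of_real \<tau> * z) = \<tau> * dist ?c z"
          using \<tau> unfolding dist_norm right_diff_distrib[symmetric] norm_mult by simp
        ultimately show "of_real \<tau> * z \<in> sphere (of_real \<tau> * ?c) (\<tau> * \<delta>)" by simp
      qed
    qed (intro continuous_intros)
    thus "continuous_on (path_image (circlepath ?c \<delta>)) f" unfolding f_eq by (rule continuous_on_mult_left)
  qed
  have "contour_integral (circlepath ?c \<delta>) f = contour_integral (circlepath (of_real \<tau> * ?c) (\<tau> * \<delta>)) ?g"
    unfolding f_eq by (rule contour_integral_circlepath_scale[OF \<tau>, symmetric])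
  also have "\<dots> = system_integral {circlepath (of_real \<tau> * ?c) (\<tau> * \<delta>)} ?g" by (simp add: system_integral_def)
  also have "\<dots> = 2 * of_real pi * \<i> * (\<Sum>x\<in>?N \<inter> enclosed_by {circlepath (of_real \<tau> * ?c) (\<tau> * \<delta>)}. residue ?g x)"
  proof (rule system_integral_residues[OF contour_system_circlepath[OF r] _ _ _ g])
    show "open ?S" "convex ?S" by (simp_all add: open_halfspace_Re_gt convex_halfspace_Re_gt)
    show "finite ?N" by (simp add: jacobi_nodes_eq)
    show "trace_of {circlepath (of_real \<tau> * ?c) (\<tau> * \<delta>)} \<subseteq> ?S - ?N" using sph by (simp only: trace_of_circlepath[OF r])
  qed
  also have "?N \<inter> enclosed_by {circlepath (of_real \<tau> * ?c) (\<tau> * \<delta>)} = (\<lambda>s. of_real (\<tau> * \<xi> i + real s)) ` {..<n i}"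
    unfolding enclosed_by_circlepath[OF r]
  proof (intro equalityI subsetI)
    fix t assume t: "t \<in> ?N \<inter> ball (of_real \<tau> * ?c) (\<tau> * \<delta>)"
    then obtain k s where ks: "(k, s) \<in> node_index p n" "t = of_real (\<tau> * \<xi> k + real s)" by (auto simp: jacobi_nodes_eq)
    have "k = i" using out[OF ks(1)] t unfolding ks(2) by fastforce
    thus "t \<in> (\<lambda>s. of_real (\<tau> * \<xi> i + real s)) ` {..<n i}" using ks by (auto simp: node_index_def)
  next
    fix t assume "t \<in> (\<lambda>s. complex_of_real (\<tau> * \<xi> i + real s)) ` {..<n i}"
    then obtain s where s: "s < n i" "t = of_real (\<tau> * \<xi> i + real s)" by blast
    have "(i, s) \<in> node_index p n" unfolding node_index_def using i s by blast
    hence "t \<in> ?N" unfolding jacobi_nodes_eq s(2) by force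
    thus "t \<in> ?N \<inter> ball (of_real \<tau> * ?c) (\<tau> * \<delta>)" using in_ball[OF s(1)] s(2) by simp
  qed
  also have "(\<Sum>x\<in>\<dots>. residue ?g x) = (\<Sum>s<n i. residue ?g (of_real (\<tau> * \<xi> i + real s)))"
    by (subst sum.reindex) (auto simp: inj_on_def)
  finally show ?E .
qed

text \<open>The counterpart for the limit on the same circle: in the variable z the path does not
  depend on \<tau>, which is what the passage to the limit under the integral needs.\<close>

lemma LII_residue_contour:
  fixes p :: nat and \<xi> :: "nat \<Rightarrow> real"
  assumes inj: "inj_on \<xi> {1..p}" and \<delta>: "0 < \<delta>" and edge: "edge < \<xi> i - \<delta>" and i: "i \<in> {1..p}"
    and far: "\<And>k. k \<in> {1..p} \<Longrightarrow> k \<noteq> i \<Longrightarrow> \<delta> < \<bar>\<xi> k - \<xi> i\<bar>"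
  shows "sphere (of_real (\<xi> i)) \<delta> \<subseteq> Hp - (\<lambda>k. of_real (\<xi> k)) ` {1..p}" (is ?S)
    and "contour_integral (circlepath (of_real (\<xi> i)) \<delta>) (\<lambda>z. W m z / (\<Prod>k=1..p. (z - of_real (\<xi> k)) ^ n k) * exp (- z * of_real y)) =
      2 * of_real pi * \<i> * residue (\<lambda>z. W m z / (\<Prod>k=1..p. (z - of_real (\<xi> k)) ^ n k) * exp (- z * of_real y)) (of_real (\<xi> i))" (is ?E)
proof -
  let ?c = "complex_of_real (\<xi> i)" and ?N = "(\<lambda>k. complex_of_real (\<xi> k)) ` {1..p}"
  let ?g = "\<lambda>z. W m z / (\<Prod>k=1..p. (z - of_real (\<xi> k)) ^ n k) * exp (- z * of_real y)"
  have dst: "dist ?c (of_real (\<xi> k)) = \<bar>\<xi> k - \<xi> i\<bar>" for k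
    unfolding dist_norm of_real_diff[symmetric] norm_of_real by simp
  show sph: ?S
  proof
    fix t assume t: "t \<in> sphere ?c \<delta>"
    have "\<bar>Re (?c - t)\<bar> \<le> \<delta>" using abs_Re_le_cmod[of "?c - t"] t by (simp add: dist_norm)
    hence "edge < Re t" using edge by simp
    moreover have "t \<noteq> of_real (\<xi> k)" if "k \<in> {1..p}" for k
      using far[OF that] dst[of k] t \<delta> by (cases "k = i") auto
    ultimately show "t \<in> Hp - ?N" unfolding Hp_def by blast
  qed
  have g: "?g holomorphic_on Hp - ?N"
    by (intro holomorphic_intros holomorphic_on_subset[OF W_holomorphic]) auto
  have "contour_integral (circlepath ?c \<delta>) ?g = system_integral {circlepath ?c \<delta>} ?g" by (simp add: system_integral_def)
  also have "\<dots> = 2 * of_real pi * \<i> * (\<Sum>x\<in>?N \<inter> enclosed_by {circlepath ?c \<delta>}. residue ?g x)"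
    by (rule system_integral_residues[OF contour_system_circlepath[OF \<delta>] Hp _ g])
       (use sph in \<open>simp_all only: trace_of_circlepath[OF \<delta>] finite_imageI finite_atLeastAtMost\<close>)
  also have "?N \<inter> enclosed_by {circlepath ?c \<delta>} = {?c}"
    unfolding enclosed_by_circlepath[OF \<delta>]
  proof (intro equalityI subsetI)
    fix t assume t: "t \<in> ?N \<inter> ball ?c \<delta>"
    then obtain k where k: "k \<in> {1..p}" "t = of_real (\<xi> k)" by blast
    have "k = i" using far[OF k(1)] t dst[of k] unfolding k(2) by fastforce
    thus "t \<in> {?c}" using k by simp
  qed (use i \<delta> in \<open>auto\<close>)
  finally show ?E by simp
qed

text \<open>Uniform convergence on one circle about \<xi>_i gives the limit of the integral, hence
  of the component times (1 - y/\<tau>)^(\<tau> \<xi>_i). This power tends to exp(-\<xi>_i y), which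
  is not 0, and is divided out at the end.\<close>

lemma jacobi_component_tendsto:
  assumes inj: "inj_on \<xi> {1..p}" and bal: "msize p n = msize q m + 1" and e: "\<And>i. i \<in> {1..p} \<Longrightarrow> edge < \<xi> i"
    and i: "i \<in> {1..p}" and y: "0 < y"
  shows "((\<lambda>\<tau>. of_real (\<tau> powr (- (\<Sum>h=1..q. d h))) * poly (Jpoly p \<xi> n m i \<tau>) (of_real (1 - y / \<tau>))) \<longlongrightarrow> LII_A_comp p q d \<rho> \<xi> n m i y) at_top"
proof -
  obtain \<delta> where \<delta>: "0 < \<delta>" and edge: "edge < \<xi> i - \<delta>" and far: "\<And>k. k \<in> {1..p} \<Longrightarrow> k \<noteq> i \<Longrightarrow> \<delta> < \<bar>\<xi> k - \<xi> i\<bar>"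
    by (rule isolating_radius[OF inj i e[OF i]]) blast
  let ?C = "circlepath (of_real (\<xi> i)) \<delta>" and ?sph = "sphere (complex_of_real (\<xi> i)) \<delta>"
  let ?g = "\<lambda>z. W m z / (\<Prod>k=1..p. (z - of_real (\<xi> k)) ^ n k) * exp (- z * of_real y)"
  define T where "T = (\<lambda>\<tau>. complex_of_real (\<tau> powr (- (\<Sum>h=1..q. d h))))"
  define f where "f = (\<lambda>\<tau> z. of_real \<tau> * (JK p \<xi> n m \<tau> (of_real \<tau> * z) * of_real (1 - y / \<tau>) powr (of_real \<tau> * z)))"
  define r where "r = (\<lambda>\<tau>. \<Sum>s<n i. residue (\<lambda>t. JK p \<xi> n m \<tau> t * of_real (1 - y / \<tau>) powr t) (of_real (\<tau> * \<xi> i + real s)))"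
  have sph: "?sph \<subseteq> Hp - (\<lambda>k. of_real (\<xi> k)) ` {1..p}"
    by (rule LII_residue_contour(1)[OF inj \<delta> edge i]) (rule far)
  have residue: "contour_integral ?C ?g = 2 * of_real pi * \<i> * residue ?g (of_real (\<xi> i))"
    by (rule LII_residue_contour(2)[OF inj \<delta> edge i]) (rule far)
  have ev1: "\<forall>\<^sub>F \<tau> in at_top. \<forall>(k, s)\<in>{(k, s) \<in> node_index p n. k = i}. \<xi> k + real s / \<tau> \<in> ball (\<xi> i) \<delta>"
    by (rule eventually_node_in) (use \<delta> in \<open>auto intro: finite_subset[OF _ finite_node_index[of p n]]\<close>)
  have ev2: "\<forall>\<^sub>F \<tau> in at_top. \<forall>(k, s)\<in>{(k, s) \<in> node_index p n. k \<noteq> i}. \<xi> k + real s / \<tau> \<in> {x. \<delta> < \<bar>x - \<xi> i\<bar>}"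
  proof (rule eventually_node_in)
    show "open {x. \<delta> < \<bar>x - \<xi> i\<bar>}" by (intro open_Collect_less continuous_intros)
    show "finite {(k, s) \<in> node_index p n. k \<noteq> i}" by (rule finite_subset[OF _ finite_node_index[of p n]]) auto
  qed (auto simp: node_index_def intro!: far)
  have main: "\<forall>\<^sub>F \<tau> in at_top. f \<tau> contour_integrable_on ?C \<and> contour_integral ?C (f \<tau>) = 2 * of_real pi * \<i> * r \<tau> \<and>
      T \<tau> * (poly (Jpoly p \<xi> n m i \<tau>) (of_real (1 - y / \<tau>)) * of_real ((1 - y / \<tau>) powr (\<tau> * \<xi> i))) = (-1) ^ msize p n * (T \<tau> * r \<tau>)"
    using ev1 ev2 eventually_gt_at_top[of 0] eventually_gt_at_top[of y] jacobi_nodes_distinct[OF inj, of n]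
  proof eventually_elim
    case (elim \<tau>)
    have x: "0 < 1 - y / \<tau>" using elim(3,4) by (simp add: field_simps)
    have near: "real s / \<tau> < \<delta>" if "s < n i" for s
    proof -
      have "(i, s) \<in> node_index p n" unfolding node_index_def using i that by blast
      hence "\<xi> i + real s / \<tau> \<in> ball (\<xi> i) \<delta>" using elim(1) by blast
      thus ?thesis using elim(3) by (simp add: dist_real_def abs_divide)
    qed
    have far': "\<delta> < \<bar>\<xi> k + real s / \<tau> - \<xi> i\<bar>" if "(k, s) \<in> node_index p n" "k \<noteq> i" for k s
      using elim(2) that by blast
    have c: "f \<tau> contour_integrable_on ?C" "contour_integral ?C (f \<tau>) = 2 * of_real pi * \<i> * r \<tau>"
      unfolding f_def r_def
      by (rule jacobi_component_contour[OF elim(3) \<delta> edge i elim(5) x]; (rule near | rule far'); assumption)+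
    have "T \<tau> * (poly (Jpoly p \<xi> n m i \<tau>) (of_real (1 - y / \<tau>)) * of_real ((1 - y / \<tau>) powr (\<tau> * \<xi> i))) = T \<tau> * ((-1) ^ msize p n * r \<tau>)"
      unfolding r_def by (subst jacobi_component[OF elim(3,5) e[OF i] i x]) (rule refl)
    thus ?case using c by (simp only: simp_thms mult.left_commute)
  qed
  have lim: "uniform_limit ?sph (\<lambda>\<tau> z. T \<tau> * f \<tau> z) ?g at_top"
  proof -
    have S: "compact ?sph" "?sph \<subseteq> Hp" using sph by (simp_all only: compact_sphere) blast
    have nz: "z \<noteq> of_real (\<xi> k)" if "k \<in> {1..p}" "z \<in> ?sph" for k z
      using sph that by blast
    have U1: "uniform_limit ?sph (\<lambda>\<tau> z. T \<tau> * (of_real \<tau> * JK p \<xi> n m \<tau> (of_real \<tau> * z))) (\<lambda>z. W m z / (\<Prod>i=1..p. (z - of_real (\<xi> i)) ^ n i)) at_top"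
      unfolding T_def by (rule uniform_limit_JK[OF bal S nz])
    have "((\<lambda>\<tau>. complex_of_real (\<tau> * ln (1 - y / \<tau>))) \<longlongrightarrow> of_real (- y)) at_top"
      by (intro tendsto_of_real scaled_log_tendsto y)
    hence U2: "uniform_limit ?sph (\<lambda>\<tau> z. exp (of_real (\<tau> * ln (1 - y / \<tau>)) * z)) (\<lambda>z. exp (of_real (- y) * z)) at_top"
      by (rule uniform_limit_exp_mult[OF compact_imp_bounded[OF S(1)]])
    have "continuous_on ?sph (\<lambda>z. W m z / (\<Prod>i=1..p. (z - of_real (\<xi> i)) ^ n i))"
    proof (intro continuous_intros)
      show "continuous_on ?sph (W m)" by (rule continuous_on_subset[OF holomorphic_on_imp_continuous_on[OF W_holomorphic] S(2)])
    qed (use nz in auto)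
    moreover have "continuous_on ?sph (\<lambda>z. exp (of_real (- y) * z))" by (intro continuous_intros)
    ultimately have b: "bounded ((\<lambda>z. W m z / (\<Prod>i=1..p. (z - of_real (\<xi> i)) ^ n i)) ` ?sph)" "bounded ((\<lambda>z. exp (of_real (- y) * z)) ` ?sph)"
      using compact_imp_bounded[OF compact_continuous_image[OF _ S(1)]] by blast+
    from uniform_lim_mult[OF U1 U2 b] show ?thesis
    proof (rule uniform_limit_cong[THEN iffD1, rotated -1])
      from eventually_gt_at_top[of 0] eventually_gt_at_top[of y]
      show "\<forall>\<^sub>F \<tau> in at_top. \<forall>z\<in>?sph. T \<tau> * (of_real \<tau> * JK p \<xi> n m \<tau> (of_real \<tau> * z)) * exp (of_real (\<tau> * ln (1 - y / \<tau>)) * z) = T \<tau> * f \<tau> z"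
      proof eventually_elim
        case (elim \<tau>)
        have x: "0 < 1 - y / \<tau>" using elim by (simp add: field_simps)
        show ?case unfolding f_def of_real_powr_complex[OF x] by (simp add: mult_ac)
      qed
    qed (simp add: mult.commute)
  qed
  have canc: "b \<noteq> 0 \<Longrightarrow> a / b * (b * s) = a * s" for a b s :: complex by simp
  have two_pi: "2 * of_real pi * \<i> \<noteq> (0 :: complex)" by simp
  have "((\<lambda>\<tau>. contour_integral ?C (\<lambda>z. T \<tau> * f \<tau> z)) \<longlongrightarrow> contour_integral ?C ?g) at_top"
  proof (rule contour_integral_uniform_limit_circlepath[OF _ lim _ \<delta>])
    show "\<forall>\<^sub>F \<tau> in at_top. (\<lambda>z. T \<tau> * f \<tau> z) contour_integrable_on ?C"
      using main by eventually_elim (blast intro: contour_integrable_lmul)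
  qed simp
  from tendsto_mult[OF tendsto_const[of "(-1) ^ msize p n / (2 * of_real pi * \<i>)"] this]
  have "((\<lambda>\<tau>. (-1) ^ msize p n / (2 * of_real pi * \<i>) * contour_integral ?C (\<lambda>z. T \<tau> * f \<tau> z)) \<longlongrightarrow>
     (-1) ^ msize p n / (2 * of_real pi * \<i>) * (2 * of_real pi * \<i> * residue ?g (of_real (\<xi> i)))) at_top"
    unfolding residue .
  also have "(-1) ^ msize p n / (2 * of_real pi * \<i>) * (2 * of_real pi * \<i> * residue ?g (of_real (\<xi> i))) = (-1) ^ msize p n * residue ?g (of_real (\<xi> i))"
    by (rule canc) simp
  also have "\<dots> = LII_A_comp p q d \<rho> \<xi> n m i y * of_real (exp (- \<xi> i * y))" by (rule LII_A_comp_residue[OF i inj e[OF i]])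
  finally have "((\<lambda>\<tau>. T \<tau> * (poly (Jpoly p \<xi> n m i \<tau>) (of_real (1 - y / \<tau>)) * of_real ((1 - y / \<tau>) powr (\<tau> * \<xi> i)))) \<longlongrightarrow>
     LII_A_comp p q d \<rho> \<xi> n m i y * of_real (exp (- \<xi> i * y))) at_top"
  proof (rule Lim_transform_eventually)
    show "\<forall>\<^sub>F \<tau> in at_top. (-1) ^ msize p n / (2 * of_real pi * \<i>) * contour_integral ?C (\<lambda>z. T \<tau> * f \<tau> z) =
       T \<tau> * (poly (Jpoly p \<xi> n m i \<tau>) (of_real (1 - y / \<tau>)) * of_real ((1 - y / \<tau>) powr (\<tau> * \<xi> i)))"
      using main
    proof eventually_elim
      case (elim \<tau>)
      have "contour_integral ?C (\<lambda>z. T \<tau> * f \<tau> z) = T \<tau> * (2 * of_real pi * \<i> * r \<tau>)"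
        using elim by (simp only: contour_integral_lmul)
      also have "\<dots> = 2 * of_real pi * \<i> * (T \<tau> * r \<tau>)" by (simp only: mult_ac)
      finally have "(-1) ^ msize p n / (2 * of_real pi * \<i>) * contour_integral ?C (\<lambda>z. T \<tau> * f \<tau> z) = (-1) ^ msize p n * (T \<tau> * r \<tau>)"
        by (simp only: canc[OF two_pi])
      from this conjunct2[OF conjunct2[OF elim], symmetric] show ?case by (rule trans)
    qed
  qed
  moreover have "((\<lambda>\<tau>. complex_of_real ((1 - y / \<tau>) powr (\<tau> * \<xi> i))) \<longlongrightarrow> of_real (exp (- \<xi> i * y))) at_top"
    using tendsto_uniform_limitI[OF uniform_limit_scaled_powr[of "{y}" "\<xi> i"], of y] by (intro tendsto_of_real) auto
  ultimately have "((\<lambda>\<tau>. T \<tau> * (poly (Jpoly p \<xi> n m i \<tau>) (of_real (1 - y / \<tau>)) * of_real ((1 - y / \<tau>) powr (\<tau> * \<xi> i))) / of_real ((1 - y / \<tau>) powr (\<tau> * \<xi> i))) \<longlongrightarrow>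
     LII_A_comp p q d \<rho> \<xi> n m i y * of_real (exp (- \<xi> i * y)) / of_real (exp (- \<xi> i * y))) at_top"
    by (intro tendsto_divide) auto
  also have "LII_A_comp p q d \<rho> \<xi> n m i y * of_real (exp (- \<xi> i * y)) / of_real (exp (- \<xi> i * y)) = LII_A_comp p q d \<rho> \<xi> n m i y" by simp
  finally show ?thesis
  proof (rule Lim_transform_eventually)
    from eventually_gt_at_top[of 0] eventually_gt_at_top[of y]
    show "\<forall>\<^sub>F \<tau> in at_top. T \<tau> * (poly (Jpoly p \<xi> n m i \<tau>) (of_real (1 - y / \<tau>)) * of_real ((1 - y / \<tau>) powr (\<tau> * \<xi> i))) / of_real ((1 - y / \<tau>) powr (\<tau> * \<xi> i)) =
      of_real (\<tau> powr (- (\<Sum>h=1..q. d h))) * poly (Jpoly p \<xi> n m i \<tau>) (of_real (1 - y / \<tau>))"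
    proof eventually_elim
      case (elim \<tau>)
      have "0 < 1 - y / \<tau>" using elim by (simp add: field_simps)
      hence "complex_of_real ((1 - y / \<tau>) powr (\<tau> * \<xi> i)) \<noteq> 0" unfolding of_real_eq_0_iff powr_eq_0_iff by linarith
      thus ?case by (simp only: T_def mult.assoc[symmetric] nonzero_mult_div_cancel_right not_False_eq_True)
    qed
  qed
qed

abbreviation Rpoly :: "nat \<Rightarrow> (nat \<Rightarrow> real) \<Rightarrow> (nat \<Rightarrow> nat) \<Rightarrow> (nat \<Rightarrow> nat) \<Rightarrow> nat \<Rightarrow> real \<Rightarrow> complex poly" where
  "Rpoly p \<xi> n m i \<tau> \<equiv> smult (of_real (\<tau> powr (- (\<Sum>h=1..q. d h)))) (pcompose (Jpoly p \<xi> n m i \<tau>) [:1, - 1 / of_real \<tau>:])"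

lemma poly_Rpoly:
  "poly (Rpoly p \<xi> n m i \<tau>) (of_real y) = of_real (\<tau> powr (- (\<Sum>h=1..q. d h))) * poly (Jpoly p \<xi> n m i \<tau>) (of_real (1 - y / \<tau>))"
  by (simp add: poly_pcompose)

text \<open>The bound n_i instead of n_i - 1 spares a case distinction for n_i = 0. What counts is
  that it is uniform in \<tau>.\<close>

lemma degree_Rpoly: "degree (Rpoly p \<xi> n m i \<tau>) \<le> n i"
proof -
  have "degree (Jpoly p \<xi> n m i \<tau>) \<le> n i"
    unfolding jacobi_A_poly_def by (intro degree_sum_le) (auto intro: order.trans[OF degree_monom_le])
  moreover have "degree (pcompose (Jpoly p \<xi> n m i \<tau>) [:1, - 1 / of_real \<tau>:]) \<le> degree (Jpoly p \<xi> n m i \<tau>) * 1"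
    by (rule order.trans[OF degree_pcompose_le]) (intro mult_le_mono order.refl, simp)
  ultimately show ?thesis by (intro order.trans[OF degree_smult_le]) simp
qed

lemma degree_Qpoly: "degree (Qpoly p \<xi> n m i) \<le> n i"
  using Qpoly_in[of p \<xi> n m i] by (auto simp: polys_below_def)

text \<open>Pointwise convergence holds on the infinite set of positive reals, and the degrees are
  bounded independently of \<tau>.\<close>

lemma jacobi_coeff_tendsto:
  assumes inj: "inj_on \<xi> {1..p}" and bal: "msize p n = msize q m + 1" and e: "\<And>i. i \<in> {1..p} \<Longrightarrow> edge < \<xi> i"
    and i: "i \<in> {1..p}"
  shows "((\<lambda>\<tau>. coeff (Rpoly p \<xi> n m i \<tau>) k) \<longlongrightarrow> coeff (Qpoly p \<xi> n m i) k) at_top"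
proof -
  have "((\<lambda>\<tau>. coeff (Rpoly p \<xi> n m i \<tau> - Qpoly p \<xi> n m i) k) \<longlongrightarrow> 0) at_top"
  proof (rule coeff_tendsto_0)
    have "inj_on complex_of_real {0<..}" by (simp add: inj_on_def)
    thus "infinite (complex_of_real ` {0<..})" using infinite_Ioi by (auto dest: finite_imageD)
    show "degree (Rpoly p \<xi> n m i \<tau> - Qpoly p \<xi> n m i) \<le> n i" for \<tau>
      by (intro degree_diff_le degree_Rpoly degree_Qpoly)
    fix x assume "x \<in> complex_of_real ` {0<..}"
    then obtain y where y: "0 < y" "x = of_real y" by auto
    have "((\<lambda>\<tau>. poly (Rpoly p \<xi> n m i \<tau>) x - poly (Qpoly p \<xi> n m i) x) \<longlongrightarrow> LII_A_comp p q d \<rho> \<xi> n m i y - LII_A_comp p q d \<rho> \<xi> n m i y) at_top"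
      unfolding y(2) poly_Rpoly poly_Qpoly[OF i inj e[OF i]]
      by (intro tendsto_diff tendsto_const jacobi_component_tendsto[OF inj bal _ i y(1)] e)
    thus "((\<lambda>\<tau>. poly (Rpoly p \<xi> n m i \<tau> - Qpoly p \<xi> n m i) x) \<longlongrightarrow> 0) at_top" by simp
  qed
  from tendsto_add[OF this tendsto_const[of "coeff (Qpoly p \<xi> n m i) k"]] show ?thesis by simp
qed

text \<open>The limit is assembled from the components, because the systems \<open>GJ \<tau>\<close>
  are arbitrary: the decomposition into components does not depend on them.\<close>

lemma jacobi_A_uniform_limit:
  assumes inj: "inj_on \<xi> {1..p}" and bal: "msize p n = msize q m + 1" and e: "\<And>i. i \<in> {1..p} \<Longrightarrow> edge < \<xi> i"
    and G: "LII_contours p q \<rho> \<xi> G" and K: "compact K" "K \<subseteq> {0<..}"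
    and GJ: "\<forall>\<^sub>F \<tau> in at_top. jacobi_contours p q (\<lambda>h. \<tau> * \<rho> h - 1) (\<lambda>h. \<tau> * \<rho> h + d h - 1) (\<lambda>i. \<tau> * \<xi> i) n m (GJ \<tau>)"
  shows "uniform_limit K (\<lambda>\<tau> y. of_real (\<tau> powr (- (\<Sum>h=1..q. d h))) *
      jacobi_A p q (\<lambda>h. \<tau> * \<rho> h - 1) (\<lambda>h. \<tau> * \<rho> h + d h - 1) (\<lambda>i. \<tau> * \<xi> i) n m (GJ \<tau>) (1 - y / \<tau>))
    (LII_A p q d \<rho> \<xi> n m G) at_top"
proof -
  have bK: "bounded K" using K compact_imp_bounded by blast
  have comp: "uniform_limit K (\<lambda>\<tau> y. poly (Rpoly p \<xi> n m i \<tau>) (of_real y) * of_real ((1 - y / \<tau>) powr (\<tau> * \<xi> i)))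
     (\<lambda>y. poly (Qpoly p \<xi> n m i) (of_real y) * of_real (exp (- \<xi> i * y))) at_top" if i: "i \<in> {1..p}" for i
  proof (rule uniform_lim_mult)
    have bo: "bounded (complex_of_real ` K)" using bK by (auto simp: bounded_iff)
    have "uniform_limit (complex_of_real ` K) (\<lambda>\<tau>. poly (Rpoly p \<xi> n m i \<tau>)) (poly (Qpoly p \<xi> n m i)) at_top"
      by (rule uniform_limit_poly[OF jacobi_coeff_tendsto[OF inj bal _ i] degree_Rpoly degree_Qpoly bo]) (rule e)
    thus "uniform_limit K (\<lambda>\<tau> y. poly (Rpoly p \<xi> n m i \<tau>) (of_real y)) (\<lambda>y. poly (Qpoly p \<xi> n m i) (of_real y)) at_top"
      by (simp add: uniform_limit_iff)
    show "uniform_limit K (\<lambda>\<tau> y. complex_of_real ((1 - y / \<tau>) powr (\<tau> * \<xi> i))) (\<lambda>y. of_real (exp (- \<xi> i * y))) at_top"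
      by (rule bounded_linear.uniform_limit[OF bounded_linear_of_real uniform_limit_scaled_powr[OF bK]])
    show "bounded ((\<lambda>y. poly (Qpoly p \<xi> n m i) (complex_of_real y)) ` K)" "bounded ((\<lambda>y. complex_of_real (exp (- \<xi> i * y))) ` K)"
      by (intro compact_imp_bounded compact_continuous_image K continuous_intros)+
  qed
  have "uniform_limit K (\<lambda>\<tau> y. \<Sum>i\<in>I. poly (Rpoly p \<xi> n m i \<tau>) (of_real y) * of_real ((1 - y / \<tau>) powr (\<tau> * \<xi> i)))
     (\<lambda>y. \<Sum>i\<in>I. poly (Qpoly p \<xi> n m i) (of_real y) * of_real (exp (- \<xi> i * y))) at_top" if "I \<subseteq> {1..p}" for I
    using finite_subset[OF that finite_atLeastAtMost] that
  proof (induction I rule: finite_induct)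
    case (insert i I)
    have i: "i \<in> {1..p}" and sub: "I \<subseteq> {1..p}" using insert.prems by auto
    show ?case unfolding sum.insert[OF insert.hyps] by (rule uniform_limit_add[OF comp[OF i] insert.IH[OF sub]])
  qed (simp add: uniform_limit_const)
  from this[OF order.refl] show ?thesis
  proof (rule uniform_limit_cong[THEN iffD1, rotated -1])
    \<comment> \<open>For \<tau> > M the arguments 1 - y/\<tau> are positive for all y in K at once,
      as the decomposition requires.\<close>
    obtain M where M: "\<And>y. y \<in> K \<Longrightarrow> \<bar>y\<bar> \<le> M" using bK by (auto simp: bounded_iff)
    from GJ jacobi_nodes_distinct[OF inj, of n] eventually_gt_at_top[of 0] eventually_gt_at_top[of M]
    show "\<forall>\<^sub>F \<tau> in at_top. \<forall>y\<in>K. (\<Sum>i=1..p. poly (Rpoly p \<xi> n m i \<tau>) (of_real y) * of_real ((1 - y / \<tau>) powr (\<tau> * \<xi> i))) =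
      of_real (\<tau> powr (- (\<Sum>h=1..q. d h))) * jacobi_A p q (\<lambda>h. \<tau> * \<rho> h - 1) (\<lambda>h. \<tau> * \<rho> h + d h - 1) (\<lambda>i. \<tau> * \<xi> i) n m (GJ \<tau>) (1 - y / \<tau>)"
    proof eventually_elim
      case (elim \<tau>)
      show ?case
      proof
        fix y assume y: "y \<in> K"
        have x: "0 < 1 - y / \<tau>" using M[OF y] elim by (simp add: field_simps)
        have "jacobi_A p q (\<lambda>h. \<tau> * \<rho> h - 1) (\<lambda>h. \<tau> * \<rho> h + d h - 1) (\<lambda>i. \<tau> * \<xi> i) n m (GJ \<tau>) (1 - y / \<tau>) =
           (\<Sum>i=1..p. poly (Jpoly p \<xi> n m i \<tau>) (of_real (1 - y / \<tau>)) * of_real ((1 - y / \<tau>) powr (\<tau> * \<xi> i)))"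
          by (rule jacobi_A_decomposition[OF elim(3,2) _ x elim(1)]) (rule e)
        thus "(\<Sum>i=1..p. poly (Rpoly p \<xi> n m i \<tau>) (of_real y) * of_real ((1 - y / \<tau>) powr (\<tau> * \<xi> i))) =
      of_real (\<tau> powr (- (\<Sum>h=1..q. d h))) * jacobi_A p q (\<lambda>h. \<tau> * \<rho> h - 1) (\<lambda>h. \<tau> * \<rho> h + d h - 1) (\<lambda>i. \<tau> * \<xi> i) n m (GJ \<tau>) (1 - y / \<tau>)"
          unfolding poly_Rpoly by (simp only: sum_distrib_left mult.assoc)
      qed
    qed
  next
    fix y
    show "(\<Sum>i=1..p. poly (Qpoly p \<xi> n m i) (of_real y) * of_real (exp (- \<xi> i * y))) = LII_A p q d \<rho> \<xi> n m G y"
      by (rule LII_A_decomposition[OF G inj, symmetric]) (rule e)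
  qed
qed

end

section \<open>The theorem\<close>

lemma power_exp_bound:
  fixes \<delta> :: real assumes \<delta>: "0 < \<delta>"
  obtains M where "\<And>y. 0 \<le> y \<Longrightarrow> y ^ k \<le> M * exp (\<delta> * y)"
proof -
  \<comment> \<open>The denominator k + 1 gives k c <= \<delta> and covers k = 0.\<close>
  define c where "c = \<delta> / (real k + 1)"
  have c: "0 < c" "real k * c \<le> \<delta>" using \<delta> by (simp_all add: c_def field_simps)
  show ?thesis
  proof (rule that)
    fix y :: real assume y: "0 \<le> y"
    have "c * y \<le> exp (c * y)" using exp_ge_add_one_self[of "c * y"] by linarith
    hence "(c * y) ^ k \<le> exp (c * y) ^ k" using y c by (intro power_mono) auto
    also have "\<dots> = exp (real k * c * y)" by (simp add: exp_of_nat_mult[symmetric] mult.assoc)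
    also have "\<dots> \<le> exp (\<delta> * y)" using mult_right_mono[OF c(2) y] by simp
    finally have "c ^ k * y ^ k \<le> exp (\<delta> * y)" by (simp add: power_mult_distrib)
    thus "y ^ k \<le> 1 / c ^ k * exp (\<delta> * y)" using c by (simp add: field_simps)
  qed
qed

text \<open>Continuity comes from differentiability of the zeroth iterate, boundedness from the
  compact support.\<close>

lemma test_function_continuous_bounded:
  assumes "test_function \<phi>"
  shows "continuous_on UNIV \<phi>" and "\<exists>M. \<forall>y. norm (\<phi> y) \<le> M"
proof -
  have "((\<lambda>f x. vector_derivative f (at x)) ^^ 0) \<phi> differentiable_on UNIV"
    using assms unfolding test_function_def by blast
  thus cont: "continuous_on UNIV \<phi>" by (simp add: differentiable_imp_continuous_on)
  let ?C = "closure {y. \<phi> y \<noteq> 0}"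
  have "compact ?C" using assms by (simp add: test_function_def)
  hence "bounded (\<phi> ` ?C)"
    by (intro compact_imp_bounded compact_continuous_image continuous_on_subset[OF cont]) auto
  then obtain M where M: "\<And>y. y \<in> ?C \<Longrightarrow> norm (\<phi> y) \<le> M" by (auto simp: bounded_iff)
  have "norm (\<phi> y) \<le> max M 0" for y
    using M[of y] closure_subset[of "{y. \<phi> y \<noteq> 0}"] by (cases "\<phi> y = 0") (auto simp: le_max_iff_disj)
  thus "\<exists>M. \<forall>y. norm (\<phi> y) \<le> M" by blast
qed

lemma locally_integrable_of_integrable: "integrable lborel f \<Longrightarrow> locally_integrable f"
  unfolding locally_integrable_def set_integrable_def
  by (intro allI integrable_mult_indicator) simp_all

context gamma_system
begin

section \<open>Convergence as distributions and in moments\<close>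

context
  fixes p :: nat and \<xi> :: "nat \<Rightarrow> real" and n m :: "nat \<Rightarrow> nat" and B :: "real \<Rightarrow> real" and BJ :: "real \<Rightarrow> real \<Rightarrow> real"
  assumes bal: "msize q m = msize p n + 1" and e0: "edge < 0" and B: "is_LII_B p q d \<rho> \<xi> n m B"
    and BJ: "\<forall>\<^sub>F \<tau> in at_top. is_jacobi_B p q (\<lambda>h. \<tau> * \<rho> h - 1) (\<lambda>h. \<tau> * \<rho> h + d h - 1) (\<lambda>i. \<tau> * \<xi> i) n m (BJ \<tau>)"
begin

abbreviation (input) "BE0 \<equiv> \<lambda>y. indicator {0<..} y * B y"
abbreviation (input) "BJE0 \<equiv> \<lambda>\<tau> y. indicator {0<..<\<tau>} y * (\<tau> powr (\<Sum>h=1..q. d h) * BJ \<tau> (1 - y / \<tau>))"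

text \<open>Bounded functions have growth rate 0, which lies to the right of \<open>edge\<close>.
  The constant 1 is among them, so the functions are eventually integrable on the whole line and in
  particular locally.\<close>

lemma jacobi_B_distr: "tendsto_distr BJE0 BE0 at_top"
  unfolding tendsto_distr_def
proof (intro conjI allI impI)
  have b1: "norm ((\<lambda>_. 1 :: complex) y) \<le> 1 * exp (- 0 * y)" for y :: real by simp
  note one = jacobi_B_convergence[OF bal e0 B BJ continuous_on_const e0 b1, unfolded mult_1_right complex_of_real_integrable_eq]
  show "\<forall>\<^sub>F \<tau> in at_top. locally_integrable (BJE0 \<tau>)"
    using one(1) by eventually_elim (rule locally_integrable_of_integrable)
  show "locally_integrable BE0"
    using one(2) by (rule locally_integrable_of_integrable)
next
  fix \<phi> assume "test_function \<phi>"
  note tf = test_function_continuous_bounded[OF this]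
  obtain M where M: "\<And>y. norm (\<phi> y) \<le> M" using tf(2) by blast
  show "((\<lambda>\<tau>. LINT y|lborel. of_real (BJE0 \<tau> y) * \<phi> y) \<longlongrightarrow> (LINT y|lborel. of_real (BE0 y) * \<phi> y)) at_top"
    by (rule jacobi_B_convergence(3)[OF bal e0 B BJ tf(1) e0, of M]) (use M in simp)
qed

text \<open>For y >= 0 the weight y^k exp(-\<zeta> y) is bounded by a multiple of exp(-wy), with w
  halfway between \<open>edge\<close> and \<zeta>.\<close>

lemma jacobi_B_moments:
  assumes \<zeta>: "edge < \<zeta>"
  shows "\<forall>\<^sub>F \<tau> in at_top. integrable lborel (\<lambda>y. y ^ k * exp (- \<zeta> * y) * BJE0 \<tau> y)"
    and "integrable lborel (\<lambda>y. y ^ k * exp (- \<zeta> * y) * BE0 y)"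
    and "((\<lambda>\<tau>. LINT y|lborel. y ^ k * exp (- \<zeta> * y) * BJE0 \<tau> y) \<longlongrightarrow> (LINT y|lborel. y ^ k * exp (- \<zeta> * y) * BE0 y)) at_top"
proof -
  define w where "w = (edge + \<zeta>) / 2"
  have w: "edge < w" "0 < \<zeta> - w" using \<zeta> by (simp_all add: w_def)
  obtain M where M: "\<And>y. 0 \<le> y \<Longrightarrow> y ^ k \<le> M * exp ((\<zeta> - w) * y)" using power_exp_bound[OF w(2), of k] by blast
  let ?\<phi> = "\<lambda>y. complex_of_real (y ^ k * exp (- \<zeta> * y))"
  have c: "continuous_on UNIV ?\<phi>" by (intro continuous_intros)
  have b: "norm (?\<phi> y) \<le> M * exp (- w * y)" if y: "0 \<le> y" for y
  proof -
    have "norm (?\<phi> y) = y ^ k * exp (- \<zeta> * y)" using y by (simp add: norm_mult norm_power)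
    also have "\<dots> \<le> M * exp ((\<zeta> - w) * y) * exp (- \<zeta> * y)" using M[OF y] by (rule mult_right_mono) simp
    also have "\<dots> = M * exp (- w * y)" by (simp add: mult.assoc mult_exp_exp algebra_simps)
    finally show ?thesis .
  qed
  have eq: "of_real u * ?\<phi> y = complex_of_real (y ^ k * exp (- \<zeta> * y) * u)" for u y :: real
    by (simp only: of_real_mult mult.commute)
  note conv = jacobi_B_convergence[OF bal e0 B BJ c w(1) b, unfolded eq complex_of_real_integrable_eq integral_complex_of_real tendsto_of_real_iff]
  show "\<forall>\<^sub>F \<tau> in at_top. integrable lborel (\<lambda>y. y ^ k * exp (- \<zeta> * y) * BJE0 \<tau> y)"
    "integrable lborel (\<lambda>y. y ^ k * exp (- \<zeta> * y) * BE0 y)"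
    "((\<lambda>\<tau>. LINT y|lborel. y ^ k * exp (- \<zeta> * y) * BJE0 \<tau> y) \<longlongrightarrow> (LINT y|lborel. y ^ k * exp (- \<zeta> * y) * BE0 y)) at_top"
    by (rule conv; assumption)+
qed

end

text \<open>The values at the infinitely many real points determine a polynomial, so the limit of
  the coefficients does not depend on how \<open>Q\<close> is chosen.\<close>

lemma Qpoly_unique:
  assumes i: "i \<in> {1..p}" and inj: "inj_on \<xi> {1..p}" and e: "edge < \<xi> i"
    and Q: "\<And>y::real. poly Q (of_real y) = LII_A_comp p q d \<rho> \<xi> n m i y"
  shows "Q = Qpoly p \<xi> n m i"
proof -
  have "range complex_of_real \<subseteq> {z. poly (Q - Qpoly p \<xi> n m i) z = 0}"
    using Q poly_Qpoly[OF i inj e] by auto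
  moreover have "infinite (range complex_of_real)"
    using infinite_UNIV_char_0[where 'a = real] inj_of_real by (auto dest: finite_imageD)
  ultimately have "infinite {z. poly (Q - Qpoly p \<xi> n m i) z = 0}" by (metis finite_subset)
  thus ?thesis using poly_roots_finite[of "Q - Qpoly p \<xi> n m i"] by auto
qed

end

theorem theorem4p3:
  fixes p q :: nat
    and d \<rho> \<xi> :: "nat \<Rightarrow> real"
    and n m :: "nat \<Rightarrow> nat"
    and D C :: real
    and a b \<alpha> :: "real \<Rightarrow> nat \<Rightarrow> real"
  assumes "1 \<le> q" and "1 \<le> p"
    and "\<forall>h\<in>{1..q}. 0 < d h" and "\<forall>h\<in>{1..q}. 0 < \<rho> h"
    and "\<forall>i\<in>{1..p}. \<forall>h\<in>{1..q}. 0 < \<xi> i + \<rho> h"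
    and D: "D = (\<Sum>h=1..q. d h)"
    and C: "C = D + real (msize q m)"
    and near_diagonal: "\<forall>h\<in>{1..q}. \<forall>j\<in>{1..q}. \<bar>int (m h) - int (m j)\<bar> \<le> 1"
    and "inj_on \<xi> {1..p}"
    and "inj_on \<rho> {j\<in>{1..q}. 0 < m j}"
    and a: "a = (\<lambda>\<tau> h. \<tau> * \<rho> h - 1)"
    and b: "b = (\<lambda>\<tau> h. \<tau> * \<rho> h + d h - 1)"
    and \<alpha>: "\<alpha> = (\<lambda>\<tau> i. \<tau> * \<xi> i)"
  shows
    "(msize p n = msize q m + 1 \<longrightarrow>
       (\<exists>G. LII_contours p q \<rho> \<xi> G) \<and>
       (\<forall>G. LII_contours p q \<rho> \<xi> G \<longrightarrow>
          (\<forall>j\<in>{1..q}. \<forall>k<m j.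
             has_lebesgue_integral_on
               (\<lambda>y. of_real (y ^ k * row_F q d \<rho> j y) * LII_A p q d \<rho> \<xi> n m G y) 0 {0<..}) \<and>
          (\<exists>Q. (\<forall>i\<in>{1..p}. Q i \<in> polys_below (n i) \<and>
                  (\<forall>y::real. poly (Q i) (of_real y) = LII_A_comp p q d \<rho> \<xi> n m i y)) \<and>
               (\<forall>y::real. LII_A p q d \<rho> \<xi> n m G y =
                  (\<Sum>i=1..p. poly (Q i) (of_real y) * of_real (exp (- \<xi> i * y)))))))
   \<and>
    (msize q m = msize p n + 1 \<longrightarrow>
       (\<exists>B. is_LII_B p q d \<rho> \<xi> n m B) \<and>
       (\<forall>B. is_LII_B p q d \<rho> \<xi> n m B \<longrightarrow>
          (\<forall>i\<in>{1..p}. \<forall>k<n i.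
             has_lebesgue_integral_on (\<lambda>y. y ^ k * exp (- \<xi> i * y) * B y) 0 {0<..}) \<and>
          (\<forall>y>0. \<forall>k<msize p n. (deriv ^^ k) (conv_S q d \<rho> m) field_differentiable at y) \<and>
          (\<forall>y>0. B y = - diff_ops p \<xi> n (conv_S q d \<rho> m) y) \<and>
          (\<forall>y>0. B y =
             - (\<Sum>l\<in>PiE {1..p} (\<lambda>i. {0..n i}).
                  (-1) ^ msize p l * (\<Prod>i=1..p. real (n i choose l i) * \<xi> i ^ (n i - l i))
                  * (y powr (C - real (msize p l) - 1) / Gamma (C - real (msize p l)))
                  * Phi2 q (\<lambda>h. d h + real (m h)) (C - real (msize p l)) (\<lambda>h. - \<rho> h * y)))))
   \<and>
    (msize p n = msize q m + 1 \<longrightarrow>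
       (\<forall>\<^sub>F \<tau> in at_top.
          inj_on (\<lambda>(i, k). \<alpha> \<tau> i + real k) (SIGMA i:{1..p}. {..<n i}) \<and>
          (\<exists>G. jacobi_contours p q (a \<tau>) (b \<tau>) (\<alpha> \<tau>) n m G)) \<and>
       (\<forall>G GJ Q.
          LII_contours p q \<rho> \<xi> G \<longrightarrow>
          (\<forall>\<^sub>F \<tau> in at_top. jacobi_contours p q (a \<tau>) (b \<tau>) (\<alpha> \<tau>) n m (GJ \<tau>)) \<longrightarrow>
          (\<forall>i\<in>{1..p}. \<forall>y::real. poly (Q i) (of_real y) = LII_A_comp p q d \<rho> \<xi> n m i y) \<longrightarrow>
          (\<forall>\<^sub>F \<tau> in at_top. \<forall>x\<in>{0<..<1}.
             jacobi_A p q (a \<tau>) (b \<tau>) (\<alpha> \<tau>) n m (GJ \<tau>) x =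
             (\<Sum>i=1..p. poly (jacobi_A_poly p q (a \<tau>) (b \<tau>) (\<alpha> \<tau>) n m i) (of_real x)
                         * of_real (x powr \<alpha> \<tau> i))) \<and>
          (\<forall>K. compact K \<and> K \<subseteq> {0<..} \<longrightarrow>
             uniform_limit K
               (\<lambda>\<tau> y. of_real (\<tau> powr (- D)) *
                       jacobi_A p q (a \<tau>) (b \<tau>) (\<alpha> \<tau>) n m (GJ \<tau>) (1 - y / \<tau>))
               (LII_A p q d \<rho> \<xi> n m G) at_top) \<and>
          (\<forall>i\<in>{1..p}. 0 < n i \<longrightarrow> (\<forall>k.
             ((\<lambda>\<tau>. coeff (smult (of_real (\<tau> powr (- D)))
                     (pcompose (jacobi_A_poly p q (a \<tau>) (b \<tau>) (\<alpha> \<tau>) n m i)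
                               [:1, - 1 / of_real \<tau>:])) k)
               \<longlongrightarrow> coeff (Q i) k) at_top))))
   \<and>
    (msize q m = msize p n + 1 \<longrightarrow>
       (\<forall>\<^sub>F \<tau> in at_top. \<exists>BJ. is_jacobi_B p q (a \<tau>) (b \<tau>) (\<alpha> \<tau>) n m BJ) \<and>
       (\<forall>B BJ BE BJE.
          is_LII_B p q d \<rho> \<xi> n m B \<longrightarrow>
          (\<forall>\<^sub>F \<tau> in at_top. is_jacobi_B p q (a \<tau>) (b \<tau>) (\<alpha> \<tau>) n m (BJ \<tau>)) \<longrightarrow>
          BE = (\<lambda>y. indicator {0<..} y * B y) \<longrightarrow>
          BJE = (\<lambda>\<tau> y. indicator {0<..<\<tau>} y * (\<tau> powr D * BJ \<tau> (1 - y / \<tau>))) \<longrightarrow>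
          tendsto_distr BJE BE at_top \<and>
          (\<forall>(k::nat) (\<zeta>::real). (\<forall>h\<in>{1..q}. 0 < \<zeta> + \<rho> h) \<longrightarrow>
             (\<forall>\<^sub>F \<tau> in at_top. integrable lborel (\<lambda>y. y ^ k * exp (- \<zeta> * y) * BJE \<tau> y)) \<and>
             integrable lborel (\<lambda>y. y ^ k * exp (- \<zeta> * y) * BE y) \<and>
             ((\<lambda>\<tau>. LINT y|lborel. y ^ k * exp (- \<zeta> * y) * BJE \<tau> y) \<longlongrightarrow>
               (LINT y|lborel. y ^ k * exp (- \<zeta> * y) * BE y)) at_top)))"
proof -
  interpret gamma_system q d \<rho> using assms(1,3) by unfold_locales auto
  have e: "edge < \<xi> i" if "i \<in> {1..p}" for i
    using assms(5) that unfolding edge_less_iff by (force simp: less_diff_eq)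
  \<comment> \<open>Positive rates put 0 to the right of all abscissas, which admits bounded test
    functions.\<close>
  have e0: "edge < 0" using assms(4) by (auto simp: edge_less_iff)
  have C': "C = cc m" by (simp add: C D cc_def)
  note inj = \<open>inj_on \<xi> {1..p}\<close>
  show ?thesis
    unfolding a b \<alpha>
  proof (intro conjI impI allI ballI)
    show "\<exists>G. LII_contours p q \<rho> \<xi> G" by (rule LII_contours_exist[OF e])
  next
    fix G j k assume "msize p n = msize q m + 1" "LII_contours p q \<rho> \<xi> G" "j \<in> {1..q}" "k < m j"
    thus "has_lebesgue_integral_on (\<lambda>y. of_real (y ^ k * row_F q d \<rho> j y) * LII_A p q d \<rho> \<xi> n m G y) 0 {0<..}"
      using near_diagonal by (intro LII_A_orthogonal inj e) blast+
  next
    fix G assume G: "LII_contours p q \<rho> \<xi> G"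
    show "\<exists>Q. (\<forall>i\<in>{1..p}. Q i \<in> polys_below (n i) \<and>
                  (\<forall>y::real. poly (Q i) (of_real y) = LII_A_comp p q d \<rho> \<xi> n m i y)) \<and>
               (\<forall>y::real. LII_A p q d \<rho> \<xi> n m G y =
                  (\<Sum>i=1..p. poly (Q i) (of_real y) * of_real (exp (- \<xi> i * y))))"
      by (intro exI[of _ "Qpoly p \<xi> n m"] conjI ballI allI Qpoly_in poly_Qpoly LII_A_decomposition[OF G] inj e)
  next
    assume "msize q m = msize p n + 1"
    thus "\<exists>B. is_LII_B p q d \<rho> \<xi> n m B" by (blast intro: is_LII_B_Bfun)
  next
    fix B i k assume "msize q m = msize p n + 1" "is_LII_B p q d \<rho> \<xi> n m B" "i \<in> {1..p}" "k < n i"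
    thus "has_lebesgue_integral_on (\<lambda>y. y ^ k * exp (- \<xi> i * y) * B y) 0 {0<..}"
      by (rule LII_B_moments) (use assms(5) \<open>i \<in> {1..p}\<close> in blast)
  next
    fix y :: real and k assume "msize q m = msize p n + 1" "0 < y" "k < msize p n"
    thus "(deriv ^^ k) (conv_S q d \<rho> m) field_differentiable at y"
      by (intro funpow_deriv_conv_S_differentiable) simp_all
  next
    fix B and y :: real assume h: "msize q m = msize p n + 1" "is_LII_B p q d \<rho> \<xi> n m B" "0 < y"
    show "B y = - diff_ops p \<xi> n (conv_S q d \<rho> m) y"
      by (rule trans[OF is_LII_B_unique[OF h] Bfun_diff_ops[OF h(1,3)]])
  next
    fix B and y :: real assume h: "msize q m = msize p n + 1" "is_LII_B p q d \<rho> \<xi> n m B" "0 < y"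
    show "B y =
             - (\<Sum>l\<in>PiE {1..p} (\<lambda>i. {0..n i}).
                  (-1) ^ msize p l * (\<Prod>i=1..p. real (n i choose l i) * \<xi> i ^ (n i - l i))
                  * (y powr (C - real (msize p l) - 1) / Gamma (C - real (msize p l)))
                  * Phi2 q (\<lambda>h. d h + real (m h)) (C - real (msize p l)) (\<lambda>h. - \<rho> h * y))"
      unfolding C' by (rule trans[OF is_LII_B_unique[OF h] Bfun_Phi2[OF h(1,3)]])
  next
    show "\<forall>\<^sub>F \<tau> in at_top. inj_on (\<lambda>(i, k). \<tau> * \<xi> i + real k) (SIGMA i:{1..p}. {..<n i}) \<and>
        (\<exists>G. jacobi_contours p q (\<lambda>h. \<tau> * \<rho> h - 1) (\<lambda>h. \<tau> * \<rho> h + d h - 1) (\<lambda>i. \<tau> * \<xi> i) n m G)"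
      using jacobi_nodes_distinct[OF inj, of n, unfolded node_index_def] jacobi_contours_exist[OF e]
      by (rule eventually_conj)
  next
    fix GJ assume GJ: "\<forall>\<^sub>F \<tau> in at_top. jacobi_contours p q (\<lambda>h. \<tau> * \<rho> h - 1) (\<lambda>h. \<tau> * \<rho> h + d h - 1) (\<lambda>i. \<tau> * \<xi> i) n m (GJ \<tau>)"
    from GJ eventually_gt_at_top[of 0] jacobi_nodes_distinct[OF inj, of n]
    show "\<forall>\<^sub>F \<tau> in at_top. \<forall>x\<in>{0<..<1}.
             jacobi_A p q (\<lambda>h. \<tau> * \<rho> h - 1) (\<lambda>h. \<tau> * \<rho> h + d h - 1) (\<lambda>i. \<tau> * \<xi> i) n m (GJ \<tau>) x =
             (\<Sum>i=1..p. poly (jacobi_A_poly p q (\<lambda>h. \<tau> * \<rho> h - 1) (\<lambda>h. \<tau> * \<rho> h + d h - 1) (\<lambda>i. \<tau> * \<xi> i) n m i) (of_real x)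
                         * of_real (x powr (\<tau> * \<xi> i)))"
    proof eventually_elim
      case (elim \<tau>)
      thus ?case using jacobi_A_decomposition[OF elim(2,3) e _ elim(1)] by simp
    qed
  next
    fix G GJ and K :: "real set"
    assume "msize p n = msize q m + 1" "LII_contours p q \<rho> \<xi> G" "compact K \<and> K \<subseteq> {0<..}"
      "\<forall>\<^sub>F \<tau> in at_top. jacobi_contours p q (\<lambda>h. \<tau> * \<rho> h - 1) (\<lambda>h. \<tau> * \<rho> h + d h - 1) (\<lambda>i. \<tau> * \<xi> i) n m (GJ \<tau>)"
    thus "uniform_limit K
               (\<lambda>\<tau> y. of_real (\<tau> powr (- D)) *
                       jacobi_A p q (\<lambda>h. \<tau> * \<rho> h - 1) (\<lambda>h. \<tau> * \<rho> h + d h - 1) (\<lambda>i. \<tau> * \<xi> i) n m (GJ \<tau>) (1 - y / \<tau>))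
               (LII_A p q d \<rho> \<xi> n m G) at_top"
      unfolding D by (intro jacobi_A_uniform_limit inj e) blast+
  next
    fix Q i k
    assume bal: "msize p n = msize q m + 1" and i: "i \<in> {1..p}"
      and Q: "\<forall>i\<in>{1..p}. \<forall>y::real. poly (Q i) (of_real y) = LII_A_comp p q d \<rho> \<xi> n m i y"
    have "Q i = Qpoly p \<xi> n m i" by (rule Qpoly_unique[OF i inj e[OF i]]) (use Q i in blast)
    thus "((\<lambda>\<tau>. coeff (smult (of_real (\<tau> powr (- D)))
                     (pcompose (jacobi_A_poly p q (\<lambda>h. \<tau> * \<rho> h - 1) (\<lambda>h. \<tau> * \<rho> h + d h - 1) (\<lambda>i. \<tau> * \<xi> i) n m i)
                               [:1, - 1 / of_real \<tau>:])) k)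
               \<longlongrightarrow> coeff (Q i) k) at_top"
      using jacobi_coeff_tendsto[OF inj bal e i] unfolding D by simp
  next
    assume "msize q m = msize p n + 1"
    thus "\<forall>\<^sub>F \<tau> in at_top. \<exists>BJ. is_jacobi_B p q (\<lambda>h. \<tau> * \<rho> h - 1) (\<lambda>h. \<tau> * \<rho> h + d h - 1) (\<lambda>i. \<tau> * \<xi> i) n m BJ"
      by (rule jacobi_B_eventually_exists)
  next
    fix B BJ BE BJE
    assume h: "msize q m = msize p n + 1" "is_LII_B p q d \<rho> \<xi> n m B"
        "\<forall>\<^sub>F \<tau> in at_top. is_jacobi_B p q (\<lambda>h. \<tau> * \<rho> h - 1) (\<lambda>h. \<tau> * \<rho> h + d h - 1) (\<lambda>i. \<tau> * \<xi> i) n m (BJ \<tau>)"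
      and eqs: "BE = (\<lambda>y. indicator {0<..} y * B y)"
        "BJE = (\<lambda>\<tau> y. indicator {0<..<\<tau>} y * (\<tau> powr D * BJ \<tau> (1 - y / \<tau>)))"
    show "tendsto_distr BJE BE at_top"
      unfolding eqs D by (rule jacobi_B_distr[OF h(1) e0 h(2,3)])
    fix k \<zeta> assume "\<forall>h\<in>{1..q}. 0 < \<zeta> + \<rho> h"
    hence \<zeta>: "edge < \<zeta>" unfolding edge_less_iff by (force simp: less_diff_eq)
    note mom = jacobi_B_moments[OF h(1) e0 h(2,3) \<zeta>, of k]
    show "\<forall>\<^sub>F \<tau> in at_top. integrable lborel (\<lambda>y. y ^ k * exp (- \<zeta> * y) * BJE \<tau> y)"
      "integrable lborel (\<lambda>y. y ^ k * exp (- \<zeta> * y) * BE y)"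
      "((\<lambda>\<tau>. LINT y|lborel. y ^ k * exp (- \<zeta> * y) * BJE \<tau> y) \<longlongrightarrow> (LINT y|lborel. y ^ k * exp (- \<zeta> * y) * BE y)) at_top"
      unfolding eqs D by (rule mom)+
  qed
qed

end
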